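(* Let $\xi_\infty$ be the random entire function described in the context. Let $z_1,\dots,z_k$ be distinct complex numbers in $\mathbb{C}\setminus\mathbb{R}$, and let $A\subset\{1,\dots,k\}$ be the set of indices $j$ such that $z_j$ has negative imaginary part. Let $\mathfrak{S}_{k,A}$ be the set of permutations of $\{1,\dots,k\}$ such that all the fixed points are in $A$ and all the $2$-cycles have one element in $A$ and one outside $A$. For a permutation $\rho$, let $F(\rho)$ be its set of fixed points and $\epsilon(\rho)$ its signature, and for $\rho\in\mathfrak{S}_{k,A}$ let $G(\rho,A)$ be the set of elements of $A$ belonging to the $2$-cycles of $\rho$. Then $$\mathbb{E}\left[\prod_{j=1}^k\frac{\xi_\infty'(z_j)}{\xi_\infty(z_j)}\right]=(-1)^k\sum_{\rho\in\mathfrak{S}_{k,A}}\epsilon(\rho)(-2i\pi)^{|F(\rho)|}\prod_{j\notin F(\rho)}(z_{\rho^{-1}(j)}-z_j)^{-1}\,e^{2i\pi\sum_{j\in A}(z_{\rho(j)}-z_j)}\prod_{j\in G(\rho,A)}\left(1-e^{2i\pi(z_j-z_{\rho(j)})}\right).$$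
   Context: Let $(y_k)_{k\in\mathbb{Z}}$ be a determinantal sine-kernel point process on $\mathbb{R}$ (correlation functions $\rho_r(x_1,\dots,x_r)=\det\left(\frac{\sin[\pi(x_i-x_j)]}{\pi(x_i-x_j)}\right)_{i,j=1}^r$), indexed increasingly with $y_0<0<y_1$. The random entire function $\xi_\infty$ is given almost surely by the absolutely convergent product $\xi_\infty(z)=e^{i\pi z}\left(1-\frac{z}{y_0}\right)\prod_{k\ge1}\left[\left(1-\frac{z}{y_k}\right)\left(1-\frac{z}{y_{-k}}\right)\right]$. It is the limit in law, for uniform convergence on compact sets, of $\xi_n(z)=Z_n(e^{2i\pi z/n})/Z_n(1)$, where $Z_n(X)=\det(\mathrm{Id}-U_n^{-1}X)$ and $U_n$ is Haar distributed on $U(n)$. *)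

theory Defs
  imports
    "HOL-Probability.Probability"
    "HOL-Complex_Analysis.Complex_Analysis"
    "HOL-Combinatorics.Permutations"
    "Jordan_Normal_Form.Determinant"
begin

(* sinc is the continuous extension, sinc 0 = 1, so the diagonal entries below are 1. *)
definition sine_kernel_corr :: "nat \<Rightarrow> (nat \<Rightarrow> real) \<Rightarrow> real" where
  "sine_kernel_corr r x =
     Determinant.det (Matrix.mat r r (\<lambda>(i, j). sinc (pi * (x i - x j))))"

(* The r-point correlation function rho r is the density, with respect to Lebesgue measure on
   R^r, of the r-th factorial moment measure: the inner integral against count_space is the
   sum of f (y_{s 0}, ..., y_{s (r-1)}) over all r-tuples s of pairwise distinct indices. *)
definition has_correlation_functions ::
    "'a measure \<Rightarrow> (int \<Rightarrow> 'a \<Rightarrow> real) \<Rightarrow> (nat \<Rightarrow> (nat \<Rightarrow> real) \<Rightarrow> real) \<Rightarrow> bool" where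
  "has_correlation_functions M y rho \<longleftrightarrow>
     (\<forall>r. \<forall>f \<in> borel_measurable (Pi\<^sub>M {..<r} (\<lambda>_. lborel :: real measure)).
        (\<integral>\<^sup>+ \<omega>. (\<integral>\<^sup>+ s. f (\<lambda>i\<in>{..<r}. y (s i) \<omega>)
            \<partial>count_space {s \<in> {..<r} \<rightarrow>\<^sub>E (UNIV :: int set). inj_on s {..<r}}) \<partial>M)
        = (\<integral>\<^sup>+ x. f x * ennreal (rho r x) \<partial>Pi\<^sub>M {..<r} (\<lambda>_. lborel)))"

definition sine_kernel_process :: "'a measure \<Rightarrow> (int \<Rightarrow> 'a \<Rightarrow> real) \<Rightarrow> bool" where
  "sine_kernel_process M y \<longleftrightarrow>
     prob_space M \<and>
     (\<forall>k. y k \<in> borel_measurable M) \<and>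
     (AE \<omega> in M. strict_mono (\<lambda>k. y k \<omega>) \<and> y 0 \<omega> < 0 \<and> 0 < y 1 \<omega>) \<and>
     has_correlation_functions M y sine_kernel_corr"

(* The product runs over k :: nat, so index k here stands for the pair y_{k+1}, y_{-(k+1)}. *)
definition xi_product :: "(int \<Rightarrow> real) \<Rightarrow> complex \<Rightarrow> complex" where
  "xi_product y z =
     exp (\<i> * of_real pi * z) * (1 - z / of_real (y 0)) *
     (\<Prod>k. (1 - z / of_real (y (int k + 1))) * (1 - z / of_real (y (- (int k + 1)))))"

(* A version of xi_infinity: every path is entire, each evaluation is a random variable, and
   almost surely the path is the product. On the null set where the product formula may fail
   the path is only required to be some entire function, so that quantities such as
   deriv (xi w) z / xi w z are measurable even if M is not complete. *)
definition is_xi_infinity ::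
    "'a measure \<Rightarrow> (int \<Rightarrow> 'a \<Rightarrow> real) \<Rightarrow> ('a \<Rightarrow> complex \<Rightarrow> complex) \<Rightarrow> bool" where
  "is_xi_infinity M y \<xi> \<longleftrightarrow>
     (\<forall>\<omega> \<in> space M. \<xi> \<omega> holomorphic_on UNIV) \<and>
     (\<forall>z. (\<lambda>\<omega>. \<xi> \<omega> z) \<in> borel_measurable M) \<and>
     (AE \<omega> in M. \<forall>z. \<xi> \<omega> z = xi_product (\<lambda>k. y k \<omega>) z)"

definition fixed_pts :: "nat \<Rightarrow> (nat \<Rightarrow> nat) \<Rightarrow> nat set" where
  "fixed_pts k \<rho> = {j \<in> {1..k}. \<rho> j = j}"

definition two_cycle_pts :: "nat \<Rightarrow> (nat \<Rightarrow> nat) \<Rightarrow> nat set" where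
  "two_cycle_pts k \<rho> = {j \<in> {1..k}. \<rho> j \<noteq> j \<and> \<rho> (\<rho> j) = j}"

(* The 2-cycle containing j is {j, rho j}; it has exactly one element in A. *)
definition perms_kA :: "nat \<Rightarrow> nat set \<Rightarrow> (nat \<Rightarrow> nat) set" where
  "perms_kA k A = {\<rho>. \<rho> permutes {1..k} \<and> fixed_pts k \<rho> \<subseteq> A \<and>
     (\<forall>j \<in> two_cycle_pts k \<rho>. j \<in> A \<longleftrightarrow> \<rho> j \<notin> A)}"

definition two_cycle_pts_in :: "nat \<Rightarrow> (nat \<Rightarrow> nat) \<Rightarrow> nat set \<Rightarrow> nat set" where
  "two_cycle_pts_in k \<rho> A = two_cycle_pts k \<rho> \<inter> A"

end

theory Submission
  imports Defs
begin

text \<open>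
  Let \<open>L = \<xi>' / \<xi>\<close>. A difference \<open>L z - L w\<close> is the absolutely convergent linear statistic
  \<open>\<Sum>m. 1 / (z - y m) - 1 / (w - y m)\<close>, so the mixed moments of such differences are integrals of Cauchy
  kernels against the sine-kernel determinants. On the real line the sine kernel is conjugate to a
  constant multiple of \<open>kern\<close>, which extends to complex nodes. A determinant of \<open>kern\<close> corrected by a signed
  sum over fixed-point-free involutions (the functional \<open>Psi\<close>) reproduces itself: integrating one real node
  against \<open>1 / (z - t) - 1 / (w - t)\<close> replaces that node by \<open>z\<close> minus the same with \<open>w\<close>, by contour shifting.
  Iterating, the expectation of \<open>\<Prod>j. L (z j) - L (w j)\<close> becomes an alternating sum of values of \<open>Psi\<close>.

  Next the \<open>w j\<close> escape to \<open>+\<i>\<infinity>\<close> at separated speeds. Almost surely \<open>L (w j)\<close> tends to \<open>0\<close>, and every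
  value of \<open>Psi\<close> that involves an escaping node tends to \<open>0\<close>. The exchange of limit and expectation uses
  that the products over the \<open>z j\<close> in one half plane are Cauchy in \<open>L\<^sup>2\<close>, because their Gram matrix
  converges by the same moment formula; the full product is then Cauchy in \<open>L\<^sup>1\<close>.
  Expanding \<open>Psi\<close> over permutations, the involution part only affects 2-cycles: it cancels those with
  both points on the same side of the real axis.
\<close>

section \<open>Determinants with pairing corrections\<close>

text \<open>Differences \<open>L z - L w\<close> are used because
  \<open>\<Sum>m. 1 / (z - y m)\<close> is controlled only after pairing opposite points, whereas
  the summands of the difference are of order 1/x^2. The reference points must leave upwards: there
  the factor exp(i pi z) contributes i pi and points of density one contribute about -i pi, so
  \<open>L\<close> decays; in the lower half plane the two add up. Correspondingly the diagonal of
  \<open>kern\<close> is 0 above the axis and -2 pi i below it, so an escaping upper node leaves no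
  trace. This asymmetry is the origin of \<open>A\<close>.

  The pairing correction is forced by double poles. Splicing a node t into a loop at a gives a term
  1/(t - a)^2 when both lie in the same half plane, which a Cauchy integral along the axis cannot
  produce; pairings with weight -1/(a - b)^2 remove these terms.

  Half planes are separated in the L^2 step because the Gram matrix has the \<open>z j\<close> and
  their conjugates as nodes of one moment formula, whose nodes must be distinct. Within one half
  plane no \<open>z i\<close> is the conjugate of a \<open>z j\<close>; across both this can
  happen.\<close>

definition expq :: "complex \<Rightarrow> complex" where
  "expq u = (if u = 0 then 2 * \<i> * of_real pi else (exp (2 * \<i> * of_real pi * u) - 1) / u)"

text \<open>The value 0 for a real first argument makes \<open>kern x b\<close>, x real, equal to
  the lower branch of \<open>kern t b\<close> minus its upper branch, that is, to the jump across
  the axis. The Cauchy integral of the recursion rebuilds a function from exactly this jump. It also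
  makes every pairing with a real node vanish.\<close>

definition ckern :: "complex \<Rightarrow> complex \<Rightarrow> complex" where
  "ckern a b = (if Im a = 0 then 0 else 1 / (a - b))"

text \<open>For real arguments \<open>kern x y\<close> is \<open>- 2\<pi>\<i> e\<^bsup>\<i>\<pi>(y - x)\<^esup> sinc (\<pi> (x - y))\<close>, a conjugate of the sine kernel up to the factor;
  \<open>kern a b\<close> is \<open>1 / (a - b)\<close> for \<open>a\<close> in the upper half plane.\<close>

definition kern :: "complex \<Rightarrow> complex \<Rightarrow> complex" where
  "kern a b = ckern a b - (if Im a \<le> 0 then expq (b - a) else 0)"

definition permdet :: "('i \<Rightarrow> 'i \<Rightarrow> complex) \<Rightarrow> 'i set \<Rightarrow> complex" where
  "permdet K J = (\<Sum>s | s permutes J. of_int (sign s) * (\<Prod>i\<in>J. K i (s i)))"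

definition fpf_invol :: "'i set \<Rightarrow> ('i \<Rightarrow> 'i) set" where
  "fpf_invol S = {m. m permutes S \<and> (\<forall>i. m (m i) = i) \<and> (\<forall>i\<in>S. m i \<noteq> i)}"

text \<open>The Hafnian of the symmetric array \<open>ckern a b * ckern b a\<close>: in each pair
  the two factors \<i> multiply to -1, which cancels the sign of the transposition. The signed form
  over permutations lets a pairing and a determinant permutation be merged later into one
  permutation.\<close>

definition hafn :: "('i \<Rightarrow> complex) \<Rightarrow> 'i set \<Rightarrow> complex" where
  "hafn p S = (\<Sum>m\<in>fpf_invol S. of_int (sign m) * (\<Prod>i\<in>S. \<i> * ckern (p i) (p (m i))))"

definition Psi :: "('i \<Rightarrow> complex) \<Rightarrow> 'i set \<Rightarrow> complex" where
  "Psi p I = (\<Sum>S\<in>Pow I. hafn p S * permdet (\<lambda>i j. kern (p i) (p j)) (I - S))"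

text \<open>Weight of routing the arrow from b to a of a permutation through t. For a loop, a = b,
  the subtracted term removes the double pole at t = a. Positions are compared, not indices, so that
  the whole is a function of a, b and t alone.\<close>

definition edge_pair :: "complex \<Rightarrow> complex \<Rightarrow> complex \<Rightarrow> complex" where
  "edge_pair a b t = kern t a * kern b t - (if a = b then ckern t a * ckern a t else 0)"

text \<open>A determinant with an extra row and column at t, expanded along them, together with the
  terms in which t is paired with one node of J. The node t is a position without a label, since it
  serves as an integration variable.\<close>

definition bordered :: "('i \<Rightarrow> complex) \<Rightarrow> 'i set \<Rightarrow> complex \<Rightarrow> complex" where
  "bordered p J t = kern t t * permdet (\<lambda>i j. kern (p i) (p j)) J
     - (\<Sum>s | s permutes J. of_int (sign s) *
         (\<Sum>b\<in>J. edge_pair (p (s b)) (p b) t * (\<Prod>i\<in>J - {b}. kern (p i) (p (s i)))))"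

text \<open>In the cycle picture z is either a fixed point or is spliced into the arrow from b to
  \<open>s b\<close> of a permutation of J. Splicing is one transposition, hence the minus
  sign.\<close>

lemma permdet_insert:
  assumes fin: "finite J" and z: "z \<notin> J"
  shows "permdet K (insert z J) = K z z * permdet K J
     - (\<Sum>s | s permutes J. of_int (sign s) *
         (\<Sum>b\<in>J. K z (s b) * K b z * (\<Prod>i\<in>J - {b}. K i (s i))))"
proof -
  have perm: "permutation q" if "q permutes J" for q
    using that fin permutation_permutes by blast
  have diag: "(\<Sum>q | q permutes J. of_int (sign (Transposition.transpose z z \<circ> q)) *
        (\<Prod>i\<in>insert z J. K i ((Transposition.transpose z z \<circ> q) i))) = K z z * permdet K J"
    unfolding permdet_def sum_distrib_left
  proof (rule sum.cong[OF refl])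
    fix q assume "q \<in> {q. q permutes J}"
    then have q: "q permutes J" by simp
    have "q z = z" using q z by (simp add: permutes_not_in)
    then show "of_int (sign (Transposition.transpose z z \<circ> q)) * (\<Prod>i\<in>insert z J. K i ((Transposition.transpose z z \<circ> q) i))
        = K z z * (of_int (sign q) * (\<Prod>i\<in>J. K i (q i)))"
      using fin z by (simp add: prod.insert o_def)
  qed
  have off: "(\<Sum>b\<in>J. of_int (sign (Transposition.transpose z b \<circ> q)) *
        (\<Prod>i\<in>insert z J. K i ((Transposition.transpose z b \<circ> q) i)))
      = - (of_int (sign q) * (\<Sum>b\<in>J. K z (q b) * K b z * (\<Prod>i\<in>J - {b}. K i (q i))))"
    if q: "q permutes J" for q
  proof -
    have qz: "q z = z" using q z by (simp add: permutes_not_in)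
    \<comment> \<open>The transposition with b makes b the image of z. Substituting
      \<open>q b\<close> for b makes b the preimage of z instead, so that only the old factor at b
      changes.\<close>
    have "(\<Sum>b\<in>J. of_int (sign (Transposition.transpose z b \<circ> q)) *
        (\<Prod>i\<in>insert z J. K i ((Transposition.transpose z b \<circ> q) i)))
      = (\<Sum>b\<in>J. of_int (sign (Transposition.transpose z (q b) \<circ> q)) *
        (\<Prod>i\<in>insert z J. K i ((Transposition.transpose z (q b) \<circ> q) i)))"
      by (subst sum.permute[OF q]) (simp add: o_def)
    also have "\<dots> = (\<Sum>b\<in>J. - (of_int (sign q) * (K z (q b) * K b z * (\<Prod>i\<in>J - {b}. K i (q i)))))"
    proof (rule sum.cong[OF refl])
      fix b assume b: "b \<in> J"
      have qb: "q b \<in> J" using b q by (simp add: permutes_in_image)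
      have "sign (Transposition.transpose z (q b) \<circ> q) = - sign q"
        using qb z by (subst sign_compose)
          (auto simp: perm[OF q] permutation_swap_id sign_swap_id)
      moreover have "(\<Prod>i\<in>insert z J. K i ((Transposition.transpose z (q b) \<circ> q) i))
          = K z (q b) * (\<Prod>i\<in>J. K i (Transposition.transpose z (q b) (q i)))"
        using fin z qz by (simp add: prod.insert)
      moreover have "(\<Prod>i\<in>J. K i (Transposition.transpose z (q b) (q i)))
         = K b z * (\<Prod>i\<in>J - {b}. K i (Transposition.transpose z (q b) (q i)))"
        using fin b by (subst prod.remove[of _ b]) auto
      moreover have "(\<Prod>i\<in>J - {b}. K i (Transposition.transpose z (q b) (q i))) = (\<Prod>i\<in>J - {b}. K i (q i))"
      proof (rule prod.cong[OF refl])
        fix i assume i: "i \<in> J - {b}"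
        have "q i \<noteq> z" using i q z by (metis DiffD1 permutes_in_image)
        moreover have "q i \<noteq> q b" using i permutes_inj[OF q] by (auto dest: injD)
        ultimately show "K i (Transposition.transpose z (q b) (q i)) = K i (q i)"
          by (simp add: transpose_def)
      qed
      ultimately show "of_int (sign (Transposition.transpose z (q b) \<circ> q)) *
          (\<Prod>i\<in>insert z J. K i ((Transposition.transpose z (q b) \<circ> q) i))
        = - (of_int (sign q) * (K z (q b) * K b z * (\<Prod>i\<in>J - {b}. K i (q i))))"
        by (simp add: algebra_simps)
    qed
    finally show ?thesis by (simp add: sum_negf sum_distrib_left)
  qed
  have "permdet K (insert z J) = K z z * permdet K J + (\<Sum>b\<in>J. \<Sum>q | q permutes J.
      of_int (sign (Transposition.transpose z b \<circ> q)) * (\<Prod>i\<in>insert z J. K i ((Transposition.transpose z b \<circ> q) i)))"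
    using diag fin z unfolding permdet_def
    by (subst sum_over_permutations_insert[OF fin z]) (simp add: sum.insert)
  also have "\<dots> = K z z * permdet K J + (\<Sum>q | q permutes J. \<Sum>b\<in>J.
      of_int (sign (Transposition.transpose z b \<circ> q)) * (\<Prod>i\<in>insert z J. K i ((Transposition.transpose z b \<circ> q) i)))"
    by (subst sum.swap) simp
  also have "(\<Sum>q | q permutes J. \<Sum>b\<in>J.
      of_int (sign (Transposition.transpose z b \<circ> q)) * (\<Prod>i\<in>insert z J. K i ((Transposition.transpose z b \<circ> q) i)))
     = (\<Sum>q | q permutes J. - (of_int (sign q) *
         (\<Sum>b\<in>J. K z (q b) * K b z * (\<Prod>i\<in>J - {b}. K i (q i)))))"
    by (rule sum.cong[OF refl], drule CollectD, rule off)
  finally show ?thesis by (simp add: sum_negf)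
qed

lemma permdet_cong:
  assumes "\<And>i j. i \<in> J \<Longrightarrow> j \<in> J \<Longrightarrow> K i j = L i j"
  shows "permdet K J = permdet L J"
  unfolding permdet_def
  by (intro sum.cong refl arg_cong2[where f=times] prod.cong) (auto simp: assms permutes_in_image)

text \<open>A loop weight at b selects the permutations fixing b. These are the permutations of
  \<open>J - {b}\<close>, with the same sign and the same remaining factors, so principal minors
  appear.\<close>

lemma permdet_minor_sum:
  assumes fin: "finite J"
  shows "(\<Sum>s | s permutes J. of_int (sign s) *
           (\<Sum>b\<in>J. (if s b = b then c b else 0) * (\<Prod>i\<in>J - {b}. K i (s i))))
       = (\<Sum>b\<in>J. c b * permdet K (J - {b}))"
proof -
  have "(\<Sum>s | s permutes J. of_int (sign s) *
           (\<Sum>b\<in>J. (if s b = b then c b else 0) * (\<Prod>i\<in>J - {b}. K i (s i))))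
     = (\<Sum>b\<in>J. \<Sum>s | s permutes J. if s b = b then of_int (sign s) * (c b * (\<Prod>i\<in>J - {b}. K i (s i))) else 0)"
    by (subst sum.swap) (auto simp: sum_distrib_left intro!: sum.cong)
  also have "\<dots> = (\<Sum>b\<in>J. c b * permdet K (J - {b}))"
  proof (rule sum.cong[OF refl])
    fix b assume b: "b \<in> J"
    have eq: "{s \<in> {s. s permutes J}. s b = b} = {s. s permutes (J - {b})}"
    proof (intro Set.set_eqI iffI)
      fix s assume "s \<in> {s \<in> {s. s permutes J}. s b = b}"
      then have s: "s permutes J" "s b = b" by auto
      have "s permutes (J - {b})"
        by (rule permutes_superset[OF s(1)]) (use s in auto)
      then show "s \<in> {s. s permutes (J - {b})}" by simp
    next
      fix s assume s: "s \<in> {s. s permutes (J - {b})}"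
      then show "s \<in> {s \<in> {s. s permutes J}. s b = b}"
        by (auto intro: permutes_subset simp: permutes_not_in)
    qed
    have "(\<Sum>s | s permutes J. if s b = b then of_int (sign s) * (c b * (\<Prod>i\<in>J - {b}. K i (s i))) else 0)
      = (\<Sum>s\<in>{s \<in> {s. s permutes J}. s b = b}. of_int (sign s) * (c b * (\<Prod>i\<in>J - {b}. K i (s i))))"
      by (rule sum.inter_filter[symmetric]) (simp add: fin finite_permutations)
    then show "(\<Sum>s | s permutes J. if s b = b then of_int (sign s) * (c b * (\<Prod>i\<in>J - {b}. K i (s i))) else 0)
      = c b * permdet K (J - {b})"
      unfolding eq permdet_def by (simp add: sum_distrib_left algebra_simps)
  qed
  finally show ?thesis .
qed

section \<open>Signed sums over pairings\<close>

lemma finite_fpf_invol: "finite S \<Longrightarrow> finite (fpf_invol S)"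
  unfolding fpf_invol_def by (rule finite_subset[OF _ finite_permutations[of S]]) auto

lemma fpf_invol_empty [simp]: "fpf_invol {} = {id}"
  by (auto simp: fpf_invol_def)

lemma hafn_empty [simp]: "hafn p {} = 1"
  by (simp add: hafn_def)

lemma hafn_cong: "(\<And>i. i \<in> S \<Longrightarrow> p i = q i) \<Longrightarrow> hafn p S = hafn q S"
  unfolding hafn_def
  by (intro sum.cong refl arg_cong2[where f=times] prod.cong)
     (auto simp: fpf_invol_def permutes_in_image)

text \<open>Every paired index occurs once as a first argument of \<open>ckern\<close>, which
  vanishes at a real first argument. Hence only the determinant sees the real nodes.\<close>

lemma hafn_real:
  assumes "finite S" "i \<in> S" "Im (p i) = 0"
  shows "hafn p S = 0"
  unfolding hafn_def
proof (rule sum.neutral, rule ballI)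
  fix m
  have "\<i> * ckern (p i) (p (m i)) = 0" using assms(3) by (simp add: ckern_def)
  then have "(\<Prod>i\<in>S. \<i> * ckern (p i) (p (m i))) = 0"
    using assms by (meson prod_zero)
  then show "of_int (sign m) * (\<Prod>i\<in>S. \<i> * ckern (p i) (p (m i))) = 0" by simp
qed

lemma transpose_fpf_invol:
  assumes "z \<notin> S" "j \<in> S" "m \<in> fpf_invol (S - {j})"
  shows "Transposition.transpose z j \<circ> m \<in> fpf_invol (insert z S)"
proof -
  have m: "m permutes (S - {j})" "\<And>i. m (m i) = i" "\<And>i. i \<in> S - {j} \<Longrightarrow> m i \<noteq> i"
    using assms(3) by (auto simp: fpf_invol_def)
  have mz: "m z = z" "m j = j" using m(1) assms(1) by (auto simp: permutes_not_in)
  have ne: "i \<noteq> z \<Longrightarrow> i \<noteq> j \<Longrightarrow> m i \<noteq> z \<and> m i \<noteq> j" for i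
    by (metis m(2) mz)
  have "Transposition.transpose z j \<circ> m permutes insert z S"
    by (rule permutes_compose[OF permutes_subset[OF m(1)] permutes_swap_id]) (use assms in auto)
  moreover have "(Transposition.transpose z j \<circ> m) ((Transposition.transpose z j \<circ> m) i) = i" for i
    using ne[of i] by (cases "i = z \<or> i = j") (auto simp: mz m(2))
  moreover have "(Transposition.transpose z j \<circ> m) i \<noteq> i" if "i \<in> insert z S" for i
    using that ne[of i] m(3)[of i] assms(1,2) by (cases "i = z \<or> i = j") (auto simp: mz)
  ultimately show ?thesis by (auto simp: fpf_invol_def)
qed

text \<open>Pairings are sorted by the partner j = \<open>m z\<close> of z. Deleting the pair leaves
  a pairing of \<open>S - {j}\<close>; the lost transposition sign -1 is compensated by the two
  factors \<i> of the pair.\<close>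

lemma hafn_insert:
  assumes fin: "finite S" and z: "z \<notin> S"
  shows "hafn p (insert z S)
    = (\<Sum>j\<in>S. ckern (p z) (p j) * ckern (p j) (p z) * hafn p (S - {j}))"
proof -
  let ?w = "\<lambda>S m. of_int (sign m) * (\<Prod>i\<in>S. \<i> * ckern (p i) (p (m i)))"
  have "hafn p (insert z S) = (\<Sum>(j,m)\<in>Sigma S (\<lambda>j. fpf_invol (S - {j})). ?w (insert z S) (Transposition.transpose z j \<circ> m))"
    unfolding hafn_def
  proof (rule sum.reindex_bij_witness[where i="\<lambda>(j,m). Transposition.transpose z j \<circ> m"
        and j="\<lambda>m. (m z, Transposition.transpose z (m z) \<circ> m)"])
    fix m assume m: "m \<in> fpf_invol (insert z S)"
    then have mm: "m permutes (insert z S)" "\<And>i. m (m i) = i" "\<And>i. i \<in> insert z S \<Longrightarrow> m i \<noteq> i"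
      by (auto simp: fpf_invol_def)
    show "(case (m z, Transposition.transpose z (m z) \<circ> m) of (j, m) \<Rightarrow> Transposition.transpose z j \<circ> m) = m"
      by (auto simp: fun_eq_iff)
    show "(case (m z, Transposition.transpose z (m z) \<circ> m) of (j, m) \<Rightarrow> ?w (insert z S) (Transposition.transpose z j \<circ> m)) = ?w (insert z S) m"
      by (simp add: o_def)
    have mzS: "m z \<in> S" using mm(3)[of z] mm(1) by (metis insertE insertI1 permutes_in_image)
    have ne: "i \<noteq> z \<Longrightarrow> i \<noteq> m z \<Longrightarrow> m i \<noteq> z \<and> m i \<noteq> m z" for i
      by (metis mm(2))
    have 1: "(Transposition.transpose z (m z) \<circ> m) i = (if i = z \<or> i = m z then i else m i)" for i
      using ne[of i] mm(2) by (cases "i = z \<or> i = m z") auto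
    have "Transposition.transpose z (m z) \<circ> m permutes (S - {m z})"
    proof (rule permutes_superset)
      show "Transposition.transpose z (m z) \<circ> m permutes (insert z S)"
        by (rule permutes_compose[OF mm(1) permutes_swap_id]) (use mzS in auto)
      show "(Transposition.transpose z (m z) \<circ> m) x = x" if "x \<in> insert z S - (S - {m z})" for x
        unfolding 1 using that by auto
    qed
    moreover have "(Transposition.transpose z (m z) \<circ> m) ((Transposition.transpose z (m z) \<circ> m) i) = i" for i
      unfolding 1 using ne[of i] mm(2) by auto
    moreover have "(Transposition.transpose z (m z) \<circ> m) i \<noteq> i" if "i \<in> S - {m z}" for i
      unfolding 1 using that z mm(3) by auto
    ultimately show "(m z, Transposition.transpose z (m z) \<circ> m) \<in> Sigma S (\<lambda>j. fpf_invol (S - {j}))"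
      using mzS by (auto simp: fpf_invol_def)
  next
    fix b assume "b \<in> Sigma S (\<lambda>j. fpf_invol (S - {j}))"
    then obtain j m where b: "b = (j, m)" "j \<in> S" and m: "m \<in> fpf_invol (S - {j})" by auto
    have mz: "m z = z" using m z by (auto simp: fpf_invol_def permutes_not_in)
    show "((case b of (j, m) \<Rightarrow> Transposition.transpose z j \<circ> m) z,
          Transposition.transpose z ((case b of (j, m) \<Rightarrow> Transposition.transpose z j \<circ> m) z) \<circ> (case b of (j, m) \<Rightarrow> Transposition.transpose z j \<circ> m)) = b"
      by (simp add: b mz fun_eq_iff)
    show "(case b of (j, m) \<Rightarrow> Transposition.transpose z j \<circ> m) \<in> fpf_invol (insert z S)"
      using transpose_fpf_invol[OF z \<open>j \<in> S\<close> m] by (simp add: b)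
  qed
  also have "\<dots> = (\<Sum>j\<in>S. \<Sum>m\<in>fpf_invol (S - {j}). ?w (insert z S) (Transposition.transpose z j \<circ> m))"
    using fin by (subst sum.Sigma) (auto simp: finite_fpf_invol)
  also have "\<dots> = (\<Sum>j\<in>S. ckern (p z) (p j) * ckern (p j) (p z) * hafn p (S - {j}))"
    unfolding hafn_def sum_distrib_left
  proof (intro sum.cong refl)
    fix j m assume j: "j \<in> S" and m: "m \<in> fpf_invol (S - {j})"
    have mp: "m permutes (S - {j})" using m by (auto simp: fpf_invol_def)
    have mz: "m z = z" "m j = j" using mp z by (auto simp: permutes_not_in)
    have "permutation m" using mp fin permutation_permutes by blast
    then have sg: "sign (Transposition.transpose z j \<circ> m) = - sign m"
      using j z by (subst sign_compose) (auto simp: permutation_swap_id sign_swap_id)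
    have "(\<Prod>i\<in>insert z S. \<i> * ckern (p i) (p ((Transposition.transpose z j \<circ> m) i)))
      = (\<i> * ckern (p z) (p j)) * ((\<i> * ckern (p j) (p z)) *
          (\<Prod>i\<in>S - {j}. \<i> * ckern (p i) (p (Transposition.transpose z j (m i)))))"
      using fin z j mz by (simp add: prod.insert prod.remove[of S j])
    also have "(\<Prod>i\<in>S - {j}. \<i> * ckern (p i) (p (Transposition.transpose z j (m i))))
        = (\<Prod>i\<in>S - {j}. \<i> * ckern (p i) (p (m i)))"
    proof (rule prod.cong[OF refl])
      fix i assume i: "i \<in> S - {j}"
      then have "m i \<in> S - {j}" using mp by (metis permutes_in_image)
      then have "m i \<noteq> z" "m i \<noteq> j" using z by auto
      then show "\<i> * ckern (p i) (p (Transposition.transpose z j (m i))) = \<i> * ckern (p i) (p (m i))"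
        by (simp add: transpose_def)
    qed
    finally show "?w (insert z S) (Transposition.transpose z j \<circ> m)
       = ckern (p z) (p j) * ckern (p j) (p z) * ?w (S - {j}) m"
      unfolding sg by (simp add: algebra_simps)
  qed
  finally show ?thesis .
qed

text \<open>\<open>edge_pair\<close> subtracts whenever two positions coincide. For nonreal
  positions injectivity turns this into \<open>s b = b\<close>, the loops counted by principal
  minors; at coinciding real positions the subtracted product is 0 anyway.\<close>

lemma bordered_eq:
  assumes fin: "finite J" and z: "z \<notin> J"
    and inj: "\<And>i j. i \<in> J \<Longrightarrow> j \<in> J \<Longrightarrow> p i = p j \<Longrightarrow> Im (p i) \<noteq> 0 \<Longrightarrow> i = j"
  shows "bordered p J (p z) = permdet (\<lambda>i j. kern (p i) (p j)) (insert z J)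
     + (\<Sum>j\<in>J. ckern (p z) (p j) * ckern (p j) (p z) * permdet (\<lambda>i j. kern (p i) (p j)) (J - {j}))"
proof -
  let ?K = "\<lambda>i j. kern (p i) (p j)"
  have "(\<Sum>s | s permutes J. of_int (sign s) *
         (\<Sum>b\<in>J. edge_pair (p (s b)) (p b) (p z) * (\<Prod>i\<in>J - {b}. ?K i (s i))))
     = (\<Sum>s | s permutes J. of_int (sign s) * (\<Sum>b\<in>J. ?K z (s b) * ?K b z * (\<Prod>i\<in>J - {b}. ?K i (s i))))
     - (\<Sum>s | s permutes J. of_int (sign s) * (\<Sum>b\<in>J. (if s b = b then ckern (p z) (p b) * ckern (p b) (p z) else 0) *
            (\<Prod>i\<in>J - {b}. ?K i (s i))))"
    unfolding sum_subtractf[symmetric] right_diff_distrib[symmetric] left_diff_distrib[symmetric]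
  proof (intro sum.cong refl arg_cong2[where f=times])
    fix s b assume "s \<in> {s. s permutes J}" and b: "b \<in> J"
    then have sb: "s b \<in> J" by (auto simp: permutes_in_image)
    show "edge_pair (p (s b)) (p b) (p z) = ?K z (s b) * ?K b z
       - (if s b = b then ckern (p z) (p b) * ckern (p b) (p z) else 0)"
      using inj[OF sb b] by (auto simp: edge_pair_def ckern_def)
  qed
  then show ?thesis
    using permdet_minor_sum[OF fin, of "\<lambda>b. ckern (p z) (p b) * ckern (p b) (p z)" ?K]
    unfolding bordered_def permdet_insert[OF fin z] by simp
qed

text \<open>The new node z lies either in the determinant part or in the paired part. In the second
  case its pair is detached from the Hafnian and becomes one of the pairing terms inside
  \<open>bordered\<close>.\<close>

lemma Psi_insert:
  assumes fin: "finite I" and z: "z \<notin> I"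
    and inj: "\<And>i j. i \<in> I \<Longrightarrow> j \<in> I \<Longrightarrow> p i = p j \<Longrightarrow> Im (p i) \<noteq> 0 \<Longrightarrow> i = j"
  shows "Psi p (insert z I) = (\<Sum>S\<in>Pow I. hafn p S * bordered p (I - S) (p z))"
proof -
  let ?K = "\<lambda>i j. kern (p i) (p j)"
  let ?u = "\<lambda>j. ckern (p z) (p j) * ckern (p j) (p z)"
  have "Psi p (insert z I) = (\<Sum>S\<in>Pow I. hafn p S * permdet ?K (insert z I - S))
      + (\<Sum>S\<in>insert z ` Pow I. hafn p S * permdet ?K (insert z I - S))"
    unfolding Psi_def Pow_insert
    by (rule sum.union_disjoint) (use fin z in auto)
  also have "(\<Sum>S\<in>Pow I. hafn p S * permdet ?K (insert z I - S)) = (\<Sum>S\<in>Pow I. hafn p S * permdet ?K (insert z (I - S)))"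
  proof (intro sum.cong refl)
    fix S assume "S \<in> Pow I"
    then have "insert z I - S = insert z (I - S)" using z by auto
    then show "hafn p S * permdet ?K (insert z I - S) = hafn p S * permdet ?K (insert z (I - S))" by simp
  qed
  also have "(\<Sum>S\<in>insert z ` Pow I. hafn p S * permdet ?K (insert z I - S))
      = (\<Sum>S\<in>Pow I. hafn p (insert z S) * permdet ?K (I - S))"
  proof (subst sum.reindex)
    show "inj_on (insert z) (Pow I)" using z by (auto simp: inj_on_def insert_ident)
    show "(\<Sum>S\<in>Pow I. ((\<lambda>S. hafn p S * permdet ?K (insert z I - S)) \<circ> insert z) S)
        = (\<Sum>S\<in>Pow I. hafn p (insert z S) * permdet ?K (I - S))"
      using z by (intro sum.cong refl) (simp add: Diff_insert_absorb)
  qed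
  also have "\<dots> = (\<Sum>S\<in>Pow I. \<Sum>j\<in>S. ?u j * hafn p (S - {j}) * permdet ?K (I - S))"
  proof (intro sum.cong refl)
    fix S assume "S \<in> Pow I"
    then have "finite S" "z \<notin> S" using fin z by (auto intro: finite_subset)
    then show "hafn p (insert z S) * permdet ?K (I - S) = (\<Sum>j\<in>S. ?u j * hafn p (S - {j}) * permdet ?K (I - S))"
      by (simp add: hafn_insert sum_distrib_right)
  qed
  also have "\<dots> = (\<Sum>(S,j)\<in>Sigma (Pow I) (\<lambda>S. S). ?u j * hafn p (S - {j}) * permdet ?K (I - S))"
    using fin by (subst sum.Sigma) (auto intro: finite_subset)
  \<comment> \<open>The partner j of z moves from the paired set to its complement: (S, j) with j in
    S becomes (\<open>S - {j}\<close>, j).\<close>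
  also have "\<dots> = (\<Sum>(S,j)\<in>Sigma (Pow I) (\<lambda>S. I - S). ?u j * hafn p S * permdet ?K (I - S - {j}))"
    by (rule sum.reindex_bij_witness[where i="\<lambda>(S,j). (insert j S, j)" and j="\<lambda>(S,j). (S - {j}, j)"])
       (auto simp: insert_absorb intro!: arg_cong[where f="permdet _"])
  also have "\<dots> = (\<Sum>S\<in>Pow I. \<Sum>j\<in>I - S. ?u j * hafn p S * permdet ?K (I - S - {j}))"
    using fin by (subst sum.Sigma) (auto intro: finite_subset)
  finally show ?thesis
    unfolding sum.distrib[symmetric]
  proof (rule trans)
    show "(\<Sum>S\<in>Pow I. hafn p S * permdet ?K (insert z (I - S)) + (\<Sum>j\<in>I - S. ?u j * hafn p S * permdet ?K (I - S - {j})))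
      = (\<Sum>S\<in>Pow I. hafn p S * bordered p (I - S) (p z))"
    proof (intro sum.cong refl)
      fix S assume "S \<in> Pow I"
      have "bordered p (I - S) (p z) = permdet ?K (insert z (I - S)) + (\<Sum>j\<in>I - S. ?u j * permdet ?K (I - S - {j}))"
        by (rule bordered_eq) (use fin z inj in auto)
      then show "hafn p S * permdet ?K (insert z (I - S)) + (\<Sum>j\<in>I - S. ?u j * hafn p S * permdet ?K (I - S - {j}))
        = hafn p S * bordered p (I - S) (p z)"
        by (simp add: algebra_simps sum_distrib_left)
    qed
  qed
qed

section \<open>Cauchy integrals on the real line\<close>

lemma expq_holomorphic: "expq holomorphic_on A"
proof -
  have "(\<lambda>z. if z = 0 then deriv (\<lambda>u. exp (2 * \<i> * of_real pi * u)) 0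
      else (exp (2 * \<i> * of_real pi * z) - exp (2 * \<i> * of_real pi * 0)) / (z - 0)) holomorphic_on UNIV"
    by (rule pole_lemma_open) (auto intro!: holomorphic_intros)
  moreover have "deriv (\<lambda>u. exp (2 * \<i> * of_real pi * u)) 0 = 2 * \<i> * of_real pi"
    by (rule DERIV_imp_deriv) (auto intro!: derivative_eq_intros)
  ultimately have "expq holomorphic_on UNIV"
    by (simp add: expq_def[abs_def] if_distrib cong: if_cong)
  then show ?thesis by (rule holomorphic_on_subset) simp
qed

lemma continuous_on_expq [continuous_intros]:
  "continuous_on A f \<Longrightarrow> continuous_on A (\<lambda>x. expq (f x))"
  using continuous_on_compose2[OF holomorphic_on_imp_continuous_on[OF expq_holomorphic[of UNIV]]]
  by auto

lemma expq_borel_measurable [measurable]: "expq \<in> borel_measurable borel"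
  by (intro borel_measurable_continuous_onI continuous_intros)

text \<open>Mean value inequality for exp on the half plane \<open>Re w \<le> 2 * pi * c\<close>,
  which is convex, contains 0 and w, and on which the derivative is at most exp(2 pi c). The
  removable singularity at 0 and the behaviour at infinity are covered by the same bound.\<close>

lemma norm_expq_le:
  assumes "c \<ge> 0" "- c \<le> Im u"
  shows "norm (expq u) \<le> 2 * pi * exp (2 * pi * c)"
proof (cases "u = 0")
  case True
  then show ?thesis using assms by (simp add: expq_def norm_mult)
next
  case False
  define w where "w = 2 * \<i> * of_real pi * u"
  have "norm (exp w - exp 0) \<le> exp (2 * pi * c) * norm (w - 0)"
  proof (rule field_differentiable_bound[where S="{w. Re w \<le> 2 * pi * c}" and f'=exp])
    show "convex {w. Re w \<le> 2 * pi * c}" by (rule convex_halfspace_Re_le)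
    have "pi * - Im u \<le> pi * c" using assms by (intro mult_left_mono) auto
    then show "w \<in> {w. Re w \<le> 2 * pi * c}" by (simp add: w_def)
    show "0 \<in> {w. Re w \<le> 2 * pi * c}" using assms by simp
  qed (auto intro!: derivative_eq_intros)
  then show ?thesis
    using False by (simp add: expq_def w_def norm_divide norm_mult field_simps)
qed

lemma expq_reflect: "expq (- u) = expq u * exp (- (2 * \<i> * of_real pi * u))"
  by (cases "u = 0") (auto simp: expq_def field_simps exp_minus)

lemma integrable_cauchy_density: "integrable lborel (\<lambda>x::real. 1 / (1 + x\<^sup>2))"
  and integral_cauchy_density: "(\<integral>x. 1 / (1 + x\<^sup>2) \<partial>lborel) = pi"
proof -
  show "integrable lborel (\<lambda>x::real. 1 / (1 + x\<^sup>2))"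
    using Sinc_Integral.integrable_inverse_1_plus_square
    by (simp add: set_integrable_def einterval_eq_UNIV inverse_eq_divide)
  show "(\<integral>x. 1 / (1 + x\<^sup>2) \<partial>lborel) = pi"
    using LBINT_inverse_1_plus_square
    by (simp add: interval_lebesgue_integral_def set_lebesgue_integral_def einterval_eq_UNIV inverse_eq_divide)
qed

lemma one_plus_norm_le:
  fixes u z :: complex
  assumes "\<eta> > 0" "\<eta> \<le> norm (u - z)"
  shows "1 + norm u \<le> (1 + (norm z + 1) / \<eta>) * norm (u - z)"
proof -
  have "norm u \<le> norm (u - z) + norm z" by (metis add.commute norm_triangle_sub)
  moreover have "norm z + 1 \<le> (norm z + 1) / \<eta> * norm (u - z)"
    using assms by (simp add: field_simps)
      (metis add_mono mult_left_mono norm_ge_zero mult.commute)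
  ultimately show ?thesis by (simp add: algebra_simps)
qed

lemma one_plus_norm_square_le: "1 + (norm u)\<^sup>2 \<le> (1 + norm (u::complex))\<^sup>2"
  by (simp add: power2_eq_square algebra_simps)

lemma norm_inverse_prod_le:
  fixes u z w :: complex
  assumes "\<eta> > 0" "\<eta> \<le> norm (u - z)" "\<eta> \<le> norm (u - w)"
  shows "norm (1 / ((u - z) * (u - w))) \<le>
    (1 + (norm z + 1) / \<eta>) * (1 + (norm w + 1) / \<eta>) / (1 + (norm u)\<^sup>2)"
proof -
  have pos: "norm (u - z) > 0" "norm (u - w) > 0" using assms by linarith+
  have "1 + (norm u)\<^sup>2 \<le> (1 + norm u) * (1 + norm u)"
    using one_plus_norm_square_le by (simp add: power2_eq_square)
  also have "\<dots> \<le> ((1 + (norm z + 1) / \<eta>) * norm (u - z)) * ((1 + (norm w + 1) / \<eta>) * norm (u - w))"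
    by (rule mult_mono) (use one_plus_norm_le assms in auto)
  finally have "(1 + (norm u)\<^sup>2) \<le> (1 + (norm z + 1) / \<eta>) * (1 + (norm w + 1) / \<eta>) * (norm (u - z) * norm (u - w))"
    by (simp add: algebra_simps)
  moreover have "1 + (norm u)\<^sup>2 > 0" by (simp add: add_pos_nonneg)
  ultimately show ?thesis using pos
    by (simp add: norm_divide norm_mult divide_le_eq le_divide_eq pos_divide_le_eq mult.commute)
qed

lemma integrable_decay:
  fixes g :: "real \<Rightarrow> complex"
  assumes [measurable]: "g \<in> borel_measurable borel" and "\<And>x. norm (g x) \<le> C / (1 + x\<^sup>2)"
  shows "integrable lborel g"
proof (rule Bochner_Integration.integrable_bound)
  show "integrable lborel (\<lambda>x. C * (1 / (1 + x\<^sup>2)))"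
    by (intro integrable_mult_right integrable_cauchy_density)
  show "AE x in lborel. norm (g x) \<le> norm (C * (1 / (1 + x\<^sup>2)))"
  proof (rule AE_I2)
    fix x
    have "norm (g x) \<le> C * (1 / (1 + x\<^sup>2))" using assms(2)[of x] by simp
    also have "\<dots> \<le> norm (C * (1 / (1 + x\<^sup>2)))" unfolding real_norm_def by (rule abs_ge_self)
    finally show "norm (g x) \<le> norm (C * (1 / (1 + x\<^sup>2)))" .
  qed
qed simp

text \<open>Cauchy's theorem for the segment from -n to n closed by the upper semicircle; the arc
  contributes at most pi n C / (1 + n^2). The strip of width \<delta> below the axis keeps the
  closed path inside an open convex domain of holomorphy.\<close>

lemma upper_half_plane_integral_zero:
  fixes g :: "complex \<Rightarrow> complex"
  assumes "\<delta> > 0" and hol: "g holomorphic_on {u. Im u > - \<delta>}"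
    and bound: "\<And>u. Im u \<ge> 0 \<Longrightarrow> norm (g u) \<le> C / (1 + (norm u)\<^sup>2)"
  shows "integrable lborel (\<lambda>x. g (of_real x))" "(\<integral>x. g (of_real x) \<partial>lborel) = 0"
proof -
  let ?S = "{u. Im u > - \<delta>}"
  have contg: "continuous_on ?S g" using hol by (rule holomorphic_on_imp_continuous_on)
  have cont: "continuous_on UNIV (\<lambda>x. g (of_real x))"
    by (rule continuous_on_compose2[OF contg]) (use \<open>\<delta> > 0\<close> in \<open>auto intro!: continuous_intros\<close>)
  then have meas: "(\<lambda>x. g (of_real x)) \<in> borel_measurable borel"
    by (rule borel_measurable_continuous_onI)
  have C: "C \<ge> 0" using bound[of 0] by (simp) (meson norm_ge_zero order_trans)
  show int: "integrable lborel (\<lambda>x. g (of_real x))"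
  proof (rule integrable_decay[OF meas])
    fix x show "norm (g (of_real x)) \<le> C / (1 + x\<^sup>2)" using bound[of "of_real x"] by simp
  qed
  have lim1: "(\<lambda>n. \<integral>x. indicator {- real n..real n} x *\<^sub>R g (of_real x) \<partial>lborel)
      \<longlonglongrightarrow> (\<integral>x. g (of_real x) \<partial>lborel)"
  proof (rule integral_dominated_convergence[where w="\<lambda>x. norm (g (of_real x))"])
    show "AE x in lborel. (\<lambda>n. indicator {- real n..real n} x *\<^sub>R g (of_real x)) \<longlonglongrightarrow> g (of_real x)"
    proof (rule AE_I2)
      fix x :: real
      have "eventually (\<lambda>n. indicator {- real n..real n} x *\<^sub>R g (of_real x) = g (of_real x)) sequentially"
        using eventually_ge_at_top[of "nat \<lceil>\<bar>x\<bar>\<rceil>"]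
      proof eventually_elim
        fix n assume "nat \<lceil>\<bar>x\<bar>\<rceil> \<le> n"
        then have "\<bar>x\<bar> \<le> real n" by linarith
        then show "indicator {- real n..real n} x *\<^sub>R g (of_real x) = g (of_real x)"
          by (auto simp: indicator_def)
      qed
      then show "(\<lambda>n. indicator {- real n..real n} x *\<^sub>R g (of_real x)) \<longlonglongrightarrow> g (of_real x)"
        by (rule tendsto_eventually)
    qed
    show "integrable lborel (\<lambda>x. norm (g (of_real x)))" using int by simp
  qed (use meas in \<open>auto simp: indicator_def\<close>)
  have lim2: "(\<lambda>n. \<integral>x. indicator {- real n..real n} x *\<^sub>R g (of_real x) \<partial>lborel) \<longlonglongrightarrow> 0"
  proof (rule Lim_null_comparison)
    show "\<forall>\<^sub>F n in sequentially. norm (\<integral>x. indicator {- real n..real n} x *\<^sub>R g (of_real x) \<partial>lborel)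
        \<le> C / (1 + (real n)\<^sup>2) * real n * (pi - 0)"
      using eventually_gt_at_top[of 0]
    proof eventually_elim
      fix n :: nat assume n: "n > 0"
      let ?L = "linepath (- of_real (real n)) (of_real (real n)) :: real \<Rightarrow> complex"
      let ?A = "part_circlepath 0 (real n) 0 pi"
      have "convex {u. Im u > - \<delta>}" by (rule convex_halfspace_Im_gt)
      from this have lS: "path_image ?L \<subseteq> ?S"
        unfolding path_image_linepath
        by (intro closed_segment_subset) (use \<open>\<delta> > 0\<close> in auto)
      have aIm: "Im u \<ge> 0" if "u \<in> path_image ?A" for u
        using that by (auto simp: path_image_part_circlepath Im_exp intro!: mult_nonneg_nonneg sin_ge_zero)
      then have aS: "path_image ?A \<subseteq> ?S" using \<open>\<delta> > 0\<close> by force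
      have "(g has_contour_integral 0) (?L +++ ?A)"
        by (rule Cauchy_theorem_convex_simple[OF hol \<open>convex {u. Im u > - \<delta>}\<close>])
           (use lS aS in \<open>auto simp: path_image_join exp_eq_polar intro!: valid_path_join\<close>)
      moreover have Li: "g contour_integrable_on ?L"
        by (rule contour_integrable_continuous_linepath)
           (use lS contg in \<open>auto intro: continuous_on_subset simp flip: path_image_linepath\<close>)
      moreover have Ai: "g contour_integrable_on ?A"
        by (rule contour_integrable_continuous_part_circlepath)
           (use aS contg in \<open>auto intro: continuous_on_subset\<close>)
      ultimately have "contour_integral ?L g + contour_integral ?A g = 0"
        by (metis contour_integral_join contour_integral_unique valid_path_linepath valid_path_part_circlepath)
      then have "norm (contour_integral ?L g) = norm (contour_integral ?A g)"
        by (simp add: add_eq_0_iff)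
      also have "\<dots> \<le> C / (1 + (real n)\<^sup>2) * real n * (pi - 0)"
      proof (rule has_contour_integral_bound_part_circlepath[OF has_contour_integral_integral[OF Ai]])
        fix u assume u: "u \<in> path_image ?A"
        have "norm u = real n" using in_path_image_part_circlepath[OF u] by simp
        then show "norm (g u) \<le> C / (1 + (real n)\<^sup>2)" using bound[OF aIm[OF u]] by simp
      qed (use n C in auto)
      also have "contour_integral ?L g = integral {- real n..real n} (\<lambda>x. g (of_real x))"
        using n by (subst contour_integral_linepath_Reals_eq) auto
      also have "\<dots> = (\<integral>x. indicator {- real n..real n} x *\<^sub>R g (of_real x) \<partial>lborel)"
      proof -
        have "set_integrable lborel {- real n..real n} (\<lambda>x. g (of_real x))"
          unfolding set_integrable_def by (rule integrable_mult_indicator) (use int in auto)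
        from set_borel_integral_eq_integral(2)[OF this] show ?thesis
          by (simp add: set_lebesgue_integral_def)
      qed
      finally show "norm (\<integral>x. indicator {- real n..real n} x *\<^sub>R g (of_real x) \<partial>lborel)
        \<le> C / (1 + (real n)\<^sup>2) * real n * (pi - 0)" .
    qed
    have "(\<lambda>n. C * pi * inverse (real n)) \<longlonglongrightarrow> 0"
      using tendsto_mult_right_zero[OF lim_inverse_n, of "C * pi"] by simp
    moreover have "\<forall>\<^sub>F n in sequentially. norm (C / (1 + (real n)\<^sup>2) * real n * (pi - 0)) \<le> C * pi * inverse (real n)"
      using eventually_gt_at_top[of 0]
    proof eventually_elim
      fix n :: nat assume "n > 0"
      then have "real n / (1 + (real n)\<^sup>2) \<le> real n / (real n)\<^sup>2"
        by (intro divide_left_mono mult_pos_pos) (auto simp: add_pos_nonneg)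
      also have "\<dots> = inverse (real n)" using \<open>n > 0\<close> by (simp add: power2_eq_square divide_simps)
      finally have "real n / (1 + (real n)\<^sup>2) \<le> inverse (real n)" .
      from mult_left_mono[OF this, of "C * pi"] C
      show "norm (C / (1 + (real n)\<^sup>2) * real n * (pi - 0)) \<le> C * pi * inverse (real n)"
        by (simp add: algebra_simps)
    qed
    ultimately show "(\<lambda>n. C / (1 + (real n)\<^sup>2) * real n * (pi - 0)) \<longlonglongrightarrow> 0"
      by (rule Lim_null_comparison[rotated])
  qed
  show "(\<integral>x. g (of_real x) \<partial>lborel) = 0"
    using LIMSEQ_unique[OF lim1 lim2] .
qed

lemma convex_upper_subset: "\<delta>' \<le> \<delta> \<Longrightarrow> f holomorphic_on {u. Im u > - \<delta>} \<Longrightarrow> f holomorphic_on {u. Im u > - \<delta>'}"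
  by (erule holomorphic_on_subset) auto

text \<open>The difference is (z - w) / ((x - z)(x - w)): the leading 1/x terms cancel, and this
  makes bounded densities integrable against it.\<close>

lemma cauchy_pair_decay:
  fixes z w :: complex
  assumes "Im z \<noteq> 0" "Im w \<noteq> 0"
  obtains C where "C \<ge> 0" "\<And>x. norm (1 / (of_real x - z) - 1 / (of_real x - w)) \<le> C / (1 + x\<^sup>2)"
proof -
  define \<eta> where "\<eta> = min \<bar>Im z\<bar> \<bar>Im w\<bar>"
  have \<eta>: "\<eta> > 0" using assms by (auto simp: \<eta>_def)
  define C where "C = norm (z - w) * ((1 + (norm z + 1) / \<eta>) * (1 + (norm w + 1) / \<eta>))"
  have "C \<ge> 0" unfolding C_def using \<eta> by (intro mult_nonneg_nonneg add_nonneg_nonneg divide_nonneg_pos) auto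
  moreover have "norm (1 / (of_real x - z) - 1 / (of_real x - w)) \<le> C / (1 + x\<^sup>2)" for x
  proof -
    have nz: "of_real x - z \<noteq> 0" "of_real x - w \<noteq> 0" using assms by (auto simp: complex_eq_iff)
    have "\<eta> \<le> norm (of_real x - z)" "\<eta> \<le> norm (of_real x - w)"
      using abs_Im_le_cmod[of "of_real x - z"] abs_Im_le_cmod[of "of_real x - w"] by (auto simp: \<eta>_def)
    note * = norm_inverse_prod_le[OF \<eta> this]
    have "1 / (of_real x - z) - 1 / (of_real x - w) = (z - w) * (1 / ((of_real x - z) * (of_real x - w)))"
      using nz by (simp add: field_simps)
    then have "norm (1 / (of_real x - z) - 1 / (of_real x - w))
      = norm (z - w) * norm (1 / ((of_real x - z) * (of_real x - w)))" by (metis norm_mult)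
    also have "\<dots> \<le> norm (z - w) * ((1 + (norm z + 1) / \<eta>) * (1 + (norm w + 1) / \<eta>) / (1 + (norm (of_real x :: complex))\<^sup>2))"
      by (rule mult_left_mono[OF *]) simp
    finally show ?thesis by (simp add: C_def)
  qed
  ultimately show thesis using that by blast
qed

lemma integrable_cauchy_pair:
  fixes f :: "real \<Rightarrow> complex"
  assumes [measurable]: "f \<in> borel_measurable borel" and B: "\<And>x. norm (f x) \<le> B"
    and "Im z \<noteq> 0" "Im w \<noteq> 0"
  shows "integrable lborel (\<lambda>x. f x * (1 / (of_real x - z) - 1 / (of_real x - w)))"
proof -
  obtain C where C: "C \<ge> 0" "\<And>x. norm (1 / (of_real x - z) - 1 / (of_real x - w)) \<le> C / (1 + x\<^sup>2)"
    using cauchy_pair_decay[OF assms(3,4)] by blast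
  show ?thesis
  proof (rule integrable_decay)
    fix x
    have "norm (f x * (1 / (of_real x - z) - 1 / (of_real x - w))) \<le> B * (C / (1 + x\<^sup>2))"
      unfolding norm_mult by (rule mult_mono[OF B C(2)]) (use B[of 0] norm_ge_zero order_trans in \<open>blast+\<close>)
    then show "norm (f x * (1 / (of_real x - z) - 1 / (of_real x - w))) \<le> B * C / (1 + x\<^sup>2)" by simp
  qed measurable
qed

text \<open>Both poles lie below the axis, so the integrand is holomorphic on a neighbourhood of the
  closed upper half plane, where boundedness of f and the paired kernel give quadratic
  decay.\<close>

lemma plemelj_both_below:
  fixes f :: "complex \<Rightarrow> complex"
  assumes "\<delta> > 0" and hol: "f holomorphic_on {u. Im u > - \<delta>}"
    and bound: "\<And>u. Im u \<ge> 0 \<Longrightarrow> norm (f u) \<le> B"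
    and z: "Im z < 0" and w: "Im w < 0"
  shows "(\<integral>x. f (of_real x) * (1 / (of_real x - z) - 1 / (of_real x - w)) \<partial>lborel) = 0"
proof -
  define \<eta> where "\<eta> = min \<delta> (min (- Im z) (- Im w))"
  have \<eta>: "\<eta> > 0" "\<eta> \<le> \<delta>" "\<eta> \<le> - Im z" "\<eta> \<le> - Im w" using assms by (auto simp: \<eta>_def)
  let ?g = "\<lambda>u. f u * (1 / (u - z) - 1 / (u - w))"
  define C where "C = B * norm (z - w) * ((1 + (norm z + 1) / \<eta>) * (1 + (norm w + 1) / \<eta>))"
  show ?thesis
  proof (rule upper_half_plane_integral_zero(2)[of \<eta> ?g C])
    show "?g holomorphic_on {u. - \<eta> < Im u}"
      by (intro holomorphic_intros holomorphic_on_subset[OF hol]) (use \<eta> in auto)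
    fix u assume u: "0 \<le> Im u"
    have nz: "u - z \<noteq> 0" "u - w \<noteq> 0" using u z w by auto
    have "\<eta> \<le> norm (u - z)" "\<eta> \<le> norm (u - w)"
      using abs_Im_le_cmod[of "u - z"] abs_Im_le_cmod[of "u - w"] \<eta> u by auto
    note * = norm_inverse_prod_le[OF \<eta>(1) this]
    have "?g u = f u * (z - w) * (1 / ((u - z) * (u - w)))"
      using nz by (simp add: field_simps)
    then have "norm (?g u) = norm (f u) * norm (z - w) * norm (1 / ((u - z) * (u - w)))"
      by (metis norm_mult)
    also have "\<dots> \<le> B * norm (z - w) * ((1 + (norm z + 1) / \<eta>) * (1 + (norm w + 1) / \<eta>) / (1 + (norm u)\<^sup>2))"
      using bound[OF u] by (intro mult_mono * mult_nonneg_nonneg order_trans[OF norm_ge_zero bound[OF u]]) auto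
    finally show "norm (?g u) \<le> C / (1 + (norm u)\<^sup>2)" by (simp add: C_def)
  qed (use \<eta> in auto)
qed

text \<open>The integrand is 2\<i> times the Poisson kernel of z, whose total mass is pi.\<close>

lemma cauchy_pair_conjugate:
  assumes "Im z > 0"
  shows "(\<integral>x. (1 / (of_real x - z) - 1 / (of_real x - cnj z)) \<partial>lborel) = 2 * \<i> * of_real pi"
proof -
  have eq: "1 / (of_real x - z) - 1 / (of_real x - cnj z)
     = 2 * \<i> * of_real (Im z / ((x - Re z)\<^sup>2 + (Im z)\<^sup>2))" for x
  proof -
    have nz: "of_real x - z \<noteq> 0" "of_real x - cnj z \<noteq> 0" using assms by (auto simp: complex_eq_iff)
    have "(of_real x - z) * (of_real x - cnj z) = of_real ((x - Re z)\<^sup>2 + (Im z)\<^sup>2)"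
      by (simp add: complex_eq_iff power2_eq_square algebra_simps)
    then have "1 / (of_real x - z) - 1 / (of_real x - cnj z) = (z - cnj z) / of_real ((x - Re z)\<^sup>2 + (Im z)\<^sup>2)"
      using nz by (simp add: divide_simps)
    also have "z - cnj z = 2 * \<i> * of_real (Im z)" by (simp add: complex_eq_iff)
    finally show ?thesis by simp
  qed
  have "(\<integral>x. Im z / ((x - Re z)\<^sup>2 + (Im z)\<^sup>2) \<partial>lborel)
     = \<bar>Im z\<bar> *\<^sub>R (\<integral>x. Im z / ((Re z + Im z * x - Re z)\<^sup>2 + (Im z)\<^sup>2) \<partial>lborel)"
    by (rule lborel_integral_real_affine) (use assms in auto)
  also have "\<dots> = (\<integral>x. \<bar>Im z\<bar> * (Im z / ((Re z + Im z * x - Re z)\<^sup>2 + (Im z)\<^sup>2)) \<partial>lborel)"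
    unfolding real_scaleR_def by (rule integral_mult_right_zero[symmetric])
  also have "\<dots> = (\<integral>x. 1 / (1 + x\<^sup>2) \<partial>lborel)"
  proof (rule Bochner_Integration.integral_cong[OF refl])
    fix x :: real
    have "Im z * x * (Im z * x) + Im z * Im z = Im z * Im z * (1 + x * x)" by (simp add: algebra_simps)
    then show "\<bar>Im z\<bar> * (Im z / ((Re z + Im z * x - Re z)\<^sup>2 + (Im z)\<^sup>2)) = 1 / (1 + x\<^sup>2)"
      using assms by (simp add: power2_eq_square)
  qed
  also have "\<dots> = pi" by (rule integral_cauchy_density)
  finally have "(\<integral>x. Im z / ((x - Re z)\<^sup>2 + (Im z)\<^sup>2) \<partial>lborel) = pi" .
  then show ?thesis unfolding eq
    by (subst integral_mult_right_zero, subst integral_complex_of_real) simp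
qed

lemma cauchy_pair_mixed:
  assumes "Im z > 0" "Im w < 0"
  shows "(\<integral>x. (1 / (of_real x - z) - 1 / (of_real x - w)) \<partial>lborel) = 2 * \<i> * of_real pi"
proof -
  have "(\<integral>x. 1 * (1 / (of_real x - cnj z) - 1 / (of_real x - w)) \<partial>lborel) = (0::complex)"
    by (rule plemelj_both_below[of 1 "\<lambda>_. 1" 1]) (use assms in auto)
  moreover have "integrable lborel (\<lambda>x. 1 * (1 / (of_real x - z) - 1 / (of_real x - cnj z)))"
     "integrable lborel (\<lambda>x. 1 * (1 / (of_real x - cnj z) - 1 / (of_real x - w)))"
    by (rule integrable_cauchy_pair[of _ 1]; use assms in simp)+
  ultimately have "(\<integral>x. (1 / (of_real x - z) - 1 / (of_real x - cnj z)) + (1 / (of_real x - cnj z) - 1 / (of_real x - w)) \<partial>lborel)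
     = 2 * \<i> * of_real pi + 0"
    using cauchy_pair_conjugate[OF assms(1)] by (subst Bochner_Integration.integral_add) auto
  then show ?thesis by simp
qed

text \<open>Near z the extended quotient is continuous on a compact set; at distance more than 1
  from z it is at most \<open>2 * B / norm (u - z)\<close>. Both are dominated by a multiple of 1 /
  (1 + |u|).\<close>

lemma removable_quotient_bounded:
  fixes f :: "complex \<Rightarrow> complex"
  assumes "open S" and hol: "f holomorphic_on S" and T: "closed T" "T \<subseteq> S"
    and bound: "\<And>u. u \<in> T \<Longrightarrow> norm (f u) \<le> B" and fz: "norm (f z) \<le> B"
  obtains C where "C \<ge> 0"
    "\<And>u. u \<in> T \<Longrightarrow> norm (if u = z then deriv f z else (f u - f z) / (u - z)) \<le> C / (1 + norm u)"
proof -
  let ?Q = "\<lambda>u. if u = z then deriv f z else (f u - f z) / (u - z)"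
  have hQ: "?Q holomorphic_on S" by (rule pole_lemma_open[OF hol \<open>open S\<close>])
  have "compact (cball z 1 \<inter> T)" using T by (intro compact_Int_closed) auto
  moreover have "continuous_on (cball z 1 \<inter> T) ?Q"
    using T by (intro continuous_on_subset[OF holomorphic_on_imp_continuous_on[OF hQ]]) auto
  ultimately have "bounded (?Q ` (cball z 1 \<inter> T))"
    by (intro compact_imp_bounded compact_continuous_image)
  then obtain M0 where M0: "\<And>u. u \<in> cball z 1 \<inter> T \<Longrightarrow> norm (?Q u) \<le> M0"
    unfolding bounded_iff by blast
  define M where "M = max M0 0"
  have M: "\<And>u. u \<in> cball z 1 \<inter> T \<Longrightarrow> norm (?Q u) \<le> M" "M \<ge> 0" using M0 by (force simp: M_def)+
  define C where "C = M * (2 + norm z) + 2 * B * (1 + (norm z + 1) / 1)"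
  have B: "B \<ge> 0" using fz norm_ge_zero order_trans by blast
  show thesis
  proof (rule that[of C])
    show "C \<ge> 0" unfolding C_def using M(2) B by (intro add_nonneg_nonneg mult_nonneg_nonneg) auto
    fix u assume u: "u \<in> T"
    show "norm (?Q u) \<le> C / (1 + norm u)"
    proof (cases "norm (u - z) \<le> 1")
      case True
      then have "1 + norm u \<le> 2 + norm z"
        using norm_triangle_ineq2[of u z] by simp
      then have "norm (?Q u) * (1 + norm u) \<le> M * (2 + norm z)"
        using M(1)[of u] True u by (intro mult_mono M(2)) (auto simp: dist_norm norm_minus_commute)
      also have "\<dots> \<le> C" unfolding C_def using B by simp
      finally show ?thesis by (subst pos_le_divide_eq) (auto simp: add_pos_nonneg)
    next
      case False
      then have ne: "u \<noteq> z" by auto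
      have "1 + norm u \<le> (1 + (norm z + 1) / 1) * norm (u - z)"
        by (rule one_plus_norm_le) (use False in auto)
      moreover have "norm (?Q u) \<le> 2 * B / norm (u - z)"
        using ne norm_triangle_ineq4[of "f u" "f z"] bound[OF u] fz
        by (simp add: norm_divide divide_right_mono)
      ultimately have "norm (?Q u) * (1 + norm u) \<le> 2 * B / norm (u - z) * ((1 + (norm z + 1) / 1) * norm (u - z))"
        using B by (intro mult_mono) auto
      also have "\<dots> = 2 * B * (1 + (norm z + 1) / 1)" using ne by simp
      also have "\<dots> \<le> C" unfolding C_def using M(2) by simp
      finally show ?thesis by (subst pos_le_divide_eq) (auto simp: add_pos_nonneg)
    qed
  qed
qed

text \<open>Subtracting the constant \<open>f z\<close> from f removes the pole at z. The quotient
  times (z - w) / (u - w) then decays quadratically and integrates to 0, and the constant leaves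
  \<open>f z\<close> times a known integral, so no residue calculus enters.\<close>

lemma plemelj_mixed:
  fixes f :: "complex \<Rightarrow> complex"
  assumes "\<delta> > 0" and hol: "f holomorphic_on {u. Im u > - \<delta>}"
    and bound: "\<And>u. Im u \<ge> 0 \<Longrightarrow> norm (f u) \<le> B"
    and z: "Im z > 0" and w: "Im w < 0"
  shows "(\<integral>x. f (of_real x) * (1 / (of_real x - z) - 1 / (of_real x - w)) \<partial>lborel) = 2 * \<i> * of_real pi * f z"
proof -
  define \<eta> where "\<eta> = min \<delta> (- Im w)"
  have \<eta>: "\<eta> > 0" "\<eta> \<le> \<delta>" "\<eta> \<le> - Im w" using assms by (auto simp: \<eta>_def)
  let ?Q = "\<lambda>u. if u = z then deriv f z else (f u - f z) / (u - z)"
  have op: "open {u. Im u > - \<eta>}" by (rule open_halfspace_Im_gt)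
  have hol': "f holomorphic_on {u. Im u > - \<eta>}"
    by (rule convex_upper_subset[OF \<eta>(2) hol])
  obtain C where C: "C \<ge> 0" "\<And>u. u \<in> {u. Im u \<ge> 0} \<Longrightarrow> norm (?Q u) \<le> C / (1 + norm u)"
    by (rule removable_quotient_bounded[OF op hol' closed_halfspace_Im_ge[of 0]])
       (use bound z \<eta> in auto)
  let ?g = "\<lambda>u. ?Q u * ((z - w) / (u - w))"
  define D where "D = C * (norm (z - w) * (1 + (norm w + 1) / \<eta>))"
  have zero: "(\<integral>x. ?g (of_real x) \<partial>lborel) = 0" and int: "integrable lborel (\<lambda>x. ?g (of_real x))"
  proof -
    have h: "?g holomorphic_on {u. - \<eta> < Im u}"
      by (intro holomorphic_intros pole_lemma_open[OF hol' op]) (use \<eta> in auto)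
    have b: "norm (?g u) \<le> D / (1 + (norm u)\<^sup>2)" if u: "0 \<le> Im u" for u
    proof -
      have "\<eta> \<le> norm (u - w)" using abs_Im_le_cmod[of "u - w"] \<eta> u by auto
      then have l: "1 + norm u \<le> (1 + (norm w + 1) / \<eta>) * norm (u - w)" "norm (u - w) > 0"
        using one_plus_norm_le[OF \<eta>(1)] \<eta>(1) by auto
      have p: "1 + norm u > 0" "1 + (norm u)\<^sup>2 > 0" by (auto simp: add_pos_nonneg)
      have "1 / norm (u - w) \<le> (1 + (norm w + 1) / \<eta>) / (1 + norm u)"
        using l p by (simp add: divide_simps mult.commute)
      then have "norm (?g u) \<le> C / (1 + norm u) * (norm (z - w) * ((1 + (norm w + 1) / \<eta>) / (1 + norm u)))"
        unfolding norm_mult norm_divide[of "z - w"] divide_inverse[of "norm (z - w)"]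
        using C u p by (intro mult_mono mult_left_mono) (auto simp: inverse_eq_divide)
      also have "\<dots> = D / (1 + norm u)\<^sup>2" by (simp add: D_def power2_eq_square)
      also have "\<dots> \<le> D / (1 + (norm u)\<^sup>2)"
        by (rule divide_left_mono[OF one_plus_norm_square_le])
           (use C(1) \<eta> p in \<open>auto simp: D_def intro!: mult_nonneg_nonneg add_nonneg_nonneg divide_nonneg_pos\<close>)
      finally show ?thesis .
    qed
    show "(\<integral>x. ?g (of_real x) \<partial>lborel) = 0" "integrable lborel (\<lambda>x. ?g (of_real x))"
      using upper_half_plane_integral_zero[OF \<eta>(1) h b] by auto
  qed
  have eq: "f (of_real x) * (1 / (of_real x - z) - 1 / (of_real x - w))
    = ?g (of_real x) + f z * (1 / (of_real x - z) - 1 / (of_real x - w))" for x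
  proof -
    have nz: "of_real x - z \<noteq> 0" "of_real x - w \<noteq> 0" "of_real x \<noteq> z"
      using z w by (auto simp: complex_eq_iff)
    have "1 / (of_real x - z) - 1 / (of_real x - w) = (z - w) / ((of_real x - z) * (of_real x - w))"
      using nz by (simp add: field_simps)
    moreover have "?g (of_real x) = (f (of_real x) - f z) * ((z - w) / ((of_real x - z) * (of_real x - w)))"
      using nz by simp
    ultimately show ?thesis by (simp only: left_diff_distrib) simp
  qed
  have "integrable lborel (\<lambda>x. f z * (1 / (of_real x - z) - 1 / (of_real x - w)))"
    by (rule integrable_cauchy_pair[of _ "norm (f z)"]) (use z w in auto)
  then show ?thesis unfolding eq
    using int zero cauchy_pair_mixed[OF z w] by (subst Bochner_Integration.integral_add) auto
qed

text \<open>Both z and w are compared with the common reference point -\<i> below the axis, which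
  reduces the four sign cases to the two already treated.\<close>

lemma plemelj_upper:
  fixes f :: "complex \<Rightarrow> complex"
  assumes "\<delta> > 0" and hol: "f holomorphic_on {u. Im u > - \<delta>}"
    and bound: "\<And>u. Im u \<ge> 0 \<Longrightarrow> norm (f u) \<le> B"
    and z: "Im z \<noteq> 0" and w: "Im w \<noteq> 0"
  shows "integrable lborel (\<lambda>x. f (of_real x) * (1 / (of_real x - z) - 1 / (of_real x - w)))"
    and "(\<integral>x. f (of_real x) * (1 / (of_real x - z) - 1 / (of_real x - w)) \<partial>lborel)
      = 2 * \<i> * of_real pi * ((if Im z > 0 then f z else 0) - (if Im w > 0 then f w else 0))"
proof -
  have "continuous_on UNIV (\<lambda>x. f (of_real x))"
    by (rule continuous_on_compose2[OF holomorphic_on_imp_continuous_on[OF hol]])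
       (use \<open>\<delta> > 0\<close> in \<open>auto intro!: continuous_intros\<close>)
  then have meas: "(\<lambda>x. f (of_real x)) \<in> borel_measurable borel"
    by (rule borel_measurable_continuous_onI)
  have int: "integrable lborel (\<lambda>x. f (of_real x) * (1 / (of_real x - a) - 1 / (of_real x - b)))"
    if "Im a \<noteq> 0" "Im b \<noteq> 0" for a b
    by (rule integrable_cauchy_pair[OF meas, of B]) (use bound that in auto)
  show "integrable lborel (\<lambda>x. f (of_real x) * (1 / (of_real x - z) - 1 / (of_real x - w)))"
    by (rule int[OF z w])
  have ref: "(\<integral>x. f (of_real x) * (1 / (of_real x - a) - 1 / (of_real x - (- \<i>))) \<partial>lborel)
      = 2 * \<i> * of_real pi * (if Im a > 0 then f a else 0)" if "Im a \<noteq> 0" for a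
    using that plemelj_mixed[OF assms(1-3), of a "- \<i>"] plemelj_both_below[OF assms(1-3), of a "- \<i>"]
    by (cases "Im a > 0") auto
  have "f (of_real x) * (1 / (of_real x - z) - 1 / (of_real x - w))
     = f (of_real x) * (1 / (of_real x - z) - 1 / (of_real x - (- \<i>))) -
       f (of_real x) * (1 / (of_real x - w) - 1 / (of_real x - (- \<i>)))" for x
    by (simp add: algebra_simps)
  then have "(\<integral>x. f (of_real x) * (1 / (of_real x - z) - 1 / (of_real x - w)) \<partial>lborel) =
    (\<integral>x. f (of_real x) * (1 / (of_real x - z) - 1 / (of_real x - (- \<i>))) \<partial>lborel)
    - (\<integral>x. f (of_real x) * (1 / (of_real x - w) - 1 / (of_real x - (- \<i>))) \<partial>lborel)"
    using int[of z "- \<i>"] int[of w "- \<i>"] z w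
    by (subst Bochner_Integration.integral_diff[symmetric]) auto
  then show "(\<integral>x. f (of_real x) * (1 / (of_real x - z) - 1 / (of_real x - w)) \<partial>lborel)
      = 2 * \<i> * of_real pi * ((if Im z > 0 then f z else 0) - (if Im w > 0 then f w else 0))"
    using ref[OF z] ref[OF w] by (simp add: algebra_simps)
qed

text \<open>The reflection u to -u exchanges the half planes and preserves Lebesgue measure; it
  reverses the sign of the Cauchy kernel, hence the minus sign.\<close>

lemma plemelj_lower:
  fixes f :: "complex \<Rightarrow> complex"
  assumes "\<delta> > 0" and hol: "f holomorphic_on {u. Im u < \<delta>}"
    and bound: "\<And>u. Im u \<le> 0 \<Longrightarrow> norm (f u) \<le> B"
    and z: "Im z \<noteq> 0" and w: "Im w \<noteq> 0"
  shows "integrable lborel (\<lambda>x. f (of_real x) * (1 / (of_real x - z) - 1 / (of_real x - w)))"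
    and "(\<integral>x. f (of_real x) * (1 / (of_real x - z) - 1 / (of_real x - w)) \<partial>lborel)
      = - (2 * \<i> * of_real pi * ((if Im z < 0 then f z else 0) - (if Im w < 0 then f w else 0)))"
proof -
  let ?h = "\<lambda>x. f (of_real x) * (1 / (of_real x - z) - 1 / (of_real x - w))"
  let ?f = "\<lambda>u. f (- u)"
  have hol': "?f holomorphic_on {u. Im u > - \<delta>}"
    by (rule holomorphic_on_compose_gen[OF _ hol, unfolded o_def]) (auto intro!: holomorphic_intros)
  have b': "norm (?f u) \<le> B" if "Im u \<ge> 0" for u using bound[of "- u"] that by simp
  have eq: "?h (0 + (-1) * x) = - (?f (of_real x) * (1 / (of_real x - (- z)) - 1 / (of_real x - (- w))))" for x
  proof -
    have "1 / (- of_real x - a) = - (1 / (of_real x + a))" for a :: complex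
      by (metis minus_add_distrib diff_conv_add_uminus minus_divide_right)
    then show ?thesis by (simp add: algebra_simps)
  qed
  note P = plemelj_upper[OF \<open>\<delta> > 0\<close> hol' b', of "- z" "- w"]
  have "integrable lborel (\<lambda>x. ?h (0 + (-1) * x))" unfolding eq
    using P(1) z w by simp
  then show "integrable lborel ?h" by (subst (asm) lborel_integrable_real_affine_iff) auto
  have "(\<integral>x. ?h x \<partial>lborel) = \<bar>-1\<bar> *\<^sub>R (\<integral>x. ?h (0 + (-1) * x) \<partial>lborel)"
    by (rule lborel_integral_real_affine) simp
  also have "\<dots> = - (2 * \<i> * of_real pi * ((if Im z < 0 then f z else 0) - (if Im w < 0 then f w else 0)))"
    unfolding eq using P(2) z w by simp
  finally show "(\<integral>x. ?h x \<partial>lborel) = - (2 * \<i> * of_real pi * ((if Im z < 0 then f z else 0) - (if Im w < 0 then f w else 0)))" .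
qed

text \<open>A function with bounded holomorphic branches above and below is recovered from its jump
  up to an additive ambiguity, which the difference between z and w eliminates. The jump is required
  almost everywhere only, as the formula for it may break down at a real node.\<close>

lemma plemelj_jump:
  fixes Fp Fm :: "complex \<Rightarrow> complex"
  assumes "\<delta> > 0" and "Fp holomorphic_on {u. Im u > - \<delta>}" "Fm holomorphic_on {u. Im u < \<delta>}"
    and "\<And>u. Im u \<ge> 0 \<Longrightarrow> norm (Fp u) \<le> B" "\<And>u. Im u \<le> 0 \<Longrightarrow> norm (Fm u) \<le> C"
    and z: "Im z \<noteq> 0" and w: "Im w \<noteq> 0"
    and jump: "AE x in lborel. j x = Fm (of_real x) - Fp (of_real x)"
    and [measurable]: "j \<in> borel_measurable borel"
  shows "integrable lborel (\<lambda>x. j x * (1 / (z - of_real x) - 1 / (w - of_real x)))" (is ?A)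
    and "(if Im z > 0 then Fp z else Fm z) - (if Im w > 0 then Fp w else Fm w)
      = 1 / (2 * \<i> * of_real pi) * (\<integral>x. j x * (1 / (z - of_real x) - 1 / (w - of_real x)) \<partial>lborel)" (is ?B)
proof -
  let ?K = "\<lambda>x. 1 / (of_real x - z) - 1 / (of_real x - w) :: complex"
  note U = plemelj_upper[OF assms(1,2,4) z w]
  note L = plemelj_lower[OF assms(1,3,5) z w]
  have K: "1 / (z - of_real x) - 1 / (w - of_real x) = - ?K x" for x
    by (simp add: divide_simps) (simp add: algebra_simps)
  have ae: "AE x in lborel. j x * (1 / (z - of_real x) - 1 / (w - of_real x))
      = Fp (of_real x) * ?K x - Fm (of_real x) * ?K x"
    using jump by eventually_elim (simp only: K, simp add: algebra_simps)
  have int: "integrable lborel (\<lambda>x. Fp (of_real x) * ?K x - Fm (of_real x) * ?K x)"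
    by (rule Bochner_Integration.integrable_diff[OF U(1) L(1)])
  show ?A
    by (rule integrable_cong_AE_imp[OF int]) (use ae in \<open>auto elim: eventually_mono\<close>)
  have "(\<integral>x. j x * (1 / (z - of_real x) - 1 / (w - of_real x)) \<partial>lborel)
     = (\<integral>x. Fp (of_real x) * ?K x - Fm (of_real x) * ?K x \<partial>lborel)"
    by (rule integral_cong_AE[OF _ _ ae]) (use int in auto)
  also have "\<dots> = (\<integral>x. Fp (of_real x) * ?K x \<partial>lborel) - (\<integral>x. Fm (of_real x) * ?K x \<partial>lborel)"
    by (rule Bochner_Integration.integral_diff[OF U(1) L(1)])
  also have "\<dots> = 2 * \<i> * of_real pi * ((if Im z > 0 then Fp z else 0) - (if Im w > 0 then Fp w else 0))
      - - (2 * \<i> * of_real pi * ((if Im z < 0 then Fm z else 0) - (if Im w < 0 then Fm w else 0)))"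
    by (rule arg_cong2[where f="(-)", OF U(2) L(2)])
  also have "\<dots> = 2 * \<i> * of_real pi * ((if Im z > 0 then Fp z else Fm z) - (if Im w > 0 then Fp w else Fm w))"
    using z w by (auto simp: algebra_simps)
  finally show ?B by simp
qed

section \<open>The kernel with complex nodes\<close>

lemma holomorphic_on_expq [holomorphic_intros]:
  "f holomorphic_on A \<Longrightarrow> (\<lambda>x. expq (f x)) holomorphic_on A"
  using holomorphic_on_compose[OF _ expq_holomorphic] by (auto simp: o_def)

lemma expq_diff: "x \<noteq> y \<Longrightarrow> expq (x - y) = (exp (2 * \<i> * of_real pi * x) / exp (2 * \<i> * of_real pi * y) - 1) / (x - y)"
  by (simp add: expq_def right_diff_distrib exp_diff)

lemma expq_zero [simp]: "expq 0 = 2 * \<i> * of_real pi"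
  by (simp add: expq_def)

lemma kern_borel_measurable [measurable]:
  "(\<lambda>(a, b). kern a b) \<in> borel_measurable (borel \<Otimes>\<^sub>M borel)"
  unfolding kern_def ckern_def by measurable

lemma edge_pair_borel_measurable [measurable]: "edge_pair a b \<in> borel_measurable borel"
  unfolding edge_pair_def kern_def ckern_def by measurable

lemma kern_upper: "Im b > 0 \<Longrightarrow> kern b t = 1 / (b - t)"
  by (simp add: kern_def ckern_def)

lemma kern_lower:
  assumes "Im b < 0" "b \<noteq> t"
  shows "kern b t = - (exp (2 * \<i> * of_real pi * t) / exp (2 * \<i> * of_real pi * b)) / (t - b)"
proof -
  have "1 / (b - t) = - 1 / (t - b)" by (metis minus_diff_eq minus_divide_left minus_divide_right)
  then show ?thesis
    using assms by (simp add: kern_def ckern_def expq_diff diff_divide_distrib)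
qed

lemma kern_real: "Im b = 0 \<Longrightarrow> kern b t = - expq (t - b)"
  by (simp add: kern_def ckern_def)

lemma edge_pair_real_axis: "edge_pair a b (of_real x) = - expq (a - of_real x) * kern b (of_real x)"
  by (simp add: edge_pair_def kern_def ckern_def)

text \<open>Partial fractions split off the simple poles at a and b. The rest is 0 above the axis,
  and below it has its only pole at b, which lies in the other half plane. For a = b the subtraction
  in \<open>edge_pair\<close> cancels the double pole and \<open>kern b a\<close> is 0.\<close>

lemma edge_pair_decomp_upper:
  assumes b: "Im b > 0" and t: "Im t \<noteq> 0" "t \<noteq> a" "t \<noteq> b"
  shows "edge_pair a b t = (if Im t > 0 then 0 else expq (a - t) / (t - b)) + kern b a / (t - a) - kern b a / (t - b)"
proof -
  define p q where "p = t - a" and "q = t - b"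
  have pq: "p \<noteq> 0" "q \<noteq> 0" using t by (auto simp: p_def q_def)
  define Q where "Q = (if Im t > 0 then 0 else expq (a - t))"
  have Q: "(if Im t > 0 then 0 else expq (a - t) / (t - b)) = Q / q" by (simp add: Q_def q_def)
  have k: "kern t a = 1 / p - Q" "kern b t = 1 / (- q)"
    using t b by (auto simp: kern_def ckern_def p_def q_def Q_def)
  show ?thesis
  proof (cases "a = b")
    case True
    have "kern b a = 0" "ckern t a = 1 / p" "ckern a t = 1 / (- q)" "p = q"
      using t b True by (auto simp: kern_def ckern_def p_def q_def)
    then have "edge_pair a b t = (1 / q - Q) * (1 / (- q)) - 1 / q * (1 / (- q))" "kern b a = 0"
      using True unfolding edge_pair_def k by auto
    then show ?thesis using pq unfolding Q by (simp add: left_diff_distrib diff_divide_distrib)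
  next
    case False
    have k': "kern b a = 1 / (p - q)" using b by (simp add: kern_def ckern_def p_def q_def)
    have "p - q \<noteq> 0" using False by (auto simp: p_def q_def)
    then have "(1 / p - Q) * (1 / (- q)) = Q / q + 1 / (p - q) / p - 1 / (p - q) / q"
      using pq by (simp add: divide_simps) (simp add: algebra_simps)
    moreover have "edge_pair a b t = (1 / p - Q) * (1 / (- q))" using False unfolding edge_pair_def k by simp
    ultimately show ?thesis unfolding k' Q by (simp add: p_def q_def)
  qed
qed

text \<open>The mirror case: now the nonpolar part lives above the axis, and its pole at b lies
  below. The exponential quotient is the factor by which \<open>kern b a\<close> differs from a
  plain Cauchy kernel.\<close>

lemma edge_pair_decomp_lower:
  assumes b: "Im b < 0" and t: "Im t \<noteq> 0" "t \<noteq> a" "t \<noteq> b"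
  shows "edge_pair a b t = (if Im t > 0 then - (exp (2 * \<i> * of_real pi * a) / exp (2 * \<i> * of_real pi * b)) * expq (t - a) / (t - b) else 0)
     + kern b a / (t - a) - kern b a / (t - b)"
proof -
  define ea eb et where "ea = exp (2 * \<i> * of_real pi * a)" and "eb = exp (2 * \<i> * of_real pi * b)" and "et = exp (2 * \<i> * of_real pi * t)"
  have enz: "ea \<noteq> 0" "eb \<noteq> 0" "et \<noteq> 0" by (auto simp: ea_def eb_def et_def)
  define p q where "p = t - a" and "q = t - b"
  have pq: "p \<noteq> 0" "q \<noteq> 0" using t by (auto simp: p_def q_def)
  have kbt: "kern b t = - (et / eb) / q"
    unfolding et_def eb_def q_def by (rule kern_lower) (use b t in auto)
  have kta: "kern t a = (if Im t > 0 then 1 / p else (ea / et) / p)"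
  proof (cases "Im t > 0")
    case False
    then have "kern t a = - (ea / et) / (a - t)" unfolding et_def ea_def by (intro kern_lower) (use t in auto)
    also have "a - t = - p" by (simp add: p_def)
    finally show ?thesis using False by simp
  qed (simp add: kern_upper p_def)
  have q: "expq (t - a) = (et / ea - 1) / p" using t by (simp add: expq_diff ea_def et_def p_def)
  show ?thesis
  proof (cases "a = b")
    case True
    have "ckern t a = 1 / p" "ckern a t = 1 / (- q)" "p = q" "ea = eb"
      using t b True by (auto simp: ckern_def p_def q_def ea_def eb_def)
    then have "edge_pair a b t = (if Im t > 0 then 1 / q else (eb / et) / q) * (- (et / eb) / q) - 1 / q * (1 / (- q))"
      using True unfolding edge_pair_def kbt kta by auto
    note E = this
    have "t - a = q" using True by (auto simp: q_def)
    then show ?thesis using pq enz \<open>p = q\<close> \<open>ea = eb\<close>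
      unfolding E ea_def[symmetric] eb_def[symmetric] q q_def[symmetric]
      by (cases "Im t > 0"; simp add: divide_simps; simp add: algebra_simps)
  next
    case False
    have d: "q - p \<noteq> 0" using False by (auto simp: p_def q_def)
    define X where "X = ea / eb"
    have k': "kern b a = - X / (q - p)"
      using kern_lower[OF b, of a] False by (simp add: ea_def eb_def p_def q_def X_def)
    have X: "et / eb = X * (et / ea)" using enz by (simp add: X_def)
    define Y where "Y = et / ea"
    have Y: "ea / et * (X * Y) = X" "Y \<noteq> 0" using enz by (auto simp: X_def Y_def)
    have "1 / p * (- (X * Y) / q) = - X * ((Y - 1) / p) / q + - X / (q - p) / p - - X / (q - p) / q"
      using pq d by (simp add: divide_simps) (simp add: algebra_simps)
    moreover have "X / p * (- 1 / q) = - X / (q - p) / p - - X / (q - p) / q"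
      using pq d by (simp add: divide_simps) (simp add: algebra_simps)
    moreover have "(ea / et) / p * (- (X * Y) / q) = (ea / et * (X * Y)) / p * (- 1 / q)"
      by simp
    moreover have "edge_pair a b t = (if Im t > 0 then 1 / p else (ea / et) / p) * (- (X * Y) / q)"
      using False unfolding edge_pair_def kbt kta X Y_def by simp
    ultimately show ?thesis
      unfolding ea_def[symmetric] eb_def[symmetric] q k' Y Y_def[symmetric] X_def[symmetric]
      unfolding p_def[symmetric] q_def[symmetric] by (cases "Im t > 0") simp_all
  qed
qed

text \<open>For b on the axis a pole at b would lie on the contour. The constant
  \<open>expq (a - b)\<close> makes both numerators vanish at t = b, so the singularity there is
  removable and only the pole at a is split off.\<close>

lemma edge_pair_decomp_real:
  assumes b: "Im b = 0" and t: "Im t \<noteq> 0" "t \<noteq> a" "t \<noteq> b"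
  shows "edge_pair a b t = (if Im t > 0
      then (- (exp (2 * \<i> * of_real pi * a) / exp (2 * \<i> * of_real pi * b)) * expq (t - a) + expq (a - b)) / (t - b)
      else (- expq (a - t) + expq (a - b)) / (t - b)) + kern b a / (t - a)"
proof -
  define ea eb et where "ea = exp (2 * \<i> * of_real pi * a)" and "eb = exp (2 * \<i> * of_real pi * b)" and "et = exp (2 * \<i> * of_real pi * t)"
  have enz: "ea \<noteq> 0" "eb \<noteq> 0" "et \<noteq> 0" by (auto simp: ea_def eb_def et_def)
  define p q where "p = t - a" and "q = t - b"
  have pq: "p \<noteq> 0" "q \<noteq> 0" using t by (auto simp: p_def q_def)
  have kbt: "kern b t = - ((et / eb - 1) / q)"
    using b t by (simp add: kern_real expq_diff eb_def et_def q_def)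
  have kta: "kern t a = (if Im t > 0 then 1 / p else (ea / et) / p)"
  proof (cases "Im t > 0")
    case False
    then have "kern t a = - (ea / et) / (a - t)" unfolding et_def ea_def by (intro kern_lower) (use t in auto)
    also have "a - t = - p" by (simp add: p_def)
    finally show ?thesis using False by simp
  qed (simp add: kern_upper p_def)
  have at: "a - t = - p" by (simp add: p_def)
  have q: "expq (t - a) = (et / ea - 1) / p" "expq (a - t) = (ea / et - 1) / (- p)"
    using t by (simp_all add: expq_diff ea_def et_def p_def)
  have kba: "kern b a = - expq (a - b)" using b by (rule kern_real)
  show ?thesis
  proof (cases "a = b")
    case True
    have "ckern a t = 0" "p = q" "ea = eb"
      using b True by (auto simp: ckern_def p_def q_def ea_def eb_def)
    then have "edge_pair a b t = (if Im t > 0 then 1 / q else (eb / et) / q) * (- ((et / eb - 1) / q))"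
      using True unfolding edge_pair_def kbt kta by auto
    note E = this
    have "t - a = q" using True by (auto simp: q_def)
    then show ?thesis using pq enz \<open>p = q\<close> \<open>ea = eb\<close>
      unfolding E ea_def[symmetric] eb_def[symmetric] q kba q_def[symmetric]
      by (cases "Im t > 0"; simp add: divide_simps; simp add: algebra_simps)
  next
    case False
    have d: "q - p \<noteq> 0" using False by (auto simp: p_def q_def)
    define X Y where "X = ea / eb" and "Y = et / ea"
    have x: "expq (a - b) = (X - 1) / (q - p)" using False by (simp add: expq_diff ea_def eb_def X_def p_def q_def)
    have X: "et / eb = X * Y" "ea / et = 1 / Y" "Y \<noteq> 0" using enz by (simp_all add: X_def Y_def)
    have "1 / p * (- ((X * Y - 1) / q)) = (- X * ((Y - 1) / p) + (X - 1) / (q - p)) / q + - ((X - 1) / (q - p)) / p"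
      using pq d by (simp add: divide_simps) (simp add: algebra_simps)
    moreover have "1 / Y / p * (- ((X * Y - 1) / q)) = (- ((1 / Y - 1) / (- p)) + (X - 1) / (q - p)) / q + - ((X - 1) / (q - p)) / p"
      using pq d X by (simp add: divide_simps) (simp add: algebra_simps)
    moreover have "edge_pair a b t = (if Im t > 0 then 1 / p else 1 / Y / p) * (- ((X * Y - 1) / q))"
      using False unfolding edge_pair_def kbt kta X by simp
    ultimately show ?thesis
      unfolding ea_def[symmetric] eb_def[symmetric] q kba x X(2) X_def[symmetric] Y_def[symmetric]
      unfolding p_def[symmetric] q_def[symmetric] by (cases "Im t > 0") simp_all
  qed
qed

text \<open>The nonpolar part is recovered from its jump by the Cauchy integral, while the polar
  terms are carried along explicitly. A real b has no polar term of its own, hence the case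
  distinction.\<close>

lemma edge_pair_recursion:
  assumes z: "Im z \<noteq> 0" and w: "Im w \<noteq> 0" and ne: "z \<noteq> a" "z \<noteq> b" "w \<noteq> a" "w \<noteq> b"
  shows "integrable lborel (\<lambda>x. edge_pair a b (of_real x) * (1 / (z - of_real x) - 1 / (w - of_real x)))"
      (is "?A")
    and "edge_pair a b z - edge_pair a b w
      = kern b a * (1 / (z - a) - 1 / (w - a))
        - (if Im b = 0 then 0 else kern b a * (1 / (z - b) - 1 / (w - b)))
        + 1 / (2 * \<i> * of_real pi) *
          (\<integral>x. edge_pair a b (of_real x) * (1 / (z - of_real x) - 1 / (w - of_real x)) \<partial>lborel)"
      (is "?B")
proof -
  let ?e = "\<lambda>u. exp (2 * \<i> * of_real pi * u)"
  have core: "?A \<and> ?B"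
    if \<delta>: "\<delta> > 0" and hp: "Fp holomorphic_on {u. Im u > - \<delta>}" and hm: "Fm holomorphic_on {u. Im u < \<delta>}"
      and bp: "\<And>u. Im u \<ge> 0 \<Longrightarrow> norm (Fp u) \<le> B" and bm: "\<And>u. Im u \<le> 0 \<Longrightarrow> norm (Fm u) \<le> C"
      and jump: "\<And>x. of_real x \<noteq> b \<Longrightarrow> edge_pair a b (of_real x) = Fm (of_real x) - Fp (of_real x)"
      and F: "\<And>t. Im t \<noteq> 0 \<Longrightarrow> t \<noteq> a \<Longrightarrow> t \<noteq> b \<Longrightarrow>
        edge_pair a b t = (if Im t > 0 then Fp t else Fm t) + kern b a / (t - a)
          - (if Im b = 0 then 0 else kern b a / (t - b))"
    for \<delta> B C Fp Fm
  proof -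
    \<comment> \<open>For real b the branches are defined at b by derivatives, and the jump formula
      is derived only away from this single point.\<close>
    have "AE x in lborel. x \<noteq> Re b" by (rule AE_lborel_singleton)
    then have ae: "AE x in lborel. edge_pair a b (of_real x) = Fm (of_real x) - Fp (of_real x)"
      by eventually_elim (rule jump, auto)
    note P = plemelj_jump[OF \<delta> hp hm bp bm z w ae]
    have ?A by (rule P(1)) auto
    moreover have ?B
      using P(2) F[OF z ne(1,2)] F[OF w ne(3,4)] by (simp add: right_diff_distrib)
    ultimately show ?thesis by simp
  qed
  have en: "?e u \<noteq> 0" for u by simp
  have refl: "expq (a - t) = expq (t - a) * (?e a / ?e t)" for t
    using expq_reflect[of "t - a"] by (simp add: right_diff_distrib exp_diff exp_minus field_simps)
  have bd1: "norm (expq (a - u)) \<le> 2 * pi * exp (2 * pi * \<bar>Im a\<bar>)" if "Im u \<le> 0" for u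
    by (rule norm_expq_le) (use that in auto)
  have bd2: "norm (expq (u - a)) \<le> 2 * pi * exp (2 * pi * \<bar>Im a\<bar>)" if "Im u \<ge> 0" for u
    by (rule norm_expq_le) (use that in auto)
  let ?M = "2 * pi * exp (2 * pi * \<bar>Im a\<bar>)"
  consider "Im b > 0" | "Im b < 0" | "Im b = 0" by linarith
  then have "?A \<and> ?B"
  proof cases
    case 1
    show ?thesis
    proof (rule core[of "Im b" "\<lambda>_. 0" "\<lambda>t. expq (a - t) / (t - b)" 0 "?M / Im b"])
      show "(\<lambda>t. expq (a - t) / (t - b)) holomorphic_on {u. Im u < Im b}"
        by (intro holomorphic_intros) auto
      fix u assume u: "Im u \<le> 0"
      have "Im b \<le> norm (u - b)" using abs_Im_le_cmod[of "u - b"] u 1 by auto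
      then show "norm (expq (a - u) / (u - b)) \<le> ?M / Im b"
        unfolding norm_divide using bd1[OF u] 1 by (intro frac_le) auto
    next
      fix x :: real assume "of_real x \<noteq> b"
      then show "edge_pair a b (of_real x) = expq (a - of_real x) / (of_real x - b) - 0"
        unfolding edge_pair_real_axis kern_upper[OF 1] minus_diff_eq[of "of_real x" b, symmetric]
        by (simp del: minus_diff_eq)
    next
      fix t assume t: "Im t \<noteq> 0" "t \<noteq> a" "t \<noteq> b"
      show "edge_pair a b t = (if Im t > 0 then 0 else expq (a - t) / (t - b)) + kern b a / (t - a)
          - (if Im b = 0 then 0 else kern b a / (t - b))"
        using edge_pair_decomp_upper[OF 1 t] 1 by simp
    qed (use 1 in auto)
  next
    case 2
    let ?Fp = "\<lambda>t. - (?e a / ?e b) * expq (t - a) / (t - b)"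
    show ?thesis
    proof (rule core[of "- Im b" ?Fp "\<lambda>_. 0" "norm (?e a / ?e b) * ?M / (- Im b)" 0])
      show "?Fp holomorphic_on {u. - (- Im b) < Im u}"
        by (intro holomorphic_intros) auto
      fix u assume u: "Im u \<ge> 0"
      have "- Im b \<le> norm (u - b)" using abs_Im_le_cmod[of "u - b"] u 2 by auto
      then show "norm (?Fp u) \<le> norm (?e a / ?e b) * ?M / (- Im b)"
        unfolding norm_divide[of "_ * _"] norm_mult[of "- _"] norm_minus_cancel using bd2[OF u] 2
        by (intro frac_le mult_left_mono) auto
    next
      fix x :: real assume "of_real x \<noteq> b"
      show "edge_pair a b (of_real x) = 0 - ?Fp (of_real x)"
        unfolding edge_pair_real_axis refl kern_lower[OF 2 not_sym[OF \<open>of_real x \<noteq> b\<close>]] by simp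
    next
      fix t assume t: "Im t \<noteq> 0" "t \<noteq> a" "t \<noteq> b"
      show "edge_pair a b t = (if Im t > 0 then ?Fp t else 0) + kern b a / (t - a)
          - (if Im b = 0 then 0 else kern b a / (t - b))"
        using edge_pair_decomp_lower[OF 2 t] 2 by simp
    qed (use 2 in auto)
  next
    case 3
    let ?f = "\<lambda>t. - (?e a / ?e b) * expq (t - a)"
    let ?g = "\<lambda>t. - expq (a - t)"
    \<comment> \<open>Difference quotients at the real point b, filled in by derivatives: entire
      functions whose bounds in the two half planes come from those of \<open>expq\<close>.\<close>
    let ?Fp = "\<lambda>t. if t = b then deriv ?f b else (?f t - ?f b) / (t - b)"
    let ?Fm = "\<lambda>t. if t = b then deriv ?g b else (?g t - ?g b) / (t - b)"
    have hf: "?f holomorphic_on UNIV" and hg: "?g holomorphic_on UNIV"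
      by (intro holomorphic_intros)+
    have fb: "- ?f b = expq (a - b)" using refl[of b] by simp
    obtain B where B: "B \<ge> 0" "\<And>u. u \<in> {u. Im u \<ge> 0} \<Longrightarrow> norm (?Fp u) \<le> B / (1 + norm u)"
    proof (rule removable_quotient_bounded[OF open_UNIV hf closed_halfspace_Im_ge[of 0], where B="norm (?e a / ?e b) * ?M" and z=b])
      show "norm (?f u) \<le> norm (?e a / ?e b) * ?M" if "u \<in> {u. Im u \<ge> 0}" for u
        unfolding norm_mult[of "- _"] norm_minus_cancel by (rule mult_left_mono) (use bd2 that in auto)
      show "norm (?f b) \<le> norm (?e a / ?e b) * ?M"
        unfolding norm_mult[of "- _"] norm_minus_cancel by (rule mult_left_mono) (use bd2 3 in auto)
    qed auto
    obtain C where C: "C \<ge> 0" "\<And>u. u \<in> {u. Im u \<le> 0} \<Longrightarrow> norm (?Fm u) \<le> C / (1 + norm u)"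
      by (rule removable_quotient_bounded[OF open_UNIV hg closed_halfspace_Im_le[of 0], where B="?M" and z=b])
         (use bd1 3 in auto)
    have le: "D / (1 + norm u) \<le> D" if "D \<ge> 0" for D and u :: complex
      using divide_left_mono[of 1 "1 + norm u" D] that by (simp add: add_pos_nonneg)
    show ?thesis
    proof (rule core[of 1 ?Fp ?Fm B C])
      show "?Fp holomorphic_on {u. - 1 < Im u}" "?Fm holomorphic_on {u. Im u < 1}"
        using pole_lemma_open[OF hf open_UNIV, of b] pole_lemma_open[OF hg open_UNIV, of b]
        by (auto elim: holomorphic_on_subset)
      show "norm (?Fp u) \<le> B" if "Im u \<ge> 0" for u
        using B(2)[of u] le[OF B(1), of u] that by (intro order_trans[OF B(2)]) auto
      show "norm (?Fm u) \<le> C" if "Im u \<le> 0" for u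
        using C(2)[of u] le[OF C(1), of u] that by (intro order_trans[OF C(2)]) auto
    next
      fix x :: real assume x: "of_real x \<noteq> b"
      have "?Fm (of_real x) - ?Fp (of_real x) = (expq (of_real x - a) * (?e a / ?e b) - expq (a - of_real x)) / (of_real x - b)"
        using x fb by (simp add: diff_divide_distrib[symmetric])
      also have "\<dots> = edge_pair a b (of_real x)"
      proof -
        have "(G * (ea / eb) - G * (ea / et)) / q = - (G * (ea / et)) * - ((et / eb - 1) / q)"
          if "et \<noteq> 0" for G ea eb et q :: complex
          using that by (simp add: right_diff_distrib diff_divide_distrib)
        then show ?thesis
          unfolding edge_pair_real_axis kern_real[OF 3] expq_diff[OF x] refl[of "of_real x"] by simp
      qed
      finally show "edge_pair a b (of_real x) = ?Fm (of_real x) - ?Fp (of_real x)" by simp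
    next
      fix t assume t: "Im t \<noteq> 0" "t \<noteq> a" "t \<noteq> b"
      show "edge_pair a b t = (if Im t > 0 then ?Fp t else ?Fm t) + kern b a / (t - a)
          - (if Im b = 0 then 0 else kern b a / (t - b))"
        using edge_pair_decomp_real[OF 3 t] 3 t(3) fb by simp
    qed auto
  qed
  then show ?A ?B by auto
qed

lemma kern_diagonal: "kern t t = (if Im t \<le> 0 then - (2 * \<i> * of_real pi) else 0)"
  by (simp add: kern_def ckern_def)

text \<open>The diagonal is a step function with constant branches 0 above and -2 pi i below; its
  value on the axis equals the jump.\<close>

lemma kern_diagonal_recursion:
  assumes z: "Im z \<noteq> 0" and w: "Im w \<noteq> 0"
  shows "integrable lborel (\<lambda>x. kern (of_real x) (of_real x) * (1 / (z - of_real x) - 1 / (w - of_real x)))"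
    and "kern z z - kern w w = 1 / (2 * \<i> * of_real pi) *
          (\<integral>x. kern (of_real x) (of_real x) * (1 / (z - of_real x) - 1 / (w - of_real x)) \<partial>lborel)"
proof -
  have 1: "(\<lambda>_. 0) holomorphic_on {u. - 1 < Im u}" and 2: "(\<lambda>_. - (2 * \<i> * of_real pi)) holomorphic_on {u. Im u < 1}"
    by auto
  note P = plemelj_jump[of 1, OF _ 1 2 _ _ z w, of 0 "2 * pi" "\<lambda>x. kern (of_real x) (of_real x)"]
  show "integrable lborel (\<lambda>x. kern (of_real x) (of_real x) * (1 / (z - of_real x) - 1 / (w - of_real x)))"
    by (rule P(1)) (auto simp: kern_diagonal norm_mult)
  have "kern z z - kern w w = (if Im z > 0 then 0 else - (2 * \<i> * of_real pi)) - (if Im w > 0 then 0 else - (2 * \<i> * of_real pi))"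
    using z w by (auto simp: kern_diagonal)
  also have "\<dots> = 1 / (2 * \<i> * of_real pi) *
          (\<integral>x. kern (of_real x) (of_real x) * (1 / (z - of_real x) - 1 / (w - of_real x)) \<partial>lborel)"
    by (rule P(2)) (auto simp: kern_diagonal norm_mult)
  finally show "kern z z - kern w w = 1 / (2 * \<i> * of_real pi) *
          (\<integral>x. kern (of_real x) (of_real x) * (1 / (z - of_real x) - 1 / (w - of_real x)) \<partial>lborel)" .
qed

lemma diff_diff_rearrange: "a - b - (c - d) = a - c - (b - d :: complex)"
  by simp

text \<open>For each permutation the polar terms at \<open>p (s b)\<close> and \<open>p b\<close>
  telescope along the cycles. Only the real nodes survive, since their outgoing arrows lack the
  second pole, and they produce the explicit sum in front of the determinant.\<close>

lemma bordered_recursion: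
  fixes p :: "'i \<Rightarrow> complex"
  assumes fin: "finite J" and z: "Im z \<noteq> 0" and w: "Im w \<noteq> 0" and ne: "z \<notin> p ` J" "w \<notin> p ` J"
  defines "K \<equiv> \<lambda>i j. kern (p i) (p j)"
  shows "integrable lborel (\<lambda>x. bordered p J (of_real x) * (1 / (z - of_real x) - 1 / (w - of_real x)))" (is ?A)
    and "bordered p J z - bordered p J w
      = - (\<Sum>i\<in>{i\<in>J. Im (p i) = 0}. 1 / (z - p i) - 1 / (w - p i)) * permdet K J
        + 1 / (2 * \<i> * of_real pi) *
          (\<integral>x. bordered p J (of_real x) * (1 / (z - of_real x) - 1 / (w - of_real x)) \<partial>lborel)" (is ?B)
proof -
  let ?k = "\<lambda>x. 1 / (z - of_real x) - 1 / (w - of_real x) :: complex"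
  let ?c = "\<lambda>a. 1 / (z - a) - 1 / (w - a) :: complex"
  let ?R = "\<lambda>s b. of_int (sign s) * (\<Prod>i\<in>J - {b}. K i (s i)) :: complex"
  let ?S = "{s. s permutes J}"
  have finS: "finite ?S" using fin by (rule finite_permutations)
  have exp: "bordered p J t = kern t t * permdet K J - (\<Sum>s\<in>?S. \<Sum>b\<in>J. ?R s b * edge_pair (p (s b)) (p b) t)" for t
    unfolding bordered_def K_def by (simp add: sum_distrib_left algebra_simps)
  have ne': "z \<noteq> p b" "w \<noteq> p b" "z \<noteq> p (s b)" "w \<noteq> p (s b)" if "s \<in> ?S" "b \<in> J" for s b
    using ne that by (auto simp: image_iff permutes_in_image)
  define Q where "Q s b = (\<integral>x. edge_pair (p (s b)) (p b) (of_real x) * ?k x \<partial>lborel)" for s b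
  have E: "integrable lborel (\<lambda>x. edge_pair (p (s b)) (p b) (of_real x) * ?k x)"
    "edge_pair (p (s b)) (p b) z - edge_pair (p (s b)) (p b) w
      = kern (p b) (p (s b)) * (?c (p (s b)) - (if Im (p b) = 0 then 0 else ?c (p b)))
        + 1 / (2 * \<i> * of_real pi) * Q s b"
    if "s \<in> ?S" "b \<in> J" for s b
    unfolding Q_def by (rule edge_pair_recursion(1); use z w ne'[OF that] in simp)
       (subst edge_pair_recursion(2), (use z w ne'[OF that] in simp_all)[6], simp add: right_diff_distrib)
  have int1: "integrable lborel (\<lambda>x. ?R s b * (edge_pair (p (s b)) (p b) (of_real x) * ?k x))" if "s \<in> ?S" "b \<in> J" for s b
    by (rule integrable_mult_right) (rule E(1)[OF that])
  have int0: "integrable lborel (\<lambda>x. permdet K J * (kern (of_real x) (of_real x) * ?k x))"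
    by (rule integrable_mult_right) (rule kern_diagonal_recursion(1)[OF z w])
  have expk: "bordered p J (of_real x) * ?k x = permdet K J * (kern (of_real x) (of_real x) * ?k x)
      - (\<Sum>s\<in>?S. \<Sum>b\<in>J. ?R s b * (edge_pair (p (s b)) (p b) (of_real x) * ?k x))" for x
  proof -
    have "(\<Sum>s\<in>?S. \<Sum>b\<in>J. ?R s b * edge_pair (p (s b)) (p b) (of_real x)) * ?k x
      = (\<Sum>s\<in>?S. \<Sum>b\<in>J. ?R s b * (edge_pair (p (s b)) (p b) (of_real x) * ?k x))"
      by (simp only: sum_distrib_right mult.assoc)
    then show ?thesis unfolding exp left_diff_distrib[of "_ * _"] by (simp only: mult.assoc mult.left_commute[of "permdet K J"])
  qed
  have int2: "integrable lborel (\<lambda>x. \<Sum>s\<in>?S. \<Sum>b\<in>J. ?R s b * (edge_pair (p (s b)) (p b) (of_real x) * ?k x))"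
    by (intro Bochner_Integration.integrable_sum int1)
  show ?A unfolding expk by (rule Bochner_Integration.integrable_diff[OF int0 int2])
  have I: "(\<integral>x. bordered p J (of_real x) * ?k x \<partial>lborel)
    = permdet K J * (\<integral>x. kern (of_real x) (of_real x) * ?k x \<partial>lborel)
      - (\<Sum>s\<in>?S. \<Sum>b\<in>J. ?R s b * Q s b)"
  proof -
    have "(\<integral>x. (\<Sum>s\<in>?S. \<Sum>b\<in>J. ?R s b * (edge_pair (p (s b)) (p b) (of_real x) * ?k x)) \<partial>lborel)
      = (\<Sum>s\<in>?S. \<integral>x. (\<Sum>b\<in>J. ?R s b * (edge_pair (p (s b)) (p b) (of_real x) * ?k x)) \<partial>lborel)"
      by (rule Bochner_Integration.integral_sum) (intro Bochner_Integration.integrable_sum int1; assumption)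
    also have "\<dots> = (\<Sum>s\<in>?S. \<Sum>b\<in>J. \<integral>x. ?R s b * (edge_pair (p (s b)) (p b) (of_real x) * ?k x) \<partial>lborel)"
      by (intro sum.cong refl Bochner_Integration.integral_sum int1)
    also have "\<dots> = (\<Sum>s\<in>?S. \<Sum>b\<in>J. ?R s b * Q s b)"
      by (simp only: Q_def integral_mult_right_zero)
    finally show ?thesis
      unfolding expk Bochner_Integration.integral_diff[OF int0 int2] integral_mult_right_zero by simp
  qed
  have col: "(\<Sum>b\<in>J. ?R s b * (edge_pair (p (s b)) (p b) z - edge_pair (p (s b)) (p b) w))
     = of_int (sign s) * (\<Prod>i\<in>J. K i (s i)) * (\<Sum>i\<in>{i\<in>J. Im (p i) = 0}. ?c (p i))
       + 1 / (2 * \<i> * of_real pi) * (\<Sum>b\<in>J. ?R s b * Q s b)"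
    if s: "s \<in> ?S" for s
  proof -
    let ?T = "of_int (sign s) * (\<Prod>i\<in>J. K i (s i))"
    have "?R s b * (edge_pair (p (s b)) (p b) z - edge_pair (p (s b)) (p b) w)
      = ?T * (?c (p (s b)) - (if Im (p b) = 0 then 0 else ?c (p b)))
        + 1 / (2 * \<i> * of_real pi) * (?R s b * Q s b)"
      if b: "b \<in> J" for b
    proof -
      \<comment> \<open>The residue of the arrow at b is the kernel factor missing from the
        remaining product. So every arrow carries the same full product \<open>?T\<close>, and the
        polar terms can be summed over b.\<close>
      have T: "?T = ?R s b * kern (p b) (p (s b))"
        using fin b by (subst prod.remove[of _ b]) (auto simp: K_def)
      show ?thesis unfolding E(2)[OF s b] T by (simp only: distrib_left mult.assoc mult.left_commute)
    qed
    then have "(\<Sum>b\<in>J. ?R s b * (edge_pair (p (s b)) (p b) z - edge_pair (p (s b)) (p b) w))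
      = ?T * (\<Sum>b\<in>J. ?c (p (s b)) - (if Im (p b) = 0 then 0 else ?c (p b)))
        + 1 / (2 * \<i> * of_real pi) * (\<Sum>b\<in>J. ?R s b * Q s b)"
      unfolding sum_distrib_left sum.distrib[symmetric] by (rule sum.cong[OF refl])
    \<comment> \<open>s permutes J, so the terms at \<open>p (s b)\<close> may be summed as terms at
      \<open>p b\<close>.\<close>
    also have "(\<Sum>b\<in>J. ?c (p (s b)) - (if Im (p b) = 0 then 0 else ?c (p b)))
       = (\<Sum>b\<in>J. ?c (p b) - (if Im (p b) = 0 then 0 else ?c (p b)))"
      using sum.permute[of s J "\<lambda>b. ?c (p b)"] s by (simp only: sum_subtractf o_def mem_Collect_eq)
    also have "\<dots> = (\<Sum>i\<in>{i\<in>J. Im (p i) = 0}. ?c (p i))"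
      by (subst sum.inter_filter[OF fin], rule sum.cong[OF refl], simp)
    finally show ?thesis .
  qed
  have "bordered p J z - bordered p J w = (kern z z - kern w w) * permdet K J
      - (\<Sum>s\<in>?S. \<Sum>b\<in>J. ?R s b * (edge_pair (p (s b)) (p b) z - edge_pair (p (s b)) (p b) w))"
    unfolding exp by (simp only: right_diff_distrib left_diff_distrib sum_subtractf) (rule diff_diff_rearrange)
  also have "\<dots> = (kern z z - kern w w) * permdet K J
      - (permdet K J * (\<Sum>i\<in>{i\<in>J. Im (p i) = 0}. ?c (p i))
       + 1 / (2 * \<i> * of_real pi) * (\<Sum>s\<in>?S. \<Sum>b\<in>J. ?R s b * Q s b))"
    by (simp only: col cong: sum.cong)
       (simp only: sum.distrib permdet_def sum_distrib_left[symmetric] sum_distrib_right[symmetric])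
  finally show ?B unfolding I kern_diagonal_recursion(2)[OF z w] by (simp add: algebra_simps)
qed

definition Psi_ext :: "('i \<Rightarrow> complex) \<Rightarrow> 'i set \<Rightarrow> complex \<Rightarrow> complex" where
  "Psi_ext p I t = (\<Sum>S\<in>Pow I. hafn p S * bordered p (I - S) t)"

text \<open>A set S containing a real node has Hafnian 0. For every other S all real nodes lie in
  \<open>I - S\<close>, so the same sum over real nodes factors out of all terms.\<close>

lemma Psi_ext_recursion:
  fixes p :: "'i \<Rightarrow> complex"
  assumes fin: "finite I" and z: "Im z \<noteq> 0" and w: "Im w \<noteq> 0" and ne: "z \<notin> p ` I" "w \<notin> p ` I"
  shows "integrable lborel (\<lambda>x. Psi_ext p I (of_real x) * (1 / (z - of_real x) - 1 / (w - of_real x)))" (is ?A)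
    and "Psi_ext p I z - Psi_ext p I w
      = - (\<Sum>i\<in>{i\<in>I. Im (p i) = 0}. 1 / (z - p i) - 1 / (w - p i)) * Psi p I
        + 1 / (2 * \<i> * of_real pi) *
          (\<integral>x. Psi_ext p I (of_real x) * (1 / (z - of_real x) - 1 / (w - of_real x)) \<partial>lborel)" (is ?B)
proof -
  let ?k = "\<lambda>x. 1 / (z - of_real x) - 1 / (w - of_real x) :: complex"
  let ?K = "\<lambda>i j. kern (p i) (p j)"
  have B: "integrable lborel (\<lambda>x. bordered p (I - S) (of_real x) * ?k x)"
    "bordered p (I - S) z - bordered p (I - S) w
      = - (\<Sum>i\<in>{i\<in>I - S. Im (p i) = 0}. 1 / (z - p i) - 1 / (w - p i)) * permdet ?K (I - S)
        + 1 / (2 * \<i> * of_real pi) * (\<integral>x. bordered p (I - S) (of_real x) * ?k x \<partial>lborel)" for S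
    by (rule bordered_recursion; use fin z w ne in auto)+
  have int: "integrable lborel (\<lambda>x. hafn p S * (bordered p (I - S) (of_real x) * ?k x))" for S
    by (rule integrable_mult_right) (rule B(1))
  have exp: "Psi_ext p I (of_real x) * ?k x = (\<Sum>S\<in>Pow I. hafn p S * (bordered p (I - S) (of_real x) * ?k x))" for x
    unfolding Psi_ext_def sum_distrib_right by (simp only: mult.assoc)
  show ?A unfolding exp by (intro Bochner_Integration.integrable_sum int)
  have I: "(\<integral>x. Psi_ext p I (of_real x) * ?k x \<partial>lborel)
     = (\<Sum>S\<in>Pow I. hafn p S * (\<integral>x. bordered p (I - S) (of_real x) * ?k x \<partial>lborel))"
    unfolding exp by (subst Bochner_Integration.integral_sum) (auto intro: int)
  have "hafn p S * (bordered p (I - S) z - bordered p (I - S) w)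
     = - (\<Sum>i\<in>{i\<in>I. Im (p i) = 0}. 1 / (z - p i) - 1 / (w - p i)) * (hafn p S * permdet ?K (I - S))
       + 1 / (2 * \<i> * of_real pi) * (hafn p S * (\<integral>x. bordered p (I - S) (of_real x) * ?k x \<partial>lborel))"
    if S: "S \<in> Pow I" for S
  proof (cases "\<exists>i\<in>S. Im (p i) = 0")
    case True
    then have "hafn p S = 0" using S fin by (auto intro: hafn_real finite_subset)
    then show ?thesis by simp
  next
    case False
    then have "{i\<in>I - S. Im (p i) = 0} = {i\<in>I. Im (p i) = 0}" by auto
    then show ?thesis unfolding B(2) by (simp only: distrib_left mult.assoc mult.left_commute mult_minus_left mult_minus_right)
  qed
  then have "(\<Sum>S\<in>Pow I. hafn p S * (bordered p (I - S) z - bordered p (I - S) w))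
     = (\<Sum>S\<in>Pow I. - (\<Sum>i\<in>{i\<in>I. Im (p i) = 0}. 1 / (z - p i) - 1 / (w - p i)) * (hafn p S * permdet ?K (I - S))
       + 1 / (2 * \<i> * of_real pi) * (hafn p S * (\<integral>x. bordered p (I - S) (of_real x) * ?k x \<partial>lborel)))"
    by (rule sum.cong[OF refl])
  then show ?B
    unfolding I Psi_def unfolding Psi_ext_def
    by (simp only: sum_subtractf[symmetric] right_diff_distrib[symmetric] sum.distrib sum_distrib_left[symmetric])
qed

section \<open>Relabelling of nodes and the sine kernel on the real axis\<close>

lemma permdet_image:
  assumes inj: "inj_on f J" and fin: "finite J"
  shows "permdet K (f ` J) = permdet (\<lambda>i j. K (f i) (f j)) J"
proof -
  have bij: "bij_betw f J (f ` J)" using inj by (rule inj_on_imp_bij_betw)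
  have bij': "bij_betw (inv_into J f) (f ` J) J" by (rule bij_betw_inv_into[OF bij])
  have "permdet (\<lambda>i j. K (f i) (f j)) J = permdet K (f ` J)"
    unfolding permdet_def
  proof (rule sum.reindex_bij_witness[where j="map_permutation J f" and i="map_permutation (f ` J) (inv_into J f)"])
    fix s assume "s \<in> {s. s permutes J}"
    then have s: "s permutes J" by simp
    show "map_permutation (f ` J) (inv_into J f) (map_permutation J f s) = s"
      by (rule map_permutation_compose_inv[OF bij s]) (simp add: inj)
    show "map_permutation J f s \<in> {s. s permutes f ` J}"
      using map_permutation_permutes[OF bij s] by simp
    show "of_int (sign (map_permutation J f s)) * (\<Prod>i\<in>f ` J. K i (map_permutation J f s i))
        = of_int (sign s) * (\<Prod>i\<in>J. K (f i) (f (s i)))"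
      by (simp add: sign_map_permutation[OF inj s fin] prod.reindex[OF inj] map_permutation_apply[OF inj])
  next
    fix s assume "s \<in> {s. s permutes f ` J}"
    then have s: "s permutes f ` J" by simp
    show "map_permutation J f (map_permutation (f ` J) (inv_into J f) s) = s"
      by (rule map_permutation_compose_inv[OF bij' s]) (auto simp: f_inv_into_f)
    show "map_permutation (f ` J) (inv_into J f) s \<in> {s. s permutes J}"
      using map_permutation_permutes[OF bij' s] by simp
  qed
  then show ?thesis by simp
qed

text \<open>From exp(2\<i>v) - 1 = 2\<i> exp(\<i>v) sin v at v = pi d: up to a phase and the
  constant 2 pi \<i>, \<open>expq\<close> is the sine kernel.\<close>

lemma expq_of_real:
  "expq (of_real d) = 2 * \<i> * of_real pi * (cis (pi * d) * of_real (sinc (pi * d)))"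
proof (cases "d = 0")
  case False
  have "exp (2 * \<i> * of_real pi * of_real d) = cis (2 * (pi * d))"
    by (simp add: cis_conv_exp mult_ac)
  also have "cis (2 * (pi * d)) - 1 = cis (pi * d) * (2 * \<i> * of_real (sin (pi * d)))"
    unfolding complex_eq_iff cis.simps using sin_double[of "pi * d"] cos_double_sin[of "pi * d"]
    by (simp add: power2_eq_square)
  finally have "exp (2 * \<i> * of_real pi * of_real d) - 1 = cis (pi * d) * (2 * \<i> * of_real (sin (pi * d)))" .
  then show ?thesis using False by (simp add: expq_def)
qed simp

lemma kern_of_real:
  "kern (of_real x) (of_real y) = - (2 * \<i> * of_real pi) * (cis (pi * y) / cis (pi * x) * of_real (sinc (pi * (x - y))))"
proof -
  have "sinc (pi * (y - x)) = sinc (pi * (x - y))"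
  proof -
    have "pi * (y - x) = - (pi * (x - y))" by (simp add: algebra_simps)
    then show ?thesis by (simp only:) simp
  qed
  then show ?thesis
    unfolding kern_def ckern_def of_real_diff[symmetric] expq_of_real
    by (simp add: right_diff_distrib cis_divide)
qed

lemma prod_permuted_ratio:
  fixes g :: "'i \<Rightarrow> 'a :: field"
  assumes "finite J" "s permutes J" "\<And>i. i \<in> J \<Longrightarrow> g i \<noteq> 0"
  shows "(\<Prod>i\<in>J. g (s i) / g i) = 1"
proof -
  have "prod g J \<noteq> 0" using assms by simp
  then show ?thesis unfolding prod_dividef using prod.permute[OF assms(2), of g] by (simp add: o_def)
qed

text \<open>The phases enter as ratios between a point and its image, and their product over a
  permutation is 1. Each row contributes the constant -2 pi \<i>.\<close>

lemma permdet_sine_kernel: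
  "permdet (\<lambda>i j. kern (of_real (x i)) (of_real (x j))) {..<r}
     = (- (2 * \<i> * of_real pi)) ^ r * of_real (sine_kernel_corr r x)"
proof -
  have "sine_kernel_corr r x = (\<Sum>s | s permutes {..<r}. of_int (sign s) * (\<Prod>i<r. sinc (pi * (x i - x (s i)))))"
    unfolding sine_kernel_corr_def
  proof (subst det_def'[of _ r])
    show "(\<Sum>p | p permutes {0..<r}. of_int (sign p) * (\<Prod>i = 0..<r. mat r r (\<lambda>(i, j). sinc (pi * (x i - x j))) $$ (i, p i)))
      = (\<Sum>s | s permutes {..<r}. of_int (sign s) * (\<Prod>i<r. sinc (pi * (x i - x (s i)))))"
      unfolding atLeast0LessThan
    proof (intro sum.cong refl arg_cong2[where f=times] prod.cong)
      fix s i assume "s \<in> {s. s permutes {..<r}}" "i \<in> {..<r}"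
      then have "i < r" "s i < r" by (auto dest: permutes_in_image[of s _ i])
      then show "mat r r (\<lambda>(i, j). sinc (pi * (x i - x j))) $$ (i, s i) = sinc (pi * (x i - x (s i)))" by simp
    qed
  qed simp
  moreover have "(\<Prod>i<r. kern (of_real (x i)) (of_real (x (s i))))
      = (- (2 * \<i> * of_real pi)) ^ r * of_real (\<Prod>i<r. sinc (pi * (x i - x (s i))))"
    if s: "s permutes {..<r}" for s
    unfolding kern_of_real prod.distrib
    using prod_permuted_ratio[OF _ s, of "\<lambda>i. cis (pi * x i)"] by (simp del: cis_divide)
  ultimately show ?thesis
    unfolding permdet_def by (simp add: sum_distrib_left algebra_simps)
qed

section \<open>Sine-kernel correlation functions\<close>

text \<open>Along the segment from the matrix to the identity the determinant cannot vanish for s >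
  0: a kernel vector v would make (1 - s) times the quadratic form plus s |v|^2 equal to 0. As it is
  1 at s = 1, it stays positive, and the limit s to 0 gives the claim.\<close>

lemma det_nonneg_of_psd:
  fixes a :: "nat \<Rightarrow> nat \<Rightarrow> real"
  assumes psd: "\<And>v. (\<Sum>i<n. \<Sum>j<n. v i * v j * a i j) \<ge> 0"
  shows "Determinant.det (mat n n (\<lambda>(i, j). a i j)) \<ge> 0"
proof -
  define B where "B s = mat n n (\<lambda>(i, j). (1 - s) * a i j + (if i = j then s else 0))" for s :: real
  have B: "B s \<in> carrier_mat n n" for s by (simp add: B_def)
  have det: "Determinant.det (B s) = (\<Sum>p | p permutes {0..<n}. of_int (sign p) *
      (\<Prod>i = 0..<n. (1 - s) * a i (p i) + (if i = p i then s else 0)))" for s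
    unfolding det_def'[OF B]
  proof (intro sum.cong refl arg_cong2[where f=times] prod.cong)
    fix p i assume "p \<in> {p. p permutes {0..<n}}" "i \<in> {0..<n}"
    then have "i < n" "p i < n" by (auto dest: permutes_in_image[of p _ i])
    then show "B s $$ (i, p i) = (1 - s) * a i (p i) + (if i = p i then s else 0)" by (simp add: B_def)
  qed
  have "continuous_on UNIV (\<lambda>s. (1 - s) * a i j + (if i = j then s else 0))" for i j
    by (cases "i = j") (auto intro!: continuous_intros)
  then have cont: "continuous_on UNIV (\<lambda>s. Determinant.det (B s))"
    unfolding det by (intro continuous_on_sum continuous_on_mult continuous_on_prod continuous_on_const)
  have nonzero: "Determinant.det (B s) \<noteq> 0" if s: "0 < s" "s \<le> 1" for s
  proof
    assume "Determinant.det (B s) = 0"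
    then obtain v where v: "v \<in> carrier_vec n" "v \<noteq> 0\<^sub>v n" "B s *\<^sub>v v = 0\<^sub>v n"
      unfolding det_0_iff_vec_prod_zero_field[OF B] by blast
    have row: "(\<Sum>j<n. B s $$ (i, j) * v $ j) = 0" if i: "i < n" for i
    proof -
      have "(B s *\<^sub>v v) $ i = (\<Sum>j<n. B s $$ (i, j) * v $ j)"
        using i v(1) B[of s] by (simp add: scalar_prod_def atLeast0LessThan B_def)
      then show ?thesis using v(3) i by simp
    qed
    have "0 = (\<Sum>i<n. v $ i * (\<Sum>j<n. B s $$ (i, j) * v $ j))" using row by simp
    also have "\<dots> = (\<Sum>i<n. \<Sum>j<n. (1 - s) * (v $ i * v $ j * a i j) + (if i = j then s * (v $ i)\<^sup>2 else 0))"
      unfolding sum_distrib_left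
      by (intro sum.cong refl) (auto simp: B_def algebra_simps power2_eq_square)
    also have "\<dots> = (1 - s) * (\<Sum>i<n. \<Sum>j<n. v $ i * v $ j * a i j) + s * (\<Sum>i<n. (v $ i)\<^sup>2)"
      by (simp add: sum.distrib sum_distrib_left)
    finally have eq: "(1 - s) * (\<Sum>i<n. \<Sum>j<n. v $ i * v $ j * a i j) + s * (\<Sum>i<n. (v $ i)\<^sup>2) = 0" by simp
    have "(1 - s) * (\<Sum>i<n. \<Sum>j<n. v $ i * v $ j * a i j) \<ge> 0"
      using s psd[of "\<lambda>i. v $ i"] by (intro mult_nonneg_nonneg) auto
    moreover have "(\<Sum>i<n. (v $ i)\<^sup>2) \<ge> 0" by (intro sum_nonneg) auto
    ultimately have "s * (\<Sum>i<n. (v $ i)\<^sup>2) \<le> 0" using eq by linarith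
    then have "(\<Sum>i<n. (v $ i)\<^sup>2) = 0"
      using s \<open>(\<Sum>i<n. (v $ i)\<^sup>2) \<ge> 0\<close> by (simp add: mult_le_0_iff)
    then have "v $ i = 0" if "i < n" for i using that by (simp add: sum_nonneg_eq_0_iff)
    then have "v = 0\<^sub>v n" using v(1) by (intro eq_vecI) auto
    then show False using v(2) by simp
  qed
  have B1: "Determinant.det (B 1) = 1"
  proof -
    have "B 1 = 1\<^sub>m n" by (rule eq_matI) (auto simp: B_def)
    then show ?thesis by simp
  qed
  have pos: "Determinant.det (B s) \<ge> 0" if s: "0 < s" "s \<le> 1" for s
  proof (rule ccontr)
    assume "\<not> ?thesis"
    then have "\<exists>x\<ge>s. x \<le> 1 \<and> Determinant.det (B x) = 0"
      using s B1 by (intro IVT' continuous_on_subset[OF cont]) auto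
    then show False using nonzero s by force
  qed
  have "((\<lambda>s. Determinant.det (B s)) \<longlongrightarrow> Determinant.det (B 0)) (at_right 0)"
    using cont by (auto simp: continuous_on_def intro: tendsto_mono[OF at_le])
  moreover have "eventually (\<lambda>s. Determinant.det (B s) \<ge> 0) (at_right (0::real))"
    using eventually_at_right_field[of _ "0::real"] pos by (intro eventually_at_right_field[THEN iffD2] exI[of _ 1]) auto
  ultimately have "Determinant.det (B 0) \<ge> 0"
    by (intro tendsto_lowerbound) auto
  moreover have "B 0 = mat n n (\<lambda>(i, j). a i j)" by (rule eq_matI) (auto simp: B_def)
  ultimately show ?thesis by simp
qed

text \<open>Exhibits sinc as the Fourier transform of an interval, the source of positive
  semidefiniteness of the sine kernel.\<close>

lemma sinc_integral_representation:
  "((\<lambda>t. cos (2 * d * t)) has_integral sinc d) {-1/2..1/2}"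
proof (cases "d = 0")
  case True
  show ?thesis using True has_integral_const_real[of "1::real" "-1/2" "1/2"] by simp
next
  case False
  have "((\<lambda>t. cos (2 * d * t)) has_integral sin (2 * d * (1/2)) / (2 * d) - sin (2 * d * (-1/2)) / (2 * d)) {-1/2..1/2}"
  proof (rule fundamental_theorem_of_calculus)
    fix t :: real assume "t \<in> {-1/2..1/2}"
    show "((\<lambda>t. sin (2 * d * t) / (2 * d)) has_vector_derivative cos (2 * d * t)) (at t within {-1/2..1/2})"
      unfolding has_real_derivative_iff_has_vector_derivative[symmetric]
      using False by (auto intro!: derivative_eq_intros)
  qed simp
  also have "sin (2 * d * (1/2)) / (2 * d) - sin (2 * d * (-1/2)) / (2 * d) = sinc d"
    using False by (simp add: field_simps)
  finally show ?thesis .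
qed

text \<open>The quadratic form is the integral over t of |\<Sum>i. v i exp(2 pi \<i> x i t)|^2,
  written with cosines and sines. Nonnegativity is what makes \<open>ennreal (rho r x)\<close> in
  the definition of the process a faithful copy of the determinant.\<close>

lemma sine_kernel_corr_nonneg: "sine_kernel_corr r x \<ge> 0"
  unfolding sine_kernel_corr_def
proof (rule det_nonneg_of_psd)
  fix v :: "nat \<Rightarrow> real"
  let ?c = "\<lambda>t. \<Sum>i<r. v i * cos (2 * (pi * x i) * t)" and ?s = "\<lambda>t. \<Sum>i<r. v i * sin (2 * (pi * x i) * t)"
  have "((\<lambda>t. \<Sum>i<r. \<Sum>j<r. v i * v j * cos (2 * (pi * (x i - x j)) * t)) has_integral
      (\<Sum>i<r. \<Sum>j<r. v i * v j * sinc (pi * (x i - x j)))) {-1/2..1/2}"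
    by (intro has_integral_sum has_integral_mult_right sinc_integral_representation) auto
  moreover have "(\<Sum>i<r. \<Sum>j<r. v i * v j * cos (2 * (pi * (x i - x j)) * t)) = (?c t)\<^sup>2 + (?s t)\<^sup>2" for t
  proof -
    have "cos (2 * (pi * (x i - x j)) * t) = cos (2 * (pi * x i) * t) * cos (2 * (pi * x j) * t)
      + sin (2 * (pi * x i) * t) * sin (2 * (pi * x j) * t)" for i j
      unfolding cos_diff[symmetric] by (simp add: algebra_simps)
    then show ?thesis
      by (simp add: power2_eq_square sum_product sum.distrib[symmetric] algebra_simps)
  qed
  ultimately have "((\<lambda>t. (?c t)\<^sup>2 + (?s t)\<^sup>2) has_integral
      (\<Sum>i<r. \<Sum>j<r. v i * v j * sinc (pi * (x i - x j)))) {-1/2..1/2}" by simp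
  then show "0 \<le> (\<Sum>i<r. \<Sum>j<r. v i * v j * sinc (pi * (x i - x j)))"
    by (rule has_integral_nonneg) simp
qed

definition tuples :: "nat \<Rightarrow> (nat \<Rightarrow> int) set" where
  "tuples r = {s \<in> {..<r} \<rightarrow>\<^sub>E UNIV. inj_on s {..<r}}"

lemma countable_tuples [simp]: "countable (tuples r)"
  unfolding tuples_def
  by (rule countable_subset[of _ "{..<r} \<rightarrow>\<^sub>E UNIV"]) (auto intro: countable_PiE)

lemma tuples_0 [simp]: "tuples 0 = {\<lambda>_. undefined}"
  by (auto simp: tuples_def)

lemma bij_betw_tuples_Suc:
  "bij_betw (\<lambda>s. (restrict s {..<r}, s r)) (tuples (Suc r)) (Sigma (tuples r) (\<lambda>s. - s ` {..<r}))"
proof (rule bij_betw_byWitness[where f'="\<lambda>(s, m). s(r := m)"])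
  show "\<forall>s\<in>tuples (Suc r). (case (restrict s {..<r}, s r) of (s, m) \<Rightarrow> s(r := m)) = s"
    by (auto simp: tuples_def fun_eq_iff PiE_def extensional_def restrict_def)
  show "\<forall>b\<in>Sigma (tuples r) (\<lambda>s. - s ` {..<r}).
     (restrict (case b of (s, m) \<Rightarrow> s(r := m)) {..<r}, (case b of (s, m) \<Rightarrow> s(r := m)) r) = b"
    by (auto simp: tuples_def fun_eq_iff PiE_def extensional_def restrict_def)
  show "(\<lambda>s. (restrict s {..<r}, s r)) ` tuples (Suc r) \<subseteq> Sigma (tuples r) (\<lambda>s. - s ` {..<r})"
    by (fastforce simp: tuples_def inj_on_def)
  show "(\<lambda>(s, m). s(r := m)) ` Sigma (tuples r) (\<lambda>s. - s ` {..<r}) \<subseteq> tuples (Suc r)"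
    by (fastforce simp: tuples_def PiE_def extensional_def inj_on_def less_Suc_eq image_iff)
qed

text \<open>In the product of a sum over m and a sum over tuples s, the index m either already
  occurs in s, which gives the diagonal sum, or extends s to an injective tuple of length r +
  1.\<close>

lemma tuple_step:
  fixes b :: "int \<Rightarrow> 'b :: {real_normed_field, banach, second_countable_topology}"
  assumes b: "Infinite_Set_Sum.abs_summable_on b UNIV" and H: "Infinite_Set_Sum.abs_summable_on H (tuples r)"
  shows "Infinite_Set_Sum.abs_summable_on (\<lambda>s. b (s r) * H (restrict s {..<r})) (tuples (Suc r))" (is ?A)
    and "Infinite_Set_Sum.abs_summable_on (\<lambda>s. (\<Sum>i<r. b (s i)) * H s) (tuples r)" (is ?B)
    and "infsetsum b UNIV * infsetsum H (tuples r)
      = infsetsum (\<lambda>s. (\<Sum>i<r. b (s i)) * H s) (tuples r)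
        + infsetsum (\<lambda>s. b (s r) * H (restrict s {..<r})) (tuples (Suc r))" (is ?C)
proof -
  let ?f = "\<lambda>(s, m). H s * b m"
  let ?I = "Sigma (tuples r) (\<lambda>s. s ` {..<r})" and ?O = "Sigma (tuples r) (\<lambda>s. - s ` {..<r})"
  have un: "tuples r \<times> UNIV = ?I \<union> ?O" "?I \<inter> ?O = {}" by auto
  have P: "Infinite_Set_Sum.abs_summable_on ?f (tuples r \<times> UNIV)"
    and PI: "infsetsum ?f (tuples r \<times> UNIV) = infsetsum H (tuples r) * infsetsum b UNIV"
    using abs_summable_on_product[OF _ _ H b] infsetsum_product[OF _ _ H b] by auto
  have PI': "Infinite_Set_Sum.abs_summable_on ?f ?I" and PO: "Infinite_Set_Sum.abs_summable_on ?f ?O"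
    by (rule abs_summable_on_subset[OF P]; auto)+
  have inner: "infsetsum (\<lambda>m. H s * b m) (s ` {..<r}) = (\<Sum>i<r. b (s i)) * H s" if "s \<in> tuples r" for s
  proof -
    have "inj_on s {..<r}" using that by (simp add: tuples_def)
    then show ?thesis by (simp add: sum.reindex sum_distrib_left mult.commute)
  qed
  have "Infinite_Set_Sum.abs_summable_on (\<lambda>s. infsetsum (\<lambda>m. H s * b m) (s ` {..<r})) (tuples r)"
    using abs_summable_on_Sigma_project1'[of "\<lambda>s m. H s * b m" "tuples r" "\<lambda>s. s ` {..<r}"] PI' by auto
  then show ?B by (subst (asm) abs_summable_on_cong[OF inner refl]) auto
  have IB: "infsetsum ?f ?I = infsetsum (\<lambda>s. (\<Sum>i<r. b (s i)) * H s) (tuples r)"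
    using PI' by (subst infsetsum_Sigma) (auto intro!: infsetsum_cong simp: inner simp del: infsetsum_finite)
  show ?A
    using abs_summable_on_reindex_bij_betw[OF bij_betw_tuples_Suc[of r], of ?f] PO by (simp add: mult.commute)
  have IO: "infsetsum ?f ?O = infsetsum (\<lambda>s. b (s r) * H (restrict s {..<r})) (tuples (Suc r))"
    by (subst infsetsum_reindex_bij_betw[OF bij_betw_tuples_Suc[of r], symmetric]) (simp add: mult.commute)
  have "infsetsum ?f (tuples r \<times> UNIV) = infsetsum ?f ?I + infsetsum ?f ?O"
    unfolding un(1) by (rule infsetsum_Un_disjoint[OF PI' PO un(2)])
  then show ?C using PI IB IO by (simp add: mult.commute)
qed

section \<open>Integrating out real nodes\<close>

definition bounded_fun :: "('x \<Rightarrow> complex) \<Rightarrow> bool" where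
  "bounded_fun f \<longleftrightarrow> (\<exists>B. \<forall>x. norm (f x) \<le> B)"

lemma bounded_fun_const [intro]: "bounded_fun (\<lambda>_. c)"
  by (auto simp: bounded_fun_def)

lemma bounded_fun_diff [intro]: "bounded_fun f \<Longrightarrow> bounded_fun g \<Longrightarrow> bounded_fun (\<lambda>x. f x - g x)"
  unfolding bounded_fun_def by (meson add_mono norm_triangle_ineq4 order_trans)

lemma bounded_fun_add [intro]: "bounded_fun f \<Longrightarrow> bounded_fun g \<Longrightarrow> bounded_fun (\<lambda>x. f x + g x)"
  unfolding bounded_fun_def by (meson add_mono norm_triangle_ineq order_trans)

lemma bounded_fun_mult [intro]:
  assumes "bounded_fun f" "bounded_fun g"
  shows "bounded_fun (\<lambda>x. f x * g x)"
proof -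
  obtain B C where "\<And>x. norm (f x) \<le> B" "\<And>x. norm (g x) \<le> C"
    using assms unfolding bounded_fun_def by blast
  then have "norm (f x * g x) \<le> B * C" for x
    unfolding norm_mult by (intro mult_mono) (auto intro: order_trans[OF norm_ge_zero])
  then show ?thesis unfolding bounded_fun_def by blast
qed

lemma bounded_fun_sum [intro]: "(\<And>i. i \<in> A \<Longrightarrow> bounded_fun (f i)) \<Longrightarrow> bounded_fun (\<lambda>x. \<Sum>i\<in>A. f i x)"
  by (induction A rule: infinite_finite_induct) auto

lemma bounded_fun_prod [intro]: "(\<And>i. i \<in> A \<Longrightarrow> bounded_fun (f i)) \<Longrightarrow> bounded_fun (\<lambda>x. \<Prod>i\<in>A. f i x)"
  by (induction A rule: infinite_finite_induct) auto

text \<open>Left labels carry the fixed complex nodes, right labels the points of the process that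
  are to be integrated out.\<close>

definition node_pos :: "(nat \<Rightarrow> complex) \<Rightarrow> (nat \<Rightarrow> real) \<Rightarrow> nat + nat \<Rightarrow> complex" where
  "node_pos \<zeta> x = case_sum \<zeta> (\<lambda>i. of_real (x i))"

lemma node_pos_simps [simp]:
  "node_pos \<zeta> x (Inl j) = \<zeta> j" "node_pos \<zeta> x (Inr i) = of_real (x i)"
  by (simp_all add: node_pos_def)

lemma bounded_fun_ckern:
  assumes "\<And>j. j \<in> J \<Longrightarrow> Im (\<zeta> j) \<noteq> 0" "a \<in> J <+> {..<r}" "b \<in> J <+> {..<r}"
  shows "bounded_fun (\<lambda>x. ckern (node_pos \<zeta> x a) (node_pos \<zeta> x b))"
proof (cases a)
  case (Inr i)
  then show ?thesis by (simp add: ckern_def bounded_fun_const)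
next
  case (Inl i)
  then have i: "Im (\<zeta> i) \<noteq> 0" using assms by auto
  show ?thesis
  proof (cases b)
    case (Inl j)
    then show ?thesis using \<open>a = Inl i\<close> by (simp add: bounded_fun_const)
  next
    case (Inr j)
    have "norm (ckern (\<zeta> i) (of_real t)) \<le> 1 / \<bar>Im (\<zeta> i)\<bar>" for t
      using i abs_Im_le_cmod[of "\<zeta> i - of_real t"] by (simp add: ckern_def norm_divide frac_le)
    then show ?thesis using \<open>a = Inl i\<close> Inr unfolding bounded_fun_def by auto
  qed
qed

lemma bounded_fun_kern:
  assumes "\<And>j. j \<in> J \<Longrightarrow> Im (\<zeta> j) \<noteq> 0" "a \<in> J <+> {..<r}" "b \<in> J <+> {..<r}"
  shows "bounded_fun (\<lambda>x. kern (node_pos \<zeta> x a) (node_pos \<zeta> x b))"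
proof -
  define im where "im = case_sum (\<lambda>j. Im (\<zeta> j)) (\<lambda>_::nat. 0)"
  have im: "Im (node_pos \<zeta> x c) = im c" for x c by (cases c) (auto simp: im_def)
  have "norm (expq (node_pos \<zeta> x b - node_pos \<zeta> x a)) \<le> 2 * pi * exp (2 * pi * \<bar>im b - im a\<bar>)" for x
    by (rule norm_expq_le) (auto simp: im)
  then have "bounded_fun (\<lambda>x. expq (node_pos \<zeta> x b - node_pos \<zeta> x a))"
    unfolding bounded_fun_def by blast
  then have "bounded_fun (\<lambda>x. if im a \<le> 0 then expq (node_pos \<zeta> x b - node_pos \<zeta> x a) else 0)"
    by (cases "im a \<le> 0") auto
  then show ?thesis unfolding kern_def im using bounded_fun_ckern[OF assms] by auto
qed

lemma bounded_fun_Psi: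
  assumes "\<And>j. j \<in> J \<Longrightarrow> Im (\<zeta> j) \<noteq> 0"
  shows "bounded_fun (\<lambda>x. Psi (node_pos \<zeta> x) (J <+> {..<r}))"
  unfolding Psi_def hafn_def permdet_def
proof (intro bounded_fun_sum bounded_fun_mult bounded_fun_const bounded_fun_prod)
  fix S m i assume S: "S \<in> Pow (J <+> {..<r})" and "m \<in> fpf_invol S" "i \<in> S"
  then have "m i \<in> S" by (auto simp: fpf_invol_def permutes_in_image)
  then show "bounded_fun (\<lambda>x. ckern (node_pos \<zeta> x i) (node_pos \<zeta> x (m i)))"
    using S \<open>i \<in> S\<close> by (intro bounded_fun_ckern[of J _ _ r] assms) auto
next
  fix S s i assume S: "S \<in> Pow (J <+> {..<r})" and s: "s \<in> {s. s permutes (J <+> {..<r}) - S}"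
    and i: "i \<in> (J <+> {..<r}) - S"
  then have "s i \<in> (J <+> {..<r}) - S" using permutes_in_image[of s _ i] by blast
  then show "bounded_fun (\<lambda>x. kern (node_pos \<zeta> x i) (node_pos \<zeta> x (s i)))"
    using i by (intro bounded_fun_kern[of J _ _ r] assms) auto
qed

abbreviation lebesgue_power :: "nat \<Rightarrow> (nat \<Rightarrow> real) measure" where
  "lebesgue_power r \<equiv> Pi\<^sub>M {..<r} (\<lambda>_. lborel)"

lemma node_pos_measurable:
  assumes "a \<in> J <+> {..<r}"
  shows "(\<lambda>x. node_pos \<zeta> x a) \<in> borel_measurable (lebesgue_power r)"
proof (cases a)
  case (Inr i)
  have [measurable]: "(\<lambda>x. x i) \<in> borel_measurable (lebesgue_power r)"
  proof -
    have "i \<in> {..<r}" using assms Inr by auto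
    from measurable_component_singleton[OF this, of "\<lambda>_. lborel :: real measure"] show ?thesis by simp
  qed
  show ?thesis unfolding Inr by simp
qed simp

lemma kern_measurable_compose:
  "f \<in> borel_measurable N \<Longrightarrow> g \<in> borel_measurable N \<Longrightarrow> (\<lambda>x. kern (f x) (g x)) \<in> borel_measurable N"
  using measurable_compose[OF measurable_Pair kern_borel_measurable, of f N g] by simp

lemma ckern_measurable_compose:
  assumes [measurable]: "f \<in> borel_measurable N" "g \<in> borel_measurable N"
  shows "(\<lambda>x. ckern (f x) (g x)) \<in> borel_measurable N"
  unfolding ckern_def by measurable

lemma Psi_measurable: "(\<lambda>x. Psi (node_pos \<zeta> x) (J <+> {..<r})) \<in> borel_measurable (lebesgue_power r)"
  unfolding Psi_def hafn_def permdet_def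
proof (intro borel_measurable_sum borel_measurable_times borel_measurable_const borel_measurable_prod)
  fix S m i assume S: "S \<in> Pow (J <+> {..<r})" and "m \<in> fpf_invol S" "i \<in> S"
  then have "m i \<in> S" by (auto simp: fpf_invol_def permutes_in_image)
  then show "(\<lambda>x. ckern (node_pos \<zeta> x i) (node_pos \<zeta> x (m i))) \<in> borel_measurable (lebesgue_power r)"
    using S \<open>i \<in> S\<close> by (intro ckern_measurable_compose node_pos_measurable[of _ J]) auto
next
  fix S s i assume S: "S \<in> Pow (J <+> {..<r})" and s: "s \<in> {s. s permutes (J <+> {..<r}) - S}"
    and i: "i \<in> (J <+> {..<r}) - S"
  then have "s i \<in> (J <+> {..<r}) - S" using permutes_in_image[of s _ i] by blast
  then show "(\<lambda>x. kern (node_pos \<zeta> x i) (node_pos \<zeta> x (s i))) \<in> borel_measurable (lebesgue_power r)"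
    using i by (intro kern_measurable_compose node_pos_measurable[of _ J]) auto
qed

lemma Psi_ext_cong:
  assumes "\<And>i. i \<in> I \<Longrightarrow> p i = q i"
  shows "Psi_ext p I t = Psi_ext q I t"
  unfolding Psi_ext_def bordered_def
proof (intro sum.cong refl arg_cong2[where f=times] arg_cong2[where f=minus] hafn_cong permdet_cong prod.cong)
  fix S s b assume "S \<in> Pow I" "s \<in> {s. s permutes I - S}" "b \<in> I - S"
  then have "s b \<in> I" "b \<in> I" using permutes_in_image[of s _ b] by blast+
  then show "edge_pair (p (s b)) (p b) t = edge_pair (q (s b)) (q b) t" using assms by simp
  fix i assume "i \<in> I - S - {b}"
  then have "s i \<in> I" "i \<in> I" using \<open>s \<in> {s. s permutes I - S}\<close> permutes_in_image[of s _ i] by blast+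
  then show "kern (p i) (p (s i)) = kern (q i) (q (s i))" using assms by simp
qed (auto simp: assms)

lemma Psi_cong:
  assumes "\<And>i. i \<in> I \<Longrightarrow> p i = q i"
  shows "Psi p I = Psi q I"
  unfolding Psi_def
  by (intro sum.cong refl arg_cong2[where f=times] hafn_cong permdet_cong) (auto simp: assms)

definition cauchy_diff :: "complex \<Rightarrow> complex \<Rightarrow> real \<Rightarrow> complex" where
  "cauchy_diff z w x = 1 / (z - of_real x) - 1 / (w - of_real x)"

text \<open>Integrating the last real node trades it for a complex node at z minus one at w. The sum
  over the remaining real nodes has the same shape as the diagonal part in
  \<open>tuple_step\<close>, where a new index coincides with an old one; this match drives the
  moment formula.\<close>

lemma Psi_node_recursion:
  assumes fin: "finite J" and \<nu>: "\<nu> \<notin> J" and re: "\<And>j. j \<in> J \<Longrightarrow> Im (\<zeta> j) \<noteq> 0" and inj: "inj_on \<zeta> J"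
    and z: "Im z \<noteq> 0" "z \<notin> \<zeta> ` J" and w: "Im w \<noteq> 0" "w \<notin> \<zeta> ` J"
  shows "integrable lborel (\<lambda>t. Psi (node_pos \<zeta> (x(r := t))) (J <+> {..<Suc r}) * cauchy_diff z w t)"
    and "Psi (node_pos (\<zeta>(\<nu> := z)) x) (insert \<nu> J <+> {..<r}) - Psi (node_pos (\<zeta>(\<nu> := w)) x) (insert \<nu> J <+> {..<r})
      = - (\<Sum>i<r. cauchy_diff z w (x i)) * Psi (node_pos \<zeta> x) (J <+> {..<r})
        + 1 / (2 * \<i> * of_real pi) *
          (\<integral>t. Psi (node_pos \<zeta> (x(r := t))) (J <+> {..<Suc r}) * cauchy_diff z w t \<partial>lborel)"
proof -
  let ?I = "J <+> {..<r}" and ?p = "node_pos \<zeta> x"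
  have finI: "finite ?I" using fin by simp
  have injI: "a = b" if "a \<in> ?I" "b \<in> ?I" "node_pos \<eta> x' a = node_pos \<eta> x' b" "Im (node_pos \<eta> x' a) \<noteq> 0"
    "\<And>j. j \<in> J \<Longrightarrow> \<eta> j = \<zeta> j" for \<eta> x' a b
  proof (cases a)
    case (Inl j)
    show ?thesis
    proof (cases b)
      case (Inl j')
      with \<open>a = Inl j\<close> that have "j \<in> J" "j' \<in> J" "\<zeta> j = \<zeta> j'" by auto
      then show ?thesis using inj \<open>a = Inl j\<close> Inl by (auto dest: inj_onD)
    next
      case (Inr i)
      with Inl that(3,4) show ?thesis by simp
    qed
  next
    case (Inr i)
    with that(4) show ?thesis by simp
  qed
  have 1: "Psi (node_pos (\<zeta>(\<nu> := u)) x) (insert \<nu> J <+> {..<r}) = Psi_ext ?p ?I u" for u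
  proof -
    have "insert \<nu> J <+> {..<r} = insert (Inl \<nu>) ?I" by auto
    then have "Psi (node_pos (\<zeta>(\<nu> := u)) x) (insert \<nu> J <+> {..<r})
        = Psi_ext (node_pos (\<zeta>(\<nu> := u)) x) ?I (node_pos (\<zeta>(\<nu> := u)) x (Inl \<nu>))"
      unfolding Psi_ext_def
    proof (elim ssubst, intro Psi_insert)
      fix i j assume "i \<in> ?I" "j \<in> ?I" "node_pos (\<zeta>(\<nu> := u)) x i = node_pos (\<zeta>(\<nu> := u)) x j"
         "Im (node_pos (\<zeta>(\<nu> := u)) x i) \<noteq> 0"
      then show "i = j" by (rule injI) (use \<nu> in auto)
    qed (use \<nu> fin in auto)
    also have "\<dots> = Psi_ext ?p ?I u"
    proof -
      have "node_pos (\<zeta>(\<nu> := u)) x i = ?p i" if "i \<in> ?I" for i using that \<nu> by auto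
      then show ?thesis using Psi_ext_cong[of ?I "node_pos (\<zeta>(\<nu> := u)) x" ?p] by simp
    qed
    finally show ?thesis .
  qed
  have 2: "Psi (node_pos \<zeta> (x(r := t))) (J <+> {..<Suc r}) = Psi_ext ?p ?I (of_real t)" for t
  proof -
    have "J <+> {..<Suc r} = insert (Inr r) ?I" by (auto simp: less_Suc_eq)
    then have "Psi (node_pos \<zeta> (x(r := t))) (J <+> {..<Suc r})
        = Psi_ext (node_pos \<zeta> (x(r := t))) ?I (node_pos \<zeta> (x(r := t)) (Inr r))"
      unfolding Psi_ext_def
    proof (elim ssubst, intro Psi_insert)
      fix i j assume "i \<in> ?I" "j \<in> ?I" "node_pos \<zeta> (x(r := t)) i = node_pos \<zeta> (x(r := t)) j"
         "Im (node_pos \<zeta> (x(r := t)) i) \<noteq> 0"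
      then show "i = j" by (rule injI) auto
    qed (use fin in auto)
    also have "\<dots> = Psi_ext ?p ?I (of_real t)"
    proof -
      have "node_pos \<zeta> (x(r := t)) i = ?p i" if "i \<in> ?I" for i using that by auto
      then show ?thesis using Psi_ext_cong[of ?I "node_pos \<zeta> (x(r := t))" ?p] by simp
    qed
    finally show ?thesis .
  qed
  have ne: "u \<notin> ?p ` ?I" if "Im u \<noteq> 0" "u \<notin> \<zeta> ` J" for u
    using that by auto
  note R = Psi_ext_recursion[OF finI z(1) w(1) ne[OF z] ne[OF w]]
  have 3: "(\<Sum>i\<in>{i\<in>?I. Im (?p i) = 0}. 1 / (z - ?p i) - 1 / (w - ?p i)) = (\<Sum>i<r. cauchy_diff z w (x i))"
  proof -
    have "{i\<in>?I. Im (?p i) = 0} = Inr ` {..<r}" using re by auto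
    then show ?thesis by (simp only:) (simp add: sum.reindex cauchy_diff_def)
  qed
  show "integrable lborel (\<lambda>t. Psi (node_pos \<zeta> (x(r := t))) (J <+> {..<Suc r}) * cauchy_diff z w t)"
    using R(1) unfolding 2 cauchy_diff_def .
  show "Psi (node_pos (\<zeta>(\<nu> := z)) x) (insert \<nu> J <+> {..<r}) - Psi (node_pos (\<zeta>(\<nu> := w)) x) (insert \<nu> J <+> {..<r})
      = - (\<Sum>i<r. cauchy_diff z w (x i)) * Psi (node_pos \<zeta> x) (J <+> {..<r})
        + 1 / (2 * \<i> * of_real pi) *
          (\<integral>t. Psi (node_pos \<zeta> (x(r := t))) (J <+> {..<Suc r}) * cauchy_diff z w t \<partial>lborel)"
    using R(2) unfolding 1 2 3 unfolding cauchy_diff_def .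
qed

fun diff_Psi :: "(complex \<times> complex) list \<Rightarrow> nat set \<Rightarrow> (nat \<Rightarrow> complex) \<Rightarrow> nat \<Rightarrow> (nat \<Rightarrow> real) \<Rightarrow> complex" where
  "diff_Psi [] J \<zeta> r x = Psi (node_pos \<zeta> x) (J <+> {..<r})"
| "diff_Psi ((z, w) # ps) J \<zeta> r x = diff_Psi ps (insert (length ps) J) (\<zeta>(length ps := z)) r x
     - diff_Psi ps (insert (length ps) J) (\<zeta>(length ps := w)) r x"

fun flat_pairs :: "('a \<times> 'a) list \<Rightarrow> 'a list" where
  "flat_pairs [] = []"
| "flat_pairs ((z, w) # ps) = z # w # flat_pairs ps"

lemma bounded_fun_diff_Psi:
  assumes "\<And>j. j \<in> J \<Longrightarrow> Im (\<zeta> j) \<noteq> 0" "\<And>u. u \<in> set (flat_pairs ps) \<Longrightarrow> Im u \<noteq> 0"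
  shows "bounded_fun (diff_Psi ps J \<zeta> r)"
  using assms
proof (induction ps arbitrary: J \<zeta>)
  case Nil
  then have "bounded_fun (\<lambda>x. Psi (node_pos \<zeta> x) (J <+> {..<r}))" by (intro bounded_fun_Psi)
  then show ?case by (simp add: bounded_fun_def)
next
  case (Cons a ps)
  obtain z w where a: "a = (z, w)" by (cases a)
  have "bounded_fun (\<lambda>x. diff_Psi ps (insert (length ps) J) (\<zeta>(length ps := z)) r x
     - diff_Psi ps (insert (length ps) J) (\<zeta>(length ps := w)) r x)"
    by (intro bounded_fun_diff Cons.IH) (use Cons.prems in \<open>auto simp: a\<close>)
  then show ?case by (simp add: bounded_fun_def a)
qed

lemma diff_Psi_measurable: "diff_Psi ps J \<zeta> r \<in> borel_measurable (lebesgue_power r)"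
proof (induction ps arbitrary: J \<zeta>)
  case Nil
  then show ?case using Psi_measurable[of \<zeta> J r] by (subst measurable_cong[OF diff_Psi.simps(1)])
next
  case (Cons a ps)
  obtain z w where a: "a = (z, w)" by (cases a)
  show ?case unfolding a by (subst measurable_cong[OF diff_Psi.simps(2)]) (intro borel_measurable_diff Cons.IH)
qed

text \<open>The recursion for \<open>Psi\<close> is linear and is applied in every branch of the
  alternating sum. The new label \<nu> lies above all labels still to be assigned, hence the node it
  carries can be added before or after them.\<close>

lemma diff_Psi_recursion:
  assumes "finite J" "\<nu> \<notin> J" "\<nu> \<ge> length ps" "\<And>j. j \<in> J \<Longrightarrow> j \<ge> length ps"
    and "\<And>j. j \<in> J \<Longrightarrow> Im (\<zeta> j) \<noteq> 0" "inj_on \<zeta> J" "\<zeta> ` J \<inter> set (flat_pairs ps) = {}"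
    and "distinct (flat_pairs ps)" "\<And>u. u \<in> set (flat_pairs ps) \<Longrightarrow> Im u \<noteq> 0"
    and "Im z \<noteq> 0" "z \<notin> \<zeta> ` J" "z \<notin> set (flat_pairs ps)"
    and "Im w \<noteq> 0" "w \<notin> \<zeta> ` J" "w \<notin> set (flat_pairs ps)"
  shows "integrable lborel (\<lambda>t. diff_Psi ps J \<zeta> (Suc r) (x(r := t)) * cauchy_diff z w t) \<and>
     diff_Psi ps (insert \<nu> J) (\<zeta>(\<nu> := z)) r x - diff_Psi ps (insert \<nu> J) (\<zeta>(\<nu> := w)) r x
      = - (\<Sum>i<r. cauchy_diff z w (x i)) * diff_Psi ps J \<zeta> r x
        + 1 / (2 * \<i> * of_real pi) *
          (\<integral>t. diff_Psi ps J \<zeta> (Suc r) (x(r := t)) * cauchy_diff z w t \<partial>lborel)"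
  using assms
proof (induction ps arbitrary: J \<zeta>)
  case Nil
  show ?case unfolding diff_Psi.simps
    by (intro conjI Psi_node_recursion) (use Nil.prems in auto)
next
  case (Cons a ps)
  obtain z' w' where a: "a = (z', w')" by (cases a)
  let ?l = "length ps"
  let ?F = "\<lambda>u t. diff_Psi ps (insert ?l J) (\<zeta>(?l := u)) (Suc r) (x(r := t)) * cauchy_diff z w t"
  note P = Cons.prems[unfolded a, simplified]
  have l: "?l \<notin> J" "?l \<noteq> \<nu>" using P by force+
  have IH: "integrable lborel (?F u) \<and>
     diff_Psi ps (insert \<nu> (insert ?l J)) (\<zeta>(?l := u, \<nu> := z)) r x - diff_Psi ps (insert \<nu> (insert ?l J)) (\<zeta>(?l := u, \<nu> := w)) r x
      = - (\<Sum>i<r. cauchy_diff z w (x i)) * diff_Psi ps (insert ?l J) (\<zeta>(?l := u)) r x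
        + 1 / (2 * \<i> * of_real pi) * (\<integral>t. ?F u t \<partial>lborel)"
    if u: "u = z' \<or> u = w'" for u
  proof (rule Cons.IH)
    have im: "(\<zeta>(?l := u)) ` insert ?l J = insert u (\<zeta> ` J)" using l by auto
    show "inj_on (\<zeta>(?l := u)) (insert ?l J)"
      using l P u by (auto simp: inj_on_def)
    show "(\<zeta>(?l := u)) ` insert ?l J \<inter> set (flat_pairs ps) = {}" unfolding im using P u by auto
    show "z \<notin> (\<zeta>(?l := u)) ` insert ?l J" "w \<notin> (\<zeta>(?l := u)) ` insert ?l J" unfolding im using P u by auto
    show "length ps \<le> \<nu>" using P by simp
    show "length ps \<le> j" if "j \<in> insert ?l J" for j
    proof (cases "j = ?l")
      case False
      then show ?thesis using P(4)[of j] that by simp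
    qed simp
    show "Im ((\<zeta>(?l := u)) j) \<noteq> 0" if "j \<in> insert ?l J" for j
      using P u that by auto
  qed (use P l in auto)
  \<comment> \<open>The updates at \<open>?l\<close> and \<nu> commute, as the two labels
    differ.\<close>
  have com: "insert ?l (insert \<nu> J) = insert \<nu> (insert ?l J)" "\<zeta>(\<nu> := v, ?l := u) = \<zeta>(?l := u, \<nu> := v)" for u v
    using l by auto
  have int: "integrable lborel (?F z')" "integrable lborel (?F w')" using IH by auto
  have split: "diff_Psi (a # ps) J \<zeta> (Suc r) (x(r := t)) * cauchy_diff z w t = ?F z' t - ?F w' t" for t
    by (simp add: a left_diff_distrib)
  show ?case unfolding split
  proof (intro conjI Bochner_Integration.integrable_diff int)
    show "diff_Psi (a # ps) (insert \<nu> J) (\<zeta>(\<nu> := z)) r x - diff_Psi (a # ps) (insert \<nu> J) (\<zeta>(\<nu> := w)) r x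
      = - (\<Sum>i<r. cauchy_diff z w (x i)) * diff_Psi (a # ps) J \<zeta> r x
        + 1 / (2 * \<i> * of_real pi) * (\<integral>t. ?F z' t - ?F w' t \<partial>lborel)"
      unfolding Bochner_Integration.integral_diff[OF int] a diff_Psi.simps com
      by (subst diff_diff_rearrange, subst IH[THEN conjunct2], simp, subst IH[THEN conjunct2], simp)
         (simp only: right_diff_distrib add_diff_add)
  qed
qed

section \<open>Linear statistics of the process\<close>

lemma infsetsum_measurable:
  fixes f :: "'i \<Rightarrow> 'a \<Rightarrow> 'b :: {banach, second_countable_topology}"
  assumes "countable A" "\<And>a. a \<in> A \<Longrightarrow> f a \<in> borel_measurable M"
  shows "(\<lambda>\<omega>. infsetsum (\<lambda>a. f a \<omega>) A) \<in> borel_measurable M"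
proof -
  interpret sigma_finite_measure "count_space A"
    by (rule sigma_finite_measure_count_space_countable) fact
  have "(\<lambda>p. f (snd p) (fst p)) \<in> borel_measurable (M \<Otimes>\<^sub>M count_space A)"
    by (rule measurable_compose_countable'[where I=A and f="\<lambda>a p. f a (fst p)" and g=snd])
       (use assms in \<open>auto intro: measurable_compose[OF measurable_fst]\<close>)
  then have "(\<lambda>(\<omega>, a). f a \<omega>) \<in> borel_measurable (M \<Otimes>\<^sub>M count_space A)"
    by (simp add: case_prod_beta')
  then show ?thesis unfolding infsetsum_def
    by (rule borel_measurable_lebesgue_integral)
qed

text \<open>A common majorant, up to constants, of all Cauchy differences with nodes off the
  axis.\<close>

definition cauchy_weight :: "real \<Rightarrow> real" where
  "cauchy_weight x = 1 / (1 + x\<^sup>2)"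

lemma cauchy_weight_pos: "cauchy_weight x > 0"
  by (simp add: cauchy_weight_def add_pos_nonneg)

lemma cauchy_weight_le_1: "cauchy_weight x \<le> 1"
  by (simp add: cauchy_weight_def divide_simps add_pos_nonneg)

lemma cauchy_weight_measurable [measurable]: "cauchy_weight \<in> borel_measurable borel"
  unfolding cauchy_weight_def by measurable

lemma cauchy_diff_measurable [measurable]: "cauchy_diff z w \<in> borel_measurable borel"
  unfolding cauchy_diff_def by measurable

lemma cauchy_diff_decay:
  assumes "Im z \<noteq> 0" "Im w \<noteq> 0"
  obtains C where "C \<ge> 0" "\<And>x. norm (cauchy_diff z w x) \<le> C * cauchy_weight x"
proof -
  obtain C where C: "C \<ge> 0" "\<And>x. norm (1 / (of_real x - z) - 1 / (of_real x - w)) \<le> C / (1 + x\<^sup>2)"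
    using cauchy_pair_decay[OF assms] by blast
  have "norm (cauchy_diff z w x) \<le> C * cauchy_weight x" for x
  proof -
    have neg: "1 / (u - of_real x) = - (1 / (of_real x - u))" for u :: complex
      by (metis minus_diff_eq minus_divide_right)
    have "cauchy_diff z w x = - (1 / (of_real x - z) - 1 / (of_real x - w))"
      unfolding cauchy_diff_def neg by simp
    then show ?thesis using C(2)[of x] by (simp add: cauchy_weight_def norm_minus_commute del: minus_diff_eq)
  qed
  then show thesis using C(1) that by blast
qed

definition weight_prod :: "nat \<Rightarrow> (nat \<Rightarrow> real) \<Rightarrow> real" where
  "weight_prod r x = (\<Prod>i<r. cauchy_weight (x i))"

lemma weight_prod_pos: "weight_prod r x > 0"
  by (auto simp: weight_prod_def cauchy_weight_pos intro!: prod_pos)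

interpretation lebesgue_product: product_sigma_finite "\<lambda>_. lborel :: real measure"
  by standard

lemma component_measurable:
  assumes "i < r"
  shows "(\<lambda>x. x i) \<in> borel_measurable (lebesgue_power r)"
  using measurable_component_singleton[of i "{..<r}" "\<lambda>_. lborel :: real measure"] assms by simp

lemma weight_prod_measurable [measurable]: "weight_prod r \<in> borel_measurable (lebesgue_power r)"
  unfolding weight_prod_def
  by (intro borel_measurable_prod measurable_compose[OF component_measurable cauchy_weight_measurable]) auto

lemma weight_prod_integrable: "integrable (lebesgue_power r) (weight_prod r)"
  unfolding weight_prod_def
  by (rule lebesgue_product.product_integrable_prod)
     (use integrable_cauchy_density in \<open>auto simp: cauchy_weight_def[abs_def]\<close>)

definition weight_bounded :: "nat \<Rightarrow> ((nat \<Rightarrow> real) \<Rightarrow> complex) \<Rightarrow> bool" where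
  "weight_bounded r h \<longleftrightarrow> h \<in> borel_measurable (lebesgue_power r) \<and> (\<exists>C\<ge>0. \<forall>x. norm (h x) \<le> C * weight_prod r x)"

lemma weight_bounded_integrable:
  assumes h: "weight_bounded r h" and g: "g \<in> borel_measurable (lebesgue_power r)" "bounded_fun g"
  shows "integrable (lebesgue_power r) (\<lambda>x. h x * g x)"
proof -
  obtain B where B: "\<And>x. norm (g x) \<le> B" using g(2) by (auto simp: bounded_fun_def)
  obtain C where C: "C \<ge> 0" "\<And>x. norm (h x) \<le> C * weight_prod r x" using h by (auto simp: weight_bounded_def)
  have B0: "B \<ge> 0" using B norm_ge_zero order_trans by blast
  show ?thesis
  proof (rule Bochner_Integration.integrable_bound)
    show "integrable (lebesgue_power r) (\<lambda>x. (C * B) * weight_prod r x)"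
      by (intro integrable_mult_right weight_prod_integrable)
    show "(\<lambda>x. h x * g x) \<in> borel_measurable (lebesgue_power r)"
      using h g by (auto simp: weight_bounded_def)
    have "norm (h x * g x) \<le> norm ((C * B) * weight_prod r x)" for x
    proof -
      have "norm (h x * g x) \<le> (C * weight_prod r x) * B"
        unfolding norm_mult by (rule mult_mono[OF C(2) B]) (use C weight_prod_pos[of r x] in auto)
      then show ?thesis using C B0 weight_prod_pos[of r x] by (simp add: abs_mult algebra_simps)
    qed
    then show "AE x in lebesgue_power r. norm (h x * g x) \<le> norm ((C * B) * weight_prod r x)" by simp
  qed
qed

text \<open>Without complex nodes every nonempty pairing vanishes, so only the determinant over the
  real points is left. This anchors the moment formula and also yields measurability and boundedness
  of the correlation functions.\<close>

lemma sine_kernel_corr_eq_diff_Psi: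
  "of_real (sine_kernel_corr r x) = diff_Psi [] {} \<zeta> r x / (- (2 * \<i> * of_real pi)) ^ r"
proof -
  let ?I = "{} <+> {..<r} :: (nat + nat) set" and ?p = "node_pos \<zeta> x"
  have I: "?I = Inr ` {..<r}" by auto
  have "hafn ?p S = 0" if S: "S \<in> Pow ?I - {{}}" for S
  proof -
    obtain i where "i \<in> S" using S by blast
    then show ?thesis using S by (intro hafn_real[of _ i]) (auto intro: finite_subset[of S ?I])
  qed
  then have "(\<Sum>S\<in>Pow ?I. hafn ?p S * permdet (\<lambda>i j. kern (?p i) (?p j)) (?I - S))
     = (\<Sum>S\<in>{{}}. hafn ?p S * permdet (\<lambda>i j. kern (?p i) (?p j)) (?I - S))"
    by (intro sum.mono_neutral_right) auto
  then have "diff_Psi [] {} \<zeta> r x = permdet (\<lambda>i j. kern (?p i) (?p j)) ?I"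
    by (simp add: Psi_def)
  also have "\<dots> = permdet (\<lambda>i j. kern (of_real (x i)) (of_real (x j))) {..<r}"
    unfolding I by (subst permdet_image) auto
  also have "\<dots> = (- (2 * \<i> * of_real pi)) ^ r * of_real (sine_kernel_corr r x)"
    by (rule permdet_sine_kernel)
  finally show ?thesis by simp
qed

lemma sine_kernel_corr_measurable [measurable]:
  "sine_kernel_corr r \<in> borel_measurable (lebesgue_power r)"
proof -
  have "(\<lambda>x. Re (diff_Psi [] {} (\<lambda>_. 0) r x / (- (2 * \<i> * of_real pi)) ^ r)) \<in> borel_measurable (lebesgue_power r)"
    using diff_Psi_measurable[of "[]" "{}" "\<lambda>_. 0" r] by (simp del: diff_Psi.simps)
  then show ?thesis unfolding sine_kernel_corr_eq_diff_Psi[symmetric] by simp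
qed

lemma bounded_sine_kernel_corr: "bounded_fun (\<lambda>x. of_real (sine_kernel_corr r x))"
  unfolding sine_kernel_corr_eq_diff_Psi[where \<zeta>="\<lambda>_. 0"] divide_inverse
  by (intro bounded_fun_mult bounded_fun_diff_Psi bounded_fun_const) auto

section \<open>Sums over tuples of points and their moments\<close>

locale sine_process =
  fixes M :: "'a measure" and y :: "int \<Rightarrow> 'a \<Rightarrow> real"
  assumes sine: "sine_kernel_process M y"
begin

sublocale prob_space M
  using sine by (simp add: sine_kernel_process_def)

lemma y_measurable [measurable]: "y k \<in> borel_measurable M"
  using sine by (simp add: sine_kernel_process_def)

definition sample :: "nat \<Rightarrow> 'a \<Rightarrow> (nat \<Rightarrow> int) \<Rightarrow> nat \<Rightarrow> real" where
  "sample r \<omega> s = (\<lambda>i\<in>{..<r}. y (s i) \<omega>)"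

lemma sample_measurable1: "(\<lambda>\<omega>. sample r \<omega> s) \<in> M \<rightarrow>\<^sub>M lebesgue_power r"
  unfolding sample_def by (rule measurable_restrict) simp

lemma sample_measurable [measurable]:
  "(\<lambda>p. sample r (fst p) (snd p)) \<in> M \<Otimes>\<^sub>M count_space (tuples r) \<rightarrow>\<^sub>M lebesgue_power r"
  by (rule measurable_compose_countable'[where I="tuples r" and f="\<lambda>s p. sample r (fst p) s" and g=snd])
     (auto intro: measurable_compose[OF measurable_fst] sample_measurable1)

lemma pair_sigma_finite_tuples: "pair_sigma_finite M (count_space (tuples r))"
  by (simp add: pair_sigma_finite_def sigma_finite_measure_axioms sigma_finite_measure_count_space_countable)

text \<open>The defining identity of correlation functions, tested on indicators, says that the
  sampling map pushes M times counting measure to this density. In this form it applies to complex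
  integrands.\<close>

lemma distr_sample:
  "distr (M \<Otimes>\<^sub>M count_space (tuples r)) (lebesgue_power r) (\<lambda>p. sample r (fst p) (snd p))
    = density (lebesgue_power r) (\<lambda>x. ennreal (sine_kernel_corr r x))"
proof (rule measure_eqI)
  interpret pair_sigma_finite M "count_space (tuples r)" by (rule pair_sigma_finite_tuples)
  let ?N = "M \<Otimes>\<^sub>M count_space (tuples r)"
  fix A assume "A \<in> sets (distr ?N (lebesgue_power r) (\<lambda>p. sample r (fst p) (snd p)))"
  then have A[measurable]: "A \<in> sets (lebesgue_power r)" by simp
  have "emeasure (distr ?N (lebesgue_power r) (\<lambda>p. sample r (fst p) (snd p))) A
      = (\<integral>\<^sup>+ x. indicator A x \<partial>distr ?N (lebesgue_power r) (\<lambda>p. sample r (fst p) (snd p)))"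
    by simp
  also have "\<dots> = (\<integral>\<^sup>+ p. indicator A (sample r (fst p) (snd p)) \<partial>?N)"
    by (rule nn_integral_distr) measurable
  also have "\<dots> = (\<integral>\<^sup>+ \<omega>. \<integral>\<^sup>+ s. indicator A (sample r \<omega> s) \<partial>count_space (tuples r) \<partial>M)"
    by (subst M2.nn_integral_fst[symmetric]) auto
  also have "\<dots> = (\<integral>\<^sup>+ x. indicator A x * ennreal (sine_kernel_corr r x) \<partial>lebesgue_power r)"
    using sine unfolding sine_kernel_process_def has_correlation_functions_def sample_def tuples_def
    by (auto simp: restrict_def)
  also have "\<dots> = emeasure (density (lebesgue_power r) (\<lambda>x. ennreal (sine_kernel_corr r x))) A"
    by (subst emeasure_density) (auto simp: mult.commute)
  finally show "emeasure (distr ?N (lebesgue_power r) (\<lambda>p. sample r (fst p) (snd p))) A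
     = emeasure (density (lebesgue_power r) (\<lambda>x. ennreal (sine_kernel_corr r x))) A" .
qed simp

definition linear_stat :: "nat \<Rightarrow> ((nat \<Rightarrow> real) \<Rightarrow> 'b :: {banach, second_countable_topology}) \<Rightarrow> 'a \<Rightarrow> 'b" where
  "linear_stat r h \<omega> = infsetsum (\<lambda>s. h (sample r \<omega> s)) (tuples r)"

lemma linear_stat_measurable:
  fixes h :: "(nat \<Rightarrow> real) \<Rightarrow> 'b :: {banach, second_countable_topology}"
  shows "h \<in> borel_measurable (lebesgue_power r) \<Longrightarrow> linear_stat r h \<in> borel_measurable M"
  unfolding linear_stat_def
  by (intro infsetsum_measurable measurable_compose[OF sample_measurable1]) auto

text \<open>An infinite sum over tuples is an integral against counting measure, so Fubini on M
  times that measure and a change of variables give summability, integrability and the mean at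
  once.\<close>

lemma linear_stat_integral:
  fixes h :: "(nat \<Rightarrow> real) \<Rightarrow> 'b :: {banach, second_countable_topology}"
  assumes h: "h \<in> borel_measurable (lebesgue_power r)"
    and int: "integrable (lebesgue_power r) (\<lambda>x. sine_kernel_corr r x *\<^sub>R h x)"
  shows "AE \<omega> in M. Infinite_Set_Sum.abs_summable_on (\<lambda>s. h (sample r \<omega> s)) (tuples r)"
    and "integrable M (linear_stat r h)"
    and "(\<integral>\<omega>. linear_stat r h \<omega> \<partial>M) = (\<integral>x. sine_kernel_corr r x *\<^sub>R h x \<partial>lebesgue_power r)"
proof -
  interpret pair_sigma_finite M "count_space (tuples r)" by (rule pair_sigma_finite_tuples)
  let ?N = "M \<Otimes>\<^sub>M count_space (tuples r)"
  have "integrable (density (lebesgue_power r) (\<lambda>x. ennreal (sine_kernel_corr r x))) h"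
    using int h by (subst integrable_density) (auto simp: sine_kernel_corr_nonneg)
  then have int': "integrable ?N (\<lambda>p. h (sample r (fst p) (snd p)))"
    unfolding distr_sample[symmetric] by (subst (asm) integrable_distr_eq) (use h in auto)
  show "AE \<omega> in M. Infinite_Set_Sum.abs_summable_on (\<lambda>s. h (sample r \<omega> s)) (tuples r)"
    unfolding Infinite_Set_Sum.abs_summable_on_def using AE_integrable_fst'[OF int'] by simp
  show "integrable M (linear_stat r h)"
    unfolding linear_stat_def[abs_def] infsetsum_def using integrable_fst'[OF int'] by simp
  have "(\<integral>\<omega>. linear_stat r h \<omega> \<partial>M) = (\<integral>p. h (sample r (fst p) (snd p)) \<partial>?N)"
    unfolding linear_stat_def[abs_def] infsetsum_def using integral_fst'[OF int'] by simp
  also have "\<dots> = (\<integral>x. h x \<partial>density (lebesgue_power r) (\<lambda>x. ennreal (sine_kernel_corr r x)))"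
    unfolding distr_sample[symmetric] by (subst integral_distr) (use h in auto)
  also have "\<dots> = (\<integral>x. sine_kernel_corr r x *\<^sub>R h x \<partial>lebesgue_power r)"
    by (subst integral_density) (use h in \<open>auto simp: sine_kernel_corr_nonneg\<close>)
  finally show "(\<integral>\<omega>. linear_stat r h \<omega> \<partial>M) = (\<integral>x. sine_kernel_corr r x *\<^sub>R h x \<partial>lebesgue_power r)" .
qed

lemma weight_prod_corr_integrable: "integrable (lebesgue_power r) (\<lambda>x. sine_kernel_corr r x *\<^sub>R weight_prod r x)"
proof -
  have "weight_bounded r (\<lambda>x. of_real (weight_prod r x))"
    using weight_prod_pos[of r] by (auto simp: weight_bounded_def abs_of_pos intro!: exI[of _ 1])
  from weight_bounded_integrable[OF this _ bounded_sine_kernel_corr]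
  have "integrable (lebesgue_power r) (\<lambda>x. complex_of_real (sine_kernel_corr r x *\<^sub>R weight_prod r x))"
    by (simp add: mult.commute)
  then show ?thesis by (subst (asm) complex_of_real_integrable_eq)
qed

definition weight_sum :: "'a \<Rightarrow> real" where
  "weight_sum \<omega> = infsetsum (\<lambda>m. cauchy_weight (y m \<omega>)) UNIV"

definition regular :: "'a \<Rightarrow> bool" where
  "regular \<omega> \<longleftrightarrow> Infinite_Set_Sum.abs_summable_on (\<lambda>m. cauchy_weight (y m \<omega>)) UNIV"

lemma AE_regular: "AE \<omega> in M. regular \<omega>"
proof -
  have bij: "bij_betw (\<lambda>s. s 0) (tuples (Suc 0)) (UNIV :: int set)"
    by (rule bij_betw_byWitness[where f'="\<lambda>m. \<lambda>i\<in>{..<Suc 0}. m"])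
       (auto simp: tuples_def PiE_def extensional_def fun_eq_iff inj_on_def)
  have "AE \<omega> in M. Infinite_Set_Sum.abs_summable_on (\<lambda>s. weight_prod 1 (sample 1 \<omega> s)) (tuples 1)"
    by (rule linear_stat_integral(1)[OF weight_prod_measurable weight_prod_corr_integrable])
  then show ?thesis
  proof eventually_elim
    case (elim \<omega>)
    then have "Infinite_Set_Sum.abs_summable_on (\<lambda>s. cauchy_weight (y (s 0) \<omega>)) (tuples (Suc 0))"
      by (simp add: weight_prod_def sample_def)
    then show ?case unfolding regular_def
      using abs_summable_on_reindex_bij_betw[OF bij, of "\<lambda>m. cauchy_weight (y m \<omega>)"] by simp
  qed
qed

lemma sample_restrict: "sample r \<omega> (restrict s {..<r}) = restrict (sample (Suc r) \<omega> s) {..<r}"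
  by (auto simp: sample_def restrict_def)

lemma regular_weight_summable:
  assumes "regular \<omega>"
  shows "Infinite_Set_Sum.abs_summable_on (\<lambda>s. weight_prod r (sample r \<omega> s)) (tuples r)"
proof (induction r)
  case (Suc r)
  have "weight_prod (Suc r) (sample (Suc r) \<omega> s)
     = cauchy_weight (y (s r) \<omega>) * weight_prod r (sample r \<omega> (restrict s {..<r}))" for s
    by (simp add: weight_prod_def sample_def mult.commute)
  then show ?case by (simp only: tuple_step(1)[OF assms[unfolded regular_def] Suc])
qed simp

lemma weight_sum_nonneg: "weight_sum \<omega> \<ge> 0"
  unfolding weight_sum_def using cauchy_weight_pos by (intro infsetsum_nonneg) (simp add: less_imp_le)

lemma linear_stat_weight_nonneg: "linear_stat r (weight_prod r) \<omega> \<ge> 0"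
  unfolding linear_stat_def using weight_prod_pos by (intro infsetsum_nonneg) (simp add: less_imp_le)

lemma weight_sum_measurable [measurable]: "weight_sum \<in> borel_measurable M"
  unfolding weight_sum_def by (intro infsetsum_measurable) auto

text \<open>One factor \<open>weight_sum\<close> is absorbed into the tuple sum. Its diagonal part
  is at most r times the same sum, as the weight is at most 1, and the rest is the sum over tuples
  of length r + 1. Induction on k therefore yields all moments.\<close>

lemma weight_moment_integrable:
  "integrable M (\<lambda>\<omega>. weight_sum \<omega> ^ k * linear_stat r (weight_prod r) \<omega>)"
proof (induction k arbitrary: r)
  case 0
  show ?case
    using linear_stat_integral(2)[OF weight_prod_measurable weight_prod_corr_integrable] by simp
next
  case (Suc k)
  let ?W = "\<lambda>r \<omega>. linear_stat r (weight_prod r) \<omega>"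
  have [measurable]: "linear_stat r (weight_prod r) \<in> borel_measurable M" for r
    by (rule linear_stat_measurable) simp
  show ?case
  proof (rule Bochner_Integration.integrable_bound)
    show "integrable M (\<lambda>\<omega>. real r * (weight_sum \<omega> ^ k * ?W r \<omega>) + weight_sum \<omega> ^ k * ?W (Suc r) \<omega>)"
      by (intro Bochner_Integration.integrable_add integrable_mult_right Suc)
    show "AE \<omega> in M. norm (weight_sum \<omega> ^ Suc k * ?W r \<omega>)
        \<le> norm (real r * (weight_sum \<omega> ^ k * ?W r \<omega>) + weight_sum \<omega> ^ k * ?W (Suc r) \<omega>)"
      using AE_regular
    proof eventually_elim
      case (elim \<omega>)
      note W = regular_weight_summable[OF elim]
      note T = tuple_step[OF elim[unfolded regular_def] W[of r]]
      have "infsetsum (\<lambda>s. (\<Sum>i<r. cauchy_weight (y (s i) \<omega>)) * weight_prod r (sample r \<omega> s)) (tuples r)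
        \<le> infsetsum (\<lambda>s. real r * weight_prod r (sample r \<omega> s)) (tuples r)"
      proof (rule infsetsum_mono[OF T(2)])
        show "Infinite_Set_Sum.abs_summable_on (\<lambda>s. real r * weight_prod r (sample r \<omega> s)) (tuples r)"
          using W by (rule abs_summable_on_cmult_right)
        fix s
        have "(\<Sum>i<r. cauchy_weight (y (s i) \<omega>)) \<le> (\<Sum>i<r. 1)"
          by (rule sum_mono) (rule cauchy_weight_le_1)
        then show "(\<Sum>i<r. cauchy_weight (y (s i) \<omega>)) * weight_prod r (sample r \<omega> s) \<le> real r * weight_prod r (sample r \<omega> s)"
          using weight_prod_pos[of r "sample r \<omega> s"] by (intro mult_right_mono) auto
      qed
      also have "\<dots> = real r * ?W r \<omega>"
        unfolding linear_stat_def by (rule infsetsum_cmult_right) (rule W)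
      finally have 1: "infsetsum (\<lambda>s. (\<Sum>i<r. cauchy_weight (y (s i) \<omega>)) * weight_prod r (sample r \<omega> s)) (tuples r) \<le> real r * ?W r \<omega>" .
      have 2: "infsetsum (\<lambda>s. cauchy_weight (y (s r) \<omega>) * weight_prod r (sample r \<omega> (restrict s {..<r}))) (tuples (Suc r)) = ?W (Suc r) \<omega>"
        unfolding linear_stat_def by (rule infsetsum_cong) (auto simp: weight_prod_def sample_def mult.commute)
      have "weight_sum \<omega> * ?W r \<omega> \<le> real r * ?W r \<omega> + ?W (Suc r) \<omega>"
        using T(3) 1 2 unfolding weight_sum_def linear_stat_def by linarith
      from mult_left_mono[OF this, of "weight_sum \<omega> ^ k"]
      have "weight_sum \<omega> ^ Suc k * ?W r \<omega> \<le> real r * (weight_sum \<omega> ^ k * ?W r \<omega>) + weight_sum \<omega> ^ k * ?W (Suc r) \<omega>"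
        using weight_sum_nonneg[of \<omega>] by (simp add: algebra_simps)
      then show ?case
        using weight_sum_nonneg[of \<omega>] linear_stat_weight_nonneg[of r \<omega>]
        by (subst real_norm_def, subst abs_of_nonneg) (auto intro: order_trans abs_ge_self)
    qed
  qed measurable
qed

end

section \<open>Mixed moments of Cauchy statistics\<close>

context sine_process
begin

definition cauchy_stat :: "complex \<Rightarrow> complex \<Rightarrow> 'a \<Rightarrow> complex" where
  "cauchy_stat z w \<omega> = infsetsum (\<lambda>m. cauchy_diff z w (y m \<omega>)) UNIV"

fun cauchy_stats :: "(complex \<times> complex) list \<Rightarrow> 'a \<Rightarrow> complex" where
  "cauchy_stats [] \<omega> = 1"
| "cauchy_stats ((z, w) # ps) \<omega> = cauchy_stat z w \<omega> * cauchy_stats ps \<omega>"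

lemma cauchy_stat_measurable [measurable]: "cauchy_stat z w \<in> borel_measurable M"
  unfolding cauchy_stat_def by (intro infsetsum_measurable) auto

lemma cauchy_stats_measurable [measurable]: "cauchy_stats ps \<in> borel_measurable M"
proof (induction ps)
  case Nil
  then show ?case by (subst measurable_cong[OF cauchy_stats.simps(1)]) auto
next
  case (Cons a ps)
  obtain z w where a: "a = (z, w)" by (cases a)
  show ?case unfolding a
    by (subst measurable_cong[OF cauchy_stats.simps(2)]) (intro borel_measurable_times cauchy_stat_measurable Cons)
qed

lemma regular_cauchy_summable:
  assumes "regular \<omega>" "Im z \<noteq> 0" "Im w \<noteq> 0"
  shows "Infinite_Set_Sum.abs_summable_on (\<lambda>m. cauchy_diff z w (y m \<omega>)) UNIV"
proof -
  obtain C where C: "C \<ge> 0" "\<And>x. norm (cauchy_diff z w x) \<le> C * cauchy_weight x"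
    using cauchy_diff_decay[OF assms(2,3)] by blast
  show ?thesis
    by (rule abs_summable_on_comparison_test'[OF abs_summable_on_cmult_right[OF assms(1)[unfolded regular_def], of C] C(2)])
qed

lemma cauchy_stat_bound:
  assumes "Im z \<noteq> 0" "Im w \<noteq> 0"
  obtains C where "C \<ge> 0" "\<And>\<omega>. regular \<omega> \<Longrightarrow> norm (cauchy_stat z w \<omega>) \<le> C * weight_sum \<omega>"
proof -
  obtain C where C: "C \<ge> 0" "\<And>x. norm (cauchy_diff z w x) \<le> C * cauchy_weight x"
    using cauchy_diff_decay[OF assms] by blast
  have "norm (cauchy_stat z w \<omega>) \<le> C * weight_sum \<omega>" if reg: "regular \<omega>" for \<omega>
  proof -
    note S = reg[unfolded regular_def]
    have "norm (cauchy_stat z w \<omega>) \<le> infsetsum (\<lambda>m. norm (cauchy_diff z w (y m \<omega>))) UNIV"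
      unfolding cauchy_stat_def by (rule norm_infsetsum_bound)
    also have "\<dots> \<le> infsetsum (\<lambda>m. C * cauchy_weight (y m \<omega>)) UNIV"
      by (rule infsetsum_mono) (use regular_cauchy_summable[OF reg assms] abs_summable_on_cmult_right[OF S] C(2) in auto)
    also have "\<dots> = C * weight_sum \<omega>"
      unfolding weight_sum_def by (rule infsetsum_cmult_right) (rule S)
    finally show ?thesis .
  qed
  then show thesis using C(1) that by blast
qed

lemma cauchy_stats_bound:
  assumes "\<And>u. u \<in> set (flat_pairs ps) \<Longrightarrow> Im u \<noteq> 0"
  obtains C where "C \<ge> 0" "\<And>\<omega>. regular \<omega> \<Longrightarrow> norm (cauchy_stats ps \<omega>) \<le> C * weight_sum \<omega> ^ length ps"
  using assms
proof (induction ps arbitrary: thesis)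
  case Nil
  show ?case by (rule Nil(1)[of 1]) auto
next
  case (Cons a ps)
  obtain z w where a: "a = (z, w)" by (cases a)
  obtain C where C: "C \<ge> 0" "\<And>\<omega>. regular \<omega> \<Longrightarrow> norm (cauchy_stats ps \<omega>) \<le> C * weight_sum \<omega> ^ length ps"
    by (rule Cons.IH) (use Cons.prems(2) in \<open>auto simp: a\<close>)
  obtain D where D: "D \<ge> 0" "\<And>\<omega>. regular \<omega> \<Longrightarrow> norm (cauchy_stat z w \<omega>) \<le> D * weight_sum \<omega>"
    by (rule cauchy_stat_bound[of z w]) (use Cons.prems(2) in \<open>auto simp: a\<close>)
  show ?case
  proof (rule Cons.prems(1)[of "D * C"])
    fix \<omega> assume reg: "regular \<omega>"
    have "norm (cauchy_stats (a # ps) \<omega>) \<le> (D * weight_sum \<omega>) * (C * weight_sum \<omega> ^ length ps)"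
      unfolding a cauchy_stats.simps norm_mult
      by (rule mult_mono[OF D(2)[OF reg] C(2)[OF reg]]) (use D(1) weight_sum_nonneg in auto)
    then show "norm (cauchy_stats (a # ps) \<omega>) \<le> D * C * weight_sum \<omega> ^ length (a # ps)"
      by (simp add: algebra_simps)
  qed (use C D in auto)
qed

lemma weight_bounded_summable:
  assumes "weight_bounded r h" "regular \<omega>"
  shows "Infinite_Set_Sum.abs_summable_on (\<lambda>s. h (sample r \<omega> s)) (tuples r)"
proof -
  obtain C where "C \<ge> 0" "\<And>x. norm (h x) \<le> C * weight_prod r x" using assms(1) by (auto simp: weight_bounded_def)
  then show ?thesis
    by (intro abs_summable_on_comparison_test'[OF abs_summable_on_cmult_right[OF regular_weight_summable[OF assms(2)], of C r]]) auto
qed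

lemma linear_stat_bound:
  assumes "weight_bounded r h"
  obtains C where "C \<ge> 0" "\<And>\<omega>. regular \<omega> \<Longrightarrow> norm (linear_stat r h \<omega>) \<le> C * linear_stat r (weight_prod r) \<omega>"
proof -
  obtain C where C: "C \<ge> 0" "\<And>x. norm (h x) \<le> C * weight_prod r x" using assms by (auto simp: weight_bounded_def)
  have "norm (linear_stat r h \<omega>) \<le> C * linear_stat r (weight_prod r) \<omega>" if reg: "regular \<omega>" for \<omega>
  proof -
    note S = regular_weight_summable[OF reg, of r]
    have "norm (linear_stat r h \<omega>) \<le> infsetsum (\<lambda>s. norm (h (sample r \<omega> s))) (tuples r)"
      unfolding linear_stat_def by (rule norm_infsetsum_bound)
    also have "\<dots> \<le> infsetsum (\<lambda>s. C * weight_prod r (sample r \<omega> s)) (tuples r)"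
      by (rule infsetsum_mono) (use weight_bounded_summable[OF assms reg] abs_summable_on_cmult_right[OF S] C(2) in auto)
    also have "\<dots> = C * linear_stat r (weight_prod r) \<omega>"
      unfolding linear_stat_def by (rule infsetsum_cmult_right) (rule S)
    finally show ?thesis .
  qed
  then show thesis using C(1) that by blast
qed

lemma cauchy_stats_integrable:
  assumes "\<And>u. u \<in> set (flat_pairs ps) \<Longrightarrow> Im u \<noteq> 0" and h: "weight_bounded r h"
  shows "integrable M (\<lambda>\<omega>. cauchy_stats ps \<omega> * linear_stat r h \<omega>)"
proof -
  obtain C where C: "C \<ge> 0" "\<And>\<omega>. regular \<omega> \<Longrightarrow> norm (cauchy_stats ps \<omega>) \<le> C * weight_sum \<omega> ^ length ps"
    using cauchy_stats_bound[OF assms(1)] by blast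
  obtain D where D: "D \<ge> 0" "\<And>\<omega>. regular \<omega> \<Longrightarrow> norm (linear_stat r h \<omega>) \<le> D * linear_stat r (weight_prod r) \<omega>"
    using linear_stat_bound[OF h] by blast
  show ?thesis
  proof (rule Bochner_Integration.integrable_bound)
    show "integrable M (\<lambda>\<omega>. (C * D) * (weight_sum \<omega> ^ length ps * linear_stat r (weight_prod r) \<omega>))"
      by (intro integrable_mult_right weight_moment_integrable)
    show "(\<lambda>\<omega>. cauchy_stats ps \<omega> * linear_stat r h \<omega>) \<in> borel_measurable M"
      using h by (intro borel_measurable_times cauchy_stats_measurable linear_stat_measurable) (auto simp: weight_bounded_def)
    show "AE \<omega> in M. norm (cauchy_stats ps \<omega> * linear_stat r h \<omega>)
       \<le> norm ((C * D) * (weight_sum \<omega> ^ length ps * linear_stat r (weight_prod r) \<omega>))"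
      using AE_regular
    proof eventually_elim
      case (elim \<omega>)
      have "norm (cauchy_stats ps \<omega> * linear_stat r h \<omega>)
        \<le> (C * weight_sum \<omega> ^ length ps) * (D * linear_stat r (weight_prod r) \<omega>)"
        unfolding norm_mult
        by (rule mult_mono[OF C(2)[OF elim] D(2)[OF elim]]) (use C(1) weight_sum_nonneg in auto)
      also have "\<dots> = (C * D) * (weight_sum \<omega> ^ length ps * linear_stat r (weight_prod r) \<omega>)"
        by (simp add: algebra_simps)
      also have "\<dots> \<le> norm ((C * D) * (weight_sum \<omega> ^ length ps * linear_stat r (weight_prod r) \<omega>))"
        unfolding real_norm_def by (rule abs_ge_self)
      finally show ?case .
    qed
  qed
qed

lemma weight_bounded_diag:
  assumes h: "weight_bounded r h" and "Im z \<noteq> 0" "Im w \<noteq> 0"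
  shows "weight_bounded r (\<lambda>x. (\<Sum>i<r. cauchy_diff z w (x i)) * h x)"
proof -
  obtain C where C: "C \<ge> 0" "\<And>x. norm (h x) \<le> C * weight_prod r x" using h by (auto simp: weight_bounded_def)
  obtain D where D: "D \<ge> 0" "\<And>x. norm (cauchy_diff z w x) \<le> D * cauchy_weight x"
    using cauchy_diff_decay[OF assms(2,3)] by blast
  have "norm ((\<Sum>i<r. cauchy_diff z w (x i)) * h x) \<le> (real r * D * C) * weight_prod r x" for x
  proof -
    have "norm (cauchy_diff z w t) \<le> D" for t
      using D(2)[of t] mult_left_mono[OF cauchy_weight_le_1 D(1), of t] by simp
    then have "norm (\<Sum>i<r. cauchy_diff z w (x i)) \<le> (\<Sum>i<r. D)"
      by (intro order_trans[OF norm_sum] sum_mono) auto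
    then have "norm ((\<Sum>i<r. cauchy_diff z w (x i)) * h x) \<le> (real r * D) * (C * weight_prod r x)"
      unfolding norm_mult using D(1) by (intro mult_mono C(2)) auto
    then show ?thesis by (simp add: algebra_simps)
  qed
  moreover have "(\<lambda>x. (\<Sum>i<r. cauchy_diff z w (x i)) * h x) \<in> borel_measurable (lebesgue_power r)"
    using h by (intro borel_measurable_times borel_measurable_sum measurable_compose[OF component_measurable cauchy_diff_measurable])
      (auto simp: weight_bounded_def)
  moreover have "0 \<le> real r * D * C" using C D by simp
  ultimately show ?thesis unfolding weight_bounded_def by blast
qed

lemma restrict_measurable: "(\<lambda>x. restrict x {..<r}) \<in> lebesgue_power (Suc r) \<rightarrow>\<^sub>M lebesgue_power r"
  by (rule measurable_restrict_subset) auto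

lemma weight_bounded_extend:
  assumes h: "weight_bounded r h" and "Im z \<noteq> 0" "Im w \<noteq> 0"
  shows "weight_bounded (Suc r) (\<lambda>x. cauchy_diff z w (x r) * h (restrict x {..<r}))"
proof -
  obtain C where C: "C \<ge> 0" "\<And>x. norm (h x) \<le> C * weight_prod r x" using h by (auto simp: weight_bounded_def)
  obtain D where D: "D \<ge> 0" "\<And>x. norm (cauchy_diff z w x) \<le> D * cauchy_weight x"
    using cauchy_diff_decay[OF assms(2,3)] by blast
  have "norm (cauchy_diff z w (x r) * h (restrict x {..<r})) \<le> (D * C) * weight_prod (Suc r) x" for x
  proof -
    have "norm (cauchy_diff z w (x r) * h (restrict x {..<r})) \<le> (D * cauchy_weight (x r)) * (C * weight_prod r (restrict x {..<r}))"
      unfolding norm_mult using D(1) cauchy_weight_pos[of "x r"] by (intro mult_mono C(2) D(2)) auto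
    then show ?thesis by (simp add: weight_prod_def algebra_simps)
  qed
  moreover have "(\<lambda>x. cauchy_diff z w (x r) * h (restrict x {..<r})) \<in> borel_measurable (lebesgue_power (Suc r))"
    using h by (intro borel_measurable_times measurable_compose[OF component_measurable cauchy_diff_measurable]
        measurable_compose[OF restrict_measurable]) (auto simp: weight_bounded_def)
  moreover have "0 \<le> D * C" using C D by simp
  ultimately show ?thesis unfolding weight_bounded_def by blast
qed

lemma cauchy_stat_times_linear_stat:
  assumes reg: "regular \<omega>" and h: "weight_bounded r h" and "Im z \<noteq> 0" "Im w \<noteq> 0"
  shows "cauchy_stat z w \<omega> * linear_stat r h \<omega>
    = linear_stat r (\<lambda>x. (\<Sum>i<r. cauchy_diff z w (x i)) * h x) \<omega>
      + linear_stat (Suc r) (\<lambda>x. cauchy_diff z w (x r) * h (restrict x {..<r})) \<omega>"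
proof -
  have 1: "(\<Sum>i<r. cauchy_diff z w (y (s i) \<omega>)) = (\<Sum>i<r. cauchy_diff z w (sample r \<omega> s i))" for s
    by (rule sum.cong) (auto simp: sample_def)
  have 2: "cauchy_diff z w (y (s r) \<omega>) * h (sample r \<omega> (restrict s {..<r}))
     = cauchy_diff z w (sample (Suc r) \<omega> s r) * h (restrict (sample (Suc r) \<omega> s) {..<r})" for s
    unfolding sample_restrict by (simp add: sample_def)
  show ?thesis
    using tuple_step(3)[OF regular_cauchy_summable[OF reg assms(3,4)] weight_bounded_summable[OF h reg]]
    unfolding cauchy_stat_def linear_stat_def 1 2 .
qed

text \<open>The induction needs arbitrary r and h: removing one pair turns h into a function of r
  points (the new index coincides with an old one) and a function of r + 1 points. The two induction
  hypotheses then add up to the recursion for \<open>diff_Psi\<close>. Each real point carries a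
  factor -2 pi \<i> because \<open>kern\<close> is that multiple of the sine kernel, and each pair
  carries a factor -1.\<close>

lemma expectation_cauchy_stats:
  assumes "distinct (flat_pairs ps)" "\<And>u. u \<in> set (flat_pairs ps) \<Longrightarrow> Im u \<noteq> 0" and h: "weight_bounded r h"
  shows "(\<integral>\<omega>. cauchy_stats ps \<omega> * linear_stat r h \<omega> \<partial>M)
     = (- 1) ^ length ps / (- (2 * \<i> * of_real pi)) ^ r
        * (\<integral>x. h x * diff_Psi ps {} (\<lambda>_. 0) r x \<partial>lebesgue_power r)"
  using assms
proof (induction ps arbitrary: r h)
  case Nil
  have "(\<integral>\<omega>. linear_stat r h \<omega> \<partial>M) = (\<integral>x. sine_kernel_corr r x *\<^sub>R h x \<partial>lebesgue_power r)"
  proof (rule linear_stat_integral(3))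
    show "h \<in> borel_measurable (lebesgue_power r)" using Nil.prems by (simp add: weight_bounded_def)
    show "integrable (lebesgue_power r) (\<lambda>x. sine_kernel_corr r x *\<^sub>R h x)"
      using weight_bounded_integrable[OF Nil.prems(3) _ bounded_sine_kernel_corr]
      by (simp add: scaleR_conv_of_real mult.commute)
  qed
  also have "\<dots> = (\<integral>x. 1 / (- (2 * \<i> * of_real pi)) ^ r * (h x * diff_Psi [] {} (\<lambda>_. 0) r x) \<partial>lebesgue_power r)"
    unfolding scaleR_conv_of_real sine_kernel_corr_eq_diff_Psi[where \<zeta>="\<lambda>_. 0"]
    by (intro Bochner_Integration.integral_cong refl) (simp only: divide_inverse mult_ac mult_1)
  finally show ?case unfolding integral_mult_right_zero by simp
next
  case (Cons a ps)
  obtain z w where a: "a = (z, w)" by (cases a)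
  note P = Cons.prems[unfolded a, simplified]
  have zw: "Im z \<noteq> 0" "Im w \<noteq> 0" and dps: "distinct (flat_pairs ps)"
    and nps: "\<And>u. u \<in> set (flat_pairs ps) \<Longrightarrow> Im u \<noteq> 0" using P by auto
  let ?h1 = "\<lambda>x. (\<Sum>i<r. cauchy_diff z w (x i)) * h x"
  let ?h2 = "\<lambda>x. cauchy_diff z w (x r) * h (restrict x {..<r})"
  let ?c = "- (2 * \<i> * of_real pi) :: complex"
  let ?G = "diff_Psi ps {} (\<lambda>_. 0)"
  let ?J = "\<lambda>x. \<integral>t. ?G (Suc r) (x(r := t)) * cauchy_diff z w t \<partial>lborel"
  have wb1: "weight_bounded r ?h1" by (rule weight_bounded_diag[OF P(3) zw])
  have wb2: "weight_bounded (Suc r) ?h2" by (rule weight_bounded_extend[OF P(3) zw])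
  have G: "?G r \<in> borel_measurable (lebesgue_power r)" "bounded_fun (?G r)" for r
    by (rule diff_Psi_measurable, rule bounded_fun_diff_Psi) (use nps in auto)
  have rec: "diff_Psi (a # ps) {} (\<lambda>_. 0) r x = - (\<Sum>i<r. cauchy_diff z w (x i)) * ?G r x
      + 1 / (2 * \<i> * of_real pi) * ?J x" for x
    unfolding a diff_Psi.simps
    by (rule diff_Psi_recursion[THEN conjunct2]) (use P zw nps in auto)
  have "(\<integral>\<omega>. cauchy_stats (a # ps) \<omega> * linear_stat r h \<omega> \<partial>M)
     = (\<integral>\<omega>. cauchy_stats ps \<omega> * linear_stat r ?h1 \<omega> + cauchy_stats ps \<omega> * linear_stat (Suc r) ?h2 \<omega> \<partial>M)"
  proof (rule integral_cong_AE)
    show "AE \<omega> in M. cauchy_stats (a # ps) \<omega> * linear_stat r h \<omega> =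
      cauchy_stats ps \<omega> * linear_stat r ?h1 \<omega> + cauchy_stats ps \<omega> * linear_stat (Suc r) ?h2 \<omega>"
      using AE_regular
    proof eventually_elim
      case (elim \<omega>)
      have "cauchy_stats (a # ps) \<omega> * linear_stat r h \<omega> = cauchy_stats ps \<omega> * (cauchy_stat z w \<omega> * linear_stat r h \<omega>)"
        by (simp add: a)
      then show ?case unfolding cauchy_stat_times_linear_stat[OF elim P(3) zw] by (simp only: distrib_left)
    qed
    have "h \<in> borel_measurable (lebesgue_power r)" "?h1 \<in> borel_measurable (lebesgue_power r)"
      "?h2 \<in> borel_measurable (lebesgue_power (Suc r))"
      using P(3) wb1 wb2 by (auto simp: weight_bounded_def)
    note m = this[THEN linear_stat_measurable]
    show "(\<lambda>\<omega>. cauchy_stats (a # ps) \<omega> * linear_stat r h \<omega>) \<in> borel_measurable M"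
      by (intro borel_measurable_times cauchy_stats_measurable m(1))
    show "(\<lambda>\<omega>. cauchy_stats ps \<omega> * linear_stat r ?h1 \<omega> + cauchy_stats ps \<omega> * linear_stat (Suc r) ?h2 \<omega>) \<in> borel_measurable M"
      by (intro borel_measurable_add borel_measurable_times cauchy_stats_measurable m)
  qed
  also have "\<dots> = (\<integral>\<omega>. cauchy_stats ps \<omega> * linear_stat r ?h1 \<omega> \<partial>M) + (\<integral>\<omega>. cauchy_stats ps \<omega> * linear_stat (Suc r) ?h2 \<omega> \<partial>M)"
    by (rule Bochner_Integration.integral_add) (rule cauchy_stats_integrable; use nps wb1 wb2 in auto)+
  also have "\<dots> = (- 1) ^ length ps / ?c ^ r * (\<integral>x. ?h1 x * ?G r x \<partial>lebesgue_power r)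
     + (- 1) ^ length ps / ?c ^ Suc r * (\<integral>x. ?h2 x * ?G (Suc r) x \<partial>lebesgue_power (Suc r))"
    by (rule arg_cong2[where f="(+)", OF Cons.IH[OF dps nps wb1] Cons.IH[OF dps nps wb2]])
  also have "(\<integral>x. ?h2 x * ?G (Suc r) x \<partial>lebesgue_power (Suc r)) = (\<integral>x. h x * ?J x \<partial>lebesgue_power r)"
  proof -
    \<comment> \<open>The last coordinate, the position of the newly sampled point, is integrated
      first; h depends on the other coordinates only.\<close>
    have int2: "integrable (Pi\<^sub>M (insert r {..<r}) (\<lambda>_. lborel)) (\<lambda>x. ?h2 x * ?G (Suc r) x)"
      using weight_bounded_integrable[OF wb2 G] unfolding lessThan_Suc .
    have "(\<integral>x. ?h2 x * ?G (Suc r) x \<partial>lebesgue_power (Suc r))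
      = (\<integral>x. \<integral>t. ?h2 (x(r := t)) * ?G (Suc r) (x(r := t)) \<partial>lborel \<partial>lebesgue_power r)"
      unfolding lessThan_Suc by (rule lebesgue_product.product_integral_insert[OF _ _ int2]) auto
    also have "\<dots> = (\<integral>x. h x * ?J x \<partial>lebesgue_power r)"
    proof (rule Bochner_Integration.integral_cong[OF refl])
      fix x :: "nat \<Rightarrow> real" assume "x \<in> space (lebesgue_power r)"
      then have res: "restrict (x(r := t)) {..<r} = x" for t
        by (auto simp: space_PiM PiE_def extensional_def fun_eq_iff restrict_def)
      have "?h2 (x(r := t)) * ?G (Suc r) (x(r := t)) = h x * (?G (Suc r) (x(r := t)) * cauchy_diff z w t)" for t
        unfolding res by simp
      then show "(\<integral>t. ?h2 (x(r := t)) * ?G (Suc r) (x(r := t)) \<partial>lborel) = h x * ?J x"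
        by (simp only: integral_mult_right_zero)
    qed
    finally show ?thesis .
  qed
  also have "(- 1) ^ length ps / ?c ^ r * (\<integral>x. ?h1 x * ?G r x \<partial>lebesgue_power r)
     + (- 1) ^ length ps / ?c ^ Suc r * (\<integral>x. h x * ?J x \<partial>lebesgue_power r)
    = (- 1) ^ length (a # ps) / ?c ^ r * (\<integral>x. h x * diff_Psi (a # ps) {} (\<lambda>_. 0) r x \<partial>lebesgue_power r)"
  proof -
    \<comment> \<open>The recursion expresses \<open>?J\<close> through two bounded functions, so
      integrability of its product with h is read off without estimating the inner integral.\<close>
    have Jint: "integrable (lebesgue_power r) (\<lambda>x. h x * ?J x)"
    proof -
      have "h x * ?J x = (2 * \<i> * of_real pi) * (h x * diff_Psi (a # ps) {} (\<lambda>_. 0) r x + ?h1 x * ?G r x)" for x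
        unfolding rec by (simp only: distrib_left mult_minus_left mult_minus_right mult.assoc) (simp add: mult_ac)
      moreover have "integrable (lebesgue_power r) (\<lambda>x. h x * diff_Psi (a # ps) {} (\<lambda>_. 0) r x)"
        by (rule weight_bounded_integrable[OF P(3) diff_Psi_measurable bounded_fun_diff_Psi]) (use P in \<open>auto simp: a\<close>)
      ultimately show ?thesis
        using weight_bounded_integrable[OF wb1 G]
        by (simp only:) (intro integrable_mult_right Bochner_Integration.integrable_add; simp)
    qed
    have int1: "integrable (lebesgue_power r) (\<lambda>x. ?h1 x * ?G r x)" by (rule weight_bounded_integrable[OF wb1 G])
    have "h x * diff_Psi (a # ps) {} (\<lambda>_. 0) r x = (- 1) * (?h1 x * ?G r x) + 1 / (2 * \<i> * of_real pi) * (h x * ?J x)" for x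
      unfolding rec by (simp only: distrib_left mult_minus_left mult_minus_right mult.assoc mult_1) (simp only: mult.left_commute)
    then have "(\<integral>x. h x * diff_Psi (a # ps) {} (\<lambda>_. 0) r x \<partial>lebesgue_power r)
      = (\<integral>x. (- 1) * (?h1 x * ?G r x) + 1 / (2 * \<i> * of_real pi) * (h x * ?J x) \<partial>lebesgue_power r)"
      by (simp only:)
    also have "\<dots> = (- 1) * (\<integral>x. ?h1 x * ?G r x \<partial>lebesgue_power r) + 1 / (2 * \<i> * of_real pi) * (\<integral>x. h x * ?J x \<partial>lebesgue_power r)"
      by (subst Bochner_Integration.integral_add) (use Jint int1 in \<open>auto simp only: integrable_mult_right integral_mult_right_zero\<close>)
    finally have R: "(\<integral>x. h x * diff_Psi (a # ps) {} (\<lambda>_. 0) r x \<partial>lebesgue_power r)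
      = (- 1) * (\<integral>x. ?h1 x * ?G r x \<partial>lebesgue_power r) + 1 / (2 * \<i> * of_real pi) * (\<integral>x. h x * ?J x \<partial>lebesgue_power r)" .
    \<comment> \<open>With c = -2 pi \<i>, the extra power of 1 / c from the additional point is, up
      to the sign of the removed pair, the prefactor 1 / (2 pi \<i>) of the Cauchy integral.\<close>
    have alg: "s / c ^ r * A + s / c ^ Suc r * B = - s / c ^ r * ((- 1) * A + 1 / (- c) * B)" if "c \<noteq> 0" for s c A B :: complex
      using that by (simp add: field_simps)
    show ?thesis unfolding R using alg[of ?c "(- 1) ^ length ps"] by simp
  qed
  finally show ?case .
qed

text \<open>The case of the empty tuple and h = 1: all points of the process are integrated out, and
  the remaining integral is over a one-point space.\<close>

lemma expectation_cauchy_stats_0: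
  assumes "distinct (flat_pairs ps)" "\<And>u. u \<in> set (flat_pairs ps) \<Longrightarrow> Im u \<noteq> 0"
  shows "integrable M (cauchy_stats ps)"
    and "(\<integral>\<omega>. cauchy_stats ps \<omega> \<partial>M) = (- 1) ^ length ps * diff_Psi ps {} (\<lambda>_. 0) 0 (\<lambda>_. undefined)"
proof -
  have wb: "weight_bounded 0 (\<lambda>_. 1)" by (auto simp: weight_bounded_def weight_prod_def intro!: exI[of _ 1])
  have L: "linear_stat 0 (\<lambda>_. 1 :: complex) \<omega> = 1" for \<omega>
    by (simp add: linear_stat_def)
  show "integrable M (cauchy_stats ps)"
    using cauchy_stats_integrable[OF assms(2) wb] by (simp add: L)
  have "(\<integral>x. diff_Psi ps {} (\<lambda>_. 0) 0 x \<partial>lebesgue_power 0) = diff_Psi ps {} (\<lambda>_. 0) 0 (\<lambda>_. undefined)"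
    by (simp add: PiM_empty lebesgue_integral_count_space_finite del: diff_Psi.simps)
  then show "(\<integral>\<omega>. cauchy_stats ps \<omega> \<partial>M) = (- 1) ^ length ps * diff_Psi ps {} (\<lambda>_. 0) 0 (\<lambda>_. undefined)"
    using expectation_cauchy_stats[OF assms wb] by (simp add: L)
qed

end

section \<open>The logarithmic derivative of the product\<close>

definition xi_factor :: "(int \<Rightarrow> real) \<Rightarrow> nat \<Rightarrow> complex \<Rightarrow> complex" where
  "xi_factor u k z = (1 - z / of_real (u (int k + 1))) * (1 - z / of_real (u (- (int k + 1))))"

lemma logderiv_linear_pair:
  fixes z a b :: complex
  assumes "a \<noteq> 0" "b \<noteq> 0" "z \<noteq> a" "z \<noteq> b"
  shows "deriv (\<lambda>z. (1 - z / a) * (1 - z / b)) z / ((1 - z / a) * (1 - z / b)) = 1 / (z - a) + 1 / (z - b)"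
proof -
  have "deriv (\<lambda>z. (1 - z / a) * (1 - z / b)) z = - (1 / a) * (1 - z / b) + (1 - z / a) * - (1 / b)"
    by (rule DERIV_imp_deriv) (auto intro!: derivative_eq_intros simp: assms)
  moreover have e: "1 - z / a = - ((z - a) / a)" "1 - z / b = - ((z - b) / b)"
    using assms by (simp_all add: field_simps)
  moreover have "z - a \<noteq> 0" "z - b \<noteq> 0" using assms by auto
  ultimately show ?thesis unfolding e using assms(1,2)
    by (simp add: divide_simps)
qed

text \<open>With s = 1/a + 1/b a paired factor is 1 - x s + x^2 / (a b). So R |s| + R^2 (1/a^2 +
  1/b^2) majorises its distance from 1 on the disc of radius R, and the reciprocals enter only in
  paired form. Locally uniform convergence then allows termwise logarithmic differentiation.\<close>

lemma xi_product_logderiv: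
  fixes u :: "int \<Rightarrow> real"
  assumes nz: "\<And>k. u k \<noteq> 0"
    and s1: "summable (\<lambda>k. \<bar>1 / u (int k + 1) + 1 / u (- (int k + 1))\<bar>)"
    and s2: "summable (\<lambda>k. 1 / (u (int k + 1))\<^sup>2)" "summable (\<lambda>k. 1 / (u (- (int k + 1)))\<^sup>2)"
    and z: "Im z \<noteq> 0"
  shows "xi_product u z \<noteq> 0"
    and "(\<lambda>k. 1 / (z - of_real (u (int k + 1))) + 1 / (z - of_real (u (- (int k + 1)))))
      sums (deriv (xi_product u) z / xi_product u z - \<i> * of_real pi - 1 / (z - of_real (u 0)))"
proof -
  define s where "s k = 1 / u (int k + 1) + 1 / u (- (int k + 1))" for k
  define M where "M R k = R * \<bar>s k\<bar> + R\<^sup>2 * (1 / (u (int k + 1))\<^sup>2 + 1 / (u (- (int k + 1)))\<^sup>2)" for R k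
  have sM: "summable (M R)" for R
    unfolding M_def s_def using s1 s2 by (intro summable_add summable_mult)
  have bound: "norm (xi_factor u k x - 1) \<le> M R k" if "norm x \<le> R" for x R k
  proof -
    let ?a = "u (int k + 1)" and ?b = "u (- (int k + 1))"
    have R: "R \<ge> 0" using that norm_ge_zero order_trans by blast
    have "xi_factor u k x - 1 = - (x * of_real (s k)) + x\<^sup>2 * of_real (1 / (?a * ?b))"
      by (simp add: xi_factor_def s_def power2_eq_square algebra_simps)
    then have "norm (xi_factor u k x - 1) \<le> norm x * \<bar>s k\<bar> + (norm x)\<^sup>2 * \<bar>1 / (?a * ?b)\<bar>"
      using norm_triangle_ineq[of "- (x * of_real (s k))" "x\<^sup>2 * of_real (1 / (?a * ?b))"]
      by (simp only: norm_minus_cancel norm_mult norm_of_real norm_power)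
    moreover have ab: "\<bar>1 / (?a * ?b)\<bar> \<le> 1 / ?a\<^sup>2 + 1 / ?b\<^sup>2"
    proof -
      have "2 * \<bar>1 / ?a\<bar> * \<bar>1 / ?b\<bar> \<le> \<bar>1 / ?a\<bar>\<^sup>2 + \<bar>1 / ?b\<bar>\<^sup>2" by (rule sum_squares_bound)
      moreover have "\<bar>1 / ?a\<bar> * \<bar>1 / ?b\<bar> \<ge> 0" by simp
      ultimately have "\<bar>1 / ?a\<bar> * \<bar>1 / ?b\<bar> \<le> \<bar>1 / ?a\<bar>\<^sup>2 + \<bar>1 / ?b\<bar>\<^sup>2" by linarith
      also have "\<dots> = 1 / ?a\<^sup>2 + 1 / ?b\<^sup>2" by (simp add: power_divide)
      finally show ?thesis by (simp add: abs_mult)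
    qed
    moreover have "norm x * \<bar>s k\<bar> \<le> R * \<bar>s k\<bar>" using that by (intro mult_right_mono) auto
    moreover have "(norm x)\<^sup>2 * \<bar>1 / (?a * ?b)\<bar> \<le> R\<^sup>2 * (1 / ?a\<^sup>2 + 1 / ?b\<^sup>2)"
      using that by (intro mult_mono[OF _ ab] power_mono) auto
    ultimately show ?thesis unfolding M_def by linarith
  qed
  have conv: "convergent_prod (\<lambda>k. xi_factor u k x)" for x
    by (intro abs_convergent_prod_imp_convergent_prod summable_imp_abs_convergent_prod
        summable_comparison_test'[OF sM[of "norm x"], of 0]) (use bound[of x "norm x"] in auto)
  define P where "P x = (\<Prod>k. xi_factor u k x)" for x
  have lim: "(\<lambda>n. \<Prod>k<n. xi_factor u k x) \<longlonglongrightarrow> P x" for x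
  proof -
    have "(\<lambda>n. \<Prod>k<Suc n. xi_factor u k x) \<longlonglongrightarrow> P x"
      using convergent_prod_LIMSEQ[OF conv] unfolding P_def lessThan_Suc_atMost .
    then show ?thesis by (rule LIMSEQ_imp_Suc)
  qed
  have cont: "continuous_on A (xi_factor u k)" for A k
    unfolding xi_factor_def by (intro continuous_intros) (auto simp: nz)
  have holo: "xi_factor u k holomorphic_on A" for A k
    unfolding xi_factor_def by (intro holomorphic_intros) (auto simp: nz)
  have unif: "uniform_limit (cball 0 R) (\<lambda>n x. \<Prod>k<n. xi_factor u k x) P sequentially" for R
  proof -
    have "uniformly_convergent_on (cball 0 R) (\<lambda>N x. \<Sum>n<N. norm (xi_factor u n x - 1))"
      by (rule Weierstrass_m_test'[OF _ sM[of R]]) (use bound in auto)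
    then have "uniformly_convergent_on (cball 0 R) (\<lambda>N x. \<Prod>n<N. xi_factor u n x)"
      by (intro Infinite_Products.uniformly_convergent_on_prod' cont) auto
    then obtain l where l: "uniform_limit (cball 0 R) (\<lambda>N x. \<Prod>n<N. xi_factor u n x) l sequentially"
      unfolding uniformly_convergent_on_def by blast
    have "l x = P x" if "x \<in> cball 0 R" for x
      using LIMSEQ_unique[OF tendsto_uniform_limitI[OF l that] lim] .
    then show ?thesis using l by (subst uniform_limit_cong'[OF refl]) auto
  qed
  define R where "R = norm z + 1"
  have zb: "z \<in> ball 0 R" by (simp add: R_def)
  have "P holomorphic_on ball 0 R"
  proof (rule holomorphic_uniform_sequence)
    show "(\<lambda>x. \<Prod>k<n. xi_factor u k x) holomorphic_on ball 0 R" for n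
      by (intro holomorphic_intros holo)
    fix x assume "x \<in> ball (0::complex) R"
    then obtain d where "d > 0" "cball x d \<subseteq> ball 0 R"
      using open_contains_cball[of "ball (0::complex) R"] by (metis open_ball)
    moreover have "ball (0::complex) R \<subseteq> cball 0 R" by auto
    ultimately show "\<exists>d>0. cball x d \<subseteq> ball 0 R \<and> uniform_limit (cball x d) (\<lambda>n x. \<Prod>k<n. xi_factor u k x) P sequentially"
      using uniform_limit_on_subset[OF unif[of R], of "cball x d"] by blast
  qed simp
  then have dP: "(P has_field_derivative deriv P z) (at z)"
    using zb by (intro holomorphic_derivI[of _ "ball 0 R"]) auto
  have zr: "z \<noteq> of_real r" for r using z by auto
  have lin: "1 - z / of_real r \<noteq> 0" if "r \<noteq> 0" for r
    using zr[of r] that by (auto simp: divide_simps)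
  have fnz: "xi_factor u k z \<noteq> 0" for k
    using lin nz by (auto simp: xi_factor_def)
  have Pnz: "P z \<noteq> 0" unfolding P_def by (rule prodinf_nonzero[OF conv fnz])
  have "(\<lambda>k. deriv (xi_factor u k) z / xi_factor u k z) sums (deriv P z / P z)"
    by (rule logderiv_prodinf_complex_uniform_limit[OF uniform_limit_on_subset[OF unif[of R]] holo Pnz, of "ball 0 R"])
       (use zb in auto)
  moreover have "deriv (xi_factor u k) z / xi_factor u k z
      = 1 / (z - of_real (u (int k + 1))) + 1 / (z - of_real (u (- (int k + 1))))" for k
    unfolding xi_factor_def[abs_def] by (rule logderiv_linear_pair) (use nz zr in auto)
  ultimately have sums: "(\<lambda>k. 1 / (z - of_real (u (int k + 1))) + 1 / (z - of_real (u (- (int k + 1))))) sums (deriv P z / P z)"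
    by simp
  have xi: "xi_product u = (\<lambda>x. exp (\<i> * of_real pi * x) * (1 - x / of_real (u 0)) * P x)"
    by (simp add: fun_eq_iff xi_product_def P_def xi_factor_def)
  have l0: "1 - z / of_real (u 0) \<noteq> 0" by (rule lin[OF nz])
  show nzx: "xi_product u z \<noteq> 0" unfolding xi using l0 Pnz by simp
  have "deriv (xi_product u) z = exp (\<i> * of_real pi * z) *
     (\<i> * of_real pi * (1 - z / of_real (u 0)) * P z - 1 / of_real (u 0) * P z + (1 - z / of_real (u 0)) * deriv P z)"
  proof -
    have 1: "((\<lambda>x. exp (\<i> * of_real pi * x)) has_field_derivative exp (\<i> * of_real pi * z) * (\<i> * of_real pi)) (at z)"
      by (auto intro!: derivative_eq_intros)
    have 2: "((\<lambda>x. 1 - x / of_real (u 0)) has_field_derivative - (1 / of_real (u 0))) (at z)"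
      by (auto intro!: derivative_eq_intros simp: nz)
    show ?thesis
      unfolding xi by (rule DERIV_imp_deriv, rule DERIV_cong[OF DERIV_mult[OF DERIV_mult[OF 1 2] dP]])
        (simp add: algebra_simps)
  qed
  then have "deriv (xi_product u) z / xi_product u z
      = (\<i> * of_real pi * (1 - z / of_real (u 0)) * P z - 1 / of_real (u 0) * P z + (1 - z / of_real (u 0)) * deriv P z)
        / ((1 - z / of_real (u 0)) * P z)"
    unfolding xi by simp
  also have "\<dots> = \<i> * of_real pi - 1 / of_real (u 0) / (1 - z / of_real (u 0)) + deriv P z / P z"
  proof -
    have "(A * b * p - c * p + b * D) / (b * p) = A - c / b + D / p" if "b \<noteq> 0" "p \<noteq> 0" for A b c D p :: complex
      using that by (simp add: field_simps)
    from this[OF l0 Pnz] show ?thesis .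
  qed
  also have "1 / of_real (u 0) / (1 - z / of_real (u 0)) = - (1 / (z - of_real (u 0)))"
  proof -
    have "of_real (u 0) * (1 - z / of_real (u 0)) = - (z - of_real (u 0))" using nz[of 0] by (simp add: field_simps)
    then show ?thesis by (simp only: divide_divide_eq_left minus_divide_right)
  qed
  finally show "(\<lambda>k. 1 / (z - of_real (u (int k + 1))) + 1 / (z - of_real (u (- (int k + 1)))))
      sums (deriv (xi_product u) z / xi_product u z - \<i> * of_real pi - 1 / (z - of_real (u 0)))"
    using sums by simp
qed

lemma infsetsum_int_split:
  fixes f :: "int \<Rightarrow> 'b :: {banach, second_countable_topology}"
  assumes f: "Infinite_Set_Sum.abs_summable_on f UNIV"
  shows "infsetsum f UNIV = f 0 + (\<Sum>k. f (int k + 1) + f (- (int k + 1)))"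
    and "summable (\<lambda>k. norm (f (int k + 1)))" "summable (\<lambda>k. norm (f (- (int k + 1))))"
proof -
  let ?p = "\<lambda>k. int k + 1" and ?n = "\<lambda>k. - (int k + 1)"
  have ip: "inj ?p" and inn: "inj ?n" by (auto simp: inj_def)
  have P: "Infinite_Set_Sum.abs_summable_on f (range ?p)" and N: "Infinite_Set_Sum.abs_summable_on f (range ?n)"
    by (rule abs_summable_on_subset[OF f]; simp)+
  have P': "Infinite_Set_Sum.abs_summable_on (\<lambda>k. f (?p k)) UNIV"
    using P abs_summable_on_reindex_iff[OF ip, of f] by simp
  have N': "Infinite_Set_Sum.abs_summable_on (\<lambda>k. f (?n k)) UNIV"
    using N abs_summable_on_reindex_iff[OF inn, of f] by simp
  show sp: "summable (\<lambda>k. norm (f (?p k)))" and sn: "summable (\<lambda>k. norm (f (?n k)))"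
    using P' N' by (simp_all add: abs_summable_on_nat_iff')
  have U: "(UNIV :: int set) = {0} \<union> (range ?p \<union> range ?n)"
  proof -
    have "i \<in> range ?p" if "i > 0" for i by (rule image_eqI[of _ _ "nat (i - 1)"]) (use that in auto)
    moreover have "i \<in> range ?n" if "i < 0" for i by (rule image_eqI[of _ _ "nat (- i - 1)"]) (use that in auto)
    ultimately have "i \<in> {0} \<union> (range ?p \<union> range ?n)" for i
      using linorder_less_linear[of i 0] by blast
    then show ?thesis by (intro equalityI subsetI UNIV_I)
  qed
  have "infsetsum f UNIV = infsetsum f {0} + (infsetsum f (range ?p) + infsetsum f (range ?n))"
  proof -
    have "?p a \<noteq> ?n b" "?p a \<noteq> 0" "?n b \<noteq> 0" for a b by linarith+
    then have d: "range ?p \<inter> range ?n = {}" "{0} \<inter> (range ?p \<union> range ?n) = {}" by (blast, force)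
    have "infsetsum f UNIV = infsetsum f ({0} \<union> (range ?p \<union> range ?n))" by (rule arg_cong[OF U])
    also have "\<dots> = infsetsum f {0} + infsetsum f (range ?p \<union> range ?n)"
      by (rule infsetsum_Un_disjoint[OF _ abs_summable_on_union[OF P N] d(2)]) simp
    also have "infsetsum f (range ?p \<union> range ?n) = infsetsum f (range ?p) + infsetsum f (range ?n)"
      by (rule infsetsum_Un_disjoint[OF P N d(1)])
    finally show ?thesis .
  qed
  also have "infsetsum f (range ?p) = (\<Sum>k. f (?p k))"
    by (subst infsetsum_reindex[OF ip]) (rule infsetsum_nat'[OF P'])
  also have "infsetsum f (range ?n) = (\<Sum>k. f (?n k))"
    by (subst infsetsum_reindex[OF inn]) (rule infsetsum_nat'[OF N'])
  also have "(\<Sum>k. f (?p k)) + (\<Sum>k. f (?n k)) = (\<Sum>k. f (?p k) + f (?n k))"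
    by (rule suminf_add) (use sp sn in \<open>auto intro: summable_norm_cancel\<close>)
  finally show "infsetsum f UNIV = f 0 + (\<Sum>k. f (?p k) + f (?n k))" by simp
qed

text \<open>The derivative in x of 1 / (\<i> T - \<sigma> x) has modulus 1 / (T^2 + x^2). The
  half-open interval is chosen so that sums of such indicators over k count points exactly.\<close>

lemma cauchy_value_difference_le:
  assumes "T > 0" "a \<le> b" "\<sigma> = 1 \<or> \<sigma> = - 1"
  shows "ennreal (norm (1 / (\<i> * of_real T - of_real (\<sigma> * a)) - 1 / (\<i> * of_real T - of_real (\<sigma> * b))))
    \<le> (\<integral>\<^sup>+x. ennreal (1 / (T\<^sup>2 + x\<^sup>2)) * indicator {a..<b} x \<partial>lborel)"
proof (cases "a = b")
  case False
  then have ab: "a < b" using assms by simp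
  let ?f = "\<lambda>x. 1 / (\<i> * of_real T - of_real (\<sigma> * x))" and ?F = "\<lambda>x. arctan (x / T) / T"
  have nz: "\<i> * of_real T - of_real (\<sigma> * x) \<noteq> 0" for x using assms(1) by (auto simp: complex_eq_iff)
  have nrm: "(norm (\<i> * of_real T - of_real (\<sigma> * x)))\<^sup>2 = T\<^sup>2 + x\<^sup>2" for x
    using assms(3) by (auto simp: cmod_def)
  have pos: "T\<^sup>2 + x\<^sup>2 > 0" for x using assms(1) by (simp add: add_pos_nonneg)
  have F: "(?F has_real_derivative 1 / (T\<^sup>2 + x\<^sup>2)) (at x)" for x
  proof -
    have "T * T * (1 + (x / T)\<^sup>2) = T\<^sup>2 + x\<^sup>2"
      using assms(1) by (simp add: power_divide distrib_left power2_eq_square)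
    then have "inverse (1 + (x / T)\<^sup>2) * (1 / T) / T = 1 / (T\<^sup>2 + x\<^sup>2)"
      by (simp add: inverse_eq_divide mult_ac)
    moreover have "(?F has_real_derivative inverse (1 + (x / T)\<^sup>2) * (1 / T) / T) (at x)"
      by (intro DERIV_cdivide DERIV_chain2[OF DERIV_arctan] DERIV_cdivide DERIV_ident)
    ultimately show ?thesis by simp
  qed
  have f: "(?f has_vector_derivative of_real \<sigma> / (\<i> * of_real T - of_real (\<sigma> * x))\<^sup>2) (at x)" for x
  proof -
    have "((\<lambda>u. 1 / (\<i> * of_real T - of_real \<sigma> * u)) has_field_derivative of_real \<sigma> / (\<i> * of_real T - of_real \<sigma> * of_real x)\<^sup>2) (at (of_real x))"
      using nz[of x] by (auto intro!: derivative_eq_intros simp: power2_eq_square)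
    from has_vector_derivative_real_field[OF this] show ?thesis by simp
  qed
  have "norm (?f b - ?f a) \<le> ?F b - ?F a"
  proof (rule differentiable_bound_general[OF ab])
    show "continuous_on {a..b} ?f" by (intro continuous_intros) (use nz in auto)
    show "continuous_on {a..b} ?F" using assms(1) by (intro continuous_intros) auto
    show "(?f has_vector_derivative of_real \<sigma> / (\<i> * of_real T - of_real (\<sigma> * x))\<^sup>2) (at x)" for x by (rule f)
    show "(?F has_vector_derivative 1 / (T\<^sup>2 + x\<^sup>2)) (at x)" for x
      using F by (simp add: has_real_derivative_iff_has_vector_derivative)
    show "norm (of_real \<sigma> / (\<i> * of_real T - of_real (\<sigma> * x))\<^sup>2) \<le> 1 / (T\<^sup>2 + x\<^sup>2)" for x
    proof -
      have "norm (of_real \<sigma> :: complex) = 1" using assms(3) by auto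
      then show ?thesis unfolding norm_divide norm_power nrm by simp
    qed
  qed
  then have "ennreal (norm (?f a - ?f b)) \<le> ennreal (?F b - ?F a)"
    by (simp add: norm_minus_commute ennreal_leI)
  also have "\<dots> = (\<integral>\<^sup>+x. ennreal (1 / (T\<^sup>2 + x\<^sup>2)) * indicator {a..b} x \<partial>lborel)"
    by (rule nn_integral_FTC_Icc[symmetric]) (use F pos assms in \<open>auto intro: less_imp_le has_field_derivative_at_within\<close>)
  also have "\<dots> = (\<integral>\<^sup>+x. ennreal (1 / (T\<^sup>2 + x\<^sup>2)) * indicator {a..<b} x \<partial>lborel)"
    by (rule nn_integral_cong_AE) (use AE_lborel_singleton[of b] in eventually_elim, auto simp: indicator_def)
  finally show ?thesis .
qed simp

text \<open>Comparison with 4 (T + x)^(-3/2): \<open>sqrt x + 1\<close> is at most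
  \<open>2 * sqrt (T + x)\<close>, as T is at least 1, and (T + x)^2 is at most 2 (T^2 + x^2). An
  antiderivative is \<open>- 8 / sqrt (T + x)\<close>, whence the 8.\<close>

lemma sqrt_weight_integral:
  assumes "T \<ge> 1"
  shows "(\<integral>\<^sup>+x. ennreal ((sqrt x + 1) / (T\<^sup>2 + x\<^sup>2)) * indicator {0..} x \<partial>lborel) \<le> ennreal (8 / sqrt T)"
proof -
  let ?F = "\<lambda>x. - 8 / sqrt (T + x)" and ?g = "\<lambda>x. 4 / ((T + x) * sqrt (T + x))"
  have "ennreal ((sqrt x + 1) / (T\<^sup>2 + x\<^sup>2)) * indicator {0..} x \<le> ennreal (?g x) * indicator {0..} x" for x
  proof (cases "x \<ge> 0")
    case True
    have p: "T + x > 0" "T\<^sup>2 + x\<^sup>2 > 0" using assms True by (auto intro: add_pos_nonneg)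
    have "sqrt x \<le> sqrt (T + x)" "1 \<le> sqrt (T + x)" using assms True by auto
    then have 1: "sqrt x + 1 \<le> 2 * sqrt (T + x)" by linarith
    have "0 \<le> (T - x)\<^sup>2" by simp
    then have 2: "(T + x) * (T + x) \<le> 2 * (T\<^sup>2 + x\<^sup>2)" by (simp add: power2_eq_square algebra_simps)
    have "(sqrt x + 1) * ((T + x) * sqrt (T + x)) \<le> (2 * sqrt (T + x)) * ((T + x) * sqrt (T + x))"
      using 1 p by (intro mult_right_mono) auto
    also have "\<dots> = 2 * ((T + x) * (T + x))" using p by simp
    also have "\<dots> \<le> 4 * (T\<^sup>2 + x\<^sup>2)" using 2 by simp
    finally have "(sqrt x + 1) / (T\<^sup>2 + x\<^sup>2) \<le> ?g x" using p by (simp add: divide_simps mult.commute)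
    then show ?thesis by (auto intro!: mult_right_mono ennreal_leI)
  qed simp
  then have "(\<integral>\<^sup>+x. ennreal ((sqrt x + 1) / (T\<^sup>2 + x\<^sup>2)) * indicator {0..} x \<partial>lborel)
     \<le> (\<integral>\<^sup>+x. ennreal (?g x) * indicator {0..} x \<partial>lborel)" by (rule nn_integral_mono)
  also have "\<dots> = ennreal (0 - ?F 0)"
  proof (rule nn_integral_FTC_atLeast)
    fix x :: real assume "0 \<le> x"
    then have p: "T + x > 0" using assms by simp
    show "(?F has_real_derivative ?g x) (at x)"
      using p by (auto intro!: derivative_eq_intros simp: field_simps)
    show "0 \<le> ?g x" using p by simp
  next
    have "filterlim (\<lambda>x. sqrt (T + x)) at_top at_top"
      by (intro filterlim_compose[OF sqrt_at_top] filterlim_tendsto_add_at_top[OF tendsto_const filterlim_ident])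
    then show "(?F \<longlongrightarrow> 0) at_top" by (intro tendsto_divide_0[OF tendsto_const] filterlim_at_top_imp_at_infinity)
  qed simp
  finally show ?thesis by simp
qed

text \<open>Lower and upper Riemann sums of T / (T^2 + x^2) enclose pi / 2, the total increase of
  arctan(x / T). They differ by the term at 0, which is 1 / T; doubling gives the bound.\<close>

lemma lattice_cauchy_sum_bound:
  assumes T: "T > 0"
  shows "summable (\<lambda>k. 2 * T / (T\<^sup>2 + (real k + 1)\<^sup>2))"
    and "\<bar>pi - (\<Sum>k. 2 * T / (T\<^sup>2 + (real k + 1)\<^sup>2))\<bar> \<le> 2 / T"
proof -
  let ?a = "\<lambda>k. T / (T\<^sup>2 + (real k + 1)\<^sup>2)" and ?b = "\<lambda>k. T / (T\<^sup>2 + (real k)\<^sup>2)"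
  let ?d = "\<lambda>k. arctan (real (Suc k) / T) - arctan (real k / T)"
  have pos: "T\<^sup>2 + x\<^sup>2 > 0" for x using T by (simp add: add_pos_nonneg)
  have D: "((\<lambda>x. arctan (x / T)) has_real_derivative T / (T\<^sup>2 + x\<^sup>2)) (at x)" for x
  proof -
    have "T * T * (1 + (x / T)\<^sup>2) = T\<^sup>2 + x\<^sup>2"
      using T by (simp add: power_divide distrib_left power2_eq_square)
    moreover have "T / (T * T * (1 + (x / T)\<^sup>2)) = inverse (1 + (x / T)\<^sup>2) * (1 / T)"
      using T by (simp add: inverse_eq_divide)
    ultimately have "inverse (1 + (x / T)\<^sup>2) * (1 / T) = T / (T\<^sup>2 + x\<^sup>2)" by simp
    moreover have "((\<lambda>x. arctan (x / T)) has_real_derivative inverse (1 + (x / T)\<^sup>2) * (1 / T)) (at x)"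
      by (intro DERIV_chain2[OF DERIV_arctan] DERIV_cdivide DERIV_ident)
    ultimately show ?thesis by simp
  qed
  have mvt: "?a k \<le> ?d k \<and> ?d k \<le> ?b k" for k
  proof -
    obtain \<xi> where \<xi>: "real k < \<xi>" "\<xi> < real (Suc k)" "?d k = (real (Suc k) - real k) * (T / (T\<^sup>2 + \<xi>\<^sup>2))"
      using MVT2[of "real k" "real (Suc k)" "\<lambda>x. arctan (x / T)" "\<lambda>x. T / (T\<^sup>2 + x\<^sup>2)"] D by auto
    have "(real k)\<^sup>2 \<le> \<xi>\<^sup>2" "\<xi>\<^sup>2 \<le> (real k + 1)\<^sup>2" using \<xi> by (auto intro!: power_mono)
    then show ?thesis unfolding \<xi>(3) using T pos by (auto intro!: divide_left_mono mult_pos_pos)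
  qed
  have dsums: "?d sums (pi / 2 - arctan (real 0 / T))"
  proof (rule telescope_sums)
    have "filterlim (\<lambda>n. real n / T) at_top sequentially"
      using T by (intro filterlim_at_top_mult_tendsto_pos[where c="1 / T", OF tendsto_const, of _ , simplified]) (auto intro: filterlim_real_sequentially)
    then show "(\<lambda>n. arctan (real n / T)) \<longlonglongrightarrow> pi / 2"
      by (rule filterlim_compose[OF tendsto_arctan_at_top])
  qed
  have sa: "summable ?a"
    by (rule summable_comparison_test'[OF sums_summable[OF dsums], of 0]) (use mvt T pos in \<open>auto simp: abs_of_pos less_imp_le\<close>)
  have sb: "summable ?b" using sa summable_Suc_iff[of ?b] by (simp add: add.commute)
  have "suminf ?a \<le> pi / 2"
    using suminf_le[OF _ sa sums_summable[OF dsums]] mvt sums_unique[OF dsums] by simp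
  moreover have "pi / 2 \<le> suminf ?b"
    using suminf_le[OF _ sums_summable[OF dsums] sb] mvt sums_unique[OF dsums] by simp
  moreover have "suminf ?b = 1 / T + suminf ?a"
    using suminf_split_head[OF sb] T by (simp add: add.commute power2_eq_square)
  moreover have "2 / T = 2 * (1 / T)" by simp
  moreover have "(\<Sum>k. 2 * T / (T\<^sup>2 + (real k + 1)\<^sup>2)) = 2 * suminf ?a"
    using suminf_mult[OF sa, of 2] by simp
  ultimately show "\<bar>pi - (\<Sum>k. 2 * T / (T\<^sup>2 + (real k + 1)\<^sup>2))\<bar> \<le> 2 / T" by linarith
  show "summable (\<lambda>k. 2 * T / (T\<^sup>2 + (real k + 1)\<^sup>2))" using summable_mult[OF sa, of 2] by simp
qed

section \<open>Number variance and distance to the integer lattice\<close>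

lemma sine_kernel_corr_1: "sine_kernel_corr 1 x = 1"
proof -
  have "{0..<1} = {0 :: nat}" by auto
  then show ?thesis
    unfolding sine_kernel_corr_def by (subst det_def'[of _ 1]) (simp_all add: permutes_sing)
qed

lemma det_2x2:
  "Determinant.det (mat 2 2 f) = f (0, 0) * f (1, 1) - f (0, 1) * (f (1, 0) :: real)"
proof -
  have s: "{0..<2} = insert 0 {1 :: nat}" by auto
  show ?thesis
    by (subst det_def'[of _ 2], simp, unfold s, subst sum_over_permutations_insert)
       (simp_all add: permutes_sing sign_swap_id)
qed

text \<open>The determinant is 1 minus the square of a sinc value: the points repel each
  other.\<close>

lemma sine_kernel_corr_2_le: "sine_kernel_corr 2 x \<le> 1"
proof -
  have "Determinant.det (mat 2 2 (\<lambda>(i, j). sinc (pi * (x i - x j)))) =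
     sinc (pi * (x 0 - x 0)) * sinc (pi * (x 1 - x 1)) - sinc (pi * (x 0 - x 1)) * sinc (pi * (x 1 - x 0))"
    unfolding det_2x2 by simp
  also have "sinc (pi * (x 1 - x 0)) = sinc (pi * (x 0 - x 1))"
  proof -
    have "pi * (x 1 - x 0) = - (pi * (x 0 - x 1))" by (simp add: algebra_simps)
    then show ?thesis by (simp only:) simp
  qed
  finally show ?thesis by (simp add: sine_kernel_corr_def)
qed

text \<open>For increasing v, \<open>v k \<le> x\<close> means k < n and
  \<open>real k + 1 \<le> x\<close> means k < m, with m the integer part of x. So x separates
  \<open>v k\<close> from \<open>k + 1\<close> exactly for the k between n and m: displacement
  becomes counting discrepancy.\<close>

lemma suminf_indicator_sublevel:
  fixes v :: "nat \<Rightarrow> real"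
  assumes mono: "strict_mono v" and fin: "finite {k. v k \<le> x}" and x: "x \<ge> 0"
  shows "summable (\<lambda>k. if v k \<le> x then 1 else 0 :: real)"
    and "(\<Sum>k. indicator {min (v k) (real k + 1)..<max (v k) (real k + 1)} x :: ennreal)
      = ennreal \<bar>(\<Sum>k. if v k \<le> x then 1 else 0) - real (nat \<lfloor>x\<rfloor>)\<bar>"
proof -
  obtain k0 where "k0 \<notin> {k. v k \<le> x}" using fin by (meson ex_new_if_finite infinite_UNIV_nat)
  then have ex: "v k0 > x" by simp
  define n where "n = (LEAST k. v k > x)"
  have nx: "v n > x" unfolding n_def by (rule LeastI[of _ k0]) fact
  have vk: "v k \<le> x \<longleftrightarrow> k < n" for k
  proof
    assume "k < n"
    then show "v k \<le> x" unfolding n_def using not_less_Least by fastforce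
  next
    assume "v k \<le> x"
    then have "v k < v n" using nx by linarith
    then show "k < n" using mono by (simp add: strict_mono_less)
  qed
  define m where "m = nat \<lfloor>x\<rfloor>"
  have km: "real k + 1 \<le> x \<longleftrightarrow> k < m" for k using x unfolding m_def by linarith
  show "summable (\<lambda>k. if v k \<le> x then 1 else 0 :: real)"
    unfolding vk by (rule summable_finite[of "{..<n}"]) auto
  have S: "(\<Sum>k. if v k \<le> x then 1 else 0 :: real) = real n"
    unfolding vk by (subst suminf_finite[of "{..<n}"]) auto
  have "(indicator {min (v k) (real k + 1)..<max (v k) (real k + 1)} x :: ennreal) = (if k \<in> {min n m..<max n m} then 1 else 0)" for k
    using vk[of k] km[of k] by (auto simp: indicator_def min_def max_def split: if_splits)
  then have "(\<Sum>k. indicator {min (v k) (real k + 1)..<max (v k) (real k + 1)} x :: ennreal)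
     = (\<Sum>k\<in>{min n m..<max n m}. 1)"
    by (subst suminf_finite[of "{min n m..<max n m}"]) auto
  also have "\<dots> = ennreal (real (max n m - min n m))" by (simp add: ennreal_of_nat_eq_real_of_nat)
  also have "real (max n m - min n m) = \<bar>real n - real m\<bar>" by (auto simp: max_def min_def of_nat_diff)
  finally show "(\<Sum>k. indicator {min (v k) (real k + 1)..<max (v k) (real k + 1)} x :: ennreal)
      = ennreal \<bar>(\<Sum>k. if v k \<le> x then 1 else 0) - real (nat \<lfloor>x\<rfloor>)\<bar>" unfolding S m_def .
qed

text \<open>A point in (0, x] has weight at least 1 / (1 + x^2), and the terms of a convergent
  series tend to 0.\<close>

lemma finite_sublevel_of_summable_weight:
  fixes v :: "nat \<Rightarrow> real"
  assumes "summable (\<lambda>k. cauchy_weight (v k))" "\<And>k. v k > 0"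
  shows "finite {k. v k \<le> x}"
proof -
  have "eventually (\<lambda>k. cauchy_weight (v k) < 1 / (1 + x\<^sup>2)) sequentially"
    using order_tendstoD(2)[OF summable_LIMSEQ_zero[OF assms(1)], of "1 / (1 + x\<^sup>2)"] by (simp add: add_pos_nonneg)
  then obtain N where N: "\<And>k. k \<ge> N \<Longrightarrow> cauchy_weight (v k) < 1 / (1 + x\<^sup>2)"
    by (auto simp: eventually_sequentially)
  have "{k. v k \<le> x} \<subseteq> {..<N}"
  proof
    fix k assume "k \<in> {k. v k \<le> x}"
    then have "v k \<le> x" by simp
    then have "(v k)\<^sup>2 \<le> x\<^sup>2" using assms(2)[of k] by (intro power_mono) auto
    then have "1 / (1 + x\<^sup>2) \<le> cauchy_weight (v k)"
      unfolding cauchy_weight_def by (intro divide_left_mono) (auto simp: add_pos_nonneg)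
    then show "k \<in> {..<N}" using N[of k] by (cases "k \<ge> N") auto
  qed
  then show ?thesis using finite_subset by blast
qed

context sine_process
begin

definition point_count :: "real set \<Rightarrow> 'a \<Rightarrow> real" where
  "point_count B \<omega> = infsetsum (\<lambda>m. indicat_real B (y m \<omega>)) UNIV"

lemma point_count_measurable: "B \<in> sets borel \<Longrightarrow> point_count B \<in> borel_measurable M"
  unfolding point_count_def by (intro infsetsum_measurable) auto

lemma regular_indicator_summable:
  assumes "regular \<omega>" "B \<subseteq> {-R..R}"
  shows "Infinite_Set_Sum.abs_summable_on (\<lambda>m. indicat_real B (y m \<omega>)) UNIV"
proof (rule abs_summable_on_comparison_test'[OF abs_summable_on_cmult_right[OF assms(1)[unfolded regular_def], of "1 + R\<^sup>2"]])
  fix m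
  show "norm (indicat_real B (y m \<omega>)) \<le> (1 + R\<^sup>2) * cauchy_weight (y m \<omega>)"
  proof (cases "y m \<omega> \<in> B")
    case True
    then have "y m \<omega> \<in> {-R..R}" using assms(2) by blast
    then have "\<bar>y m \<omega>\<bar> \<le> R" by (simp add: abs_le_iff)
    then have "(y m \<omega>)\<^sup>2 \<le> R\<^sup>2" by (metis abs_ge_zero power2_abs power_mono)
    then show ?thesis using True by (simp add: cauchy_weight_def divide_simps add_pos_nonneg)
  next
    case False
    then show ?thesis using cauchy_weight_pos[of "y m \<omega>"] by (simp add: less_imp_le)
  qed
qed

text \<open>The squared count is the count plus the number of ordered pairs of distinct points. As
  the two-point function is at most 1, that number has mean at most x^2, so the variance does not
  exceed the mean.\<close>

lemma point_count_variance:
  assumes [measurable]: "B \<in> sets borel" and B: "B \<subseteq> {-R..R}" and x: "emeasure lborel B = ennreal x" "x \<ge> 0"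
  shows "integrable M (\<lambda>\<omega>. (point_count B \<omega> - x)\<^sup>2)" "(\<integral>\<omega>. (point_count B \<omega> - x)\<^sup>2 \<partial>M) \<le> x"
proof -
  let ?b = "indicat_real B"
  let ?h1 = "\<lambda>p :: nat \<Rightarrow> real. ?b (p 0)" and ?h2 = "\<lambda>p :: nat \<Rightarrow> real. ?b (p 1) * ?b (p 0)"
  have mB: "measure lborel B = x" "integrable lborel ?b" "(\<integral>t. ?b t \<partial>lborel) = x"
    using x by (auto simp: measure_def integrable_indicator_iff)
  have h1m: "?h1 \<in> borel_measurable (lebesgue_power 1)"
    by (rule measurable_compose[OF component_measurable]) auto
  have h2m: "?h2 \<in> borel_measurable (lebesgue_power 2)"
    by (intro borel_measurable_times measurable_compose[OF component_measurable, of _ _ ?b]) auto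
  have L1: "lebesgue_power 1 = Pi\<^sub>M {0} (\<lambda>_. lborel)" by (simp add: lessThan_Suc)
  have i1: "(\<integral>p. ?h1 p \<partial>lebesgue_power 1) = x"
    unfolding L1 by (subst lebesgue_product.product_integral_singleton) (use mB in auto)
  have h2p: "?h2 p = (\<Prod>i<2. ?b (p i))" for p by (simp add: numeral_2_eq_2 lessThan_Suc)
  have int2: "integrable (lebesgue_power 2) ?h2"
    unfolding h2p by (rule lebesgue_product.product_integrable_prod) (use mB in auto)
  have i2: "(\<integral>p. ?h2 p \<partial>lebesgue_power 2) = x\<^sup>2"
    unfolding h2p by (subst lebesgue_product.product_integral_prod) (use mB in auto)
  have int1: "integrable (lebesgue_power 1) ?h1"
    using lebesgue_product.product_integrable_prod[of "{0}" "\<lambda>_. ?b"] mB unfolding L1 by simp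
  have c1: "integrable (lebesgue_power 1) (\<lambda>p. sine_kernel_corr 1 p *\<^sub>R ?h1 p)"
    using int1 unfolding sine_kernel_corr_1 by simp
  have c2: "integrable (lebesgue_power 2) (\<lambda>p. sine_kernel_corr 2 p *\<^sub>R ?h2 p)"
  proof (rule Bochner_Integration.integrable_bound[OF int2])
    show "(\<lambda>p. sine_kernel_corr 2 p *\<^sub>R ?h2 p) \<in> borel_measurable (lebesgue_power 2)"
      using h2m by measurable
    show "AE p in lebesgue_power 2. norm (sine_kernel_corr 2 p *\<^sub>R ?h2 p) \<le> norm (?h2 p)"
      using sine_kernel_corr_2_le sine_kernel_corr_nonneg by (intro AE_I2) (auto simp: indicator_def)
  qed
  note l1 = linear_stat_integral[OF h1m c1] and l2 = linear_stat_integral[OF h2m c2]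
  have e1: "(\<integral>\<omega>. linear_stat 1 ?h1 \<omega> \<partial>M) = x"
    unfolding l1(3) sine_kernel_corr_1 using i1 by simp
  have e2: "(\<integral>\<omega>. linear_stat 2 ?h2 \<omega> \<partial>M) \<le> x\<^sup>2"
    unfolding l2(3) i2[symmetric]
    by (rule integral_mono[OF c2 int2]) (use sine_kernel_corr_2_le sine_kernel_corr_nonneg in \<open>auto simp: indicator_def\<close>)
  have ae: "AE \<omega> in M. (point_count B \<omega> - x)\<^sup>2 = linear_stat 2 ?h2 \<omega> + (1 - 2 * x) * linear_stat 1 ?h1 \<omega> + x\<^sup>2"
    using AE_regular
  proof eventually_elim
    case (elim \<omega>)
    note b = regular_indicator_summable[OF elim B]
    have H0: "Infinite_Set_Sum.abs_summable_on (\<lambda>_. 1 :: real) (tuples 0)" by simp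
    have s1: "point_count B \<omega> = linear_stat 1 ?h1 \<omega>"
      using tuple_step(3)[OF b H0] by (simp add: point_count_def linear_stat_def sample_def)
    have H1: "Infinite_Set_Sum.abs_summable_on (\<lambda>s. ?h1 (sample 1 \<omega> s)) (tuples 1)"
      using tuple_step(1)[OF b H0] by (simp add: sample_def)
    \<comment> \<open>The new index either equals the old one, where the squared indicator is the
      indicator, or forms an ordered pair with it.\<close>
    have "point_count B \<omega> * linear_stat 1 ?h1 \<omega> = linear_stat 1 ?h1 \<omega> + linear_stat 2 ?h2 \<omega>"
    proof -
      have 1: "(\<Sum>i<1. ?b (y (s i) \<omega>)) * ?h1 (sample 1 \<omega> s) = ?h1 (sample 1 \<omega> s)" for s
        by (simp add: sample_def indicator_def)
      have 2: "?b (y (s 1) \<omega>) * ?h1 (sample 1 \<omega> (restrict s {..<1})) = ?h2 (sample 2 \<omega> s)" for s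
        by (simp add: sample_def)
      have "Suc 1 = 2" by simp
      then show ?thesis
        using tuple_step(3)[OF b H1] unfolding 1 2 point_count_def linear_stat_def by (simp only:)
    qed
    then show ?case unfolding s1 by (simp add: power2_eq_square algebra_simps)
  qed
  have int: "integrable M (\<lambda>\<omega>. linear_stat 2 ?h2 \<omega> + (1 - 2 * x) * linear_stat 1 ?h1 \<omega> + x\<^sup>2)"
    by (intro Bochner_Integration.integrable_add integrable_mult_right l1(2) l2(2)) auto
  have meas: "(\<lambda>\<omega>. (point_count B \<omega> - x)\<^sup>2) \<in> borel_measurable M"
    using point_count_measurable[OF assms(1)] by measurable
  show "integrable M (\<lambda>\<omega>. (point_count B \<omega> - x)\<^sup>2)"
    by (rule integrable_cong_AE_imp[OF int meas]) (use ae in \<open>auto elim: eventually_mono\<close>)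
  have "(\<integral>\<omega>. (point_count B \<omega> - x)\<^sup>2 \<partial>M) = (\<integral>\<omega>. linear_stat 2 ?h2 \<omega> + (1 - 2 * x) * linear_stat 1 ?h1 \<omega> + x\<^sup>2 \<partial>M)"
    by (rule integral_cong_AE[OF meas _ ae]) (use int in auto)
  also have "\<dots> = (\<integral>\<omega>. linear_stat 2 ?h2 \<omega> \<partial>M) + (1 - 2 * x) * (\<integral>\<omega>. linear_stat 1 ?h1 \<omega> \<partial>M) + x\<^sup>2"
    using l1(2) l2(2) by (simp add: prob_space)
  also have "\<dots> \<le> x\<^sup>2 + (1 - 2 * x) * x + x\<^sup>2" using e1 e2 by simp
  also have "\<dots> = x" by (simp add: power2_eq_square algebra_simps)
  finally show "(\<integral>\<omega>. (point_count B \<omega> - x)\<^sup>2 \<partial>M) \<le> x" .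
qed

text \<open>Pointwise |t| is at most (t^2 / sqrt x + sqrt x) / 2; after integration both halves
  contribute at most sqrt x / 2.\<close>

lemma point_count_mean_deviation:
  assumes [measurable]: "B \<in> sets borel" and B: "B \<subseteq> {-R..R}" and x: "emeasure lborel B = ennreal x" "x > 0"
  shows "(\<integral>\<^sup>+\<omega>. ennreal \<bar>point_count B \<omega> - x\<bar> \<partial>M) \<le> ennreal (sqrt x)"
proof -
  note V = point_count_variance[OF assms(1) B x(1) less_imp_le[OF x(2)]]
  have s: "sqrt x > 0" using x by simp
  have "\<bar>t\<bar> \<le> (t\<^sup>2 / sqrt x + sqrt x) / 2" for t
  proof -
    have "2 * \<bar>t\<bar> * sqrt x \<le> \<bar>t\<bar>\<^sup>2 + (sqrt x)\<^sup>2" by (rule sum_squares_bound)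
    then show ?thesis using s by (simp add: field_simps power2_eq_square)
  qed
  then have "(\<integral>\<^sup>+\<omega>. ennreal \<bar>point_count B \<omega> - x\<bar> \<partial>M)
      \<le> (\<integral>\<^sup>+\<omega>. ennreal (((point_count B \<omega> - x)\<^sup>2 / sqrt x + sqrt x) / 2) \<partial>M)"
    by (intro nn_integral_mono ennreal_leI)
  also have "\<dots> = ennreal (\<integral>\<omega>. ((point_count B \<omega> - x)\<^sup>2 / sqrt x + sqrt x) / 2 \<partial>M)"
    by (rule nn_integral_eq_integral) (use V(1) s in \<open>auto intro!: AE_I2 divide_nonneg_nonneg add_nonneg_nonneg\<close>)
  also have "(\<integral>\<omega>. ((point_count B \<omega> - x)\<^sup>2 / sqrt x + sqrt x) / 2 \<partial>M)
     = ((\<integral>\<omega>. (point_count B \<omega> - x)\<^sup>2 \<partial>M) / sqrt x + sqrt x) / 2"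
    using V(1) by (simp add: prob_space)
  also have "ennreal \<dots> \<le> ennreal (sqrt x)"
  proof (rule ennreal_leI)
    have "(\<integral>\<omega>. (point_count B \<omega> - x)\<^sup>2 \<partial>M) / sqrt x \<le> x / sqrt x" using V(2) s by (simp add: divide_right_mono)
    also have "x / sqrt x = sqrt x" using x by (simp add: real_div_sqrt)
    finally show "((\<integral>\<omega>. (point_count B \<omega> - x)\<^sup>2 \<partial>M) / sqrt x + sqrt x) / 2 \<le> sqrt x" by simp
  qed
  finally show ?thesis .
qed

definition ordered :: "'a \<Rightarrow> bool" where
  "ordered \<omega> \<longleftrightarrow> strict_mono (\<lambda>k. y k \<omega>) \<and> y 0 \<omega> < 0 \<and> 0 < y 1 \<omega>"

lemma AE_ordered: "AE \<omega> in M. ordered \<omega>"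
  using sine by (simp add: sine_kernel_process_def ordered_def)

definition pos_point :: "nat \<Rightarrow> 'a \<Rightarrow> real" where "pos_point k \<omega> = y (int k + 1) \<omega>"

text \<open>The negative points are reflected and numbered from \<open>y 0\<close> on, so that both
  sides are compared with the same lattice k + 1. The pairing in \<open>xi_product\<close> is
  shifted by one against this numbering.\<close>

definition neg_point :: "nat \<Rightarrow> 'a \<Rightarrow> real" where "neg_point k \<omega> = - y (- int k) \<omega>"

lemma side_points_measurable [measurable]:
  "pos_point k \<in> borel_measurable M" "neg_point k \<in> borel_measurable M"
  unfolding pos_point_def neg_point_def by measurable

lemma side_points_ordered:
  assumes "ordered \<omega>"
  shows "strict_mono (\<lambda>k. pos_point k \<omega>)" "strict_mono (\<lambda>k. neg_point k \<omega>)"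
    "pos_point k \<omega> > 0" "neg_point k \<omega> > 0"
proof -
  have sm: "y i \<omega> < y j \<omega>" if "i < j" for i j
    using assms that by (auto simp: ordered_def strict_mono_def)
  show "strict_mono (\<lambda>k. pos_point k \<omega>)" "strict_mono (\<lambda>k. neg_point k \<omega>)"
    by (auto simp: strict_mono_def pos_point_def neg_point_def intro: sm)
  have "y 1 \<omega> \<le> y (int k + 1) \<omega>" using sm[of 1 "int k + 1"] by (cases "k = 0") auto
  then show "pos_point k \<omega> > 0" using assms by (simp add: ordered_def pos_point_def)
  have "y (- int k) \<omega> \<le> y 0 \<omega>" using sm[of "- int k" 0] by (cases "k = 0") auto
  then show "neg_point k \<omega> > 0" using assms by (simp add: ordered_def neg_point_def)
qed

lemma side_weights_summable:
  assumes "regular \<omega>"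
  shows "summable (\<lambda>k. cauchy_weight (pos_point k \<omega>))" "summable (\<lambda>k. cauchy_weight (neg_point k \<omega>))"
proof -
  have n: "\<bar>cauchy_weight t\<bar> = cauchy_weight t" for t using cauchy_weight_pos[of t] by simp
  have even: "cauchy_weight (- t) = cauchy_weight t" for t by (simp add: cauchy_weight_def)
  note S = infsetsum_int_split(2,3)[OF assms[unfolded regular_def]]
  show "summable (\<lambda>k. cauchy_weight (pos_point k \<omega>))" using S(1) by (simp add: n pos_point_def)
  have "summable (\<lambda>k. cauchy_weight (neg_point (Suc k) \<omega>))"
    using S(2) by (simp add: n neg_point_def even algebra_simps)
  then show "summable (\<lambda>k. cauchy_weight (neg_point k \<omega>))" by (subst (asm) summable_Suc_iff)
qed

lemma point_count_sides:
  assumes "ordered \<omega>" "regular \<omega>" "x \<ge> 0"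
  shows "point_count {0<..x} \<omega> = (\<Sum>k. if pos_point k \<omega> \<le> x then 1 else 0)"
    and "point_count {-x..<0} \<omega> = (\<Sum>k. if neg_point k \<omega> \<le> x then 1 else 0)"
proof -
  note P = side_points_ordered[OF assms(1)]
  have y0: "y 0 \<omega> < 0" using assms(1) by (simp add: ordered_def)
  have pp: "y (int k + 1) \<omega> > 0" for k using P(3)[of k] by (simp add: pos_point_def)
  have nn: "y (- (int k + 1)) \<omega> < 0" for k using P(4)[of "Suc k"] by (simp add: neg_point_def algebra_simps)
  have pos: "Infinite_Set_Sum.abs_summable_on (\<lambda>m. indicat_real {0<..x} (y m \<omega>)) UNIV"
    and neg: "Infinite_Set_Sum.abs_summable_on (\<lambda>m. indicat_real {-x..<0} (y m \<omega>)) UNIV"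
    using assms(3) by (auto intro!: regular_indicator_summable[OF assms(2), of _ x])
  have "indicat_real {0<..x} (y (int k + 1) \<omega>) + indicat_real {0<..x} (y (- (int k + 1)) \<omega>)
     = (if pos_point k \<omega> \<le> x then 1 else 0)" for k
    using pp[of k] nn[of k] by (auto simp: indicator_def pos_point_def)
  then show "point_count {0<..x} \<omega> = (\<Sum>k. if pos_point k \<omega> \<le> x then 1 else 0)"
    unfolding point_count_def infsetsum_int_split(1)[OF pos] using y0 by simp
  have fin: "finite {k. neg_point k \<omega> \<le> x}"
    by (rule finite_sublevel_of_summable_weight[OF side_weights_summable(2)[OF assms(2)] P(4)])
  have "indicat_real {-x..<0} (y (int k + 1) \<omega>) + indicat_real {-x..<0} (y (- (int k + 1)) \<omega>)
     = (if neg_point (Suc k) \<omega> \<le> x then 1 else 0)" for k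
  proof -
    have "neg_point (Suc k) \<omega> = - y (- (int k + 1)) \<omega>" by (simp add: neg_point_def algebra_simps)
    then show ?thesis using pp[of k] nn[of k] by (auto simp: indicator_def)
  qed
  moreover have "indicat_real {-x..<0} (y 0 \<omega>) = (if neg_point 0 \<omega> \<le> x then 1 else 0)"
    using y0 by (auto simp: indicator_def neg_point_def)
  ultimately show "point_count {-x..<0} \<omega> = (\<Sum>k. if neg_point k \<omega> \<le> x then 1 else 0)"
    unfolding point_count_def infsetsum_int_split(1)[OF neg]
    using suminf_split_head[OF suminf_indicator_sublevel(1)[OF P(2) fin assms(3)]] by simp
qed

text \<open>Tonelli moves the sum over k and the expectation inside the integral over x, where they
  form the expected discrepancy between the count and the integer part of x. It is at most sqrt x +
  1, the 1 coming from rounding, so that the total is controlled by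
  \<open>sqrt_weight_integral\<close>.\<close>

lemma side_deviation:
  fixes v :: "nat \<Rightarrow> 'a \<Rightarrow> real"
  assumes [measurable]: "\<And>k. v k \<in> borel_measurable M"
    and good: "AE \<omega> in M. strict_mono (\<lambda>k. v k \<omega>) \<and> (\<forall>k. v k \<omega> > 0) \<and> (\<forall>x. finite {k. v k \<omega> \<le> x})"
    and dev: "\<And>x. x > 0 \<Longrightarrow> (\<integral>\<^sup>+\<omega>. ennreal \<bar>(\<Sum>k. if v k \<omega> \<le> x then 1 else 0) - x\<bar> \<partial>M) \<le> ennreal (sqrt x)"
    and T: "T \<ge> 1" and \<sigma>: "\<sigma> = 1 \<or> \<sigma> = - 1"
  shows "(\<integral>\<^sup>+\<omega>. (\<Sum>k. ennreal (norm (1 / (\<i> * of_real T - of_real (\<sigma> * v k \<omega>)) - 1 / (\<i> * of_real T - of_real (\<sigma> * (real k + 1)))))) \<partial>M)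
     \<le> ennreal (8 / sqrt T)"
proof -
  interpret L: pair_sigma_finite M lborel ..
  let ?w = "\<lambda>x::real. ennreal (1 / (T\<^sup>2 + x\<^sup>2))"
  let ?I = "\<lambda>k \<omega> x. indicator {min (v k \<omega>) (real k + 1)..<max (v k \<omega>) (real k + 1)} x :: ennreal"
  have I: "?I k \<omega> x = (if min (v k \<omega>) (real k + 1) \<le> x \<and> x < max (v k \<omega>) (real k + 1) then 1 else 0)" for k \<omega> x
    by (simp add: indicator_def)
  have [measurable]: "(\<lambda>(\<omega>, x). ?I k \<omega> x) \<in> borel_measurable (M \<Otimes>\<^sub>M borel)" for k
    unfolding I by measurable
  have [measurable]: "(\<lambda>x. ?I k \<omega> x) \<in> borel_measurable borel" for k \<omega>
    unfolding I by measurable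
  have [measurable]: "(\<lambda>\<omega>. ?I k \<omega> x) \<in> borel_measurable M" for k x
    unfolding I by measurable
  have tm: "ennreal (norm (1 / (\<i> * of_real T - of_real (\<sigma> * a)) - 1 / (\<i> * of_real T - of_real (\<sigma> * b))))
    \<le> (\<integral>\<^sup>+x. ?w x * indicator {min a b..<max a b} x \<partial>lborel)" for a b
    using cauchy_value_difference_le[of T a b \<sigma>] cauchy_value_difference_le[of T b a \<sigma>] T \<sigma>
    by (cases "a \<le> b") (auto simp: min_def max_def norm_minus_commute)
  have "(\<integral>\<^sup>+\<omega>. (\<Sum>k. ennreal (norm (1 / (\<i> * of_real T - of_real (\<sigma> * v k \<omega>)) - 1 / (\<i> * of_real T - of_real (\<sigma> * (real k + 1)))))) \<partial>M)
     \<le> (\<integral>\<^sup>+\<omega>. (\<Sum>k. \<integral>\<^sup>+x. ?w x * ?I k \<omega> x \<partial>lborel) \<partial>M)"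
    by (intro nn_integral_mono suminf_le tm) auto
  also have "\<dots> = (\<integral>\<^sup>+\<omega>. \<integral>\<^sup>+x. ?w x * (\<Sum>k. ?I k \<omega> x) \<partial>lborel \<partial>M)"
    by (intro nn_integral_cong) (simp add: nn_integral_suminf[symmetric])
  also have "\<dots> = (\<integral>\<^sup>+x. \<integral>\<^sup>+\<omega>. ?w x * (\<Sum>k. ?I k \<omega> x) \<partial>M \<partial>lborel)"
    by (rule L.Fubini'[symmetric]) simp
  also have "\<dots> \<le> (\<integral>\<^sup>+x. ennreal ((sqrt x + 1) / (T\<^sup>2 + x\<^sup>2)) * indicator {0..} x \<partial>lborel)"
  proof (rule nn_integral_mono_AE)
    show "AE x in lborel. (\<integral>\<^sup>+\<omega>. ?w x * (\<Sum>k. ?I k \<omega> x) \<partial>M) \<le> ennreal ((sqrt x + 1) / (T\<^sup>2 + x\<^sup>2)) * indicator {0..} x"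
      using AE_lborel_singleton[of 0]
    proof eventually_elim
      fix x :: real assume "x \<noteq> 0"
      then consider "x < 0" | "x > 0" by linarith
      then show "(\<integral>\<^sup>+\<omega>. ?w x * (\<Sum>k. ?I k \<omega> x) \<partial>M) \<le> ennreal ((sqrt x + 1) / (T\<^sup>2 + x\<^sup>2)) * indicator {0..} x"
      proof cases
        case 1
        have "AE \<omega> in M. ?w x * (\<Sum>k. ?I k \<omega> x) = 0"
          using good
        proof eventually_elim
          case (elim \<omega>)
          have "x < min (v k \<omega>) (real k + 1)" for k using elim 1 by (auto simp: min_def intro: less_trans)
          then have "\<not> min (v k \<omega>) (real k + 1) \<le> x" for k by (simp only: not_le)
          then have "?I k \<omega> x = 0" for k unfolding I by (simp only: simp_thms if_False)
          then show ?case by simp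
        qed
        then have "(\<integral>\<^sup>+\<omega>. ?w x * (\<Sum>k. ?I k \<omega> x) \<partial>M) = 0" by (subst nn_integral_0_iff_AE) auto
        then show ?thesis by simp
      next
        case 2
        have "(\<integral>\<^sup>+\<omega>. ?w x * (\<Sum>k. ?I k \<omega> x) \<partial>M) = ?w x * (\<integral>\<^sup>+\<omega>. (\<Sum>k. ?I k \<omega> x) \<partial>M)"
          by (rule nn_integral_cmult) measurable
        also have "(\<integral>\<^sup>+\<omega>. (\<Sum>k. ?I k \<omega> x) \<partial>M) \<le> (\<integral>\<^sup>+\<omega>. ennreal \<bar>(\<Sum>k. if v k \<omega> \<le> x then 1 else 0) - x\<bar> + 1 \<partial>M)"
        proof (rule nn_integral_mono_AE)
          show "AE \<omega> in M. (\<Sum>k. ?I k \<omega> x) \<le> ennreal \<bar>(\<Sum>k. if v k \<omega> \<le> x then 1 else 0) - x\<bar> + 1"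
            using good
          proof eventually_elim
            case (elim \<omega>)
            let ?n = "\<Sum>k. if v k \<omega> \<le> x then 1 else 0 :: real"
            have "(\<Sum>k. ?I k \<omega> x) = ennreal \<bar>?n - real (nat \<lfloor>x\<rfloor>)\<bar>"
              using elim 2 by (intro suminf_indicator_sublevel(2)) auto
            also have "\<bar>?n - real (nat \<lfloor>x\<rfloor>)\<bar> \<le> \<bar>?n - x\<bar> + 1"
            proof -
              have "real (nat \<lfloor>x\<rfloor>) \<le> x" "x \<le> real (nat \<lfloor>x\<rfloor>) + 1" using 2 by linarith+
              then show ?thesis by linarith
            qed
            then have "ennreal \<bar>?n - real (nat \<lfloor>x\<rfloor>)\<bar> \<le> ennreal (\<bar>?n - x\<bar> + 1)" by (rule ennreal_leI)
            also have "\<dots> = ennreal \<bar>?n - x\<bar> + 1" by simp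
            finally show ?case .
          qed
        qed
        also have "\<dots> = (\<integral>\<^sup>+\<omega>. ennreal \<bar>(\<Sum>k. if v k \<omega> \<le> x then 1 else 0) - x\<bar> \<partial>M) + 1"
          by (subst nn_integral_add) (auto simp: emeasure_space_1)
        also have "\<dots> \<le> ennreal (sqrt x) + 1" using dev[OF 2] by (intro add_mono) auto
        also have "?w x * (ennreal (sqrt x) + 1) = ennreal ((sqrt x + 1) / (T\<^sup>2 + x\<^sup>2))"
        proof -
          have "ennreal (sqrt x) + 1 = ennreal (sqrt x + 1)" using 2 by simp
          moreover have "?w x * ennreal (sqrt x + 1) = ennreal (1 / (T\<^sup>2 + x\<^sup>2) * (sqrt x + 1))"
            using 2 by (intro ennreal_mult[symmetric]) auto
          ultimately show ?thesis by simp
        qed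
        finally show ?thesis using 2 by (simp add: mult_left_mono)
      qed
    qed
  qed
  also have "\<dots> \<le> ennreal (8 / sqrt T)" by (rule sqrt_weight_integral[OF T])
  finally show ?thesis .
qed

lemma AE_side_points:
  "AE \<omega> in M. strict_mono (\<lambda>k. pos_point k \<omega>) \<and> (\<forall>k. pos_point k \<omega> > 0) \<and> (\<forall>x. finite {k. pos_point k \<omega> \<le> x})"
  "AE \<omega> in M. strict_mono (\<lambda>k. neg_point k \<omega>) \<and> (\<forall>k. neg_point k \<omega> > 0) \<and> (\<forall>x. finite {k. neg_point k \<omega> \<le> x})"
proof -
  have "AE \<omega> in M. regular \<omega> \<and> ordered \<omega>" using AE_regular AE_ordered by eventually_elim simp
  then show "AE \<omega> in M. strict_mono (\<lambda>k. pos_point k \<omega>) \<and> (\<forall>k. pos_point k \<omega> > 0) \<and> (\<forall>x. finite {k. pos_point k \<omega> \<le> x})"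
    "AE \<omega> in M. strict_mono (\<lambda>k. neg_point k \<omega>) \<and> (\<forall>k. neg_point k \<omega> > 0) \<and> (\<forall>x. finite {k. neg_point k \<omega> \<le> x})"
    by (safe elim!: eventually_mono intro!: side_points_ordered finite_sublevel_of_summable_weight side_weights_summable)
qed

lemma side_count_deviation:
  assumes "x > 0"
  shows "(\<integral>\<^sup>+\<omega>. ennreal \<bar>(\<Sum>k. if pos_point k \<omega> \<le> x then 1 else 0) - x\<bar> \<partial>M) \<le> ennreal (sqrt x)"
    "(\<integral>\<^sup>+\<omega>. ennreal \<bar>(\<Sum>k. if neg_point k \<omega> \<le> x then 1 else 0) - x\<bar> \<partial>M) \<le> ennreal (sqrt x)"
proof -
  have "(\<integral>\<^sup>+\<omega>. ennreal \<bar>(\<Sum>k. if pos_point k \<omega> \<le> x then 1 else 0) - x\<bar> \<partial>M)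
     = (\<integral>\<^sup>+\<omega>. ennreal \<bar>point_count {0<..x} \<omega> - x\<bar> \<partial>M)"
    by (rule nn_integral_cong_AE) (use AE_regular AE_ordered in eventually_elim, use assms point_count_sides(1) in auto)
  also have "\<dots> \<le> ennreal (sqrt x)"
    by (rule point_count_mean_deviation[of _ x]) (use assms in auto)
  finally show "(\<integral>\<^sup>+\<omega>. ennreal \<bar>(\<Sum>k. if pos_point k \<omega> \<le> x then 1 else 0) - x\<bar> \<partial>M) \<le> ennreal (sqrt x)" .
  have "(\<integral>\<^sup>+\<omega>. ennreal \<bar>(\<Sum>k. if neg_point k \<omega> \<le> x then 1 else 0) - x\<bar> \<partial>M)
     = (\<integral>\<^sup>+\<omega>. ennreal \<bar>point_count {-x..<0} \<omega> - x\<bar> \<partial>M)"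
    by (rule nn_integral_cong_AE) (use AE_regular AE_ordered in eventually_elim, use assms point_count_sides(2) in auto)
  also have "\<dots> \<le> ennreal (sqrt x)"
    by (rule point_count_mean_deviation[of _ x]) (use assms in auto)
  finally show "(\<integral>\<^sup>+\<omega>. ennreal \<bar>(\<Sum>k. if neg_point k \<omega> \<le> x then 1 else 0) - x\<bar> \<partial>M) \<le> ennreal (sqrt x)" .
qed

definition pos_deviation :: "real \<Rightarrow> 'a \<Rightarrow> nat \<Rightarrow> complex" where
  "pos_deviation T \<omega> k = 1 / (\<i> * of_real T - of_real (pos_point k \<omega>)) - 1 / (\<i> * of_real T - of_real (real k + 1))"

definition neg_deviation :: "real \<Rightarrow> 'a \<Rightarrow> nat \<Rightarrow> complex" where
  "neg_deviation T \<omega> k = 1 / (\<i> * of_real T + of_real (neg_point k \<omega>)) - 1 / (\<i> * of_real T + of_real (real k + 1))"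

lemma deviation_mean:
  assumes "T \<ge> 1"
  shows "(\<integral>\<^sup>+\<omega>. (\<Sum>k. ennreal (norm (pos_deviation T \<omega> k))) \<partial>M) \<le> ennreal (8 / sqrt T)"
    and "(\<integral>\<^sup>+\<omega>. (\<Sum>k. ennreal (norm (neg_deviation T \<omega> k))) \<partial>M) \<le> ennreal (8 / sqrt T)"
proof -
  have p: "pos_deviation T \<omega> k = 1 / (\<i> * of_real T - of_real (1 * pos_point k \<omega>)) - 1 / (\<i> * of_real T - of_real (1 * (real k + 1)))" for \<omega> k
    unfolding pos_deviation_def mult_1 ..
  have n: "neg_deviation T \<omega> k = 1 / (\<i> * of_real T - of_real (- 1 * neg_point k \<omega>)) - 1 / (\<i> * of_real T - of_real (- 1 * (real k + 1)))" for \<omega> k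
    unfolding neg_deviation_def mult_minus1 of_real_minus diff_minus_eq_add ..
  show "(\<integral>\<^sup>+\<omega>. (\<Sum>k. ennreal (norm (pos_deviation T \<omega> k))) \<partial>M) \<le> ennreal (8 / sqrt T)"
    unfolding p by (rule side_deviation[OF _ AE_side_points(1) side_count_deviation(1) assms]) auto
  show "(\<integral>\<^sup>+\<omega>. (\<Sum>k. ennreal (norm (neg_deviation T \<omega> k))) \<partial>M) \<le> ennreal (8 / sqrt T)"
    unfolding n by (rule side_deviation[OF _ AE_side_points(2) side_count_deviation(2) assms]) auto
qed

end

section \<open>Decay of the logarithmic derivative up the imaginary axis\<close>

definition log_xi :: "(int \<Rightarrow> real) \<Rightarrow> complex \<Rightarrow> complex" where
  "log_xi u z = deriv (xi_product u) z / xi_product u z"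

text \<open>The fourth power makes \<open>E |L (\<i> T)| = O(1 / \<surd>T)\<close> summable along \<open>T = escape n j\<close>, hence almost sure convergence;
  the factor in \<open>j\<close> separates the heights.\<close>

definition escape :: "nat \<Rightarrow> nat \<Rightarrow> real" where
  "escape n j = (real n + 1) ^ 4 * (real j + 1)"

lemma escape_ge: "escape n j \<ge> 1" "escape n j \<ge> (real n + 1) ^ 4"
proof -
  have p: "(real n + 1) ^ 4 \<ge> 1" by (rule one_le_power) simp
  have "(real n + 1) ^ 4 * 1 \<le> escape n j" unfolding escape_def by (rule mult_left_mono) (use p in auto)
  then show "escape n j \<ge> (real n + 1) ^ 4" by simp
  then show "escape n j \<ge> 1" using p by linarith
qed

lemma summable_inverse_square_Suc: "summable (\<lambda>k. 1 / (real k + 1)\<^sup>2)"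
proof -
  have "summable (\<lambda>n. inverse (real n ^ 2))" by (rule inverse_power_summable) simp
  then have "summable (\<lambda>n. inverse (real (Suc n) ^ 2))" by (subst summable_Suc_iff)
  then show ?thesis by (simp add: inverse_eq_divide add.commute)
qed

lemma eventually_not_in_finite:
  "finite S \<Longrightarrow> eventually (\<lambda>k::nat. k \<notin> S) sequentially"
  by (simp add: cofinite_eq_sequentially[symmetric] eventually_cofinite)

lemma summable_inverse_square_of_weight:
  fixes v :: "nat \<Rightarrow> real"
  assumes s: "summable (\<lambda>k. cauchy_weight (v k))" and pos: "\<And>k. v k > 0"
  shows "summable (\<lambda>k. 1 / (v k)\<^sup>2)"
proof (rule summable_comparison_test_ev)
  show "summable (\<lambda>k. 2 * cauchy_weight (v k))" by (rule summable_mult[OF s])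
  have "eventually (\<lambda>k. k \<notin> {k. v k \<le> 1}) sequentially"
    by (rule eventually_not_in_finite[OF finite_sublevel_of_summable_weight[OF s pos]])
  then show "eventually (\<lambda>k. norm (1 / (v k)\<^sup>2) \<le> 2 * cauchy_weight (v k)) sequentially"
  proof eventually_elim
    case (elim k)
    then have "1 \<le> (v k)\<^sup>2" by (simp add: one_le_power)
    then show ?case by (simp add: cauchy_weight_def divide_simps add_pos_nonneg)
  qed
qed

text \<open>Up to a term of order 1/t^2 a reciprocal is a Cauchy value at \<i>. So convergence of
  the paired reciprocals follows from the comparison with the lattice at height T = 1.\<close>

lemma inverse_eq_cauchy_value:
  fixes t :: real
  assumes "t \<noteq> 0"
  shows "1 / of_real t = \<i> / ((\<i> - of_real t) * of_real t) - 1 / (\<i> - of_real t :: complex)"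
    and "norm (\<i> / ((\<i> - of_real t) * of_real t)) \<le> 1 / t\<^sup>2"
proof -
  have nz: "\<i> - of_real t \<noteq> 0" by (auto simp: complex_eq_iff)
  show "1 / of_real t = \<i> / ((\<i> - of_real t) * of_real t) - 1 / (\<i> - of_real t :: complex)"
    using nz assms by (simp add: divide_simps)
  have "\<bar>t\<bar> \<le> norm (\<i> - of_real t)" using abs_Re_le_cmod[of "\<i> - of_real t"] by simp
  then have *: "\<bar>t\<bar> * \<bar>t\<bar> \<le> norm (\<i> - of_real t) * \<bar>t\<bar>" by (rule mult_right_mono) simp
  show "norm (\<i> / ((\<i> - of_real t) * of_real t)) \<le> 1 / t\<^sup>2"
  proof -
    have "1 / (norm (\<i> - of_real t) * \<bar>t\<bar>) \<le> 1 / (\<bar>t\<bar> * \<bar>t\<bar>)"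
    proof (rule frac_le)
      show "0 < \<bar>t\<bar> * \<bar>t\<bar>" using assms by (intro mult_pos_pos) auto
    qed (use * in auto)
    then show ?thesis by (simp add: norm_divide norm_mult power2_eq_square)
  qed
qed

lemma regroup_pair_sum:
  fixes x :: complex
  assumes "x = h1 - g1" "x' = h2 - g2"
  shows "x + x' = h1 + h2 - ((g1 - l1) + (g2 - l2) + (l1 + l2))"
  using assms by simp

context sine_process
begin

text \<open>The deviations at the single height 1 suffice as the convergence hypothesis: every
  summability condition of the product is derived from them and from \<open>regular\<close>.\<close>

definition good :: "'a \<Rightarrow> bool" where
  "good \<omega> \<longleftrightarrow> regular \<omega> \<and> ordered \<omega> \<and> summable (\<lambda>k. norm (pos_deviation 1 \<omega> k)) \<and> summable (\<lambda>k. norm (neg_deviation 1 \<omega> k))"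

lemma deviation_measurable [measurable]:
  "(\<lambda>\<omega>. pos_deviation T \<omega> k) \<in> borel_measurable M" "(\<lambda>\<omega>. neg_deviation T \<omega> k) \<in> borel_measurable M"
  unfolding pos_deviation_def neg_deviation_def by measurable

lemma AE_good: "AE \<omega> in M. good \<omega>"
proof -
  have 1: "AE \<omega> in M. (\<Sum>k. ennreal (norm (pos_deviation 1 \<omega> k))) \<noteq> \<infinity>"
  proof (rule nn_integral_PInf_AE)
    show "(\<integral>\<^sup>+\<omega>. (\<Sum>k. ennreal (norm (pos_deviation 1 \<omega> k))) \<partial>M) \<noteq> \<infinity>"
      using le_less_trans[OF deviation_mean(1)[OF order_refl] ennreal_less_top] by (metis infinity_ennreal_def less_irrefl)
  qed measurable
  have 2: "AE \<omega> in M. (\<Sum>k. ennreal (norm (neg_deviation 1 \<omega> k))) \<noteq> \<infinity>"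
  proof (rule nn_integral_PInf_AE)
    show "(\<integral>\<^sup>+\<omega>. (\<Sum>k. ennreal (norm (neg_deviation 1 \<omega> k))) \<partial>M) \<noteq> \<infinity>"
      using le_less_trans[OF deviation_mean(2)[OF order_refl] ennreal_less_top] by (metis infinity_ennreal_def less_irrefl)
  qed measurable
  from AE_regular AE_ordered 1 2 show ?thesis
  proof eventually_elim
    case (elim \<omega>)
    then show ?case unfolding good_def
      by (intro conjI summable_suminf_not_top norm_ge_zero) (simp_all only: infinity_ennreal_def not_False_eq_True)
  qed
qed

text \<open>The paired reciprocals become paired Cauchy values at \<i> with square-summable errors.
  Those values differ from the lattice ones by the deviations, and the lattice pairs themselves are
  of order 1/k^2 by cancellation.\<close>

lemma good_xi_conditions:
  assumes "good \<omega>"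
  shows "\<And>k. y k \<omega> \<noteq> 0"
    and "summable (\<lambda>k. \<bar>1 / y (int k + 1) \<omega> + 1 / y (- (int k + 1)) \<omega>\<bar>)"
    and "summable (\<lambda>k. 1 / (y (int k + 1) \<omega>)\<^sup>2)" "summable (\<lambda>k. 1 / (y (- (int k + 1)) \<omega>)\<^sup>2)"
proof -
  have reg: "regular \<omega>" and ord: "ordered \<omega>" using assms by (auto simp: good_def)
  note P = side_points_ordered[OF ord]
  have p: "y (int k + 1) \<omega> = pos_point k \<omega>" and n: "y (- (int k + 1)) \<omega> = - neg_point (Suc k) \<omega>" for k
    by (simp_all add: pos_point_def neg_point_def algebra_simps)
  show "y k \<omega> \<noteq> 0" for k
  proof (cases "k > 0")
    case True
    then show ?thesis using P(3)[of "nat (k - 1)"] by (simp add: pos_point_def)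
  next
    case False
    then show ?thesis using P(4)[of "nat (- k)"] by (simp add: neg_point_def)
  qed
  have sp: "summable (\<lambda>k. 1 / (pos_point k \<omega>)\<^sup>2)" and sn0: "summable (\<lambda>k. 1 / (neg_point k \<omega>)\<^sup>2)"
    by (rule summable_inverse_square_of_weight[OF _ P(3)] summable_inverse_square_of_weight[OF _ P(4)],
        rule side_weights_summable[OF reg])+
  have sn: "summable (\<lambda>k. 1 / (neg_point (Suc k) \<omega>)\<^sup>2)" using sn0 by (subst summable_Suc_iff)
  show "summable (\<lambda>k. 1 / (y (int k + 1) \<omega>)\<^sup>2)" "summable (\<lambda>k. 1 / (y (- (int k + 1)) \<omega>)\<^sup>2)"
    unfolding p n using sp sn by simp_all
  have dn: "summable (\<lambda>k. norm (neg_deviation 1 \<omega> (Suc k)))"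
    using assms unfolding good_def by (subst summable_Suc_iff) simp
  let ?B = "\<lambda>k. 1 / (pos_point k \<omega>)\<^sup>2 + 1 / (neg_point (Suc k) \<omega>)\<^sup>2 + (norm (pos_deviation 1 \<omega> k)
      + norm (neg_deviation 1 \<omega> (Suc k)) + 3 * (1 / (real k + 1)\<^sup>2))"
  have "summable ?B"
    using assms sp sn dn summable_inverse_square_Suc unfolding good_def by (intro summable_add summable_mult) auto
  then show "summable (\<lambda>k. \<bar>1 / y (int k + 1) \<omega> + 1 / y (- (int k + 1)) \<omega>\<bar>)"
  proof (rule summable_comparison_test'[of _ 0])
    fix k :: nat
    let ?a = "pos_point k \<omega>" and ?b = "- neg_point (Suc k) \<omega>"
    let ?g = "\<lambda>t::real. 1 / (\<i> - of_real t) :: complex" and ?h = "\<lambda>t::real. \<i> / ((\<i> - of_real t) * of_real t) :: complex"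
    have nz: "?a \<noteq> 0" "?b \<noteq> 0" using P(3)[of k] P(4)[of "Suc k"] by auto
    \<comment> \<open>The partner of \<open>pos_point k\<close> is \<open>neg_point (Suc k)\<close>,
      hence the lattice points k + 1 and -(k + 2). The two denominators add up to 2\<i> + 1, of
      modulus at most 3.\<close>
    have lat: "norm (?g (real k + 1) + ?g (- (real k + 2))) \<le> 3 * (1 / (real k + 1)\<^sup>2)"
    proof -
      let ?u = "\<i> - of_real (real k + 1) :: complex" and ?v = "\<i> - of_real (- (real k + 2)) :: complex"
      have nz: "?u \<noteq> 0" "?v \<noteq> 0" by (auto simp: complex_eq_iff)
      have u: "real k + 1 \<le> norm ?u" and v: "real k + 1 \<le> norm ?v"
        using abs_Re_le_cmod[of ?u] abs_Re_le_cmod[of ?v] by auto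
      have "?g (real k + 1) + ?g (- (real k + 2)) = (2 * \<i> + 1) / (?u * ?v)"
        using nz by (simp add: divide_simps)
      then have "norm (?g (real k + 1) + ?g (- (real k + 2))) = norm (2 * \<i> + 1) / (norm ?u * norm ?v)"
        by (simp only: norm_divide norm_mult)
      also have "\<dots> \<le> 3 / ((real k + 1) * (real k + 1))"
      proof (rule frac_le)
        show "norm (2 * \<i> + 1) \<le> 3" using norm_triangle_ineq[of "2 * \<i>" 1] by (simp add: norm_mult)
        show "(real k + 1) * (real k + 1) \<le> norm ?u * norm ?v" by (rule mult_mono[OF u v]) auto
      qed auto
      finally show ?thesis by (simp add: power2_eq_square)
    qed
    have pd: "pos_deviation 1 \<omega> k = ?g ?a - ?g (real k + 1)"
      and nd: "neg_deviation 1 \<omega> (Suc k) = ?g ?b - ?g (- (real k + 2))"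
      by (simp_all add: pos_deviation_def neg_deviation_def algebra_simps)
    have "of_real (1 / ?a + 1 / ?b) = ?h ?a + ?h ?b - (pos_deviation 1 \<omega> k + neg_deviation 1 \<omega> (Suc k) + (?g (real k + 1) + ?g (- (real k + 2))))"
      unfolding pd nd of_real_add of_real_divide of_real_1
      by (rule regroup_pair_sum[OF inverse_eq_cauchy_value(1)[OF nz(1)] inverse_eq_cauchy_value(1)[OF nz(2)]])
    then have "norm (of_real (1 / ?a + 1 / ?b) :: complex) \<le> norm (?h ?a) + norm (?h ?b)
       + (norm (pos_deviation 1 \<omega> k) + norm (neg_deviation 1 \<omega> (Suc k)) + norm (?g (real k + 1) + ?g (- (real k + 2))))"
      by (simp only:) (intro order_trans[OF norm_triangle_ineq4] add_mono norm_triangle_ineq order_trans[OF norm_triangle_ineq] order_refl)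
    also have "\<dots> \<le> ?B k"
      using inverse_eq_cauchy_value(2)[OF nz(1)] inverse_eq_cauchy_value(2)[OF nz(2)] lat
      by (intro add_mono order_refl) (simp_all only: power2_minus)
    finally show "norm \<bar>1 / y (int k + 1) \<omega> + 1 / y (- (int k + 1)) \<omega>\<bar> \<le> ?B k"
      unfolding p n norm_of_real by simp
  qed
qed

lemma log_xi_sums:
  assumes "good \<omega>" "Im z \<noteq> 0"
  shows "(\<lambda>k. 1 / (z - of_real (y (int k + 1) \<omega>)) + 1 / (z - of_real (y (- (int k + 1)) \<omega>)))
      sums (log_xi (\<lambda>k. y k \<omega>) z - \<i> * of_real pi - 1 / (z - of_real (y 0 \<omega>)))"
  unfolding log_xi_def
  by (rule xi_product_logderiv(2)[of "\<lambda>k. y k \<omega>"]) (use good_xi_conditions[OF assms(1)] assms(2) in auto)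

lemma log_xi_diff:
  assumes "good \<omega>" "Im z \<noteq> 0" "Im w \<noteq> 0"
  shows "log_xi (\<lambda>k. y k \<omega>) z - log_xi (\<lambda>k. y k \<omega>) w = cauchy_stat z w \<omega>"
proof -
  have reg: "regular \<omega>" using assms(1) by (simp add: good_def)
  let ?f = "\<lambda>m. cauchy_diff z w (y m \<omega>)"
  have "(\<lambda>k. ?f (int k + 1) + ?f (- (int k + 1))) sums
    (log_xi (\<lambda>k. y k \<omega>) z - \<i> * of_real pi - 1 / (z - of_real (y 0 \<omega>)) - (log_xi (\<lambda>k. y k \<omega>) w - \<i> * of_real pi - 1 / (w - of_real (y 0 \<omega>))))"
    using sums_diff[OF log_xi_sums[OF assms(1,2)] log_xi_sums[OF assms(1,3)]]
    by (simp add: cauchy_diff_def algebra_simps)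
  note S = sums_unique[OF this, symmetric]
  have alg: "A - B = (a - b) + (A - c - a - (B - c - b))" for A B a b c :: complex by simp
  show ?thesis
    unfolding cauchy_stat_def infsetsum_int_split(1)[OF regular_cauchy_summable[OF reg assms(2,3)]] S
    by (subst cauchy_diff_def) (rule alg)
qed

text \<open>The factor exp(\<i> pi z) contributes \<i> pi and the lattice contributes -\<i> S with S
  within 2 / T of pi; only this defect and the deviations of the points from the lattice remain. If
  a deviation sum is infinite the bound is trivial.\<close>

lemma log_xi_imaginary_axis_bound:
  assumes "good \<omega>" and T: "T \<ge> 1"
  shows "ennreal (norm (log_xi (\<lambda>k. y k \<omega>) (\<i> * of_real T)))
    \<le> ennreal (2 / T) + (\<Sum>k. ennreal (norm (pos_deviation T \<omega> k))) + (\<Sum>k. ennreal (norm (neg_deviation T \<omega> k)))"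
proof (cases "(\<Sum>k. ennreal (norm (pos_deviation T \<omega> k))) = \<top> \<or> (\<Sum>k. ennreal (norm (neg_deviation T \<omega> k))) = \<top>")
  case False
  then have sp: "summable (\<lambda>k. norm (pos_deviation T \<omega> k))" and sn: "summable (\<lambda>k. norm (neg_deviation T \<omega> k))"
    by (auto intro!: summable_suminf_not_top)
  have reg: "regular \<omega>" and ord: "ordered \<omega>" using assms by (auto simp: good_def)
  note P = side_points_ordered[OF ord]
  let ?z = "\<i> * of_real T :: complex" and ?X = "log_xi (\<lambda>k. y k \<omega>) (\<i> * of_real T)"
  let ?p = "\<lambda>k. 1 / (?z - of_real (pos_point k \<omega>))" and ?n = "\<lambda>k. 1 / (?z + of_real (neg_point k \<omega>))"
  have p: "y (int k + 1) \<omega> = pos_point k \<omega>" and n: "y (- (int k + 1)) \<omega> = - neg_point (Suc k) \<omega>" for k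
    by (simp_all add: pos_point_def neg_point_def algebra_simps)
  have y0: "y 0 \<omega> = - neg_point 0 \<omega>" by (simp add: neg_point_def)
  have "(\<lambda>k. ?p k + ?n (Suc k)) sums (?X - \<i> * of_real pi - ?n 0)"
    using log_xi_sums[OF assms(1), of ?z] T unfolding p n y0 by simp
  then have l1: "(\<lambda>N. \<Sum>k<N. ?p k + ?n (Suc k)) \<longlonglongrightarrow> ?X - \<i> * of_real pi - ?n 0" by (simp add: sums_def)
  have n0: "?n \<longlonglongrightarrow> 0"
  proof (rule Lim_null_comparison)
    have "(\<lambda>k. sqrt (1 / (neg_point k \<omega>)\<^sup>2)) \<longlonglongrightarrow> sqrt 0"
      by (intro tendsto_real_sqrt summable_LIMSEQ_zero summable_inverse_square_of_weight[OF side_weights_summable(2)[OF reg] P(4)])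
    then show "(\<lambda>k. 1 / neg_point k \<omega>) \<longlonglongrightarrow> 0" using P(4) by (simp add: real_sqrt_divide abs_of_pos)
    show "\<forall>\<^sub>F k in sequentially. norm (?n k) \<le> 1 / neg_point k \<omega>"
    proof (rule always_eventually, rule allI)
      fix k
      have "neg_point k \<omega> \<le> norm (?z + of_real (neg_point k \<omega>))"
        using abs_Re_le_cmod[of "?z + of_real (neg_point k \<omega>)"] P(4)[of k] by simp
      then show "norm (?n k) \<le> 1 / neg_point k \<omega>" using P(4)[of k] by (simp add: norm_divide frac_le)
    qed
  qed
  \<comment> \<open>Undoes the shift by one in the pairing: the partner \<open>?n (Suc k)\<close> is
    replaced by \<open>?n k\<close> at the cost of a boundary term \<open>?n N\<close> that tends to
    0.\<close>
  have "(\<Sum>k<N. ?p k + ?n k) = (\<Sum>k<N. ?p k + ?n (Suc k)) + ?n 0 - ?n N" for N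
    by (induction N) (simp_all add: algebra_simps)
  moreover have "(\<lambda>N. (\<Sum>k<N. ?p k + ?n (Suc k)) + ?n 0 - ?n N) \<longlonglongrightarrow> (?X - \<i> * of_real pi - ?n 0) + ?n 0 - 0"
    by (intro tendsto_add tendsto_diff l1 n0 tendsto_const)
  ultimately have s1: "(\<lambda>k. ?p k + ?n k) sums (?X - \<i> * of_real pi)" by (simp add: sums_def)
  define S where "S = (\<Sum>k. 2 * T / (T\<^sup>2 + (real k + 1)\<^sup>2))"
  \<comment> \<open>The same sum with every point replaced by its lattice companion; terms k + 1 and
    -(k + 1) combine.\<close>
  have "(\<lambda>k. - \<i> * of_real (2 * T / (T\<^sup>2 + (real k + 1)\<^sup>2))) sums (- \<i> * of_real S)"
    unfolding S_def using T by (intro sums_mult sums_of_real summable_sums lattice_cauchy_sum_bound(1)) auto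
  moreover have "- \<i> * of_real (2 * T / (T\<^sup>2 + (real k + 1)\<^sup>2)) = 1 / (?z - of_real (real k + 1)) + 1 / (?z + of_real (real k + 1))" for k
  proof -
    let ?c = "of_real (real k + 1) :: complex"
    have nz: "?z - ?c \<noteq> 0" "?z + ?c \<noteq> 0" using T by (auto simp: complex_eq_iff)
    have "(?z - ?c) * (?z + ?c) = - of_real (T\<^sup>2 + (real k + 1)\<^sup>2)"
      by (simp add: complex_eq_iff power2_eq_square algebra_simps)
    moreover have "1 / (?z - ?c) + 1 / (?z + ?c) = 2 * ?z / ((?z - ?c) * (?z + ?c))"
      using nz by (simp add: divide_simps)
    moreover have "2 * ?z / (- of_real D) = - \<i> * of_real (2 * T / D)" for D :: real by simp
    ultimately show ?thesis by (simp only:)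
  qed
  ultimately have s2: "(\<lambda>k. 1 / (?z - of_real (real k + 1)) + 1 / (?z + of_real (real k + 1))) sums (- \<i> * of_real S)" by simp
  have s3: "(\<lambda>k. pos_deviation T \<omega> k + neg_deviation T \<omega> k) sums (?X - \<i> * of_real pi - (- \<i> * of_real S))"
    using sums_diff[OF s1 s2] unfolding pos_deviation_def neg_deviation_def by (simp only: add_diff_add)
  have "norm (?X - \<i> * of_real pi - (- \<i> * of_real S)) \<le> (\<Sum>k. norm (pos_deviation T \<omega> k)) + (\<Sum>k. norm (neg_deviation T \<omega> k))"
  proof -
    have eq: "?X - \<i> * of_real pi - (- \<i> * of_real S) = (\<Sum>k. pos_deviation T \<omega> k) + (\<Sum>k. neg_deviation T \<omega> k)"
      using sums_unique[OF s3] suminf_add[OF summable_norm_cancel[OF sp] summable_norm_cancel[OF sn]] by simp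
    show ?thesis unfolding eq
      using norm_triangle_ineq[of "\<Sum>k. pos_deviation T \<omega> k" "\<Sum>k. neg_deviation T \<omega> k"] summable_norm[OF sp] summable_norm[OF sn]
      by linarith
  qed
  moreover have "norm (\<i> * of_real pi + - \<i> * of_real S) \<le> 2 / T"
  proof -
    have "\<i> * of_real pi + - \<i> * of_real S = \<i> * of_real (pi - S)" by (simp add: algebra_simps)
    then show ?thesis using lattice_cauchy_sum_bound(2)[of T] T unfolding S_def by (simp only: norm_mult norm_of_real) simp
  qed
  moreover have "norm ?X \<le> norm (?X - \<i> * of_real pi - (- \<i> * of_real S)) + norm (\<i> * of_real pi + - \<i> * of_real S)"
  proof -
    have "norm X \<le> norm (X - a - b) + norm (a + b)" for X a b :: complex
      using norm_triangle_ineq[of "X - a - b" "a + b"] by simp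
    then show ?thesis .
  qed
  ultimately have "norm ?X \<le> 2 / T + (\<Sum>k. norm (pos_deviation T \<omega> k)) + (\<Sum>k. norm (neg_deviation T \<omega> k))" by linarith
  then have "ennreal (norm ?X) \<le> ennreal (2 / T + (\<Sum>k. norm (pos_deviation T \<omega> k)) + (\<Sum>k. norm (neg_deviation T \<omega> k)))"
    by (rule ennreal_leI)
  also have "\<dots> = ennreal (2 / T) + ennreal (\<Sum>k. norm (pos_deviation T \<omega> k)) + ennreal (\<Sum>k. norm (neg_deviation T \<omega> k))"
  proof -
    have "ennreal (a + b + c) = ennreal a + ennreal b + ennreal c" if "a \<ge> 0" "b \<ge> 0" "c \<ge> 0" for a b c
      using that by (simp add: ennreal_plus)
    moreover have "2 / T \<ge> 0" using T by simp
    ultimately show ?thesis using suminf_nonneg[OF sp norm_ge_zero] suminf_nonneg[OF sn norm_ge_zero] by blast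
  qed
  finally show ?thesis
    unfolding suminf_ennreal2[OF norm_ge_zero sp] suminf_ennreal2[OF norm_ge_zero sn] .
qed auto

text \<open>The expected bounds along the sequence are at most 18 / (n + 1)^2, with 18 = 2 + 8 + 8
  from the lattice defect and the two sides. An almost surely finite sum of the bounds forces the
  terms to 0.\<close>

lemma AE_log_xi_escape: "AE \<omega> in M. (\<lambda>n. log_xi (\<lambda>k. y k \<omega>) (\<i> * of_real (escape n j))) \<longlonglongrightarrow> 0"
proof -
  let ?G = "\<lambda>T \<omega>. ennreal (2 / T) + (\<Sum>k. ennreal (norm (pos_deviation T \<omega> k))) + (\<Sum>k. ennreal (norm (neg_deviation T \<omega> k)))"
  have G: "(\<integral>\<^sup>+\<omega>. ?G (escape n j) \<omega> \<partial>M) \<le> ennreal (18 * (1 / (real n + 1)\<^sup>2))" for n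
  proof -
    let ?T = "escape n j"
    have T: "?T \<ge> 1" by (rule escape_ge)
    have "sqrt ((real n + 1) ^ 4) = (real n + 1)\<^sup>2"
      by (rule real_sqrt_unique) (auto simp: power_mult[symmetric])
    then have s: "sqrt ?T \<ge> (real n + 1)\<^sup>2" using real_sqrt_le_mono[OF escape_ge(2)[of n j]] by simp
    have s1: "(real n + 1)\<^sup>2 \<ge> 1" by (rule one_le_power) simp
    have T2: "?T \<ge> (real n + 1)\<^sup>2"
    proof -
      have "(real n + 1)\<^sup>2 \<le> (real n + 1) ^ 4" by (rule power_increasing) auto
      then show ?thesis using escape_ge(2)[of n j] by linarith
    qed
    have "(\<integral>\<^sup>+\<omega>. ?G ?T \<omega> \<partial>M) = ennreal (2 / ?T) + (\<integral>\<^sup>+\<omega>. (\<Sum>k. ennreal (norm (pos_deviation ?T \<omega> k))) \<partial>M)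
       + (\<integral>\<^sup>+\<omega>. (\<Sum>k. ennreal (norm (neg_deviation ?T \<omega> k))) \<partial>M)"
      by (subst nn_integral_add, measurable, subst nn_integral_add, measurable) (simp add: emeasure_space_1)
    also have "\<dots> \<le> ennreal (2 / ?T) + ennreal (8 / sqrt ?T) + ennreal (8 / sqrt ?T)"
      by (intro add_mono deviation_mean T order_refl)
    also have "ennreal (2 / ?T) + ennreal (8 / sqrt ?T) + ennreal (8 / sqrt ?T) = ennreal (2 / ?T + 8 / sqrt ?T) + ennreal (8 / sqrt ?T)"
      by (subst ennreal_plus) (use T in auto)
    also have "\<dots> = ennreal (2 / ?T + 8 / sqrt ?T + 8 / sqrt ?T)"
      by (subst ennreal_plus) (use T in auto)
    also have "\<dots> \<le> ennreal (2 / (real n + 1)\<^sup>2 + 8 / (real n + 1)\<^sup>2 + 8 / (real n + 1)\<^sup>2)"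
      using s s1 T T2 by (intro ennreal_leI add_mono divide_left_mono mult_pos_pos) (auto intro: less_le_trans[OF zero_less_one])
    also have "2 / (real n + 1)\<^sup>2 + 8 / (real n + 1)\<^sup>2 + 8 / (real n + 1)\<^sup>2 = 18 * (1 / (real n + 1)\<^sup>2)" by simp
    finally show ?thesis .
  qed
  have "(\<integral>\<^sup>+\<omega>. (\<Sum>n. ?G (escape n j) \<omega>) \<partial>M) = (\<Sum>n. \<integral>\<^sup>+\<omega>. ?G (escape n j) \<omega> \<partial>M)"
    by (rule nn_integral_suminf) measurable
  also have "\<dots> \<le> (\<Sum>n. ennreal (18 * (1 / (real n + 1)\<^sup>2)))"
    by (rule suminf_le) (use G in auto)
  also have "\<dots> = ennreal (\<Sum>n. 18 * (1 / (real n + 1)\<^sup>2))"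
    by (rule suminf_ennreal2) (use summable_mult[OF summable_inverse_square_Suc, of 18] in auto)
  finally have "(\<integral>\<^sup>+\<omega>. (\<Sum>n. ?G (escape n j) \<omega>) \<partial>M) \<noteq> \<infinity>" by (auto simp: top_unique)
  then have "AE \<omega> in M. (\<Sum>n. ?G (escape n j) \<omega>) \<noteq> \<infinity>"
    by (intro nn_integral_PInf_AE) measurable
  from this AE_good show ?thesis
  proof eventually_elim
    case (elim \<omega>)
    let ?X = "\<lambda>n. norm (log_xi (\<lambda>k. y k \<omega>) (\<i> * of_real (escape n j)))"
    have "(\<Sum>n. ennreal (?X n)) \<le> (\<Sum>n. ?G (escape n j) \<omega>)"
      by (rule suminf_le) (use log_xi_imaginary_axis_bound[OF elim(2) escape_ge(1)] in auto)
    then have "(\<Sum>n. ennreal (?X n)) \<noteq> \<top>" using elim(1) by (auto simp: top_unique)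
    then have "summable ?X" by (intro summable_suminf_not_top) auto
    from summable_LIMSEQ_zero[OF this] show ?case by (rule tendsto_norm_zero_cancel)
  qed
qed

end

section \<open>Escaping nodes\<close>

text \<open>Conjugation by \<open>gauge\<close> leaves determinants unchanged and bounds the kernel at \<open>(a, b)\<close> by \<open>1 / |a - b|\<close>.\<close>

definition gauge :: "complex \<Rightarrow> complex" where
  "gauge a = (if Im a < 0 then exp (2 * \<i> * of_real pi * a) else 1)"

definition gkern :: "complex \<Rightarrow> complex \<Rightarrow> complex" where
  "gkern a b = kern a b * (gauge a / gauge b)"

lemma gauge_nonzero [simp]: "gauge a \<noteq> 0"
  by (simp add: gauge_def)

lemma permdet_gkern:
  assumes "finite J"
  shows "permdet (\<lambda>i j. kern (p i) (p j)) J = permdet (\<lambda>i j. gkern (p i) (p j)) J"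
  unfolding permdet_def gkern_def prod.distrib
proof (intro sum.cong refl)
  fix s assume "s \<in> {s. s permutes J}"
  then have s: "s permutes J" by simp
  have "(\<Prod>i\<in>J. inverse (gauge (p (s i))) / inverse (gauge (p i))) = 1"
    by (rule prod_permuted_ratio[OF assms s]) simp
  then have "(\<Prod>i\<in>J. gauge (p i) / gauge (p (s i))) = 1" by (simp add: divide_inverse mult.commute)
  then show "of_int (sign s) * (\<Prod>i\<in>J. kern (p i) (p (s i)))
     = of_int (sign s) * ((\<Prod>i\<in>J. kern (p i) (p (s i))) * (\<Prod>i\<in>J. gauge (p i) / gauge (p (s i))))" by simp
qed

text \<open>For a below the axis the gauge cancels the exponential in a, leaving exp(2 pi \<i> b) /
  \<open>gauge b\<close>, which is 1 for b below and has modulus at most 1 otherwise. For a above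
  only 1 / \<open>gauge b\<close> is left, again of modulus at most 1.\<close>

lemma norm_gkern_le:
  assumes "Im a \<noteq> 0" "Im b \<noteq> 0" "a \<noteq> b"
  shows "norm (gkern a b) \<le> 1 / norm (a - b)"
proof -
  have e: "norm (exp (2 * \<i> * of_real pi * u)) = exp (- (2 * pi * Im u))" for u by simp
  have pos: "norm (a - b) > 0" using assms by simp
  show ?thesis
  proof (cases "Im a > 0")
    case True
    have "norm (gauge b) \<ge> 1" unfolding gauge_def using e[of b] by (auto simp: mult_nonneg_nonpos)
    moreover have "gkern a b = 1 / (a - b) / gauge b" using True by (simp add: gkern_def kern_upper gauge_def)
    moreover have "1 / norm (a - b) / norm (gauge b) \<le> 1 / norm (a - b) / 1"
      using calculation(1) pos by (intro divide_left_mono) auto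
    ultimately show ?thesis using pos by (simp only: norm_divide norm_one div_by_1)
  next
    case False
    then have a: "Im a < 0" using assms by simp
    have "gkern a b = - (exp (2 * \<i> * of_real pi * b) / gauge b) / (b - a)"
      using a assms(3) by (simp add: gkern_def kern_lower gauge_def)
    moreover have "norm (exp (2 * \<i> * of_real pi * b) / gauge b) \<le> 1"
    proof (cases "Im b < 0")
      case True
      then show ?thesis by (simp add: gauge_def)
    next
      case False
      then show ?thesis using e[of b] by (simp add: gauge_def)
    qed
    then have "norm (exp (2 * \<i> * of_real pi * b) / gauge b) / norm (a - b) \<le> 1 / norm (a - b)"
      by (rule divide_right_mono) simp
    ultimately show ?thesis
      by (simp only: norm_divide norm_minus_cancel norm_minus_commute[of b a])
  qed
qed

lemma norm_ckern_le: "norm (ckern a b) \<le> 1 / norm (a - b)"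
  by (simp add: ckern_def norm_divide)

lemma gkern_diagonal: "gkern a a = (if Im a \<le> 0 then - (2 * \<i> * of_real pi) else 0)"
  by (simp add: gkern_def kern_diagonal)

text \<open>The polynomial behind \<open>Psi\<close> in freely chosen entries. Limits of kernel
  entries can be inserted here although no configuration of nodes realises them.\<close>

definition Psi_of :: "('i \<Rightarrow> 'i \<Rightarrow> complex) \<Rightarrow> ('i \<Rightarrow> 'i \<Rightarrow> complex) \<Rightarrow> 'i set \<Rightarrow> complex" where
  "Psi_of C K I = (\<Sum>S\<in>Pow I. (\<Sum>m\<in>fpf_invol S. of_int (sign m) * (\<Prod>i\<in>S. \<i> * C i (m i))) *
      (\<Sum>s | s permutes I - S. of_int (sign s) * (\<Prod>i\<in>I - S. K i (s i))))"

text \<open>Every term contains an entry of row j, from the pairing if j is in S and from the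
  determinant otherwise. A pairing has no fixed point, so \<open>C j j\<close> never occurs.\<close>

lemma Psi_of_isolated:
  assumes fin: "finite I" and j: "j \<in> I" and k0: "\<And>i. i \<in> I \<Longrightarrow> K j i = 0"
    and c0: "\<And>i. i \<in> I \<Longrightarrow> i \<noteq> j \<Longrightarrow> C j i = 0"
  shows "Psi_of C K I = 0"
  unfolding Psi_of_def
proof (rule sum.neutral, rule ballI)
  fix S assume S: "S \<in> Pow I"
  show "(\<Sum>m\<in>fpf_invol S. of_int (sign m) * (\<Prod>i\<in>S. \<i> * C i (m i))) *
    (\<Sum>s | s permutes I - S. of_int (sign s) * (\<Prod>i\<in>I - S. K i (s i))) = 0"
  proof (cases "j \<in> S")
    case True
    have "(\<Prod>i\<in>S. \<i> * C i (m i)) = 0" if "m \<in> fpf_invol S" for m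
    proof (rule prod_zero)
      have "m j \<in> S" "m j \<noteq> j" using that True by (auto simp: fpf_invol_def permutes_in_image)
      then have "\<i> * C j (m j) = 0" using S by (simp add: c0 subset_eq)
      then show "\<exists>a\<in>S. \<i> * C a (m a) = 0" using True by blast
    qed (use S fin in \<open>auto intro: finite_subset\<close>)
    then show ?thesis by simp
  next
    case False
    have "(\<Prod>i\<in>I - S. K i (s i)) = 0" if "s permutes I - S" for s
    proof (rule prod_zero)
      have "s j \<in> I" using that False j by (metis DiffD1 DiffI permutes_in_image)
      then show "\<exists>a\<in>I - S. K a (s a) = 0" using k0 False j by blast
    qed (use fin in auto)
    then show ?thesis by simp
  qed
qed
lemma Psi_tendsto:
  fixes p :: "'x \<Rightarrow> 'i \<Rightarrow> complex"
  assumes fin: "finite I"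
    and K: "\<And>i j. i \<in> I \<Longrightarrow> j \<in> I \<Longrightarrow> ((\<lambda>f. gkern (p f i) (p f j)) \<longlongrightarrow> lk i j) F"
    and C: "\<And>i j. i \<in> I \<Longrightarrow> j \<in> I \<Longrightarrow> i \<noteq> j \<Longrightarrow> ((\<lambda>f. ckern (p f i) (p f j)) \<longlongrightarrow> lc i j) F"
  shows "((\<lambda>f. Psi (p f) I) \<longlongrightarrow> Psi_of lc lk I) F"
proof -
  have eq: "Psi (p f) I = (\<Sum>S\<in>Pow I. hafn (p f) S * permdet (\<lambda>i j. gkern (p f i) (p f j)) (I - S))" for f
    unfolding Psi_def using fin by (intro sum.cong refl) (simp add: permdet_gkern)
  show ?thesis
    unfolding Psi_of_def eq unfolding hafn_def permdet_def
  proof (intro tendsto_sum tendsto_mult tendsto_const tendsto_prod)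
    fix S m i assume "S \<in> Pow I" "m \<in> fpf_invol S" "i \<in> S"
    then have "m i \<in> I" "i \<in> I" "i \<noteq> m i" by (auto simp: fpf_invol_def dest: permutes_in_image[of m S i, THEN iffD2])
    then show "((\<lambda>f. ckern (p f i) (p f (m i))) \<longlongrightarrow> lc i (m i)) F" by (intro C)
  next
    fix S s i assume "S \<in> Pow I" "s \<in> {s. s permutes I - S}" "i \<in> I - S"
    then have "s i \<in> I" "i \<in> I" using permutes_in_image[of s "I - S" i] by auto
    then show "((\<lambda>f. gkern (p f i) (p f (s i))) \<longlongrightarrow> lk i (s i)) F" by (intro K)
  qed
qed

definition const_family :: "('x \<Rightarrow> complex) \<Rightarrow> bool" where
  "const_family a \<longleftrightarrow> a = (\<lambda>_. a undefined)"

text \<open>Tailored to make every gauged kernel entry converge: diverging pairs give 0, constant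
  pairs a constant, and the diagonal entry depends only on the half plane, which a family never
  leaves.\<close>

definition tame :: "'x filter \<Rightarrow> ('x \<Rightarrow> complex) set \<Rightarrow> bool" where
  "tame F \<F> \<longleftrightarrow> (\<forall>a\<in>\<F>. (\<forall>f. Im (a f) > 0) \<or> (\<forall>f. Im (a f) < 0)) \<and>
     (\<forall>a\<in>\<F>. \<forall>b\<in>\<F>. a \<noteq> b \<longrightarrow> (const_family a \<and> const_family b) \<or> filterlim (\<lambda>f. norm (a f - b f)) at_top F)"

lemma diverging_kernels_tendsto:
  assumes d: "filterlim (\<lambda>f. norm (a f - b f)) at_top F" and "\<And>f. Im (a f) \<noteq> 0" "\<And>f. Im (b f) \<noteq> 0"
  shows "((\<lambda>f. gkern (a f) (b f)) \<longlongrightarrow> 0) F" "((\<lambda>f. ckern (a f) (b f)) \<longlongrightarrow> 0) F"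
proof -
  have l: "((\<lambda>f. 1 / norm (a f - b f)) \<longlongrightarrow> 0) F"
    by (intro tendsto_divide_0[OF tendsto_const] filterlim_at_top_imp_at_infinity d)
  have "eventually (\<lambda>f. norm (a f - b f) > 0) F" using d unfolding filterlim_at_top_dense by blast
  then have "eventually (\<lambda>f. norm (gkern (a f) (b f)) \<le> 1 / norm (a f - b f)) F"
    by eventually_elim (intro norm_gkern_le assms, auto)
  then show "((\<lambda>f. gkern (a f) (b f)) \<longlongrightarrow> 0) F" by (rule Lim_null_comparison[OF _ l])
  show "((\<lambda>f. ckern (a f) (b f)) \<longlongrightarrow> 0) F"
    by (rule Lim_null_comparison[OF _ l]) (simp add: norm_ckern_le)
qed

text \<open>Entry limits are 0 for diverging pairs and otherwise the value at the arbitrary index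
  \<open>undefined\<close>, where constant families can be read off. For an upper node that leaves
  all others even the diagonal entry is 0, so its whole row vanishes in the limit.\<close>

lemma node_families_tendsto:
  fixes Z :: "nat \<Rightarrow> 'x \<Rightarrow> complex"
  assumes tame: "tame F \<F>" and fin: "finite J" and Z: "Z ` J \<subseteq> \<F>" "inj_on Z J"
  shows "\<exists>l. ((\<lambda>f. Psi (node_pos (\<lambda>j. Z j f) x) (J <+> {..<0})) \<longlongrightarrow> l) F"
    and "j \<in> J \<Longrightarrow> (\<And>f. Im (Z j f) > 0) \<Longrightarrow>
      (\<And>b. b \<in> \<F> \<Longrightarrow> b \<noteq> Z j \<Longrightarrow> filterlim (\<lambda>f. norm (Z j f - b f)) at_top F) \<Longrightarrow>
      ((\<lambda>f. Psi (node_pos (\<lambda>j. Z j f) x) (J <+> {..<0})) \<longlongrightarrow> 0) F"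
proof -
  let ?I = "J <+> {..<0} :: (nat + nat) set"
  let ?dv = "\<lambda>i j. filterlim (\<lambda>f. norm (Z i f - Z j f)) at_top F"
  let ?P = "\<lambda>i. case_sum Z (\<lambda>(_::nat) _. 0) i :: 'x \<Rightarrow> complex"
  define lk where "lk i j = (if i \<noteq> j \<and> filterlim (\<lambda>f. norm (?P i f - ?P j f)) at_top F then 0 else gkern (?P i undefined) (?P j undefined))" for i j
  define lc where "lc i j = (if i \<noteq> j \<and> filterlim (\<lambda>f. norm (?P i f - ?P j f)) at_top F then 0 else ckern (?P i undefined) (?P j undefined))" for i j
  have sgn: "(\<forall>f. Im (Z i f) > 0) \<or> (\<forall>f. Im (Z i f) < 0)" if "i \<in> J" for i
    using tame Z(1) that unfolding tame_def by blast
  have im: "Im (Z i f) \<noteq> 0" if "i \<in> J" for i f using sgn[OF that] by (elim disjE allE[of _ f]) auto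
  have cst: "Z i = (\<lambda>_. Z i undefined) \<and> Z j = (\<lambda>_. Z j undefined)" if "i \<in> J" "j \<in> J" "i \<noteq> j" "\<not> ?dv i j" for i j
  proof -
    have "Z i \<noteq> Z j" using that Z(2) by (auto dest: inj_onD)
    then show ?thesis using tame Z(1) that unfolding tame_def const_family_def by blast
  qed
  have cf: "Z i f = Z i undefined" "Z j f = Z j undefined" if "i \<in> J" "j \<in> J" "i \<noteq> j" "\<not> ?dv i j" for i j f
    using cst[OF that] by metis+
  have K: "((\<lambda>f. gkern (node_pos (\<lambda>j. Z j f) x a) (node_pos (\<lambda>j. Z j f) x b)) \<longlongrightarrow> lk a b) F" if ab: "a \<in> ?I" "b \<in> ?I" for a b
  proof -
    obtain i j where ij: "a = Inl i" "b = Inl j" "i \<in> J" "j \<in> J" using ab by auto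
    show ?thesis
    proof (cases "i = j")
      case True
      have "gkern (Z i f) (Z i f) = gkern (Z i undefined) (Z i undefined)" for f
      proof -
        have "Im (Z i f) \<le> 0 \<longleftrightarrow> Im (Z i undefined) \<le> 0"
          using sgn[OF ij(3)] by (metis less_le_not_le less_imp_le)
        then show ?thesis unfolding gkern_diagonal by simp
      qed
      then have "(\<lambda>f. gkern (Z i f) (Z i f)) = (\<lambda>_. gkern (Z i undefined) (Z i undefined))" by (rule ext)
      then show ?thesis using True ij by (simp add: lk_def)
    next
      case False
      show ?thesis
      proof (cases "?dv i j")
        case True
        then show ?thesis using False ij diverging_kernels_tendsto(1)[OF True im[OF ij(3)] im[OF ij(4)]] by (simp add: lk_def)
      next
        case nd: False
        have "gkern (Z i f) (Z j f) = gkern (Z i undefined) (Z j undefined)" for f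
          by (subst cf(1)[OF ij(3,4) False nd], subst cf(2)[OF ij(3,4) False nd]) (rule refl)
        then have "(\<lambda>f. gkern (Z i f) (Z j f)) = (\<lambda>_. gkern (Z i undefined) (Z j undefined))" by (rule ext)
        then show ?thesis using False ij nd by (simp add: lk_def)
      qed
    qed
  qed
  have C: "((\<lambda>f. ckern (node_pos (\<lambda>j. Z j f) x a) (node_pos (\<lambda>j. Z j f) x b)) \<longlongrightarrow> lc a b) F" if ab: "a \<in> ?I" "b \<in> ?I" "a \<noteq> b" for a b
  proof -
    obtain i j where ij: "a = Inl i" "b = Inl j" "i \<in> J" "j \<in> J" "i \<noteq> j" using ab by auto
    show ?thesis
    proof (cases "?dv i j")
      case True
      then show ?thesis using ij diverging_kernels_tendsto(2)[OF True im[OF ij(3)] im[OF ij(4)]] by (simp add: lc_def)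
    next
      case nd: False
      have "ckern (Z i f) (Z j f) = ckern (Z i undefined) (Z j undefined)" for f
        by (subst cf(1)[OF ij(3,4,5) nd], subst cf(2)[OF ij(3,4,5) nd]) (rule refl)
      then have "(\<lambda>f. ckern (Z i f) (Z j f)) = (\<lambda>_. ckern (Z i undefined) (Z j undefined))" by (rule ext)
      then show ?thesis using ij nd by (simp add: lc_def)
    qed
  qed
  have finI: "finite ?I" using fin by simp
  note T = Psi_tendsto[where p="\<lambda>f. node_pos (\<lambda>j. Z j f) x" and lk=lk and lc=lc and F=F, OF finI K C]
  show "\<exists>l. ((\<lambda>f. Psi (node_pos (\<lambda>j. Z j f) x) ?I) \<longlongrightarrow> l) F"
    using T by blast
  assume j: "j \<in> J" "\<And>f. Im (Z j f) > 0"
    "\<And>b. b \<in> \<F> \<Longrightarrow> b \<noteq> Z j \<Longrightarrow> filterlim (\<lambda>f. norm (Z j f - b f)) at_top F"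
  have dv: "?dv j i" if "i \<in> J" "i \<noteq> j" for i
    using j(3)[of "Z i"] that Z j(1) by (auto dest: inj_onD)
  \<comment> \<open>On the diagonal the half plane decides: it is the assumption that node j lies
    above the axis that makes this entry 0 and not -2 pi \<i>.\<close>
  have "lk (Inl j) a = 0" if a: "a \<in> ?I" for a
  proof -
    obtain i where i: "a = Inl i" "i \<in> J" using a by auto
    show ?thesis
    proof (cases "i = j")
      case True
      then show ?thesis using i j(2)[of undefined] by (simp add: lk_def gkern_diagonal)
    next
      case False
      then show ?thesis using i dv by (simp add: lk_def)
    qed
  qed
  moreover have "lc (Inl j) a = 0" if a: "a \<in> ?I" "a \<noteq> Inl j" for a
  proof -
    obtain i where i: "a = Inl i" "i \<in> J" using a by auto
    then show ?thesis using a dv by (simp add: lc_def)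
  qed
  ultimately have "Psi_of lc lk ?I = 0"
    by (intro Psi_of_isolated[OF finI, of "Inl j"]) (use j(1) in auto)
  then show "((\<lambda>f. Psi (node_pos (\<lambda>j. Z j f) x) ?I) \<longlongrightarrow> 0) F"
    using T by simp
qed

section \<open>Alternating sums with moving nodes\<close>

definition eval_pairs :: "(complex \<times> ('x \<Rightarrow> complex)) list \<Rightarrow> 'x \<Rightarrow> (complex \<times> complex) list" where
  "eval_pairs qs f = map (\<lambda>(z, W). (z, W f)) qs"

definition family_pairs :: "(complex \<times> ('x \<Rightarrow> complex)) list \<Rightarrow> (('x \<Rightarrow> complex) \<times> ('x \<Rightarrow> complex)) list" where
  "family_pairs qs = map (\<lambda>(z, W). (\<lambda>_. z, W)) qs"

lemma eval_pairs_simps [simp]: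
  "eval_pairs [] f = []" "eval_pairs ((z, W) # qs) f = (z, W f) # eval_pairs qs f"
  "family_pairs [] = []" "family_pairs ((z, W) # qs) = (\<lambda>_. z, W) # family_pairs qs"
  "length (eval_pairs qs f) = length qs"
  by (simp_all add: eval_pairs_def family_pairs_def)

lemma family_upd: "(\<lambda>j. Z j f)(l := a f) = (\<lambda>j. (Z(l := a)) j f)"
  by auto

text \<open>Both claims go through one induction in which the set of placed nodes and their families
  vary. A node that is already placed and escapes stays isolated whatever is placed later, so every
  branch containing it tends to 0.\<close>

lemma diff_Psi_family_tendsto:
  fixes Z :: "nat \<Rightarrow> 'x \<Rightarrow> complex"
  assumes "tame F \<F>" "finite J" "Z ` J \<subseteq> \<F>" "inj_on Z J" "\<And>j. j \<in> J \<Longrightarrow> j \<ge> length qs"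
    "set (flat_pairs (family_pairs qs)) \<subseteq> \<F>" "distinct (flat_pairs (family_pairs qs))"
    "Z ` J \<inter> set (flat_pairs (family_pairs qs)) = {}"
  shows "\<exists>l. ((\<lambda>f. diff_Psi (eval_pairs qs f) J (\<lambda>j. Z j f) 0 x) \<longlongrightarrow> l) F"
    and "j \<in> J \<Longrightarrow> (\<And>f. Im (Z j f) > 0) \<Longrightarrow>
      (\<And>b. b \<in> \<F> \<Longrightarrow> b \<noteq> Z j \<Longrightarrow> filterlim (\<lambda>f. norm (Z j f - b f)) at_top F) \<Longrightarrow>
      ((\<lambda>f. diff_Psi (eval_pairs qs f) J (\<lambda>j. Z j f) 0 x) \<longlongrightarrow> 0) F"
proof -
  have "(\<exists>l. ((\<lambda>f. diff_Psi (eval_pairs qs f) J (\<lambda>j. Z j f) 0 x) \<longlongrightarrow> l) F) \<and>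
    (\<forall>j\<in>J. (\<forall>f. Im (Z j f) > 0) \<longrightarrow> (\<forall>b\<in>\<F>. b \<noteq> Z j \<longrightarrow> filterlim (\<lambda>f. norm (Z j f - b f)) at_top F) \<longrightarrow>
      ((\<lambda>f. diff_Psi (eval_pairs qs f) J (\<lambda>j. Z j f) 0 x) \<longlongrightarrow> 0) F)"
    using assms
  proof (induction qs arbitrary: J Z)
    case Nil
    note N = node_families_tendsto[OF Nil.prems(1-4)]
    show ?case unfolding eval_pairs_simps diff_Psi.simps
    proof (intro conjI ballI impI)
      fix j assume j: "j \<in> J" "\<forall>f. Im (Z j f) > 0" "\<forall>b\<in>\<F>. b \<noteq> Z j \<longrightarrow> filterlim (\<lambda>f. norm (Z j f - b f)) at_top F"
      show "((\<lambda>f. Psi (node_pos (\<lambda>j. Z j f) x) (J <+> {..<0})) \<longlongrightarrow> 0) F"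
        by (rule N(2)[OF j(1) j(2)[rule_format] j(3)[rule_format]])
    qed (rule N(1))
  next
    case (Cons a qs)
    obtain z W where a: "a = (z, W)" by (cases a)
    let ?l = "length qs"
    let ?D = "\<lambda>a f. diff_Psi (eval_pairs qs f) (insert ?l J) (\<lambda>j. (Z(?l := a)) j f) 0 x"
    note P = Cons.prems[unfolded a, simplified]
    have l: "?l \<notin> J" using P(5)[of ?l] by auto
    have IH: "(\<exists>l. (?D a \<longlongrightarrow> l) F) \<and>
      (\<forall>j\<in>insert ?l J. (\<forall>f. Im ((Z(?l := a)) j f) > 0) \<longrightarrow> (\<forall>b\<in>\<F>. b \<noteq> (Z(?l := a)) j \<longrightarrow> filterlim (\<lambda>f. norm ((Z(?l := a)) j f - b f)) at_top F) \<longrightarrow> (?D a \<longlongrightarrow> 0) F)"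
      if a: "a = (\<lambda>_. z) \<or> a = W" for a
    proof (rule Cons.IH)
      have im: "(Z(?l := a)) ` insert ?l J = insert a (Z ` J)" using l by auto
      show "(Z(?l := a)) ` insert ?l J \<subseteq> \<F>" unfolding im using P(3,6) a by auto
      have aJ: "a \<notin> Z ` J" using P(8) a by (elim disjE) simp_all
      show "inj_on (Z(?l := a)) (insert ?l J)"
      proof (rule inj_onI)
        fix i j assume "i \<in> insert ?l J" "j \<in> insert ?l J" "(Z(?l := a)) i = (Z(?l := a)) j"
        then show "i = j" using inj_onD[OF P(4), of i j] aJ by (cases "i = ?l"; cases "j = ?l") auto
      qed
      show "(Z(?l := a)) ` insert ?l J \<inter> set (flat_pairs (family_pairs qs)) = {}" unfolding im using P(7,8) a by auto
      show "length qs \<le> j" if "j \<in> insert ?l J" for j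
        using that P(5)[of j] by (cases "j = ?l") auto
      show "tame F \<F>" by (rule P(1))
      show "finite (insert ?l J)" using P(2) by simp
      show "set (flat_pairs (family_pairs qs)) \<subseteq> \<F>" using P(6) by simp
      show "distinct (flat_pairs (family_pairs qs))" using P(7) by simp
    qed
    have split: "diff_Psi (eval_pairs ((z, W) # qs) f) J (\<lambda>j. Z j f) 0 x = ?D (\<lambda>_. z) f - ?D W f" for f
      by (simp only: eval_pairs_simps diff_Psi.simps family_upd[of Z f ?l "\<lambda>_. z", symmetric] family_upd[of Z f ?l W, symmetric])
    show ?case unfolding a split
    proof (intro conjI ballI impI)
      show "\<exists>l. ((\<lambda>f. ?D (\<lambda>_. z) f - ?D W f) \<longlongrightarrow> l) F"
      proof -
        obtain l1 where a1: "(?D (\<lambda>_. z) \<longlongrightarrow> l1) F" using IH[OF disjI1[OF refl], THEN conjunct1] by (rule exE)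
        obtain l2 where a2: "(?D W \<longlongrightarrow> l2) F" using IH[OF disjI2[OF refl], THEN conjunct1] by (rule exE)
        show ?thesis by (rule exI, rule tendsto_diff[OF a1 a2])
      qed
      fix j assume j: "j \<in> J" "\<forall>f. Im (Z j f) > 0" "\<forall>b\<in>\<F>. b \<noteq> Z j \<longrightarrow> filterlim (\<lambda>f. norm (Z j f - b f)) at_top F"
      have "(?D a \<longlongrightarrow> 0) F" if "a = (\<lambda>_. z) \<or> a = W" for a
      proof -
        have e: "(Z(?l := a)) j = Z j" using j l by auto
        show ?thesis
          by (rule mp[OF mp[OF bspec[OF IH[OF that, THEN conjunct2], OF insertI2[OF j(1)], unfolded e] j(2)] j(3)])
      qed
      note D = this
      from tendsto_diff[OF D[OF disjI1[OF refl]] D[OF disjI2[OF refl]]]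
      show "((\<lambda>f. ?D (\<lambda>_. z) f - ?D W f) \<longlongrightarrow> 0) F" by simp
    qed
  qed
  note R = this
  show "\<exists>l. ((\<lambda>f. diff_Psi (eval_pairs qs f) J (\<lambda>j. Z j f) 0 x) \<longlongrightarrow> l) F" by (rule conjunct1[OF R])
  assume 1: "j \<in> J" and 2: "\<And>f. Im (Z j f) > 0"
    and 3: "\<And>b. b \<in> \<F> \<Longrightarrow> b \<noteq> Z j \<Longrightarrow> filterlim (\<lambda>f. norm (Z j f - b f)) at_top F"
  show "((\<lambda>f. diff_Psi (eval_pairs qs f) J (\<lambda>j. Z j f) 0 x) \<longlongrightarrow> 0) F"
  proof (rule mp[OF mp[OF bspec[OF conjunct2[OF R] 1]]])
    show "\<forall>f. Im (Z j f) > 0" using 2 by simp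
    show "\<forall>b\<in>\<F>. b \<noteq> Z j \<longrightarrow> filterlim (\<lambda>f. norm (Z j f - b f)) at_top F" using 3 by simp
  qed
qed

text \<open>The labelling in the branch of \<open>diff_Psi\<close> that always takes the first
  component. Labels count down, so the list of nodes appears reversed.\<close>

fun place :: "complex list \<Rightarrow> (nat \<Rightarrow> complex) \<Rightarrow> nat \<Rightarrow> complex" where
  "place [] \<zeta> = \<zeta>"
| "place (z # zs) \<zeta> = place zs (\<zeta>(length zs := z))"

lemma place_eq: "place zs \<zeta> i = (if i < length zs then rev zs ! i else \<zeta> i)"
  by (induction zs arbitrary: \<zeta>) (auto simp: nth_append)

text \<open>Only the branch that takes z from every pair survives; once some W is chosen, an
  escaping upper node is present and the branch tends to 0.\<close>

lemma diff_Psi_escape_tendsto: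
  fixes F :: "'x filter" and \<zeta> :: "nat \<Rightarrow> complex"
  assumes "tame F \<F>" "finite J" "(\<lambda>j. \<lambda>_. \<zeta> j) ` J \<subseteq> \<F>" "inj_on \<zeta> J" "\<And>j. j \<in> J \<Longrightarrow> j \<ge> length qs"
    "set (flat_pairs (family_pairs qs)) \<subseteq> \<F>" "distinct (flat_pairs (family_pairs qs))"
    "(\<lambda>j. \<lambda>_. \<zeta> j) ` J \<inter> set (flat_pairs (family_pairs qs)) = {}"
    and esc: "\<And>z W f. (z, W) \<in> set qs \<Longrightarrow> Im (W f) > 0"
      "\<And>z W b. (z, W) \<in> set qs \<Longrightarrow> b \<in> \<F> \<Longrightarrow> b \<noteq> W \<Longrightarrow> filterlim (\<lambda>f. norm (W f - b f)) at_top F"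
  shows "((\<lambda>f. diff_Psi (eval_pairs qs f) J \<zeta> 0 x) \<longlongrightarrow>
     Psi (node_pos (place (map fst qs) \<zeta>) x) ((J \<union> {..<length qs}) <+> {..<0})) F"
  using assms
proof (induction qs arbitrary: J \<zeta>)
  case Nil
  show ?case by simp
next
  case (Cons a qs)
  obtain z W where a: "a = (z, W)" by (cases a)
  let ?l = "length qs"
  note P = Cons.prems[unfolded a, simplified]
  have l: "?l \<notin> J" using P(5)[of ?l] by auto
  have inj: "inj_on (\<lambda>j. (\<lambda>_::'x. \<zeta> j)) J" using P(4) by (auto simp: inj_on_def fun_eq_iff)
  have zj: "z \<notin> \<zeta> ` J" using P(8) by auto
  have lj: "length qs \<le> j" if "j \<in> insert ?l J" for j using that P(5)[of j] by (cases "j = ?l") auto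
  have e1: "\<And>z' W' f. (z', W') \<in> set qs \<Longrightarrow> Im (W' f) > 0"
    and e2: "\<And>z' W' b. (z', W') \<in> set qs \<Longrightarrow> b \<in> \<F> \<Longrightarrow> b \<noteq> W' \<Longrightarrow> filterlim (\<lambda>f. norm (W' f - b f)) at_top F"
    subgoal for z' W' f using Cons.prems(9)[of z' W' f] by (simp add: a)
    subgoal for z' W' b using Cons.prems(10)[of z' W' b] by (simp add: a)
    done
  have imJ: "(\<lambda>j. \<lambda>_::'x. (\<zeta>(?l := z)) j) ` J = (\<lambda>j. \<lambda>_. \<zeta> j) ` J" using l by (intro image_cong refl) auto
  have im: "(\<lambda>j. \<lambda>_::'x. (\<zeta>(?l := z)) j) ` insert ?l J = insert (\<lambda>_. z) ((\<lambda>j. \<lambda>_. \<zeta> j) ` J)" unfolding image_insert imJ by (simp only: fun_upd_same)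
  have inj': "inj_on (\<zeta>(?l := z)) (insert ?l J)" using l zj P(4) by (auto simp: inj_on_def)
  have 1: "((\<lambda>f. diff_Psi (eval_pairs qs f) (insert ?l J) (\<zeta>(?l := z)) 0 x) \<longlongrightarrow>
     Psi (node_pos (place (map fst qs) (\<zeta>(?l := z))) x) ((insert ?l J \<union> {..<length qs}) <+> {..<0})) F"
  proof (rule Cons.IH)
    show "(\<lambda>j. \<lambda>_. (\<zeta>(?l := z)) j) ` insert ?l J \<subseteq> \<F>" unfolding im using P by auto
    show "(\<lambda>j. \<lambda>_. (\<zeta>(?l := z)) j) ` insert ?l J \<inter> set (flat_pairs (family_pairs qs)) = {}" unfolding im using P by auto
    show "inj_on (\<zeta>(?l := z)) (insert ?l J)" by (rule inj')
    show "length qs \<le> j" if "j \<in> insert ?l J" for j using that by (rule lj)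
    show "Im (W' f) > 0" if "(z', W') \<in> set qs" for z' W' f using that by (rule e1)
    show "filterlim (\<lambda>f. norm (W' f - b f)) at_top F" if "(z', W') \<in> set qs" "b \<in> \<F>" "b \<noteq> W'" for z' W' b
      using that by (rule e2)
  qed (use P in auto)
  have idx: "insert ?l J \<union> {..<length qs} = J \<union> {..<length (a # qs)}" by auto
  let ?Z = "(\<lambda>j. (\<lambda>_::'x. \<zeta> j))(?l := W)"
  have imW: "?Z ` insert ?l J = insert W ((\<lambda>j. \<lambda>_. \<zeta> j) ` J)" using l by auto
  have Wesc: "\<And>f. Im (W f) > 0" "\<And>b. b \<in> \<F> \<Longrightarrow> b \<noteq> W \<Longrightarrow> filterlim (\<lambda>f. norm (W f - b f)) at_top F"
    using Cons.prems(9,10)[of z W] by (auto simp: a)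
  \<comment> \<open>The branch in which the escaping node W is placed at the new label
    \<open>?l\<close>.\<close>
  have "((\<lambda>f. diff_Psi (eval_pairs qs f) (insert ?l J) (\<lambda>j. ?Z j f) 0 x) \<longlongrightarrow> 0) F"
  proof (rule diff_Psi_family_tendsto(2)[OF P(1), of _ ?Z _ ?l])
    show "?Z ` insert ?l J \<subseteq> \<F>" unfolding imW using P by auto
    show "inj_on ?Z (insert ?l J)" using l inj P(8) by (auto simp: inj_on_def)
    show "?Z ` insert ?l J \<inter> set (flat_pairs (family_pairs qs)) = {}" unfolding imW using P by auto
    show "0 < Im (?Z ?l f)" for f using Wesc by simp
    show "filterlim (\<lambda>f. cmod (?Z ?l f - b f)) at_top F" if "b \<in> \<F>" "b \<noteq> ?Z ?l" for b
      using Wesc(2)[of b] that by simp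
  qed (use P lj in auto)
  moreover have "(\<lambda>j. ?Z j f) = \<zeta>(?l := W f)" for f by auto
  ultimately have 2: "((\<lambda>f. diff_Psi (eval_pairs qs f) (insert ?l J) (\<zeta>(?l := W f)) 0 x) \<longlongrightarrow> 0) F" by simp
  show ?case using tendsto_diff[OF 1 2] unfolding idx by (simp add: a)
qed

text \<open>Telescoping as (f - f') g + (g - g') f' and the weighted inequality u v \<le> u^2 / (2
  \<delta>) + \<delta> v^2 / 2, whose weight \<delta> balances the small factor against the bounded
  one.\<close>

lemma nn_integral_product_difference:
  fixes f f' g g' :: "'a \<Rightarrow> complex"
  assumes [measurable]: "f \<in> borel_measurable M" "f' \<in> borel_measurable M" "g \<in> borel_measurable M" "g' \<in> borel_measurable M"
    and "\<delta> > 0" "C \<ge> 0"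
    and b: "(\<integral>\<^sup>+x. ennreal ((norm (f x - f' x))\<^sup>2) \<partial>M) \<le> ennreal (\<delta>\<^sup>2)" "(\<integral>\<^sup>+x. ennreal ((norm (g x - g' x))\<^sup>2) \<partial>M) \<le> ennreal (\<delta>\<^sup>2)"
      "(\<integral>\<^sup>+x. ennreal ((norm (g x))\<^sup>2) \<partial>M) \<le> ennreal C" "(\<integral>\<^sup>+x. ennreal ((norm (f' x))\<^sup>2) \<partial>M) \<le> ennreal C"
  shows "(\<integral>\<^sup>+x. ennreal (norm (f x * g x - f' x * g' x)) \<partial>M) \<le> ennreal (\<delta> * (1 + C))"
proof -
  let ?h = "\<lambda>u. ennreal (u\<^sup>2)"
  have am: "u * v \<le> u\<^sup>2 / (2 * \<delta>) + \<delta> / 2 * v\<^sup>2" for u v :: real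
  proof -
    have "2 * u * (\<delta> * v) \<le> u\<^sup>2 + (\<delta> * v)\<^sup>2" by (rule sum_squares_bound)
    then show ?thesis using \<open>\<delta> > 0\<close> by (simp add: field_simps power2_eq_square)
  qed
  have pt: "norm (f x * g x - f' x * g' x) \<le> 1 / (2 * \<delta>) * (norm (f x - f' x))\<^sup>2 + \<delta> / 2 * (norm (g x))\<^sup>2
     + (1 / (2 * \<delta>) * (norm (g x - g' x))\<^sup>2 + \<delta> / 2 * (norm (f' x))\<^sup>2)" for x
  proof -
    have "f x * g x - f' x * g' x = (f x - f' x) * g x + (g x - g' x) * f' x" by (simp add: algebra_simps)
    then have "norm (f x * g x - f' x * g' x) \<le> norm (f x - f' x) * norm (g x) + norm (g x - g' x) * norm (f' x)"
      by (metis norm_mult norm_triangle_ineq)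
    then show ?thesis using am[of "norm (f x - f' x)" "norm (g x)"] am[of "norm (g x - g' x)" "norm (f' x)"] by simp
  qed
  have "(\<integral>\<^sup>+x. ennreal (norm (f x * g x - f' x * g' x)) \<partial>M)
    \<le> (\<integral>\<^sup>+x. ennreal (1 / (2 * \<delta>)) * ?h (norm (f x - f' x)) + ennreal (\<delta> / 2) * ?h (norm (g x))
     + (ennreal (1 / (2 * \<delta>)) * ?h (norm (g x - g' x)) + ennreal (\<delta> / 2) * ?h (norm (f' x))) \<partial>M)"
    using \<open>\<delta> > 0\<close> by (intro nn_integral_mono order_trans[OF ennreal_leI[OF pt]]) (simp add: ennreal_mult[symmetric] ennreal_plus[symmetric] del: ennreal_plus)
  also have "\<dots> = ennreal (1 / (2 * \<delta>)) * (\<integral>\<^sup>+x. ?h (norm (f x - f' x)) \<partial>M) + ennreal (\<delta> / 2) * (\<integral>\<^sup>+x. ?h (norm (g x)) \<partial>M)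
     + (ennreal (1 / (2 * \<delta>)) * (\<integral>\<^sup>+x. ?h (norm (g x - g' x)) \<partial>M) + ennreal (\<delta> / 2) * (\<integral>\<^sup>+x. ?h (norm (f' x)) \<partial>M))"
    by (simp add: nn_integral_add nn_integral_cmult)
  also have "\<dots> \<le> ennreal (1 / (2 * \<delta>)) * ennreal (\<delta>\<^sup>2) + ennreal (\<delta> / 2) * ennreal C
     + (ennreal (1 / (2 * \<delta>)) * ennreal (\<delta>\<^sup>2) + ennreal (\<delta> / 2) * ennreal C)"
    by (intro add_mono mult_left_mono b) auto
  also have "\<dots> = ennreal (1 / (2 * \<delta>) * \<delta>\<^sup>2 + \<delta> / 2 * C + (1 / (2 * \<delta>) * \<delta>\<^sup>2 + \<delta> / 2 * C))"
    using \<open>\<delta> > 0\<close> \<open>C \<ge> 0\<close> by (simp add: ennreal_mult[symmetric] ennreal_plus[symmetric] del: ennreal_plus)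
  also have "1 / (2 * \<delta>) * \<delta>\<^sup>2 + \<delta> / 2 * C + (1 / (2 * \<delta>) * \<delta>\<^sup>2 + \<delta> / 2 * C) = \<delta> * (1 + C)"
    using \<open>\<delta> > 0\<close> by (simp add: field_simps power2_eq_square)
  finally show ?thesis .
qed

text \<open>Two factors Cauchy and bounded in L^2 have products that are Cauchy in L^1. Fatou's
  lemma identifies the L^1 limit with the almost everywhere limit H, so no dominating function is
  involved.\<close>

lemma product_L1_limit:
  fixes f g :: "nat \<Rightarrow> 'a \<Rightarrow> complex"
  assumes [measurable]: "\<And>n. f n \<in> borel_measurable M" "\<And>n. g n \<in> borel_measurable M"
    and [measurable]: "H \<in> borel_measurable M" and lim: "AE x in M. (\<lambda>n. f n x * g n x) \<longlonglongrightarrow> H x"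
    and cf: "\<And>\<epsilon>. \<epsilon> > 0 \<Longrightarrow> \<exists>N. \<forall>n\<ge>N. \<forall>m\<ge>N. (\<integral>\<^sup>+x. ennreal ((norm (f n x - f m x))\<^sup>2) \<partial>M) \<le> ennreal \<epsilon>"
    and cg: "\<And>\<epsilon>. \<epsilon> > 0 \<Longrightarrow> \<exists>N. \<forall>n\<ge>N. \<forall>m\<ge>N. (\<integral>\<^sup>+x. ennreal ((norm (g n x - g m x))\<^sup>2) \<partial>M) \<le> ennreal \<epsilon>"
    and bf: "\<exists>C\<ge>0. \<exists>N. \<forall>n\<ge>N. (\<integral>\<^sup>+x. ennreal ((norm (f n x))\<^sup>2) \<partial>M) \<le> ennreal C"
    and bg: "\<exists>C\<ge>0. \<exists>N. \<forall>n\<ge>N. (\<integral>\<^sup>+x. ennreal ((norm (g n x))\<^sup>2) \<partial>M) \<le> ennreal C"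
    and int: "\<exists>N. \<forall>n\<ge>N. integrable M (\<lambda>x. f n x * g n x)"
  shows "integrable M H" and "(\<lambda>n. \<integral>x. f n x * g n x \<partial>M) \<longlonglongrightarrow> (\<integral>x. H x \<partial>M)"
proof -
  let ?h = "\<lambda>n x. f n x * g n x"
  obtain C1 N1 where C1: "C1 \<ge> 0" "\<And>n. n \<ge> N1 \<Longrightarrow> (\<integral>\<^sup>+x. ennreal ((norm (f n x))\<^sup>2) \<partial>M) \<le> ennreal C1" using bf by blast
  obtain C2 N2 where C2: "C2 \<ge> 0" "\<And>n. n \<ge> N2 \<Longrightarrow> (\<integral>\<^sup>+x. ennreal ((norm (g n x))\<^sup>2) \<partial>M) \<le> ennreal C2" using bg by blast
  obtain N3 where N3: "\<And>n. n \<ge> N3 \<Longrightarrow> integrable M (?h n)" using int by blast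
  define C where "C = max C1 C2"
  have C: "C \<ge> 0" "C1 \<le> C" "C2 \<le> C" using C1(1) by (auto simp: C_def)
  have cauchy: "\<exists>N\<ge>N3. \<forall>n\<ge>N. \<forall>m\<ge>N. (\<integral>\<^sup>+x. ennreal (norm (?h n x - ?h m x)) \<partial>M) \<le> ennreal \<epsilon>" if "\<epsilon> > 0" for \<epsilon>
  proof -
    define \<delta> where "\<delta> = \<epsilon> / (1 + C)"
    have \<delta>: "\<delta> > 0" using that C by (simp add: \<delta>_def)
    obtain Nf where Nf: "\<And>n m. n \<ge> Nf \<Longrightarrow> m \<ge> Nf \<Longrightarrow> (\<integral>\<^sup>+x. ennreal ((norm (f n x - f m x))\<^sup>2) \<partial>M) \<le> ennreal (\<delta>\<^sup>2)"
      using cf[of "\<delta>\<^sup>2"] \<delta> by auto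
    obtain Ng where Ng: "\<And>n m. n \<ge> Ng \<Longrightarrow> m \<ge> Ng \<Longrightarrow> (\<integral>\<^sup>+x. ennreal ((norm (g n x - g m x))\<^sup>2) \<partial>M) \<le> ennreal (\<delta>\<^sup>2)"
      using cg[of "\<delta>\<^sup>2"] \<delta> by auto
    define N where "N = Max {Nf, Ng, N1, N2, N3}"
    have N: "N \<ge> Nf" "N \<ge> Ng" "N \<ge> N1" "N \<ge> N2" "N \<ge> N3" by (auto simp: N_def)
    have "(\<integral>\<^sup>+x. ennreal (norm (?h n x - ?h m x)) \<partial>M) \<le> ennreal \<epsilon>" if nm: "n \<ge> N" "m \<ge> N" for n m
    proof -
      have "(\<integral>\<^sup>+x. ennreal (norm (?h n x - ?h m x)) \<partial>M) \<le> ennreal (\<delta> * (1 + C))"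
      proof (rule nn_integral_product_difference)
        show "(\<integral>\<^sup>+x. ennreal ((norm (g n x))\<^sup>2) \<partial>M) \<le> ennreal C"
          by (rule order_trans[OF C2(2) ennreal_leI]) (use N nm C in auto)
        show "(\<integral>\<^sup>+x. ennreal ((norm (f m x))\<^sup>2) \<partial>M) \<le> ennreal C"
          by (rule order_trans[OF C1(2) ennreal_leI]) (use N nm C in auto)
      qed (use Nf Ng N nm \<delta> C in auto)
      also have "\<delta> * (1 + C) = \<epsilon>" using C by (simp add: \<delta>_def)
      finally show ?thesis .
    qed
    then show ?thesis using N(5) by blast
  qed
  have H: "\<exists>N\<ge>N3. \<forall>m\<ge>N. (\<integral>\<^sup>+x. ennreal (norm (?h m x - H x)) \<partial>M) \<le> ennreal \<epsilon>" if "\<epsilon> > 0" for \<epsilon>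
  proof -
    from cauchy[OF \<open>\<epsilon> > 0\<close>] obtain N where N: "N \<ge> N3" "\<And>n m. n \<ge> N \<Longrightarrow> m \<ge> N \<Longrightarrow> (\<integral>\<^sup>+x. ennreal (norm (?h n x - ?h m x)) \<partial>M) \<le> ennreal \<epsilon>"
      by blast
    have "(\<integral>\<^sup>+x. ennreal (norm (?h m x - H x)) \<partial>M) \<le> ennreal \<epsilon>" if m: "m \<ge> N" for m
    proof -
      have "(\<integral>\<^sup>+x. ennreal (norm (?h m x - H x)) \<partial>M) = (\<integral>\<^sup>+x. liminf (\<lambda>n. ennreal (norm (?h n x - ?h m x))) \<partial>M)"
      proof (rule nn_integral_cong_AE)
        show "AE x in M. ennreal (norm (?h m x - H x)) = liminf (\<lambda>n. ennreal (norm (?h n x - ?h m x)))"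
          using lim
        proof eventually_elim
          case (elim x)
          then have "(\<lambda>n. ennreal (norm (?h n x - ?h m x))) \<longlonglongrightarrow> ennreal (norm (H x - ?h m x))"
            by (intro tendsto_ennrealI tendsto_norm tendsto_diff tendsto_const)
          note L = this
          have e: "norm (?h m x - H x) = norm (H x - ?h m x)" by (rule norm_minus_commute)
          show ?case unfolding e by (rule lim_imp_Liminf[OF trivial_limit_sequentially L, symmetric])
        qed
      qed
      also have "\<dots> \<le> liminf (\<lambda>n. \<integral>\<^sup>+x. ennreal (norm (?h n x - ?h m x)) \<partial>M)"
        by (rule nn_integral_liminf) measurable
      also have "\<dots> \<le> liminf (\<lambda>n. ennreal \<epsilon>)"
        by (rule Liminf_mono) (use N(2) m in \<open>auto simp: eventually_sequentially\<close>)
      also have "\<dots> = ennreal \<epsilon>" by (simp add: Liminf_const)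
      finally show ?thesis .
    qed
    then show ?thesis using N(1) by blast
  qed
  show intH: "integrable M H"
  proof -
    obtain N where N: "N \<ge> N3" "(\<integral>\<^sup>+x. ennreal (norm (?h N x - H x)) \<partial>M) \<le> ennreal 1" using H[of 1] by auto
    have "integrable M (\<lambda>x. ?h N x - H x)"
      using N(2) by (intro integrableI_bounded) (auto intro: le_less_trans simp: ennreal_less_top)
    from Bochner_Integration.integrable_diff[OF N3[OF N(1)] this] show ?thesis by simp
  qed
  have "(\<lambda>n. \<integral>x. ?h (n + N3) x \<partial>M) \<longlonglongrightarrow> (\<integral>x. H x \<partial>M)"
  proof (rule tendsto_L1_int)
    show "integrable M (?h (n + N3))" for n by (rule N3) simp
    show "(\<lambda>n. \<integral>\<^sup>+x. norm (?h (n + N3) x - H x) \<partial>M) \<longlonglongrightarrow> 0"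
    proof (rule order_tendstoI)
      fix a :: ennreal assume "0 < a"
      then obtain b where b: "0 < b" "b < a" using dense by blast
      then obtain \<epsilon> where be: "b = ennreal \<epsilon>" "\<epsilon> \<ge> 0" by (cases b) auto
      with b have \<epsilon>: "\<epsilon> > 0" "ennreal \<epsilon> < a" by (auto simp: ennreal_less_zero_iff)
      obtain N where B: "\<And>m. m \<ge> N \<Longrightarrow> (\<integral>\<^sup>+x. ennreal (norm (?h m x - H x)) \<partial>M) \<le> ennreal \<epsilon>" using H[OF \<epsilon>(1)] by blast
      then have "\<forall>n\<ge>N. (\<integral>\<^sup>+x. norm (?h (n + N3) x - H x) \<partial>M) < a" using \<epsilon>(2) by (intro allI impI le_less_trans[OF B]) auto
      then show "\<forall>\<^sub>F n in sequentially. (\<integral>\<^sup>+x. norm (?h (n + N3) x - H x) \<partial>M) < a"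
        unfolding eventually_sequentially by blast
    qed simp
  qed (rule intH)
  then show "(\<lambda>n. \<integral>x. ?h n x \<partial>M) \<longlonglongrightarrow> (\<integral>x. H x \<partial>M)" by (rule LIMSEQ_offset)
qed

section \<open>Expansion over permutations\<close>

lemma hafn_image:
  assumes inj: "inj_on f J" and fin: "finite J"
  shows "hafn p (f ` J) = hafn (\<lambda>i. p (f i)) J"
proof -
  have bij: "bij_betw f J (f ` J)" using inj by (rule inj_on_imp_bij_betw)
  have bij': "bij_betw (inv_into J f) (f ` J) J" by (rule bij_betw_inv_into[OF bij])
  have step: "map_permutation A g m \<in> fpf_invol B"
    if m: "m \<in> fpf_invol A" and g: "bij_betw g A B" for m :: "'x \<Rightarrow> 'x" and g :: "'x \<Rightarrow> 'y" and A B
  proof -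
    have mp: "m permutes A" and mm: "\<And>i. m (m i) = i" and mn: "\<And>i. i \<in> A \<Longrightarrow> m i \<noteq> i" using m by (auto simp: fpf_invol_def)
    have gi: "inj_on g A" and gB: "B = g ` A" using g by (auto simp: bij_betw_def)
    have P: "map_permutation A g m permutes B" by (rule map_permutation_permutes[OF g mp])
    have ap: "map_permutation A g m (g i) = g (m i)" if "i \<in> A" for i by (rule map_permutation_apply[OF gi that])
    have mA: "m i \<in> A" if "i \<in> A" for i using that permutes_in_image[OF mp] by blast
    have "map_permutation A g m (map_permutation A g m b) = b" for b
    proof (cases "b \<in> B")
      case True
      then obtain i where i: "i \<in> A" "b = g i" using gB by blast
      then show ?thesis using ap[of i] ap[of "m i"] mA[of i] mm[of i] by simp
    next
      case False
      then show ?thesis using permutes_not_in[OF P False] by simp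
    qed
    moreover have "map_permutation A g m b \<noteq> b" if b: "b \<in> B" for b
    proof -
      obtain i where i: "i \<in> A" "b = g i" using b gB by blast
      then show ?thesis using ap[of i] mA[of i] mn[of i] inj_onD[OF gi, of "m i" i] by auto
    qed
    ultimately show ?thesis using P by (simp add: fpf_invol_def)
  qed
  have "hafn (\<lambda>i. p (f i)) J = hafn p (f ` J)"
    unfolding hafn_def
  proof (rule sum.reindex_bij_witness[where j="map_permutation J f" and i="map_permutation (f ` J) (inv_into J f)"])
    fix s assume s': "s \<in> fpf_invol J"
    then have s: "s permutes J" by (simp add: fpf_invol_def)
    show "map_permutation (f ` J) (inv_into J f) (map_permutation J f s) = s"
      by (rule map_permutation_compose_inv[OF bij s]) (simp add: inj)
    show "map_permutation J f s \<in> fpf_invol (f ` J)" by (rule step[OF s' bij])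
    show "of_int (sign (map_permutation J f s)) * (\<Prod>i\<in>f ` J. \<i> * ckern (p i) (p (map_permutation J f s i)))
        = of_int (sign s) * (\<Prod>i\<in>J. \<i> * ckern (p (f i)) (p (f (s i))))"
      by (simp add: sign_map_permutation[OF inj s fin] prod.reindex[OF inj] map_permutation_apply[OF inj])
  next
    fix s assume s': "s \<in> fpf_invol (f ` J)"
    then have s: "s permutes f ` J" by (simp add: fpf_invol_def)
    show "map_permutation J f (map_permutation (f ` J) (inv_into J f) s) = s"
      by (rule map_permutation_compose_inv[OF bij' s]) (auto simp: f_inv_into_f)
    show "map_permutation (f ` J) (inv_into J f) s \<in> fpf_invol J" by (rule step[OF s' bij'])
  qed
  then show ?thesis by simp
qed

lemma Psi_image:
  assumes inj: "inj_on f I" and fin: "finite I"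
  shows "Psi p (f ` I) = Psi (\<lambda>i. p (f i)) I"
proof -
  have P: "Pow (f ` I) = (\<lambda>S. f ` S) ` Pow I" by (auto elim!: subset_imageE)
  have "Psi p (f ` I) = (\<Sum>S\<in>Pow I. hafn p (f ` S) * permdet (\<lambda>i j. kern (p i) (p j)) (f ` I - f ` S))"
    unfolding Psi_def P by (simp add: sum.reindex[OF inj_on_image_Pow[OF inj]])
  also have "\<dots> = Psi (\<lambda>i. p (f i)) I"
    unfolding Psi_def
  proof (rule sum.cong[OF refl])
    fix S assume "S \<in> Pow I"
    then have S: "S \<subseteq> I" by simp
    have d: "f ` I - f ` S = f ` (I - S)" using inj_on_image_set_diff[OF inj Diff_subset S] by simp
    have h: "hafn p (f ` S) = hafn (\<lambda>i. p (f i)) S"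
      by (rule hafn_image[OF inj_on_subset[OF inj S] finite_subset[OF S fin]])
    have k: "permdet (\<lambda>i j. kern (p i) (p j)) (f ` (I - S)) = permdet (\<lambda>i j. kern (p (f i)) (p (f j))) (I - S)"
      by (rule permdet_image[OF inj_on_subset[OF inj]]) (use fin in auto)
    show "hafn p (f ` S) * permdet (\<lambda>i j. kern (p i) (p j)) (f ` I - f ` S)
       = hafn (\<lambda>i. p (f i)) S * permdet (\<lambda>i j. kern (p (f i)) (p (f j))) (I - S)"
      unfolding d h k ..
  qed
  finally show ?thesis .
qed

text \<open>The unions of 2-cycles of \<rho>: the possible supports of a pairing that was merged
  into \<rho>.\<close>

definition paired_sets :: "'i set \<Rightarrow> ('i \<Rightarrow> 'i) \<Rightarrow> 'i set set" where
  "paired_sets I \<rho> = {S. S \<subseteq> I \<and> (\<forall>i\<in>S. \<rho> i \<in> S \<and> \<rho> (\<rho> i) = i \<and> \<rho> i \<noteq> i)}"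

lemma involution_permutes:
  assumes "\<And>i. m (m i) = i" "\<And>i. i \<notin> S \<Longrightarrow> m i = i"
  shows "m permutes S"
  unfolding permutes_def
proof (intro conjI allI impI)
  fix y show "\<exists>!x. m x = y"
    by (rule ex1I[of _ "m y"]) (use assms(1) in auto)
qed (rule assms(2))

text \<open>A pairing m of S and a permutation s of the complement have disjoint supports, so they
  combine to \<rho> = \<open>m \<circ> s\<close> with multiplicative sign. Conversely \<rho> and S
  determine both.\<close>

lemma Psi_permutation_expansion:
  fixes p :: "'i \<Rightarrow> complex"
  assumes fin: "finite I"
  shows "Psi p I = (\<Sum>\<rho> | \<rho> permutes I. of_int (sign \<rho>) *
     (\<Sum>S\<in>paired_sets I \<rho>. (\<Prod>i\<in>S. \<i> * ckern (p i) (p (\<rho> i))) * (\<Prod>i\<in>I - S. kern (p i) (p (\<rho> i)))))"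
proof -
  let ?c = "\<lambda>i j. \<i> * ckern (p i) (p j)" and ?k = "\<lambda>i j. kern (p i) (p j)"
  let ?T = "Sigma (Pow I) (\<lambda>S. fpf_invol S \<times> {s. s permutes I - S})"
  let ?U = "Sigma {\<rho>. \<rho> permutes I} (paired_sets I)"
  have finF: "finite (fpf_invol S)" "finite {s. s permutes I - S}" if "S \<in> Pow I" for S
    using fin that by (auto intro: finite_fpf_invol finite_permutations finite_subset)
  have finP: "finite (paired_sets I \<rho>)" for \<rho>
    by (rule finite_subset[of _ "Pow I"]) (auto simp: paired_sets_def fin)
  have "Psi p I = (\<Sum>S\<in>Pow I. \<Sum>(m, s)\<in>fpf_invol S \<times> {s. s permutes I - S}.
      (of_int (sign m) * (\<Prod>i\<in>S. ?c i (m i))) * (of_int (sign s) * (\<Prod>i\<in>I - S. ?k i (s i))))"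
    unfolding Psi_def hafn_def permdet_def by (simp add: sum_product sum.cartesian_product)
  also have "\<dots> = (\<Sum>(S, m, s)\<in>?T. (of_int (sign m) * (\<Prod>i\<in>S. ?c i (m i))) * (of_int (sign s) * (\<Prod>i\<in>I - S. ?k i (s i))))"
    using fin finF by (subst sum.Sigma) (auto simp: case_prod_beta)
  also have "\<dots> = (\<Sum>(\<rho>, S)\<in>?U. of_int (sign \<rho>) * ((\<Prod>i\<in>S. ?c i (\<rho> i)) * (\<Prod>i\<in>I - S. ?k i (\<rho> i))))"
  proof (rule sum.reindex_bij_witness[where j="\<lambda>(S, m, s). (m \<circ> s, S)"
        and i="\<lambda>(\<rho>, S). (S, \<lambda>i. if i \<in> S then \<rho> i else i, \<lambda>i. if i \<in> S then i else \<rho> i)"])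
    fix a assume "a \<in> ?T"
    then obtain S m s where a: "a = (S, m, s)" and S: "S \<subseteq> I" and m: "m \<in> fpf_invol S" and s: "s permutes I - S" by auto
    have mp: "m permutes S" and mm: "\<And>i. m (m i) = i" and mn: "\<And>i. i \<in> S \<Longrightarrow> m i \<noteq> i" using m by (auto simp: fpf_invol_def)
    have finS: "finite S" using S fin by (rule finite_subset)
    have sS: "s i = i" if "i \<in> S" for i using permutes_not_in[OF s, of i] that by auto
    have sI: "s i \<in> I - S" if "i \<in> I - S" for i using permutes_in_image[OF s, of i] that by auto
    have mS: "m i \<in> S" if "i \<in> S" for i using permutes_in_image[OF mp, of i] that by auto
    have mI: "m i = i" if "i \<notin> S" for i using permutes_not_in[OF mp that] .
    have sN: "s i \<notin> S" if "i \<notin> S" for i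
      using sI[of i] permutes_not_in[OF s, of i] that by (cases "i \<in> I") auto
    have c1: "(m \<circ> s) i = m i" if "i \<in> S" for i using sS[OF that] by simp
    have c2: "(m \<circ> s) i = s i" if "i \<notin> S" for i using mI[OF sN[OF that]] by simp
    show "(case (case a of (S, m, s) \<Rightarrow> (m \<circ> s, S)) of (\<rho>, S) \<Rightarrow>
        (S, \<lambda>i. if i \<in> S then \<rho> i else i, \<lambda>i. if i \<in> S then i else \<rho> i)) = a"
    proof -
      have "(if i \<in> S then (m \<circ> s) i else i) = m i" for i by (cases "i \<in> S") (simp_all add: c1 mI del: comp_apply)
      moreover have "(if i \<in> S then i else (m \<circ> s) i) = s i" for i by (cases "i \<in> S") (simp_all add: c2 sS del: comp_apply)
      ultimately show ?thesis unfolding a prod.case by presburger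
    qed
    have "m \<circ> s permutes I" by (rule permutes_compose[OF permutes_subset[OF s] permutes_subset[OF mp S]]) auto
    moreover have "S \<in> paired_sets I (m \<circ> s)"
      using S c1 mS mm mn by (auto simp: paired_sets_def simp del: comp_apply)
    ultimately show "(case a of (S, m, s) \<Rightarrow> (m \<circ> s, S)) \<in> ?U" unfolding a by simp
    have sg: "sign (m \<circ> s) = sign m * sign s"
      using mp s finS fin by (intro sign_compose permutation_permutes[THEN iffD2]) auto
    have "(\<Prod>i\<in>S. ?c i ((m \<circ> s) i)) = (\<Prod>i\<in>S. ?c i (m i))" by (intro prod.cong refl) (simp only: c1)
    moreover have "(\<Prod>i\<in>I - S. ?k i ((m \<circ> s) i)) = (\<Prod>i\<in>I - S. ?k i (s i))"
    proof (rule prod.cong[OF refl])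
      fix i assume "i \<in> I - S"
      then have e: "(m \<circ> s) i = s i" by (intro c2) blast
      show "?k i ((m \<circ> s) i) = ?k i (s i)" unfolding e ..
    qed
    ultimately show "(case case a of (S, m, s) \<Rightarrow> (m \<circ> s, S) of (\<rho>, S) \<Rightarrow>
        of_int (sign \<rho>) * ((\<Prod>i\<in>S. ?c i (\<rho> i)) * (\<Prod>i\<in>I - S. ?k i (\<rho> i))))
      = (case a of (S, m, s) \<Rightarrow> (of_int (sign m) * (\<Prod>i\<in>S. ?c i (m i))) * (of_int (sign s) * (\<Prod>i\<in>I - S. ?k i (s i))))"
      unfolding a prod.case sg by simp
  next
    fix a assume "a \<in> ?U"
    then obtain \<rho> S where a: "a = (\<rho>, S)" and r: "\<rho> permutes I" and S: "S \<subseteq> I"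
      and P: "\<And>i. i \<in> S \<Longrightarrow> \<rho> i \<in> S" "\<And>i. i \<in> S \<Longrightarrow> \<rho> (\<rho> i) = i" "\<And>i. i \<in> S \<Longrightarrow> \<rho> i \<noteq> i"
      by (auto simp: paired_sets_def)
    let ?m = "\<lambda>i. if i \<in> S then \<rho> i else i" and ?s = "\<lambda>i. if i \<in> S then i else \<rho> i"
    have N: "\<rho> i \<notin> S" if "i \<notin> S" for i
    proof
      assume "\<rho> i \<in> S"
      then have "\<rho> (\<rho> (\<rho> i)) = \<rho> i" "\<rho> (\<rho> i) \<in> S" using P by auto
      then have "\<rho> (\<rho> i) = i" using permutes_inj[OF r] by (auto dest: injD)
      then show False using \<open>\<rho> (\<rho> i) \<in> S\<close> that by simp
    qed
    have mm: "?m (?m i) = i" for i using P by auto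
    have "?m permutes S" by (rule involution_permutes[OF mm]) simp
    then have mI: "?m \<in> fpf_invol S" using mm P(3) by (auto simp: fpf_invol_def)
    have s': "?s = ?m \<circ> \<rho>" using P N by (auto simp: fun_eq_iff)
    have "?s permutes I" unfolding s'
      by (rule permutes_compose[OF r permutes_subset[OF \<open>?m permutes S\<close> S]])
    then have s: "?s permutes I - S" by (rule permutes_superset) auto
    have ms: "?m \<circ> ?s = \<rho>" using N by (auto simp: fun_eq_iff)
    show "(case (case a of (\<rho>, S) \<Rightarrow> (S, \<lambda>i. if i \<in> S then \<rho> i else i, \<lambda>i. if i \<in> S then i else \<rho> i)) of (S, m, s) \<Rightarrow> (m \<circ> s, S)) = a"
      unfolding a prod.case ms ..
    show "(case a of (\<rho>, S) \<Rightarrow> (S, \<lambda>i. if i \<in> S then \<rho> i else i, \<lambda>i. if i \<in> S then i else \<rho> i)) \<in> ?T"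
      unfolding a prod.case using S mI s by simp
  qed
  also have "\<dots> = (\<Sum>\<rho> | \<rho> permutes I. \<Sum>S\<in>paired_sets I \<rho>. of_int (sign \<rho>) * ((\<Prod>i\<in>S. ?c i (\<rho> i)) * (\<Prod>i\<in>I - S. ?k i (\<rho> i))))"
    using fin finP by (subst sum.Sigma[symmetric]) (auto intro: finite_permutations)
  finally show ?thesis by (simp only: sum_distrib_left)
qed

text \<open>R holds one point of each 2-cycle. A set S decides independently for every 2-cycle
  whether it is paired or left to the determinant, so the sum factors. The minus sign is the square
  of \<i>.\<close>

lemma paired_sets_sum:
  fixes c k :: "'i \<Rightarrow> complex"
  assumes fin: "finite I" and r: "\<rho> permutes I" and R: "R \<inter> \<rho> ` R = {}"
    "R \<union> \<rho> ` R = {i \<in> I. \<rho> i \<noteq> i \<and> \<rho> (\<rho> i) = i}" (is "_ = ?T")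
  shows "(\<Sum>S\<in>paired_sets I \<rho>. (\<Prod>i\<in>S. \<i> * c i) * (\<Prod>i\<in>I - S. k i))
    = (\<Prod>i\<in>I - ?T. k i) * (\<Prod>i\<in>R. k i * k (\<rho> i) - c i * c (\<rho> i))"
proof -
  have inj: "inj_on \<rho> X" for X using permutes_inj[OF r] by (rule inj_on_subset) simp
  have RI: "R \<subseteq> I" "\<rho> ` R \<subseteq> I" and Rr: "\<And>i. i \<in> R \<Longrightarrow> \<rho> (\<rho> i) = i \<and> \<rho> i \<noteq> i" using R(2) by blast+
  have finR: "finite R" using RI(1) fin by (rule finite_subset)
  have Un: "(\<Prod>i\<in>Q \<union> \<rho> ` Q. h i) = (\<Prod>i\<in>Q. h i * h (\<rho> i))" if "Q \<subseteq> R" for Q and h :: "'i \<Rightarrow> complex"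
  proof -
    have "finite Q" by (rule finite_subset[OF that finR])
    moreover have "Q \<inter> \<rho> ` Q = {}" using that R(1) by blast
    ultimately show ?thesis by (simp add: prod.union_disjoint prod.reindex[OF inj] prod.distrib)
  qed
  have "(\<Sum>S\<in>paired_sets I \<rho>. (\<Prod>i\<in>S. \<i> * c i) * (\<Prod>i\<in>I - S. k i))
     = (\<Sum>Q\<in>Pow R. (\<Prod>i\<in>I - ?T. k i) * ((\<Prod>i\<in>Q. - (c i * c (\<rho> i))) * (\<Prod>i\<in>R - Q. k i * k (\<rho> i))))"
  proof (rule sum.reindex_bij_witness[where j="\<lambda>S. S \<inter> R" and i="\<lambda>Q. Q \<union> \<rho> ` Q"])
    fix S assume S: "S \<in> paired_sets I \<rho>"
    have ST: "S \<subseteq> ?T" and SP: "\<And>i. i \<in> S \<Longrightarrow> \<rho> i \<in> S \<and> \<rho> (\<rho> i) = i" using S by (auto simp: paired_sets_def)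
    have SU: "S \<inter> R \<union> \<rho> ` (S \<inter> R) = S"
    proof (intro subset_antisym subsetI)
      fix i assume "i \<in> S \<inter> R \<union> \<rho> ` (S \<inter> R)" then show "i \<in> S" using SP by auto
    next
      fix i assume i: "i \<in> S"
      then have "i \<in> R \<union> \<rho> ` R" using ST R(2) by blast
      then show "i \<in> S \<inter> R \<union> \<rho> ` (S \<inter> R)"
      proof
        assume "i \<in> \<rho> ` R"
        then obtain j where j: "j \<in> R" "i = \<rho> j" by blast
        then have "j \<in> S" using SP[OF i] Rr[of j] by simp
        then show ?thesis using j by blast
      qed (use i in blast)
    qed
    then show "S \<inter> R \<union> \<rho> ` (S \<inter> R) = S" .
    show "S \<inter> R \<in> Pow R" by blast
    have C: "I - S = (I - ?T) \<union> ((R - S \<inter> R) \<union> \<rho> ` (R - S \<inter> R))"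
    proof -
      have "\<rho> ` (R - S \<inter> R) = \<rho> ` R - \<rho> ` (S \<inter> R)" by (rule inj_on_image_set_diff[OF inj]) auto
      moreover have "I - S = (I - T') \<union> ((R - S \<inter> R) \<union> (X - Y))"
        if "S = (S \<inter> R) \<union> Y" "Y \<subseteq> X" "R \<union> X = T'" "R \<inter> X = {}" "R \<subseteq> I" "X \<subseteq> I" for X Y T'
        using that by blast
      ultimately show ?thesis using SU[symmetric] R RI by (metis (no_types, lifting) Int_lower2 image_mono)
    qed
    have "(\<Prod>i\<in>I - S. k i) = (\<Prod>i\<in>I - ?T. k i) * (\<Prod>i\<in>(R - S \<inter> R) \<union> \<rho> ` (R - S \<inter> R). k i)"
      unfolding C by (rule prod.union_disjoint) (use fin finR R in auto)
    also have "(\<Prod>i\<in>(R - S \<inter> R) \<union> \<rho> ` (R - S \<inter> R). k i) = (\<Prod>i\<in>R - S \<inter> R. k i * k (\<rho> i))" by (rule Un) auto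
    finally have 1: "(\<Prod>i\<in>I - S. k i) = (\<Prod>i\<in>I - ?T. k i) * (\<Prod>i\<in>R - S \<inter> R. k i * k (\<rho> i))" .
    have "(\<Prod>i\<in>S. \<i> * c i) = (\<Prod>i\<in>S \<inter> R \<union> \<rho> ` (S \<inter> R). \<i> * c i)" by (simp only: SU)
    also have "\<dots> = (\<Prod>i\<in>S \<inter> R. (\<i> * c i) * (\<i> * c (\<rho> i)))" by (rule Un) auto
    also have "\<dots> = (\<Prod>i\<in>S \<inter> R. - (c i * c (\<rho> i)))"
    proof (rule prod.cong[OF refl])
      fix i
      have "(\<i> * c i) * (\<i> * c (\<rho> i)) = (\<i> * \<i>) * (c i * c (\<rho> i))" by (simp only: mult_ac)
      then show "(\<i> * c i) * (\<i> * c (\<rho> i)) = - (c i * c (\<rho> i))" by simp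
    qed
    finally show "(\<Prod>i\<in>I - ?T. k i) * ((\<Prod>i\<in>S \<inter> R. - (c i * c (\<rho> i))) * (\<Prod>i\<in>R - S \<inter> R. k i * k (\<rho> i)))
       = (\<Prod>i\<in>S. \<i> * c i) * (\<Prod>i\<in>I - S. k i)" using 1 by (simp only: mult_ac)
  next
    fix Q assume "Q \<in> Pow R"
    then have Q: "Q \<subseteq> R" by simp
    show "(Q \<union> \<rho> ` Q) \<inter> R = Q" using Q R(1) by blast
    show "Q \<union> \<rho> ` Q \<in> paired_sets I \<rho>"
      unfolding paired_sets_def
    proof (intro CollectI conjI ballI)
      show "Q \<union> \<rho> ` Q \<subseteq> I" using Q RI by blast
      fix i assume "i \<in> Q \<union> \<rho> ` Q"
      then obtain q where q: "q \<in> Q" "i = q \<or> i = \<rho> q" by blast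
      have f: "\<rho> (\<rho> q) = q" "\<rho> q \<noteq> q" using Rr[of q] q(1) Q by auto
      show "\<rho> i \<in> Q \<union> \<rho> ` Q" using q f(1) by auto
      show "\<rho> (\<rho> i) = i" using q(2) f(1) by auto
      show "\<rho> i \<noteq> i" using q(2) f by auto
    qed
  qed
  also have "\<dots> = (\<Prod>i\<in>I - ?T. k i) * (\<Prod>i\<in>R. - (c i * c (\<rho> i)) + k i * k (\<rho> i))"
    by (simp only: sum_distrib_left[symmetric] prod_add[OF finR])
  also have "(\<Prod>i\<in>R. - (c i * c (\<rho> i)) + k i * k (\<rho> i)) = (\<Prod>i\<in>R. k i * k (\<rho> i) - c i * c (\<rho> i))" by simp
  finally show ?thesis .
qed

lemma kern_lower':
  assumes "Im a < 0" "a \<noteq> b"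
  shows "kern a b = exp (2 * \<i> * of_real pi * (b - a)) * (1 / (a - b))"
proof -
  have "- u / (b - a) = u * (1 / (a - b))" for u :: complex
    using minus_divide_divide[of u "a - b"] by simp
  then show ?thesis by (simp only: kern_lower[OF assms] right_diff_distrib exp_diff)
qed

text \<open>Both products are -1 / (a - b)^2: above the axis trivially, below because the
  exponentials of the two factors are inverse to each other.\<close>

lemma same_side_two_cycle:
  assumes "Im a \<noteq> 0" "Im b \<noteq> 0" "Im a < 0 \<longleftrightarrow> Im b < 0" "a \<noteq> b"
  shows "kern a b * kern b a - ckern a b * ckern b a = 0"
proof (cases "Im a < 0")
  case True
  then have "kern a b * kern b a = (exp (2 * \<i> * of_real pi * (b - a)) * exp (2 * \<i> * of_real pi * (a - b))) * (ckern a b * ckern b a)"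
    using assms by (simp add: kern_lower' ckern_def)
  also have "exp (2 * \<i> * of_real pi * (b - a)) * exp (2 * \<i> * of_real pi * (a - b)) = 1"
    unfolding exp_add[symmetric] by (simp add: right_diff_distrib)
  finally show ?thesis by simp
next
  case False
  then have "Im a > 0" "Im b > 0" using assms by auto
  then show ?thesis by (simp add: kern_upper ckern_def)
qed

text \<open>Only the factor starting below the axis carries an exponential u. The difference
  contains u - 1 = u (1 - v) with u v = 1, which is the shape with \<open>A\<close> in the
  exponent.\<close>

lemma opposite_side_two_cycle:
  assumes "Im a < 0" "Im b > 0"
  shows "kern a b * kern b a - ckern a b * ckern b a
    = (1 / (a - b)) * (1 / (b - a)) * exp (2 * \<i> * of_real pi * (b - a)) * (1 - exp (2 * \<i> * of_real pi * (a - b)))"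
proof -
  have ab: "a \<noteq> b" using assms by auto
  have e: "exp (2 * \<i> * of_real pi * (b - a)) * exp (2 * \<i> * of_real pi * (a - b)) = 1"
    unfolding exp_add[symmetric] by (simp add: right_diff_distrib)
  have "(u * h) * h' - h * h' = h * h' * u * (1 - v)" if "u * v = 1" for u v h h' :: complex
  proof -
    have "h * h' * u * (1 - v) = h * h' * (u - u * v)" by (simp add: algebra_simps)
    then show ?thesis using that by (simp add: algebra_simps)
  qed
  note alg = this[OF e]
  have k: "kern b a = 1 / (b - a)" "ckern a b = 1 / (a - b)" "ckern b a = 1 / (b - a)"
    using assms by (simp_all add: kern_upper ckern_def)
  show ?thesis unfolding kern_lower'[OF assms(1) ab] k by (rule alg)
qed

text \<open>A fixed point above the axis gives a zero diagonal entry and a 2-cycle on one side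
  cancels, which leaves exactly \<open>perms_kA\<close>. In the surviving terms each point of
  \<open>A\<close> contributes one exponential, and each 2-cycle one extra factor, attached to its
  point in \<open>A\<close>.\<close>

lemma Psi_closed_form:
  assumes inj: "inj_on z {1..k}" and re: "\<And>j. j \<in> {1..k} \<Longrightarrow> Im (z j) \<noteq> 0"
    and A: "A = {j \<in> {1..k}. Im (z j) < 0}"
  shows "Psi z {1..k} = (\<Sum>\<rho>\<in>perms_kA k A.
        of_int (sign \<rho>) * (- 2 * \<i> * of_real pi) ^ card (fixed_pts k \<rho>) *
        (\<Prod>j\<in>{1..k} - fixed_pts k \<rho>. inverse (z (Hilbert_Choice.inv \<rho> j) - z j)) *
        exp (2 * \<i> * of_real pi * (\<Sum>j\<in>A. z (\<rho> j) - z j)) *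
        (\<Prod>j\<in>two_cycle_pts_in k \<rho> A. 1 - exp (2 * \<i> * of_real pi * (z j - z (\<rho> j)))))"
proof -
  let ?I = "{1..k}"
  define W where "W \<rho> = (\<Sum>S\<in>paired_sets ?I \<rho>. (\<Prod>i\<in>S. \<i> * ckern (z i) (z (\<rho> i))) * (\<Prod>i\<in>?I - S. kern (z i) (z (\<rho> i))))" for \<rho>
  have T: "two_cycle_pts k \<rho> = {i \<in> ?I. \<rho> i \<noteq> i \<and> \<rho> (\<rho> i) = i}" for \<rho> by (simp add: two_cycle_pts_def)
  have Weq: "W \<rho> = (\<Prod>i\<in>?I - two_cycle_pts k \<rho>. kern (z i) (z (\<rho> i))) *
      (\<Prod>i\<in>R. kern (z i) (z (\<rho> i)) * kern (z (\<rho> i)) (z i) - ckern (z i) (z (\<rho> i)) * ckern (z (\<rho> i)) (z i))"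
    if "\<rho> permutes ?I" "R \<inter> \<rho> ` R = {}" "R \<union> \<rho> ` R = two_cycle_pts k \<rho>" for \<rho> R
  proof -
    have Rr: "\<rho> (\<rho> i) = i" if "i \<in> R" for i using that \<open>R \<union> \<rho> ` R = _\<close> unfolding T by blast
    have P: "W \<rho> = (\<Prod>i\<in>?I - two_cycle_pts k \<rho>. kern (z i) (z (\<rho> i))) *
      (\<Prod>i\<in>R. kern (z i) (z (\<rho> i)) * kern (z (\<rho> i)) (z (\<rho> (\<rho> i))) - ckern (z i) (z (\<rho> i)) * ckern (z (\<rho> i)) (z (\<rho> (\<rho> i))))"
      unfolding W_def T by (rule paired_sets_sum[OF finite_atLeastAtMost that(1,2) that(3)[unfolded T]])
    have Q: "(\<Prod>i\<in>R. kern (z i) (z (\<rho> i)) * kern (z (\<rho> i)) (z (\<rho> (\<rho> i))) - ckern (z i) (z (\<rho> i)) * ckern (z (\<rho> i)) (z (\<rho> (\<rho> i))))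
      = (\<Prod>i\<in>R. kern (z i) (z (\<rho> i)) * kern (z (\<rho> i)) (z i) - ckern (z i) (z (\<rho> i)) * ckern (z (\<rho> i)) (z i))"
      by (rule prod.cong[OF refl]) (simp only: Rr)
    show ?thesis unfolding P Q ..
  qed
  have zero: "W \<rho> = 0" if r: "\<rho> permutes ?I" and n: "\<rho> \<notin> perms_kA k A" for \<rho>
  proof -
    \<comment> \<open>Representatives are chosen by order, since here a 2-cycle may have both points
      or no point in \<open>A\<close>.\<close>
    define R where "R = {j \<in> two_cycle_pts k \<rho>. j < \<rho> j}"
    have rI: "\<rho> i \<in> ?I" if "i \<in> ?I" for i using permutes_in_image[OF r, of i] that by auto
    have rT: "\<rho> i \<in> two_cycle_pts k \<rho>" "\<rho> (\<rho> i) = i" "\<rho> i \<noteq> i" if "i \<in> two_cycle_pts k \<rho>" for i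
      using that rI by (auto simp: T)
    have R: "R \<inter> \<rho> ` R = {}" "R \<union> \<rho> ` R = two_cycle_pts k \<rho>"
    proof -
      show "R \<inter> \<rho> ` R = {}"
      proof (rule equals0I)
        fix x assume "x \<in> R \<inter> \<rho> ` R"
        then obtain j where j: "j \<in> R" "\<rho> j \<in> R" by blast
        then have "j < \<rho> j" "\<rho> j < \<rho> (\<rho> j)" "\<rho> (\<rho> j) = j" using rT(2) by (auto simp: R_def)
        then show False by simp
      qed
      show "R \<union> \<rho> ` R = two_cycle_pts k \<rho>"
      proof (intro subset_antisym subsetI)
        fix i assume "i \<in> R \<union> \<rho> ` R"
        then show "i \<in> two_cycle_pts k \<rho>" using rT(1) by (auto simp: R_def)
      next
        fix i assume i: "i \<in> two_cycle_pts k \<rho>"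
        show "i \<in> R \<union> \<rho> ` R"
        proof (cases "i < \<rho> i")
          case False
          then have "\<rho> i < i" using rT(3)[OF i] by simp
          then have "\<rho> i \<in> R" using rT(1,2)[OF i] by (simp add: R_def)
          then have "\<rho> (\<rho> i) \<in> \<rho> ` R" by (rule imageI)
          then show ?thesis using rT(2)[OF i] by simp
        qed (use i in \<open>simp add: R_def\<close>)
      qed
    qed
    note W = Weq[OF r R]
    have "(\<exists>j\<in>?I. \<rho> j = j \<and> j \<notin> A) \<or> (\<exists>j\<in>two_cycle_pts k \<rho>. j \<in> A \<longleftrightarrow> \<rho> j \<in> A)"
    proof (rule ccontr)
      assume "\<not> ?thesis"
      then have a: "\<forall>j\<in>?I. \<rho> j = j \<longrightarrow> j \<in> A" "\<forall>j\<in>two_cycle_pts k \<rho>. \<not> (j \<in> A \<longleftrightarrow> \<rho> j \<in> A)" by blast+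
      have "\<rho> \<in> perms_kA k A"
        unfolding perms_kA_def mem_Collect_eq
      proof (intro conjI ballI)
        show "fixed_pts k \<rho> \<subseteq> A" using a(1) by (simp add: fixed_pts_def subset_eq)
        show "j \<in> A \<longleftrightarrow> \<rho> j \<notin> A" if "j \<in> two_cycle_pts k \<rho>" for j using a(2) that by blast
      qed (rule r)
      with n show False by contradiction
    qed
    then consider (fixed) j where "j \<in> ?I" "\<rho> j = j" "j \<notin> A"
      | (cycle) j where "j \<in> two_cycle_pts k \<rho>" "j \<in> A \<longleftrightarrow> \<rho> j \<in> A" by blast
    then show ?thesis
    proof cases
      case fixed
      then have "Im (z j) > 0" using re[of j] A by auto
      then have "kern (z j) (z (\<rho> j)) = 0" using fixed by (simp add: kern_upper)
      moreover have "j \<in> ?I - two_cycle_pts k \<rho>" using fixed by (simp add: T)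
      ultimately have "(\<Prod>i\<in>?I - two_cycle_pts k \<rho>. kern (z i) (z (\<rho> i))) = 0" by (intro prod_zero) auto
      then show ?thesis unfolding W by simp
    next
      case cycle
      have jI: "j \<in> ?I" "\<rho> j \<in> ?I" "\<rho> j \<noteq> j" "\<rho> (\<rho> j) = j"
        using rT[OF cycle(1)] cycle(1) by (auto simp: T)
      have s: "kern (z j) (z (\<rho> j)) * kern (z (\<rho> j)) (z j) - ckern (z j) (z (\<rho> j)) * ckern (z (\<rho> j)) (z j) = 0"
        using jI cycle(2) by (intro same_side_two_cycle re) (auto simp: A dest: inj_onD[OF inj])
      have "\<exists>i\<in>R. i = j \<or> i = \<rho> j"
      proof (cases "j \<in> R")
        case False
        then obtain x where x: "x \<in> R" "j = \<rho> x" using cycle(1) R(2) by blast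
        then have "\<rho> j = x" using rT(2)[of x] by (simp add: R_def)
        then show ?thesis using x by blast
      qed blast
      then obtain i where i: "i \<in> R" "i = j \<or> i = \<rho> j" by blast
      have "kern (z i) (z (\<rho> i)) * kern (z (\<rho> i)) (z i) - ckern (z i) (z (\<rho> i)) * ckern (z (\<rho> i)) (z i) = 0"
        using i(2) s jI(4) by (elim disjE) (simp_all add: mult.commute)
      then have "(\<Prod>i\<in>R. kern (z i) (z (\<rho> i)) * kern (z (\<rho> i)) (z i) - ckern (z i) (z (\<rho> i)) * ckern (z (\<rho> i)) (z i)) = 0"
        using i(1) by (intro prod_zero bexI[of _ i]) (simp_all add: R_def T)
      then show ?thesis unfolding W by simp
    qed
  qed
  have val: "W \<rho> = (- 2 * \<i> * of_real pi) ^ card (fixed_pts k \<rho>) *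
        (\<Prod>j\<in>?I - fixed_pts k \<rho>. inverse (z (Hilbert_Choice.inv \<rho> j) - z j)) *
        exp (2 * \<i> * of_real pi * (\<Sum>j\<in>A. z (\<rho> j) - z j)) *
        (\<Prod>j\<in>two_cycle_pts_in k \<rho> A. 1 - exp (2 * \<i> * of_real pi * (z j - z (\<rho> j))))"
    if rA: "\<rho> \<in> perms_kA k A" for \<rho>
  proof -
    have r: "\<rho> permutes ?I" and fx: "fixed_pts k \<rho> \<subseteq> A" and tc: "\<And>j. j \<in> two_cycle_pts k \<rho> \<Longrightarrow> j \<in> A \<longleftrightarrow> \<rho> j \<notin> A"
      using rA by (auto simp: perms_kA_def)
    \<comment> \<open>Every 2-cycle now has exactly one point in \<open>A\<close>, which represents
      it.\<close>
    define R where "R = two_cycle_pts_in k \<rho> A"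
    let ?F = "fixed_pts k \<rho>" and ?T = "two_cycle_pts k \<rho>"
    define h where "h i = inverse (z i - z (\<rho> i))" for i
    \<comment> \<open>At a fixed point this is exp 0 = 1, so the product over fixed and moved points
      together is the exponential of a sum over all of \<open>A\<close>.\<close>
    define e where "e i = (if i \<in> A then exp (2 * \<i> * of_real pi * (z (\<rho> i) - z i)) else 1)" for i
    define d where "d i = 1 - exp (2 * \<i> * of_real pi * (z i - z (\<rho> i)))" for i
    have rI: "\<rho> i \<in> ?I" if "i \<in> ?I" for i using permutes_in_image[OF r, of i] that by auto
    have RT: "R \<subseteq> ?T" "R \<subseteq> A" by (auto simp: R_def two_cycle_pts_in_def)
    have rT: "\<rho> i \<in> ?T" "\<rho> (\<rho> i) = i" "\<rho> i \<noteq> i" if "i \<in> ?T" for i using that rI by (auto simp: T)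
    have R: "R \<inter> \<rho> ` R = {}" "R \<union> \<rho> ` R = ?T"
    proof -
      show "R \<inter> \<rho> ` R = {}" using tc by (auto simp: R_def two_cycle_pts_in_def)
      show "R \<union> \<rho> ` R = ?T"
      proof (intro subset_antisym subsetI)
        fix i assume "i \<in> R \<union> \<rho> ` R" then show "i \<in> ?T" using RT rT(1) by auto
      next
        fix i assume i: "i \<in> ?T"
        show "i \<in> R \<union> \<rho> ` R"
        proof (cases "i \<in> A")
          case False
          then have "\<rho> i \<in> R" using tc[OF i] rT(1)[OF i] by (simp add: R_def two_cycle_pts_in_def)
          then have "\<rho> (\<rho> i) \<in> \<rho> ` R" by (rule imageI)
          then show ?thesis using rT(2)[OF i] by simp
        qed (use i in \<open>simp add: R_def two_cycle_pts_in_def\<close>)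
      qed
    qed
    have finR: "finite R" using RT(1) by (rule finite_subset) (simp add: T)
    have sub: "?F \<subseteq> ?I" "?T \<subseteq> ?I" "?F \<inter> ?T = {}" by (auto simp: fixed_pts_def T)
    have fin: "finite ?F" "finite ?T" using sub by (auto intro: finite_subset)
    have injr: "inj_on \<rho> X" for X using permutes_inj[OF r] by (rule inj_on_subset) simp
    have kF: "kern (z i) (z (\<rho> i)) = (- 2 * \<i> * of_real pi) * e i" if "i \<in> ?F" for i
      using that fx A by (auto simp: fixed_pts_def kern_diagonal e_def)
    have kN: "kern (z i) (z (\<rho> i)) = h i * e i" if "i \<in> ?I - ?T - ?F" for i
    proof -
      have i: "i \<in> ?I" "\<rho> i \<in> ?I" "\<rho> i \<noteq> i" using that rI by (auto simp: fixed_pts_def)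
      then have ne: "z i \<noteq> z (\<rho> i)" using inj_onD[OF inj, of i "\<rho> i"] by metis
      show ?thesis
      proof (cases "i \<in> A")
        case True
        then have "Im (z i) < 0" using A by simp
        then show ?thesis using ne True by (simp add: kern_lower' h_def e_def divide_inverse)
      next
        case False
        then have "Im (z i) > 0" using A re[of i] i by auto
        then show ?thesis using False by (simp add: kern_upper h_def e_def divide_inverse)
      qed
    qed
    have kT: "kern (z i) (z (\<rho> i)) * kern (z (\<rho> i)) (z i) - ckern (z i) (z (\<rho> i)) * ckern (z (\<rho> i)) (z i)
       = (h i * e i) * (h (\<rho> i) * e (\<rho> i)) * d i" if "i \<in> R" for i
    proof -
      have i: "i \<in> ?T" "i \<in> A" "\<rho> i \<notin> A" "\<rho> i \<in> ?I" "\<rho> (\<rho> i) = i"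
      proof -
        show iT: "i \<in> ?T" and iA: "i \<in> A" using that RT by auto
        show "\<rho> i \<notin> A" using tc[OF iT] iA by simp
        show "\<rho> i \<in> ?I" using rT(1)[OF iT] sub(2) by blast
        show "\<rho> (\<rho> i) = i" by (rule rT(2)[OF iT])
      qed
      have "Im (z i) < 0" "Im (z (\<rho> i)) > 0" using i A re[of "\<rho> i"] by auto
      from opposite_side_two_cycle[OF this] show ?thesis using i by (simp add: h_def e_def d_def divide_inverse)
    qed
    have IN: "?I - ?T = ?F \<union> (?I - ?T - ?F)" using sub by blast
    have P1: "(\<Prod>i\<in>?I - ?T. kern (z i) (z (\<rho> i))) = (- 2 * \<i> * of_real pi) ^ card ?F * (\<Prod>i\<in>?F. e i) * (\<Prod>i\<in>?I - ?T - ?F. h i * e i)"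
    proof -
      have "(\<Prod>i\<in>?I - ?T. kern (z i) (z (\<rho> i))) = (\<Prod>i\<in>?F. kern (z i) (z (\<rho> i))) * (\<Prod>i\<in>?I - ?T - ?F. kern (z i) (z (\<rho> i)))"
        by (subst IN, rule prod.union_disjoint) (use fin in auto)
      also have "(\<Prod>i\<in>?F. kern (z i) (z (\<rho> i))) = (\<Prod>i\<in>?F. (- 2 * \<i> * of_real pi) * e i)" by (rule prod.cong[OF refl kF])
      also have "(\<Prod>i\<in>?F. (- 2 * \<i> * of_real pi) * e i) = (- 2 * \<i> * of_real pi) ^ card ?F * (\<Prod>i\<in>?F. e i)"
        unfolding prod.distrib[of "\<lambda>_. - 2 * \<i> * complex_of_real pi" e] prod_constant ..
      also have "(\<Prod>i\<in>?I - ?T - ?F. kern (z i) (z (\<rho> i))) = (\<Prod>i\<in>?I - ?T - ?F. h i * e i)" by (rule prod.cong[OF refl kN])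
      finally show ?thesis .
    qed
    have P2: "(\<Prod>i\<in>?T. g i) = (\<Prod>i\<in>R. g i * g (\<rho> i))" for g :: "nat \<Rightarrow> complex"
      unfolding R(2)[symmetric] using finR R(1) by (simp add: prod.union_disjoint prod.reindex[OF injr] prod.distrib)
    have "(\<Prod>i\<in>R. kern (z i) (z (\<rho> i)) * kern (z (\<rho> i)) (z i) - ckern (z i) (z (\<rho> i)) * ckern (z (\<rho> i)) (z i))
       = (\<Prod>i\<in>R. (h i * e i) * (h (\<rho> i) * e (\<rho> i)) * d i)" by (rule prod.cong[OF refl kT])
    also have "\<dots> = (\<Prod>i\<in>?T. h i * e i) * (\<Prod>i\<in>R. d i)" by (simp only: P2 prod.distrib mult_ac)
    finally have P3: "W \<rho> = (- 2 * \<i> * of_real pi) ^ card ?F * (\<Prod>i\<in>?F. e i) * (\<Prod>i\<in>?I - ?T - ?F. h i * e i) * ((\<Prod>i\<in>?T. h i * e i) * (\<Prod>i\<in>R. d i))"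
      unfolding Weq[OF r R] P1 by simp
    have IF: "?I - ?F = (?I - ?T - ?F) \<union> ?T" using sub by blast
    have P4: "(\<Prod>i\<in>?I - ?F. h i * e i) = (\<Prod>i\<in>?I - ?T - ?F. h i * e i) * (\<Prod>i\<in>?T. h i * e i)"
      by (subst IF, rule prod.union_disjoint) (use fin in auto)
    have P5: "(\<Prod>i\<in>?I. e i) = (\<Prod>i\<in>?I - ?F. e i) * (\<Prod>i\<in>?F. e i)"
      by (rule prod.subset_diff) (use sub in auto)
    have AI: "A \<subseteq> ?I" using A by auto
    have P6: "(\<Prod>i\<in>?I. e i) = exp (2 * \<i> * of_real pi * (\<Sum>j\<in>A. z (\<rho> j) - z j))"
    proof -
      have "(\<Prod>i\<in>?I. e i) = (\<Prod>i\<in>A. exp (2 * \<i> * of_real pi * (z (\<rho> i) - z i)))"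
        unfolding e_def using AI by (intro prod.mono_neutral_cong_right) auto
      also have "\<dots> = exp (\<Sum>i\<in>A. 2 * \<i> * of_real pi * (z (\<rho> i) - z i))"
        by (rule exp_sum[symmetric]) (use AI in \<open>auto intro: finite_subset\<close>)
      finally show ?thesis by (simp only: sum_distrib_left)
    qed
    \<comment> \<open>Substituting j = \<rho> i turns the factor at j into the arrow factor
      \<open>h i\<close>; \<rho> maps moved points to moved points.\<close>
    have P7: "(\<Prod>j\<in>?I - ?F. inverse (z (Hilbert_Choice.inv \<rho> j) - z j)) = (\<Prod>i\<in>?I - ?F. h i)"
    proof (rule sym, rule prod.reindex_bij_witness[where j=\<rho> and i="Hilbert_Choice.inv \<rho>"])
      fix i assume i: "i \<in> ?I - ?F"
      show "Hilbert_Choice.inv \<rho> (\<rho> i) = i" by (rule permutes_inverses(2)[OF r])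
      have "\<rho> (\<rho> i) \<noteq> \<rho> i" using i injD[OF permutes_inj[OF r], of "\<rho> i" i] by (auto simp: fixed_pts_def)
      then show "\<rho> i \<in> ?I - ?F" using i rI by (simp add: fixed_pts_def)
      show "inverse (z (Hilbert_Choice.inv \<rho> (\<rho> i)) - z (\<rho> i)) = h i" by (simp add: h_def permutes_inverses(2)[OF r])
    next
      fix j assume j: "j \<in> ?I - ?F"
      show jj: "\<rho> (Hilbert_Choice.inv \<rho> j) = j" by (rule permutes_inverses(1)[OF r])
      have "Hilbert_Choice.inv \<rho> j \<in> ?I" using permutes_in_image[OF permutes_inv[OF r], of j] j by blast
      moreover have "\<rho> (Hilbert_Choice.inv \<rho> j) \<noteq> Hilbert_Choice.inv \<rho> j"
      proof
        assume "\<rho> (Hilbert_Choice.inv \<rho> j) = Hilbert_Choice.inv \<rho> j"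
        then have "Hilbert_Choice.inv \<rho> j = j" using jj by simp
        then show False using jj j by (auto simp: fixed_pts_def)
      qed
      ultimately show "Hilbert_Choice.inv \<rho> j \<in> ?I - ?F" by (simp add: fixed_pts_def)
    qed
    have alg: "c * f * n * (t * q) = c * h' * (e' * f) * q" if "h' * e' = n * t" for c f n t q h' e' :: complex
    proof -
      have "c * f * n * (t * q) = c * f * (n * t) * q" by (simp only: mult_ac)
      also have "\<dots> = c * h' * (e' * f) * q" unfolding that[symmetric] by (simp only: mult_ac)
      finally show ?thesis .
    qed
    have "W \<rho> = (- 2 * \<i> * of_real pi) ^ card ?F * (\<Prod>i\<in>?I - ?F. h i) * ((\<Prod>i\<in>?I - ?F. e i) * (\<Prod>i\<in>?F. e i)) * (\<Prod>i\<in>R. d i)"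
      unfolding P3 by (rule alg) (rule P4[unfolded prod.distrib[of h e "?I - ?F"]])
    then show ?thesis unfolding P5[symmetric] P6 P7 unfolding d_def R_def .
  qed
  have "Psi z ?I = (\<Sum>\<rho> | \<rho> permutes ?I. of_int (sign \<rho>) * W \<rho>)"
    unfolding W_def by (rule Psi_permutation_expansion) simp
  also have "\<dots> = (\<Sum>\<rho>\<in>perms_kA k A. of_int (sign \<rho>) * W \<rho>)"
  proof (rule sum.mono_neutral_right)
    show "finite {\<rho>. \<rho> permutes ?I}" by (rule finite_permutations) simp
    show "perms_kA k A \<subseteq> {\<rho>. \<rho> permutes ?I}" by (auto simp: perms_kA_def)
    show "\<forall>\<rho>\<in>{\<rho>. \<rho> permutes ?I} - perms_kA k A. of_int (sign \<rho>) * W \<rho> = 0" using zero by simp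
  qed
  finally have P: "Psi z ?I = (\<Sum>\<rho>\<in>perms_kA k A. of_int (sign \<rho>) * W \<rho>)" .
  show ?thesis unfolding P by (rule sum.cong[OF refl]) (simp only: val mult.assoc)
qed

section \<open>Passage to the limit\<close>

text \<open>The squared distance of P n and P m expands into four entries of the Gram matrix with
  signs adding up to 0. The joint limit over both indices puts all four within \<epsilon> / 4 of the
  same l.\<close>

lemma L2_Cauchy:
  fixes P :: "nat \<Rightarrow> 'a \<Rightarrow> complex"
  assumes int: "\<And>n m. n \<ge> N0 \<Longrightarrow> m \<ge> N0 \<Longrightarrow> integrable M (\<lambda>\<omega>. P n \<omega> * cnj (P m \<omega>))"
    and lim: "((\<lambda>(n, m). \<integral>\<omega>. P n \<omega> * cnj (P m \<omega>) \<partial>M) \<longlongrightarrow> l) (sequentially \<times>\<^sub>F sequentially)"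
  shows "\<epsilon> > 0 \<Longrightarrow> \<exists>N. \<forall>n\<ge>N. \<forall>m\<ge>N. (\<integral>\<^sup>+\<omega>. ennreal ((norm (P n \<omega> - P m \<omega>))\<^sup>2) \<partial>M) \<le> ennreal \<epsilon>"
    and "\<exists>C\<ge>0. \<exists>N. \<forall>n\<ge>N. (\<integral>\<^sup>+\<omega>. ennreal ((norm (P n \<omega>))\<^sup>2) \<partial>M) \<le> ennreal C"
proof -
  define a where "a n m = (\<integral>\<omega>. P n \<omega> * cnj (P m \<omega>) \<partial>M)" for n m
  have nn: "(\<integral>\<^sup>+\<omega>. ennreal ((norm (D \<omega>))\<^sup>2) \<partial>M) = ennreal (Re (\<integral>\<omega>. D \<omega> * cnj (D \<omega>) \<partial>M))"
    if D: "integrable M (\<lambda>\<omega>. D \<omega> * cnj (D \<omega>))" for D :: "'a \<Rightarrow> complex"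
  proof -
    have e: "(norm (D \<omega>))\<^sup>2 = Re (D \<omega> * cnj (D \<omega>))" for \<omega> by (simp flip: complex_norm_square)
    have "(\<integral>\<^sup>+\<omega>. ennreal ((norm (D \<omega>))\<^sup>2) \<partial>M) = ennreal (\<integral>\<omega>. (norm (D \<omega>))\<^sup>2 \<partial>M)"
    proof (rule nn_integral_eq_integral)
      show "integrable M (\<lambda>\<omega>. (norm (D \<omega>))\<^sup>2)" unfolding e by (rule Bochner_Integration.integrable_Re[OF D])
    qed simp
    also have "(\<integral>\<omega>. (norm (D \<omega>))\<^sup>2 \<partial>M) = Re (\<integral>\<omega>. D \<omega> * cnj (D \<omega>) \<partial>M)"
      unfolding e by (rule Bochner_Integration.integral_Re[OF D])
    finally show ?thesis .
  qed
  have near: "\<exists>N\<ge>N0. \<forall>n\<ge>N. \<forall>m\<ge>N. norm (a n m - l) \<le> \<delta>" if "\<delta> > 0" for \<delta>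
  proof -
    have "eventually (\<lambda>x. dist ((\<lambda>(n, m). a n m) x) l < \<delta>) (sequentially \<times>\<^sub>F sequentially)"
      using lim that unfolding a_def by (rule tendstoD)
    then obtain N where "\<And>n m. n \<ge> N \<Longrightarrow> m \<ge> N \<Longrightarrow> dist (a n m) l < \<delta>"
      unfolding eventually_prod_sequentially by auto
    then show ?thesis by (intro exI[of _ "max N N0"]) (auto simp: dist_norm intro: less_imp_le)
  qed
  show "\<exists>C\<ge>0. \<exists>N. \<forall>n\<ge>N. (\<integral>\<^sup>+\<omega>. ennreal ((norm (P n \<omega>))\<^sup>2) \<partial>M) \<le> ennreal C"
  proof -
    obtain N where N: "N \<ge> N0" "\<And>n m. n \<ge> N \<Longrightarrow> m \<ge> N \<Longrightarrow> norm (a n m - l) \<le> 1" using near[of 1] by auto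
    have "(\<integral>\<^sup>+\<omega>. ennreal ((norm (P n \<omega>))\<^sup>2) \<partial>M) \<le> ennreal (norm l + 1)" if n: "n \<ge> N" for n
    proof -
      have "Re (a n n) \<le> norm (a n n)" by (rule complex_Re_le_cmod)
      also have "\<dots> \<le> norm l + 1" using N(2)[OF n n] norm_triangle_sub[of "a n n" l] by linarith
      finally have b: "Re (a n n) \<le> norm l + 1" .
      have g: "n \<ge> N0" using N(1) n by simp
      show ?thesis unfolding nn[OF int[OF g g]] a_def[symmetric] by (rule ennreal_leI[OF b])
    qed
    then show ?thesis by (intro exI[of _ "norm l + 1"]) auto
  qed
  assume "\<epsilon> > 0"
  then obtain N where N: "N \<ge> N0" "\<And>n m. n \<ge> N \<Longrightarrow> m \<ge> N \<Longrightarrow> norm (a n m - l) \<le> \<epsilon> / 4" using near[of "\<epsilon> / 4"] by auto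
  have "(\<integral>\<^sup>+\<omega>. ennreal ((norm (P n \<omega> - P m \<omega>))\<^sup>2) \<partial>M) \<le> ennreal \<epsilon>" if nm: "n \<ge> N" "m \<ge> N" for n m
  proof -
    have g: "n \<ge> N0" "m \<ge> N0" using nm N(1) by auto
    have ex: "(\<lambda>\<omega>. (P n \<omega> - P m \<omega>) * cnj (P n \<omega> - P m \<omega>)) = (\<lambda>\<omega>. (P n \<omega> * cnj (P n \<omega>) - P n \<omega> * cnj (P m \<omega>)) - (P m \<omega> * cnj (P n \<omega>) - P m \<omega> * cnj (P m \<omega>)))"
      by (rule ext) (simp add: algebra_simps)
    note I = int[OF g(1) g(1)] int[OF g(1) g(2)] int[OF g(2) g(1)] int[OF g(2) g(2)]
    have D: "integrable M (\<lambda>\<omega>. (P n \<omega> - P m \<omega>) * cnj (P n \<omega> - P m \<omega>))"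
      unfolding ex by (intro Bochner_Integration.integrable_diff I)
    have "(\<integral>\<omega>. (P n \<omega> - P m \<omega>) * cnj (P n \<omega> - P m \<omega>) \<partial>M) = (a n n - a n m) - (a m n - a m m)"
      unfolding ex a_def
      by (simp only: Bochner_Integration.integral_diff[OF Bochner_Integration.integrable_diff[OF I(1,2)] Bochner_Integration.integrable_diff[OF I(3,4)]]
          Bochner_Integration.integral_diff[OF I(1,2)] Bochner_Integration.integral_diff[OF I(3,4)])
    also have "\<dots> = ((a n n - l) - (a n m - l)) - ((a m n - l) - (a m m - l))" by simp
    finally have v: "(\<integral>\<omega>. (P n \<omega> - P m \<omega>) * cnj (P n \<omega> - P m \<omega>) \<partial>M) = ((a n n - l) - (a n m - l)) - ((a m n - l) - (a m m - l))" .
    have "norm (((a n n - l) - (a n m - l)) - ((a m n - l) - (a m m - l))) \<le> (\<epsilon> / 4 + \<epsilon> / 4) + (\<epsilon> / 4 + \<epsilon> / 4)"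
      by (intro order_trans[OF norm_triangle_ineq4] add_mono N nm)
    then have "Re (((a n n - l) - (a n m - l)) - ((a m n - l) - (a m m - l))) \<le> \<epsilon>"
      using complex_Re_le_cmod order_trans by fastforce
    then show ?thesis unfolding nn[OF D] v by (rule ennreal_leI)
  qed
  then show "\<exists>N. \<forall>n\<ge>N. \<forall>m\<ge>N. (\<integral>\<^sup>+\<omega>. ennreal ((norm (P n \<omega> - P m \<omega>))\<^sup>2) \<partial>M) \<le> ennreal \<epsilon>" by blast
qed

section \<open>Geometry of the escaping nodes\<close>

definition height :: "nat \<Rightarrow> nat \<Rightarrow> complex" where
  "height n j = \<i> * of_real (escape n j)"

lemma Re_height [simp]: "Re (height n j) = 0" and Im_height [simp]: "Im (height n j) = escape n j"
  by (simp_all add: height_def)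

lemma escape_pos: "escape n j > 0"
  using escape_ge(1)[of n j] by linarith

lemma escape_nonzero [simp]: "escape n j \<noteq> 0"
  using escape_pos[of n j] by simp

lemma real_le_escape: "real n \<le> (real n + 1) ^ 4"
proof -
  have "(real n + 1) ^ 1 \<le> (real n + 1) ^ 4" by (rule power_increasing) auto
  then show ?thesis by simp
qed

lemma norm_height: "norm (height n j) = escape n j"
  using escape_pos[of n j] by (simp add: height_def norm_mult)

lemma norm_height_ge: "norm (height n j) \<ge> real n"
  unfolding norm_height using escape_ge(2)[of n j] real_le_escape[of n] by linarith

lemma height_inject [simp]: "height n i = height n j \<longleftrightarrow> i = j"
proof
  assume "height n i = height n j"
  then have "escape n i = escape n j" by (metis Im_height)
  moreover have "(real n + 1) ^ 4 \<noteq> 0" by (simp add: add_eq_0_iff_both_eq_0)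
  ultimately show "i = j" by (simp add: escape_def)
qed simp

text \<open>Heights at level n are distinct integer multiples of (n + 1)^4, so their mutual
  distances grow; a height and a conjugate height lie on opposite sides of the axis, so there the
  two distances to the axis add.\<close>

lemma height_gap:
  shows "norm (height n j - c) \<ge> real n - norm c"
    and "i \<noteq> j \<Longrightarrow> norm (height n i - height n j) \<ge> real n"
    and "norm (height n i - cnj (height m j)) \<ge> real n"
    and "norm (height n i - cnj (height m j)) \<ge> real m"
proof -
  show "norm (height n j - c) \<ge> real n - norm c"
    using norm_height_ge[of n j] norm_triangle_ineq2[of "height n j" c] by linarith
  have im: "\<bar>Im u\<bar> \<le> norm u" for u by (rule abs_Im_le_cmod)
  show "norm (height n i - height n j) \<ge> real n" if "i \<noteq> j"
  proof -
    have "real n * 1 \<le> (real n + 1) ^ 4 * \<bar>real i - real j\<bar>"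
      using that real_le_escape[of n] by (intro mult_mono) auto
    also have "\<dots> = \<bar>escape n i - escape n j\<bar>"
      by (simp add: escape_def abs_mult flip: right_diff_distrib)
    also have "\<dots> \<le> norm (height n i - height n j)" using im[of "height n i - height n j"] by simp
    finally show ?thesis by simp
  qed
  have "escape n i + escape m j \<le> norm (height n i - cnj (height m j))"
    using im[of "height n i - cnj (height m j)"] by simp
  then show "norm (height n i - cnj (height m j)) \<ge> real n" "norm (height n i - cnj (height m j)) \<ge> real m"
    using escape_ge[of n i] escape_ge[of m j] real_le_escape[of n] real_le_escape[of m] by linarith+
qed

definition up_family :: "('x \<Rightarrow> nat) \<Rightarrow> nat \<Rightarrow> 'x \<Rightarrow> complex" where
  "up_family N j = (\<lambda>f. height (N f) j)"

definition down_family :: "('x \<Rightarrow> nat) \<Rightarrow> nat \<Rightarrow> 'x \<Rightarrow> complex" where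
  "down_family N j = (\<lambda>f. cnj (height (N f) j))"

text \<open>N and N' extract the levels of upward and downward nodes from the index; for the Gram
  matrix they are the two coordinates of a pair that runs to infinity jointly.\<close>

definition families :: "complex set \<Rightarrow> ('x \<Rightarrow> nat) \<Rightarrow> ('x \<Rightarrow> nat) \<Rightarrow> ('x \<Rightarrow> complex) set" where
  "families C N N' = (\<lambda>c _. c) ` C \<union> range (up_family N) \<union> range (down_family N')"

lemma filterlim_gap:
  fixes N :: "'x \<Rightarrow> nat"
  assumes "filterlim N sequentially F" "\<And>f. h f \<ge> real (N f) - C"
  shows "filterlim h at_top F"
proof (rule filterlim_at_top_mono[OF _ always_eventually])
  have "filterlim (\<lambda>n. real n - C) at_top sequentially" by real_asymp
  then show "filterlim (\<lambda>f. real (N f) - C) at_top F" by (rule filterlim_compose[OF _ assms(1)])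
qed (use assms(2) in auto)

lemma up_family_diverges:
  assumes N: "filterlim N sequentially F" and b: "b \<in> families C N N'" "b \<noteq> up_family N j"
  shows "filterlim (\<lambda>f. norm (up_family N j f - b f)) at_top F"
proof -
  from b consider c where "b = (\<lambda>_. c)" | i where "b = up_family N i" "i \<noteq> j" | i where "b = down_family N' i"
    unfolding families_def by auto
  then show ?thesis
  proof cases
    case 1
    show ?thesis by (rule filterlim_gap[OF N, of "norm c"]) (simp add: 1 up_family_def height_gap(1))
  next
    case 2
    then have "real (N f) - 0 \<le> norm (up_family N j f - b f)" for f
      using height_gap(2)[of j i "N f"] by (simp add: up_family_def)
    then show ?thesis by (rule filterlim_gap[OF N])
  next
    case 3
    then have "real (N f) - 0 \<le> norm (up_family N j f - b f)" for f
      using height_gap(3)[of "N f" j "N' f" i] by (simp add: up_family_def down_family_def)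
    then show ?thesis by (rule filterlim_gap[OF N])
  qed
qed

lemma down_family_diverges:
  assumes N': "filterlim N' sequentially F" and b: "b \<in> families C N N'" "b \<noteq> down_family N' j"
  shows "filterlim (\<lambda>f. norm (down_family N' j f - b f)) at_top F"
proof -
  have cn: "norm (cnj u - v) = norm (u - cnj v)" for u v
    by (metis complex_cnj_cnj complex_cnj_diff complex_mod_cnj)
  from b consider c where "b = (\<lambda>_. c)" | i where "b = up_family N i" | i where "b = down_family N' i" "i \<noteq> j"
    unfolding families_def by auto
  then show ?thesis
  proof cases
    case 1
    show ?thesis
      by (rule filterlim_gap[OF N', of "norm c"]) (use height_gap(1)[where j=j and c="cnj c"] in \<open>simp add: 1 down_family_def cn\<close>)
  next
    case 2
    then have "real (N' f) - 0 \<le> norm (down_family N' j f - b f)" for f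
      using height_gap(4)[of "N' f" "N f" i j] by (simp add: up_family_def down_family_def norm_minus_commute)
    then show ?thesis by (rule filterlim_gap[OF N'])
  next
    case 3
    then have "real (N' f) - 0 \<le> norm (down_family N' j f - b f)" for f
      using height_gap(2)[of j i "N' f"] by (simp add: down_family_def cn)
    then show ?thesis by (rule filterlim_gap[OF N'])
  qed
qed

lemma tame_families:
  assumes N: "filterlim N sequentially F" and N': "filterlim N' sequentially F" and C: "\<And>c. c \<in> C \<Longrightarrow> Im c \<noteq> 0"
  shows "tame F (families C N N')"
  unfolding tame_def
proof (intro conjI ballI impI)
  fix a assume "a \<in> families C N N'"
  then consider c where "c \<in> C" "a = (\<lambda>_. c)" | i where "a = up_family N i" | i where "a = down_family N' i"
    unfolding families_def by auto
  then show "(\<forall>f. Im (a f) > 0) \<or> (\<forall>f. Im (a f) < 0)"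
  proof cases
    case 1
    then show ?thesis using C[of c] by (simp add: neq_iff disj_commute)
  qed (simp_all add: up_family_def down_family_def escape_pos)
next
  fix a b assume ab: "a \<in> families C N N'" "b \<in> families C N N'" "a \<noteq> b"
  have nc: "filterlim (\<lambda>f. norm (a f - b f)) at_top F \<longleftrightarrow> filterlim (\<lambda>f. norm (b f - a f)) at_top F"
    by (simp only: norm_minus_commute)
  from ab consider "a \<in> range (up_family N)" | "a \<in> range (down_family N')" | "b \<in> range (up_family N)" | "b \<in> range (down_family N')"
    | c d where "a = (\<lambda>_. c)" "b = (\<lambda>_. d)" unfolding families_def by blast
  then show "(const_family a \<and> const_family b) \<or> filterlim (\<lambda>f. norm (a f - b f)) at_top F"
  proof cases
    case 1
    then obtain j where j: "a = up_family N j" by blast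
    show ?thesis using up_family_diverges[OF N ab(2), of j] ab(3) j by blast
  next
    case 2
    then obtain j where j: "a = down_family N' j" by blast
    show ?thesis using down_family_diverges[OF N' ab(2), of j] ab(3) j by blast
  next
    case 3
    then obtain j where j: "b = up_family N j" by blast
    show ?thesis using up_family_diverges[OF N ab(1), of j] ab(3) j nc by blast
  next
    case 4
    then obtain j where j: "b = down_family N' j" by blast
    show ?thesis using down_family_diverges[OF N' ab(1), of j] ab(3) j nc by blast
  next
    case 5
    then show ?thesis by (simp add: const_family_def)
  qed
qed

lemma flat_pairs_append [simp]: "flat_pairs (ps @ qs) = flat_pairs ps @ flat_pairs qs"
  by (induction ps rule: flat_pairs.induct) auto

lemma set_flat_pairs_map: "set (flat_pairs (map (\<lambda>j. (a j, b j)) js)) = a ` set js \<union> b ` set js"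
  by (induction js) auto

lemma distinct_flat_pairs_map:
  assumes "distinct js" "inj_on a (set js)" "inj_on b (set js)" "a ` set js \<inter> b ` set js = {}"
  shows "distinct (flat_pairs (map (\<lambda>j. (a j, b j)) js))"
  using assms by (induction js) (auto simp: set_flat_pairs_map)

lemma images_disjoint: "(\<And>i j. i \<in> B \<Longrightarrow> j \<in> B \<Longrightarrow> f i \<noteq> g j) \<Longrightarrow> f ` B \<inter> g ` B = {}"
  by blast

lemma cnj_cauchy_diff: "cnj (cauchy_diff z w x) = cauchy_diff (cnj z) (cnj w) x"
  by (simp add: cauchy_diff_def)

section \<open>Limits of products of Cauchy statistics\<close>

context sine_process
begin

lemma cnj_cauchy_stat: "cnj (cauchy_stat z w \<omega>) = cauchy_stat (cnj z) (cnj w) \<omega>"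
  by (simp only: cauchy_stat_def infsetsum_def Bochner_Integration.integral_cnj[symmetric] cnj_cauchy_diff)

lemma cauchy_stats_append: "cauchy_stats (ps @ qs) \<omega> = cauchy_stats ps \<omega> * cauchy_stats qs \<omega>"
  by (induction ps) (auto simp: mult.assoc)

lemma cauchy_stats_map:
  "distinct js \<Longrightarrow> cauchy_stats (map (\<lambda>j. (a j, b j)) js) \<omega> = (\<Prod>j\<in>set js. cauchy_stat (a j) (b j) \<omega>)"
  by (induction js) auto

definition stat_prod :: "(nat \<Rightarrow> complex) \<Rightarrow> nat set \<Rightarrow> nat \<Rightarrow> 'a \<Rightarrow> complex" where
  "stat_prod z B n \<omega> = (\<Prod>j\<in>B. cauchy_stat (z j) (height n j) \<omega>)"

lemma stat_prod_measurable [measurable]: "stat_prod z B n \<in> borel_measurable M"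
  unfolding stat_prod_def by measurable

text \<open>The conjugate of a Cauchy statistic is the statistic at conjugate nodes, so a Gram entry
  is a mixed moment over the pairs at z with heights at level n and the conjugate pairs at level m.
  Downward nodes need not make terms vanish; existence of the joint limit is what counts.\<close>

lemma one_sided_L2:
  assumes fin: "finite B" and inj: "inj_on z B" and side: "(\<forall>j\<in>B. Im (z j) > 0) \<or> (\<forall>j\<in>B. Im (z j) < 0)"
  obtains N0 l where "\<And>n m. n \<ge> N0 \<Longrightarrow> m \<ge> N0 \<Longrightarrow> integrable M (\<lambda>\<omega>. stat_prod z B n \<omega> * cnj (stat_prod z B m \<omega>))"
    and "((\<lambda>(n, m). \<integral>\<omega>. stat_prod z B n \<omega> * cnj (stat_prod z B m \<omega>) \<partial>M) \<longlongrightarrow> l) (sequentially \<times>\<^sub>F sequentially)"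
proof -
  let ?F = "sequentially \<times>\<^sub>F sequentially :: (nat \<times> nat) filter"
  define js where "js = sorted_list_of_set B"
  have js: "distinct js" "set js = B" using fin by (simp_all add: js_def)
  define qs where "qs = map (\<lambda>j. (z j, up_family fst j)) js @ map (\<lambda>j. (cnj (z j), down_family snd j :: nat \<times> nat \<Rightarrow> complex)) js"
  define C where "C = z ` B \<union> (\<lambda>j. cnj (z j)) ` B"
  have re: "Im (z j) \<noteq> 0" if "j \<in> B" for j using side that by force
  \<comment> \<open>The place where the restriction to one half plane enters: it keeps the nodes of
    the moment formula distinct.\<close>
  have zc: "z i \<noteq> cnj (z j)" if "i \<in> B" "j \<in> B" for i j
  proof
    assume "z i = cnj (z j)"
    then have e: "Im (z i) = - Im (z j)" by simp
    from side show False
    proof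
      assume "\<forall>j\<in>B. Im (z j) > 0"
      then have "Im (z i) > 0" "Im (z j) > 0" using that by auto
      then show False using e by simp
    next
      assume "\<forall>j\<in>B. Im (z j) < 0"
      then have "Im (z i) < 0" "Im (z j) < 0" using that by auto
      then show False using e by simp
    qed
  qed
  have zinj: "inj_on (\<lambda>j. cnj (z j)) B" using inj by (auto simp: inj_on_def)
  have ev: "eval_pairs qs (n, m) = map (\<lambda>j. (z j, height n j)) js @ map (\<lambda>j. (cnj (z j), cnj (height m j))) js" for n m
    by (simp add: qs_def eval_pairs_def up_family_def down_family_def comp_def)
  have fp: "family_pairs qs = map (\<lambda>j. (\<lambda>_. z j, up_family fst j)) js @ map (\<lambda>j. (\<lambda>_. cnj (z j), down_family snd j)) js"
    by (simp add: qs_def family_pairs_def comp_def)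
  have st: "cauchy_stats (eval_pairs qs (n, m)) \<omega> = stat_prod z B n \<omega> * cnj (stat_prod z B m \<omega>)" for n m \<omega>
    unfolding ev cauchy_stats_append cauchy_stats_map[OF js(1)] stat_prod_def js(2) by (simp add: cnj_cauchy_stat)
  \<comment> \<open>Distinctness is required of the families as functions of the index; constant
    families are told apart from moving ones by their values at levels 0 and 1.\<close>
  have neU: "((\<lambda>_. c) :: nat \<times> nat \<Rightarrow> complex) \<noteq> up_family fst j" "((\<lambda>_. c) :: nat \<times> nat \<Rightarrow> complex) \<noteq> down_family snd j" "up_family fst i \<noteq> (down_family snd j :: nat \<times> nat \<Rightarrow> complex)" for c i j
  proof -
    have e: "escape 0 j < escape 1 j" by (simp add: escape_def)
    show "((\<lambda>_. c) :: nat \<times> nat \<Rightarrow> complex) \<noteq> up_family fst j"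
    proof
      assume h: "((\<lambda>_. c) :: nat \<times> nat \<Rightarrow> complex) = up_family fst j"
      have "c = height 0 j" "c = height 1 j" using fun_cong[OF h, of "(0, 0)"] fun_cong[OF h, of "(1, 0)"] by (simp_all add: up_family_def)
      then have "Im c = escape 0 j" "Im c = escape 1 j" by (metis Im_height)+
      then show False using e by linarith
    qed
    show "((\<lambda>_. c) :: nat \<times> nat \<Rightarrow> complex) \<noteq> down_family snd j"
    proof
      assume h: "((\<lambda>_. c) :: nat \<times> nat \<Rightarrow> complex) = down_family snd j"
      have "c = cnj (height 0 j)" "c = cnj (height 1 j)" using fun_cong[OF h, of "(0, 0)"] fun_cong[OF h, of "(0, 1)"] by (simp_all add: down_family_def)
      then have "cnj c = height 0 j" "cnj c = height 1 j" by simp_all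
      then have "Im (cnj c) = escape 0 j" "Im (cnj c) = escape 1 j" by (metis Im_height)+
      then show False using e by linarith
    qed
    show "up_family fst i \<noteq> (down_family snd j :: nat \<times> nat \<Rightarrow> complex)"
    proof
      assume h: "up_family fst i = (down_family snd j :: nat \<times> nat \<Rightarrow> complex)"
      have "escape 0 i = - escape 0 j" using arg_cong[where f=Im, OF fun_cong[OF h, of "(0, 0)"]] by (simp add: up_family_def down_family_def)
      then show False using escape_pos[of 0 i] escape_pos[of 0 j] by linarith
    qed
  qed
  have Uinj: "inj_on (up_family fst :: nat \<Rightarrow> nat \<times> nat \<Rightarrow> complex) B" "inj_on (down_family snd :: nat \<Rightarrow> nat \<times> nat \<Rightarrow> complex) B"
    by (auto simp: inj_on_def up_family_def down_family_def fun_eq_iff)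
  have neC: "((\<lambda>_. z i) :: nat \<times> nat \<Rightarrow> complex) \<noteq> (\<lambda>_. cnj (z j))" if "i \<in> B" "j \<in> B" for i j
  proof
    assume h: "((\<lambda>_. z i) :: nat \<times> nat \<Rightarrow> complex) = (\<lambda>_. cnj (z j))"
    then have "z i = cnj (z j)" by (rule arg_cong[where f="\<lambda>f. f (0, 0)"])
    then show False using zc[OF that] by contradiction
  qed
  have T: "tame ?F (families C fst snd)"
    by (rule tame_families) (use re in \<open>auto simp: C_def filterlim_fst filterlim_snd\<close>)
  have S1: "set (flat_pairs (family_pairs qs)) \<subseteq> families C fst snd"
    unfolding fp flat_pairs_append set_append set_flat_pairs_map js(2) by (auto simp: families_def C_def)
  have S2: "distinct (flat_pairs (family_pairs qs))"
    unfolding fp flat_pairs_append distinct_append set_flat_pairs_map js(2)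
  proof (intro conjI distinct_flat_pairs_map js(1); (unfold js(2))?)
    show "inj_on (\<lambda>j. (\<lambda>_::nat \<times> nat. z j)) B" using inj by (auto simp: inj_on_def fun_eq_iff)
    show "inj_on (\<lambda>j. (\<lambda>_::nat \<times> nat. cnj (z j))) B" using inj by (auto simp: inj_on_def fun_eq_iff)
    show "((\<lambda>j. \<lambda>_. z j) ` B \<union> up_family fst ` B) \<inter> ((\<lambda>j. \<lambda>_. cnj (z j)) ` B \<union> down_family snd ` B)
        = ({} :: (nat \<times> nat \<Rightarrow> complex) set)"
    proof -
      have "(\<lambda>j. (\<lambda>_. z j) :: nat \<times> nat \<Rightarrow> complex) ` B \<inter> (\<lambda>j. \<lambda>_. cnj (z j)) ` B = {}" by (rule images_disjoint) (rule neC)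
      moreover have "(\<lambda>j. (\<lambda>_. z j) :: nat \<times> nat \<Rightarrow> complex) ` B \<inter> down_family snd ` B = {}" by (rule images_disjoint) (rule neU(2))
      moreover have "(up_family fst :: nat \<Rightarrow> nat \<times> nat \<Rightarrow> complex) ` B \<inter> (\<lambda>j. \<lambda>_. cnj (z j)) ` B = {}"
        by (rule images_disjoint) (rule neU(1)[symmetric])
      moreover have "(up_family fst :: nat \<Rightarrow> nat \<times> nat \<Rightarrow> complex) ` B \<inter> down_family snd ` B = {}" by (rule images_disjoint) (rule neU(3))
      ultimately show ?thesis by (simp only: Int_Un_distrib Int_Un_distrib2 Un_empty_left)
    qed
    show "(\<lambda>j. (\<lambda>_. z j) :: nat \<times> nat \<Rightarrow> complex) ` B \<inter> up_family fst ` B = {}" by (rule images_disjoint) (rule neU(1))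
    show "(\<lambda>j. (\<lambda>_. cnj (z j)) :: nat \<times> nat \<Rightarrow> complex) ` B \<inter> down_family snd ` B = {}" by (rule images_disjoint) (rule neU(2))
  qed (rule Uinj)+
  obtain l where l: "((\<lambda>f. diff_Psi (eval_pairs qs f) {} (\<lambda>j. (\<lambda>_ _. 0) j f) 0 (\<lambda>_. undefined)) \<longlongrightarrow> l) ?F"
  proof -
    have "\<exists>l. ((\<lambda>f. diff_Psi (eval_pairs qs f) {} (\<lambda>j. (\<lambda>_ _. 0) j f) 0 (\<lambda>_. undefined)) \<longlongrightarrow> l) ?F"
      by (rule diff_Psi_family_tendsto(1)[OF T _ _ _ _ S1 S2]) simp_all
    then show ?thesis by (elim exE) (rule that)
  qed
  have "bounded (z ` B)" using fin by (intro finite_imp_bounded finite_imageI)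
  then obtain R where R: "\<And>j. j \<in> B \<Longrightarrow> norm (z j) \<le> R" unfolding bounded_iff by blast
  \<comment> \<open>Beyond this level every height has modulus larger than all \<open>z j\<close>,
    so the nodes are distinct and the moment formula applies.\<close>
  define N0 where "N0 = nat \<lceil>R\<rceil> + 1"
  have N0: "R < real N0" unfolding N0_def by linarith
  have zh: "norm (z i) < norm (height n j)" if "i \<in> B" "n \<ge> N0" for i j n
    using R[OF that(1)] N0 norm_height_ge[of n j] that(2) by linarith
  have dist: "distinct (flat_pairs (eval_pairs qs (n, m)))" and real: "\<And>u. u \<in> set (flat_pairs (eval_pairs qs (n, m))) \<Longrightarrow> Im u \<noteq> 0"
    if nm: "n \<ge> N0" "m \<ge> N0" for n m
  proof -
    have n1: "z i \<noteq> height n j" "z i \<noteq> cnj (height m j)" "cnj (z i) \<noteq> height n j" "cnj (z i) \<noteq> cnj (height m j)" if "i \<in> B" for i j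
    proof -
      have a: "norm (z i) \<noteq> norm (height n j)" "norm (z i) \<noteq> norm (height m j)"
        using zh[OF that nm(1), of j] zh[OF that nm(2), of j] by linarith+
      show "z i \<noteq> height n j" using a(1) by metis
      show "z i \<noteq> cnj (height m j)" using a(2) by (metis complex_mod_cnj)
      show "cnj (z i) \<noteq> height n j" using a(1) by (metis complex_mod_cnj)
      show "cnj (z i) \<noteq> cnj (height m j)" using a(2) by (metis complex_cnj_cancel_iff)
    qed
    have n2: "height n i \<noteq> cnj (height m j)" for i j
    proof
      assume "height n i = cnj (height m j)"
      then have "Im (height n i) = Im (cnj (height m j))" by (rule arg_cong)
      then have "escape n i = - escape m j" by simp
      then show False using escape_pos[of n i] escape_pos[of m j] by linarith
    qed
    show "distinct (flat_pairs (eval_pairs qs (n, m)))"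
      unfolding ev flat_pairs_append distinct_append set_flat_pairs_map js(2)
    proof (intro conjI distinct_flat_pairs_map js(1); (unfold js(2))?)
      show "inj_on (height n) B" "inj_on (\<lambda>j. cnj (height m j)) B" by (auto simp: inj_on_def)
      show "(z ` B \<union> height n ` B) \<inter> ((\<lambda>j. cnj (z j)) ` B \<union> (\<lambda>j. cnj (height m j)) ` B) = {}"
        using zc n1(2) n1(3)[symmetric] n2 by blast
      show "z ` B \<inter> height n ` B = {}" using n1(1) by blast
      show "(\<lambda>j. cnj (z j)) ` B \<inter> (\<lambda>j. cnj (height m j)) ` B = {}" using n1(4) by blast
    qed (rule inj zinj)+
    show "Im u \<noteq> 0" if "u \<in> set (flat_pairs (eval_pairs qs (n, m)))" for u
    proof -
      have "u \<in> (z ` B \<union> height n ` B) \<union> ((\<lambda>j. cnj (z j)) ` B \<union> (\<lambda>j. cnj (height m j)) ` B)"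
        using that unfolding ev flat_pairs_append set_append set_flat_pairs_map js(2) .
      then show ?thesis using re by (elim UnE imageE) simp_all
    qed
  qed
  have E: "integrable M (\<lambda>\<omega>. stat_prod z B n \<omega> * cnj (stat_prod z B m \<omega>))"
    "(\<integral>\<omega>. stat_prod z B n \<omega> * cnj (stat_prod z B m \<omega>) \<partial>M) = (- 1) ^ length qs * diff_Psi (eval_pairs qs (n, m)) {} (\<lambda>_. 0) 0 (\<lambda>_. undefined)"
    if "n \<ge> N0" "m \<ge> N0" for n m
  proof -
    have s: "cauchy_stats (eval_pairs qs (n, m)) = (\<lambda>\<omega>. stat_prod z B n \<omega> * cnj (stat_prod z B m \<omega>))"
      by (rule ext) (rule st)
    note X = expectation_cauchy_stats_0[OF dist[OF that] real[OF that], unfolded s eval_pairs_simps(5)]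
    show "integrable M (\<lambda>\<omega>. stat_prod z B n \<omega> * cnj (stat_prod z B m \<omega>))" by (rule X(1))
    show "(\<integral>\<omega>. stat_prod z B n \<omega> * cnj (stat_prod z B m \<omega>) \<partial>M) = (- 1) ^ length qs * diff_Psi (eval_pairs qs (n, m)) {} (\<lambda>_. 0) 0 (\<lambda>_. undefined)"
      by (rule X(2))
  qed
  show ?thesis
  proof (rule that[of N0 "(- 1) ^ length qs * l"])
    have "((\<lambda>f. (- 1) ^ length qs * diff_Psi (eval_pairs qs f) {} (\<lambda>_. 0) 0 (\<lambda>_. undefined)) \<longlongrightarrow> (- 1) ^ length qs * l) ?F"
      using l by (intro tendsto_mult_left)
    moreover have "eventually (\<lambda>f. (- 1) ^ length qs * diff_Psi (eval_pairs qs f) {} (\<lambda>_. 0) 0 (\<lambda>_. undefined)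
        = (case f of (n, m) \<Rightarrow> \<integral>\<omega>. stat_prod z B n \<omega> * cnj (stat_prod z B m \<omega>) \<partial>M)) ?F"
      unfolding eventually_prod_sequentially by (intro exI[of _ N0] allI impI) (simp add: E)
    ultimately show "((\<lambda>(n, m). \<integral>\<omega>. stat_prod z B n \<omega> * cnj (stat_prod z B m \<omega>) \<partial>M) \<longlongrightarrow> (- 1) ^ length qs * l) ?F"
      by (rule Lim_transform_eventually)
  qed (rule E)
qed

text \<open>No restriction to a half plane is imposed: without conjugates the nodes are just the
  \<open>z j\<close> and the heights, distinct from some level on. In the limit every branch of the
  alternating sum but one disappears.\<close>

lemma stat_prod_expectation:
  assumes inj: "inj_on z {1..k}" and re: "\<And>j. j \<in> {1..k} \<Longrightarrow> Im (z j) \<noteq> 0"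
  shows "\<exists>N. \<forall>n\<ge>N. integrable M (stat_prod z {1..k} n)"
    and "(\<lambda>n. \<integral>\<omega>. stat_prod z {1..k} n \<omega> \<partial>M) \<longlonglongrightarrow> (- 1) ^ k * Psi z {1..k}"
proof -
  \<comment> \<open>\<open>diff_Psi\<close> hands out labels downwards, so the reversed list gives
    label i the node \<open>z (Suc i)\<close>.\<close>
  define js where "js = rev [1..<Suc k]"
  have js: "distinct js" "set js = {1..k}" "length js = k" by (auto simp: js_def)
  define qs where "qs = map (\<lambda>j. (z j, up_family id j)) js"
  define C where "C = z ` {1..k}"
  have lqs: "length qs = k" by (simp add: qs_def js)
  have ev: "eval_pairs qs n = map (\<lambda>j. (z j, height n j)) js" for n
    by (simp add: qs_def eval_pairs_def up_family_def comp_def)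
  have fp: "family_pairs qs = map (\<lambda>j. (\<lambda>_. z j, up_family id j)) js"
    by (simp add: qs_def family_pairs_def comp_def)
  have st: "cauchy_stats (eval_pairs qs n) = stat_prod z {1..k} n" for n
    by (rule ext) (simp add: ev cauchy_stats_map[OF js(1)] stat_prod_def js(2))
  have neU: "(\<lambda>_. c) \<noteq> up_family id j" for c j
  proof
    assume h: "(\<lambda>_. c) = up_family id j"
    have c: "c = height 0 j" "c = height 1 j" using fun_cong[OF h, of 0] fun_cong[OF h, of 1] by (simp_all add: up_family_def)
    have "Im c = escape 0 j" by (subst c(1)) simp
    moreover have "Im c = escape 1 j" by (subst c(2)) simp
    moreover have "escape 0 j < escape 1 j" by (simp add: escape_def)
    ultimately show False by linarith
  qed
  have N: "filterlim id sequentially sequentially" by (simp add: filterlim_ident id_def)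
  have T: "tame sequentially (families C id id)"
    by (rule tame_families[OF N N]) (use re in \<open>auto simp: C_def\<close>)
  have S1: "set (flat_pairs (family_pairs qs)) \<subseteq> families C id id"
    unfolding fp set_flat_pairs_map js(2) families_def C_def image_image by blast
  have S2: "distinct (flat_pairs (family_pairs qs))"
    unfolding fp
  proof (intro distinct_flat_pairs_map js(1); (unfold js(2))?)
    show "inj_on (\<lambda>j. (\<lambda>_::nat. z j)) {1..k}"
    proof (rule inj_onI)
      fix i j assume ij: "i \<in> {1..k}" "j \<in> {1..k}" and h: "(\<lambda>_::nat. z i) = (\<lambda>_. z j)"
      from h have "z i = z j" by (rule arg_cong[where f="\<lambda>f. f 0"])
      then show "i = j" using ij by (rule inj_onD[OF inj])
    qed
    show "inj_on (up_family id) {1..k}"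
    proof (rule inj_onI)
      fix i j assume h: "up_family id i = up_family id j"
      have "height 0 i = height 0 j" using fun_cong[OF h, of 0] by (simp add: up_family_def)
      then show "i = j" by simp
    qed
    show "(\<lambda>j. (\<lambda>_::nat. z j)) ` {1..k} \<inter> up_family id ` {1..k} = {}" using neU by blast
  qed
  have W: "\<exists>j. W = up_family id j" if "(c, W) \<in> set qs" for c W using that by (auto simp: qs_def)
  have lim: "(\<lambda>n. diff_Psi (eval_pairs qs n) {} (\<lambda>_. 0) 0 (\<lambda>_. undefined))
     \<longlonglongrightarrow> Psi (node_pos (place (map fst qs) (\<lambda>_. 0)) (\<lambda>_. undefined)) (({} \<union> {..<length qs}) <+> {..<0})"
  proof (rule diff_Psi_escape_tendsto[OF T])
    show "Im (W n) > 0" if "(c, W) \<in> set qs" for c W n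
      using W[OF that] by (auto simp: up_family_def escape_pos)
    show "filterlim (\<lambda>n. norm (W n - b n)) at_top sequentially" if cW: "(c, W) \<in> set qs" and b: "b \<in> families C id id" "b \<noteq> W" for c W b
    proof -
      obtain j where j: "W = up_family id j" using W[OF cW] by blast
      show ?thesis using up_family_diverges[OF N b(1), of j] b(2) by (simp add: j)
    qed
  qed (use S1 S2 in auto)
  have "Psi (node_pos (place (map fst qs) (\<lambda>_. 0)) (\<lambda>_. undefined)) (({} \<union> {..<length qs}) <+> {..<0}) = Psi z {1..k}"
  proof -
    have "(({} \<union> {..<length qs}) <+> {..<0}) = (Inl ` {..<k} :: (nat + nat) set)" by (auto simp: lqs)
    then have "Psi (node_pos (place (map fst qs) (\<lambda>_. 0)) (\<lambda>_. undefined)) (({} \<union> {..<length qs}) <+> {..<0})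
        = Psi (\<lambda>i. node_pos (place (map fst qs) (\<lambda>_. 0)) (\<lambda>_. undefined) (Inl i)) {..<k}"
      by (simp only: Psi_image[OF inj_Inl finite_lessThan])
    also have "\<dots> = Psi (\<lambda>i. z (Suc i)) {..<k}"
    proof (rule Psi_cong)
      fix i assume i: "i \<in> {..<k}"
      have rv: "rev (map fst qs) = map z [1..<Suc k]"
        unfolding qs_def js_def by (simp only: map_map comp_def fst_conv rev_map rev_rev_ident)
      have "rev (map fst qs) ! i = z ([1..<Suc k] ! i)" unfolding rv by (rule nth_map) (use i in simp)
      also have "[1..<Suc k] ! i = Suc i" using i nth_upt[of 1 i "Suc k"] by simp
      finally show "node_pos (place (map fst qs) (\<lambda>_. 0)) (\<lambda>_. undefined) (Inl i) = z (Suc i)"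
        using i by (simp only: node_pos_simps place_eq length_map lqs lessThan_iff if_True)
    qed
    also have "\<dots> = Psi z (Suc ` {..<k})" by (rule Psi_image[symmetric]) auto
    also have "Suc ` {..<k} = {1..k}" by (simp add: image_Suc_lessThan)
    finally show ?thesis .
  qed
  note lim = lim[unfolded this]
  have "bounded (z ` {1..k})" by (intro finite_imp_bounded finite_imageI finite_atLeastAtMost)
  then obtain R where R: "\<And>j. j \<in> {1..k} \<Longrightarrow> norm (z j) \<le> R" unfolding bounded_iff by blast
  define N0 where "N0 = nat \<lceil>R\<rceil> + 1"
  have N0: "R < real N0" unfolding N0_def by linarith
  have E: "integrable M (stat_prod z {1..k} n)"
    "(\<integral>\<omega>. stat_prod z {1..k} n \<omega> \<partial>M) = (- 1) ^ k * diff_Psi (eval_pairs qs n) {} (\<lambda>_. 0) 0 (\<lambda>_. undefined)"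
    if n: "n \<ge> N0" for n
  proof -
    have zh: "z i \<noteq> height n j" if "i \<in> {1..k}" for i j
    proof
      assume "z i = height n j"
      then have "norm (z i) \<ge> real n" using norm_height_ge[of n j] by simp
      then show False using R[OF that] N0 n by linarith
    qed
    have d: "distinct (flat_pairs (eval_pairs qs n))"
      unfolding ev
    proof (intro distinct_flat_pairs_map js(1); (unfold js(2))?)
      show "inj_on (height n) {1..k}" by (auto simp: inj_on_def)
      show "z ` {1..k} \<inter> height n ` {1..k} = {}" using zh by blast
    qed (rule inj)
    have r: "Im u \<noteq> 0" if "u \<in> set (flat_pairs (eval_pairs qs n))" for u
    proof -
      have "u \<in> z ` {1..k} \<union> height n ` {1..k}" using that unfolding ev set_flat_pairs_map js(2) .
      then show ?thesis using re by (elim UnE imageE) simp_all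
    qed
    note X = expectation_cauchy_stats_0[OF d r, unfolded st eval_pairs_simps(5) lqs]
    show "integrable M (stat_prod z {1..k} n)" by (rule X(1))
    show "(\<integral>\<omega>. stat_prod z {1..k} n \<omega> \<partial>M) = (- 1) ^ k * diff_Psi (eval_pairs qs n) {} (\<lambda>_. 0) 0 (\<lambda>_. undefined)"
      by (rule X(2))
  qed
  show "\<exists>N. \<forall>n\<ge>N. integrable M (stat_prod z {1..k} n)" using E(1) by blast
  have "(\<lambda>n. (- 1) ^ k * diff_Psi (eval_pairs qs n) {} (\<lambda>_. 0) 0 (\<lambda>_. undefined)) \<longlonglongrightarrow> (- 1) ^ k * Psi z {1..k}"
    by (rule tendsto_mult_left[OF lim])
  then show "(\<lambda>n. \<integral>\<omega>. stat_prod z {1..k} n \<omega> \<partial>M) \<longlonglongrightarrow> (- 1) ^ k * Psi z {1..k}"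
  proof (rule Lim_transform_eventually)
    show "\<forall>\<^sub>F n in sequentially. (- 1) ^ k * diff_Psi (eval_pairs qs n) {} (\<lambda>_. 0) 0 (\<lambda>_. undefined) = (\<integral>\<omega>. stat_prod z {1..k} n \<omega> \<partial>M)"
      using eventually_ge_at_top[of N0] by eventually_elim (simp only: E(2))
  qed
qed

text \<open>The derivative is the limit of difference quotients along the steps 1 / (n + 1), which
  converge at every point of the space because each path is entire.\<close>

lemma xi_deriv_measurable:
  assumes "\<And>\<omega>. \<omega> \<in> space M \<Longrightarrow> \<xi> \<omega> holomorphic_on UNIV" and [measurable]: "\<And>w. (\<lambda>\<omega>. \<xi> \<omega> w) \<in> borel_measurable M"
  shows "(\<lambda>\<omega>. deriv (\<xi> \<omega>) w) \<in> borel_measurable M"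
proof (rule borel_measurable_LIMSEQ_metric)
  let ?h = "\<lambda>i. complex_of_real (inverse (real (Suc i)))"
  show "(\<lambda>\<omega>. (\<xi> \<omega> (w + ?h i) - \<xi> \<omega> w) / ?h i) \<in> borel_measurable M" for i by measurable
  fix \<omega> assume "\<omega> \<in> space M"
  then have "(\<xi> \<omega> has_field_derivative deriv (\<xi> \<omega>) w) (at w)"
    using holomorphic_derivI[OF assms(1) open_UNIV] by simp
  then have "(\<lambda>h. (\<xi> \<omega> (w + h) - \<xi> \<omega> w) / h) \<midarrow>0\<rightarrow> deriv (\<xi> \<omega>) w" by (simp only: DERIV_def)
  moreover have "filterlim ?h (at 0) sequentially"
    by (rule filterlim_atI) (use tendsto_of_real[OF LIMSEQ_inverse_real_of_nat, where 'a=complex] in \<open>auto simp del: of_nat_Suc\<close>)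
  ultimately show "(\<lambda>i. (\<xi> \<omega> (w + ?h i) - \<xi> \<omega> w) / ?h i) \<longlonglongrightarrow> deriv (\<xi> \<omega>) w"
    by (rule filterlim_compose)
qed

text \<open>Each factor is \<open>L (z j)\<close> minus the value of \<open>L\<close> at an escaping
  height, and the countably many heights decay simultaneously on one almost sure event.\<close>

lemma stat_prod_tendsto:
  assumes fin: "finite B" and re: "\<And>j. j \<in> B \<Longrightarrow> Im (z j) \<noteq> 0"
  shows "AE \<omega> in M. (\<lambda>n. stat_prod z B n \<omega>) \<longlonglongrightarrow> (\<Prod>j\<in>B. log_xi (\<lambda>k. y k \<omega>) (z j))"
proof -
  have "AE \<omega> in M. \<forall>j. (\<lambda>n. log_xi (\<lambda>k. y k \<omega>) (\<i> * of_real (escape n j))) \<longlonglongrightarrow> 0"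
    unfolding AE_all_countable using AE_log_xi_escape by blast
  from this AE_good show ?thesis
  proof eventually_elim
    case (elim \<omega>)
    let ?L = "log_xi (\<lambda>k. y k \<omega>)"
    show ?case unfolding stat_prod_def
    proof (rule tendsto_prod)
      fix j assume j: "j \<in> B"
      have "(\<lambda>n. ?L (z j) - ?L (height n j)) \<longlonglongrightarrow> ?L (z j) - 0"
        using elim(1) unfolding height_def by (intro tendsto_diff tendsto_const) blast
      moreover have "?L (z j) - ?L (height n j) = cauchy_stat (z j) (height n j) \<omega>" for n
        by (rule log_xi_diff[OF elim(2) re[OF j]]) (use escape_pos[of n j] in simp)
      ultimately show "(\<lambda>n. cauchy_stat (z j) (height n j) \<omega>) \<longlonglongrightarrow> ?L (z j)" by simp
    qed
  qed
qed

end

theorem proposition5p9: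
  fixes M :: "'a measure"
    and y :: "int \<Rightarrow> 'a \<Rightarrow> real"
    and \<xi> :: "'a \<Rightarrow> complex \<Rightarrow> complex"
    and k :: nat
    and z :: "nat \<Rightarrow> complex"
    and A :: "nat set"
  assumes "sine_kernel_process M y"
    and "is_xi_infinity M y \<xi>"
    and "inj_on z {1..k}"
    and "\<forall>j \<in> {1..k}. z j \<notin> \<real>"
    and "A = {j \<in> {1..k}. Im (z j) < 0}"
  shows "integrable M (\<lambda>\<omega>. \<Prod>j\<in>{1..k}. deriv (\<xi> \<omega>) (z j) / \<xi> \<omega> (z j)) \<and>
    (\<integral>\<omega>. (\<Prod>j\<in>{1..k}. deriv (\<xi> \<omega>) (z j) / \<xi> \<omega> (z j)) \<partial>M) =
      (-1) ^ k * (\<Sum>\<rho>\<in>perms_kA k A.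
        of_int (sign \<rho>) * (- 2 * \<i> * of_real pi) ^ card (fixed_pts k \<rho>) *
        (\<Prod>j\<in>{1..k} - fixed_pts k \<rho>. inverse (z (Hilbert_Choice.inv \<rho> j) - z j)) *
        exp (2 * \<i> * of_real pi * (\<Sum>j\<in>A. z (\<rho> j) - z j)) *
        (\<Prod>j\<in>two_cycle_pts_in k \<rho> A. 1 - exp (2 * \<i> * of_real pi * (z j - z (\<rho> j)))))"
proof -
  interpret sine_process M y by unfold_locales (rule assms(1))
  let ?I = "{1..k}"
  have re: "Im (z j) \<noteq> 0" if "j \<in> ?I" for j using assms(4) that by (auto simp: complex_is_Real_iff)
  have AI: "A \<subseteq> ?I" using assms(5) by auto
  define H where "H \<omega> = (\<Prod>j\<in>?I. deriv (\<xi> \<omega>) (z j) / \<xi> \<omega> (z j))" for \<omega>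
  have xi: "\<And>\<omega>. \<omega> \<in> space M \<Longrightarrow> \<xi> \<omega> holomorphic_on UNIV" "\<And>w. (\<lambda>\<omega>. \<xi> \<omega> w) \<in> borel_measurable M"
    "AE \<omega> in M. \<forall>w. \<xi> \<omega> w = xi_product (\<lambda>k. y k \<omega>) w"
    using assms(2) by (auto simp: is_xi_infinity_def)
  note [measurable] = xi_deriv_measurable[OF xi(1,2)] xi(2)
  have Hm: "H \<in> borel_measurable M" unfolding H_def by measurable
  \<comment> \<open>The product is cut into its lower and upper half, each of which is Cauchy in
    L^2.\<close>
  have split: "stat_prod z A n \<omega> * stat_prod z (?I - A) n \<omega> = stat_prod z ?I n \<omega>" for n \<omega>
    unfolding stat_prod_def by (subst prod.subset_diff[OF AI]) (auto simp: mult.commute)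
  have "AE \<omega> in M. (\<lambda>n. stat_prod z ?I n \<omega>) \<longlonglongrightarrow> (\<Prod>j\<in>?I. log_xi (\<lambda>k. y k \<omega>) (z j))"
    by (rule stat_prod_tendsto) (use re in auto)
  from this xi(3) have lim: "AE \<omega> in M. (\<lambda>n. stat_prod z A n \<omega> * stat_prod z (?I - A) n \<omega>) \<longlonglongrightarrow> H \<omega>"
  proof eventually_elim
    case (elim \<omega>)
    have x: "\<xi> \<omega> = xi_product (\<lambda>k. y k \<omega>)" using elim(2) by (intro ext) blast
    have "H \<omega> = (\<Prod>j\<in>?I. log_xi (\<lambda>k. y k \<omega>) (z j))" unfolding H_def log_xi_def x ..
    then show ?case unfolding split using elim(1) by simp
  qed
  obtain N1 l1 where 1: "\<And>n m. n \<ge> N1 \<Longrightarrow> m \<ge> N1 \<Longrightarrow> integrable M (\<lambda>\<omega>. stat_prod z A n \<omega> * cnj (stat_prod z A m \<omega>))"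
      "((\<lambda>(n, m). \<integral>\<omega>. stat_prod z A n \<omega> * cnj (stat_prod z A m \<omega>) \<partial>M) \<longlongrightarrow> l1) (sequentially \<times>\<^sub>F sequentially)"
    by (rule one_sided_L2[of A z]) (use AI finite_subset[OF AI] inj_on_subset[OF assms(3) AI] assms(5) in auto)
  have up: "Im (z j) > 0" if "j \<in> ?I - A" for j using re[of j] that assms(5) by auto
  obtain N2 l2 where 2: "\<And>n m. n \<ge> N2 \<Longrightarrow> m \<ge> N2 \<Longrightarrow> integrable M (\<lambda>\<omega>. stat_prod z (?I - A) n \<omega> * cnj (stat_prod z (?I - A) m \<omega>))"
      "((\<lambda>(n, m). \<integral>\<omega>. stat_prod z (?I - A) n \<omega> * cnj (stat_prod z (?I - A) m \<omega>) \<partial>M) \<longlongrightarrow> l2) (sequentially \<times>\<^sub>F sequentially)"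
    by (rule one_sided_L2[of "?I - A" z]) (use inj_on_subset[OF assms(3)] up in auto)
  note E = stat_prod_expectation[OF assms(3) re]
  have int: "\<exists>N. \<forall>n\<ge>N. integrable M (\<lambda>\<omega>. stat_prod z A n \<omega> * stat_prod z (?I - A) n \<omega>)"
    unfolding split using E(1) .
  have lower: "\<exists>N. \<forall>n\<ge>N. \<forall>m\<ge>N. (\<integral>\<^sup>+\<omega>. ennreal ((norm (stat_prod z A n \<omega> - stat_prod z A m \<omega>))\<^sup>2) \<partial>M) \<le> ennreal \<epsilon>" if "\<epsilon> > 0" for \<epsilon>
    by (rule L2_Cauchy(1)[where ?N0.0=N1 and l=l1]) (rule 1 that | assumption)+
  have lower': "\<exists>C\<ge>0. \<exists>N. \<forall>n\<ge>N. (\<integral>\<^sup>+\<omega>. ennreal ((norm (stat_prod z A n \<omega>))\<^sup>2) \<partial>M) \<le> ennreal C"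
    by (rule L2_Cauchy(2)[where ?N0.0=N1 and l=l1]) (rule 1 | assumption)+
  have upper: "\<exists>N. \<forall>n\<ge>N. \<forall>m\<ge>N. (\<integral>\<^sup>+\<omega>. ennreal ((norm (stat_prod z (?I - A) n \<omega> - stat_prod z (?I - A) m \<omega>))\<^sup>2) \<partial>M) \<le> ennreal \<epsilon>" if "\<epsilon> > 0" for \<epsilon>
    by (rule L2_Cauchy(1)[where ?N0.0=N2 and l=l2]) (rule 2 that | assumption)+
  have upper': "\<exists>C\<ge>0. \<exists>N. \<forall>n\<ge>N. (\<integral>\<^sup>+\<omega>. ennreal ((norm (stat_prod z (?I - A) n \<omega>))\<^sup>2) \<partial>M) \<le> ennreal C"
    by (rule L2_Cauchy(2)[where ?N0.0=N2 and l=l2]) (rule 2 | assumption)+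
  \<comment> \<open>L^1 convergence carries the expectations to that of H, whose value is then
    forced by the limit of the moment formula.\<close>
  note L = product_L1_limit[OF stat_prod_measurable stat_prod_measurable Hm lim lower upper lower' upper' int]
  have eq: "(\<integral>\<omega>. H \<omega> \<partial>M) = (- 1) ^ k * Psi z ?I"
    using LIMSEQ_unique[OF L(2)[unfolded split] E(2)] by simp
  show ?thesis
    unfolding H_def[symmetric] eq
    by (intro conjI L(1) arg_cong[OF Psi_closed_form[OF assms(3) re assms(5)], where f="times ((- 1) ^ k)"])
qed

end
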